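(* Let $(T,\eta,\mu,(\xi,\zeta,\rho))$ be a pseudomonad on a bicocomplete 2-category $\mathcal{C}$ such that $T\text{-}\mathbf{psAlg}$ has bicoequalizers of codescent objects. Let $I$ be a small 2-category and $\mathbb{A}:I\to T\text{-}\mathbf{psAlg}$ a 2-functor, with $\mathbb{A}(i)=(A_i,a_i,(\alpha_i^t,\alpha_i^s))$ and $\mathbb{A}(d)=(f_d,\phi_d)$. Let $\mathscr{X}_{\mathbb{A}}$ be the associated codescent object in $T\text{-}\mathbf{psAlg}$, let $(p,\pi):(TL,\mu_L,(\xi_L,\rho_L))\to(C,c,(\gamma^t,\gamma^s))$ be its bicoequalizer, where $L=\mathrm{oplaxbicolim}_I A_i$ in $\mathcal{C}$, and let $(l_i,\lambda_i):(A_i,a_i,(\alpha^t_i,\alpha^s_i))\to(C,c,(\gamma^t,\gamma^s))$, $i\in I$, be the induced oplax cocone (all constructed in the context). Then the oplax cocone $(l_i,\lambda_i)_{i\in I}$ is an oplax bicolimit of $\mathbb{A}$ in $T\text{-}\mathbf{psAlg}$.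
   Context: 2-categories and 2-functors are strict; $\mathcal{K}[X,Y]$ denotes a hom-category; juxtaposition of 1-cells and 2-cells denotes whiskering. Bicocomplete means having all small weighted bicolimits. **Oplax bicolimits.** An oplax cocone on a 2-functor $F:I\to\mathcal{K}$ with tip $B$ consists of 1-cells $q_i:F(i)\to B$ and 2-cells $q_d:q_jF(d)\Rightarrow q_i$ for $d:i\to j$, compatible with identities and composition and with $q_{d'}\circ(q_jF(\sigma))=q_d$ for 2-cells $\sigma:d\Rightarrow d'$; morphisms are modifications. It is an oplax bicolimit, with tip $L$, if composition gives equivalences, natural in $B$, between $\mathcal{K}[L,B]$ and the category of oplax cocones with tip $B$. **Codescent objects.** A codescent object $\mathscr{X}$ in $\mathcal{K}$ consists of objects $\mathscr{X}(0),\mathscr{X}(1),\mathscr{X}(2)$, 1-cells $p_0,p_1,p_2:\mathscr{X}(2)\to\mathscr{X}(1)$, $d_0,d_1:\mathscr{X}(1)\to\mathscr{X}(0)$, $i:\mathscr{X}(0)\to\mathscr{X}(1)$, and invertible 2-cells $n_0:d_0i\Rightarrow 1$, $n_1:d_1i\Rightarrow 1$, $\theta_{01}:d_0p_0\Rightarrow d_0p_1$, $\theta_{02}:d_1p_0\Rightarrow d_0p_2$, $\theta_{12}:d_1p_1\Rightarrow d_1p_2$. A morphism $x:\mathscr{X}\to\mathscr{Y}$ is a family of 1-cells $x_k:\mathscr{X}(k)\to\mathscr{Y}(k)$ with an invertible 2-cell $x_g$ filling the naturality square at each $g\in\{d_0,d_1,i,p_0,p_1,p_2\}$, compatible with the $n$'s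 and $\theta$'s (a pseudonatural transformation). A pair $(q:\mathscr{X}(0)\to C,\ \xi:qd_0\Rightarrow qd_1)$ with $\xi$ invertible pseudocoequalizes $\mathscr{X}$ if $(qn_1)\circ(\xi i)=qn_0$ and $(q\theta_{12})\circ(\xi p_1)\circ(q\theta_{01})=(\xi p_2)\circ(q\theta_{02})\circ(\xi p_0)$; morphisms of pairs are 2-cells $q\Rightarrow q'$ compatible with $\xi,\xi'$. A bicoequalizer is a pseudocoequalizing pair $(q_{\mathscr{X}},\xi_{\mathscr{X}})$ with tip $\mathrm{bicoeq}(\mathscr{X})$ such that composition gives equivalences, natural in $C$, from $\mathcal{K}[\mathrm{bicoeq}(\mathscr{X}),C]$ to the category of pseudocoequalizing pairs with tip $C$. A morphism $x:\mathscr{X}\to\mathscr{Y}$ induces, uniquely up to unique invertible 2-cell, a 1-cell $\mathrm{bicoeq}(x)$ and an invertible 2-cell $\bar x:q_{\mathscr{Y}}x_0\cong\mathrm{bicoeq}(x)q_{\mathscr{X}}$ compatible with $x_{d_0},x_{d_1},\xi_{\mathscr{X}},\xi_{\mathscr{Y}}$. **Pseudomonads and pseudo-algebras.** A pseudomonad on $\mathcal{C}$ is a 2-functor $T:\mathcal{C}\to\mathcal{C}$ with pseudonatural transformations $\eta:1\Rightarrow T$, $\mu:TT\Rightarrow T$ and invertible modifications $\xi:\mu\circ\eta_T\cong 1_T$, $\zeta:\mu\circ T\eta\cong 1_T$, $\rho:\mu\circ T\mu\cong\mu\circ\mu_T$, subject to the usual coherence axioms, i.e. each $(TA,\mu_A,(\xi_A,\rho_A))$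 satisfies (A1), (A2) below. Pseudonaturality cells: $\eta_f:Tf\,\eta_A\cong\eta_Bf$, $\mu_f:\mu_B\,TTf\cong Tf\,\mu_A$. A pseudo-algebra $(A,a,(\alpha^t,\alpha^s))$ is $a:TA\to A$ with invertible $\alpha^t:a\eta_A\Rightarrow 1_A$, $\alpha^s:a\,Ta\Rightarrow a\mu_A$ such that (A1) $(a\zeta_A)\circ(\alpha^s\,T\eta_A)=a\,T\alpha^t$; (A2) $(a\rho_A)\circ(\alpha^s\,T\mu_A)\circ(a\,T\alpha^s)=(\alpha^s\mu_{TA})\circ(a\mu_a)\circ(\alpha^s\,TTa)$. A pseudomorphism $(f,\phi):(A,a,(\alpha^t,\alpha^s))\to(B,b,(\beta^t,\beta^s))$ is $f:A\to B$ with invertible $\phi:b\,Tf\Rightarrow fa$ such that $(f\alpha^t)\circ(\phi\eta_A)=(\beta^tf)\circ(b\eta_f)$ and $(f\alpha^s)\circ(\phi\,Ta)\circ(b\,T\phi)=(\phi\mu_A)\circ(b\mu_f)\circ(\beta^s\,TTf)$. A transformation $(f,\phi)\Rightarrow(g,\gamma)$ is $\sigma:f\Rightarrow g$ with $(\sigma a)\circ\phi=\gamma\circ(b\,T\sigma)$. These form $T\text{-}\mathbf{psAlg}$. The free pseudo-algebra on $A$ is $(TA,\mu_A,(\xi_A,\rho_A))$, and $f:A\to B$ gives the pseudomorphism $(Tf,\mu_f)$ of free algebras. **Bar construction.** For a pseudo-algebra $(A,a,(\alpha^t,\alpha^s))$, its bar construction is the codescent object in $T\text{-}\mathbf{psAlg}$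 of free algebras on $A$, $TA$, $TTA$ (levels 0,1,2) with $d_0=(Ta,\mu_a)$, $d_1=(\mu_A,\rho_A)$, $i=(T\eta_A,\mu_{\eta_A})$, $p_0=(TTa,\mu_{Ta})$, $p_1=(T\mu_A,\mu_{\mu_A})$, $p_2=(\mu_{TA},\rho_{TA})$ and $n_0=T\alpha^t$, $n_1=\zeta_A$, $\theta_{01}=T\alpha^s$, $\theta_{02}=\mu_a$, $\theta_{12}=\rho_A$. It is known that $((a,\alpha^s):TA\to A,\ \alpha^s)$ is its bicoequalizer in $T\text{-}\mathbf{psAlg}$. **Construction of $\mathscr{X}_{\mathbb{A}}$.** Let $L,L_1,L_2$ be the oplax bicolimits in $\mathcal{C}$ of $i\mapsto A_i$, $TA_i$, $TTA_i$ (with transitions $f_d$, $Tf_d$, $TTf_d$), with inclusions $q_i,q^T_i,q^{TT}_i$ and transition 2-cells $q_d,q^T_d,q^{TT}_d$. The families $a_i,\eta_{A_i},Ta_i,\mu_{A_i}$ are pseudonatural in $i$ (via $\phi_d,\eta_{f_d},T\phi_d,\mu_{f_d}$) and induce 1-cells $\bar a:L_1\to L$, $\bar\eta:L\to L_1$, $\overline{Ta}:L_2\to L_1$, $\bar\mu:L_2\to L_1$ with invertible 2-cells $\theta_i:\bar a q^T_i\cong q_ia_i$, $\tilde\theta_i:\bar\eta q_i\cong q_i^T\eta_{A_i}$, $\theta'_i:\overline{Ta}\,q^{TT}_i\cong q^T_iTa_i$, $\mu_i:\bar\mu q^{TT}_i\cong q^T_i\mu_{A_i}$. The oplax cocones $(Tq_i,Tq_d)$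 and $(Tq^T_i,Tq^T_d)$ induce comparison maps $s:L_1\to TL$ and $t:L_2\to TL_1$ with $\sigma_i:sq^T_i\cong Tq_i$ and $\tau_i:tq_i^{TT}\cong Tq_i^T$. By the universal property of oplax bicolimits one has induced invertible 2-cells: $\sigma:s\bar\eta\cong\eta_L$ (from $\sigma_i$, $\eta_{q_i}$, $\tilde\theta_i$); $\theta:s\,\overline{Ta}\cong T\bar a\,t$ (from $\tau_i,T\theta_i,\sigma_i,\theta_i'$); $\tau:s\bar\mu\cong\mu_L\,Ts\,t$ (from $\tau_i,T\sigma_i,\mu_{q_i},\sigma_i,\mu_i$). $\mathscr{X}_{\mathbb{A}}$ has levels 0,1,2 the free pseudo-algebras on $L,L_1,L_2$, and $d_0=(T\bar a,\mu_{\bar a})$; $d_1=\mu_L\,Ts$ (the composite of the pseudomorphisms $(Ts,\mu_s)$ and $(\mu_L,\rho_L)$); $i=(T\bar\eta,\mu_{\bar\eta})$; $p_0=(T\overline{Ta},\mu_{\overline{Ta}})$; $p_1=(T\bar\mu,\mu_{\bar\mu})$; $p_2=\mu_{L_1}\,Tt$ (composite of $(Tt,\mu_t)$ and $(\mu_{L_1},\rho_{L_1})$). Its 2-cells are: $n_0$ the image under $T$ of the isomorphism $\bar a\bar\eta\cong1_L$ induced by the $\alpha_i^t$; $n_1:\mu_L\,Ts\,T\bar\eta\cong\mu_L\,T\eta_L\cong1$ from $T\sigma$ and $\zeta_L$; $\theta_{01}$ the image under $T$ of $\bar a\,\overline{Ta}\cong\bar a\bar\mu$ induced by the $\alpha^s_i$;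 $\theta_{02}:\mu_LTs\,T\overline{Ta}\cong\mu_L\,TT\bar a\,Tt\cong T\bar a\,\mu_{L_1}Tt$ from $T\theta$ and $\mu_{\bar a}$; $\theta_{12}:\mu_LTs\,T\bar\mu\cong\mu_L\,T\mu_L\,TTs\,Tt\cong\mu_L\mu_{TL}\,TTs\,Tt\cong\mu_L\,Ts\,\mu_{L_1}Tt$ from $T\tau$, $\rho_L$, $\mu_s$. **Construction of $(l_i,\lambda_i)$.** For each $i$ there is a morphism of codescent objects $\overline{q_i}$ from the bar construction of $(A_i,a_i,(\alpha^t_i,\alpha^s_i))$ to $\mathscr{X}_{\mathbb{A}}$ with components $(Tq_i,\mu_{q_i})$, $(Tq_i^T,\mu_{q_i^T})$, $(Tq_i^{TT},\mu_{q_i^{TT}})$ at levels 0,1,2 and pseudonaturality cells: at $d_0$, $T\theta_i$; at $d_1$, the pasting of $T\sigma_i$ and $\mu_{q_i}$; at $i$, $T\tilde\theta_i$; at $p_0$, $T\theta'_i$; at $p_1$, $T\mu_i$; at $p_2$, the pasting of $T\tau_i$ and $\mu_{q_i^T}$. Then $(l_i,\lambda_i)=\mathrm{bicoeq}(\overline{q_i})$, with the corresponding invertible 2-cell $\chi_i:p\,Tq_i\cong l_ia_i$. The transition 2-cell $l_d:l_jf_d\Rightarrow l_i$ for $d:i\to j$ is the one induced by the $q_d$ by functoriality of bicoequalizers, i.e. the unique one such that $l_da_i$ corresponds to $p\,Tq_d:p\,Tq_jTf_d\Rightarrow p\,Tq_i$ under $\chi_i$, $\chi_j$ and $\phi_d$.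 *)

theory Defs
  imports Main "HOL-Library.FuncSet" "HOL-Library.Equipollence"
begin

section \<open>Categories, functors and equivalences\<close>

record ('x, 'm) cat =
  cObj :: "'x set"
  cArr :: "'m set"
  cDom :: "'m \<Rightarrow> 'x"
  cCod :: "'m \<Rightarrow> 'x"
  cId :: "'x \<Rightarrow> 'm"
  cComp :: "'m \<Rightarrow> 'm \<Rightarrow> 'm"

definition carr :: "('x, 'm) cat \<Rightarrow> 'm \<Rightarrow> 'x \<Rightarrow> 'x \<Rightarrow> bool" where
  "carr A m x y \<longleftrightarrow> m \<in> cArr A \<and> cDom A m = x \<and> cCod A m = y"

locale category =
  fixes A :: "('x, 'm) cat"
  assumes arr_obj: "carr A m x y \<Longrightarrow> x \<in> cObj A \<and> y \<in> cObj A"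
    and id_arr: "x \<in> cObj A \<Longrightarrow> carr A (cId A x) x x"
    and comp_arr: "carr A m x y \<Longrightarrow> carr A n y z \<Longrightarrow> carr A (cComp A n m) x z"
    and id_left: "carr A m x y \<Longrightarrow> cComp A (cId A y) m = m"
    and id_right: "carr A m x y \<Longrightarrow> cComp A m (cId A x) = m"
    and assoc: "carr A m x y \<Longrightarrow> carr A n y z \<Longrightarrow> carr A k z w \<Longrightarrow>
      cComp A (cComp A k n) m = cComp A k (cComp A n m)"

definition is_functor ::
  "('x, 'm) cat \<Rightarrow> ('y, 'n) cat \<Rightarrow> ('x \<Rightarrow> 'y) \<Rightarrow> ('m \<Rightarrow> 'n) \<Rightarrow> bool" where
  "is_functor A B F0 F1 \<longleftrightarrow>
     (\<forall>x\<in>cObj A. F0 x \<in> cObj B \<and> F1 (cId A x) = cId B (F0 x)) \<and>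
     (\<forall>m x y. carr A m x y \<longrightarrow> carr B (F1 m) (F0 x) (F0 y)) \<and>
     (\<forall>m n x y z. carr A m x y \<longrightarrow> carr A n y z \<longrightarrow> F1 (cComp A n m) = cComp B (F1 n) (F1 m))"

definition cat_iso :: "('x, 'm) cat \<Rightarrow> 'm \<Rightarrow> 'x \<Rightarrow> 'x \<Rightarrow> bool" where
  "cat_iso A m x y \<longleftrightarrow> carr A m x y \<and>
     (\<exists>n. carr A n y x \<and> cComp A n m = cId A x \<and> cComp A m n = cId A y)"

definition natural_iso ::
  "('x, 'm) cat \<Rightarrow> ('y, 'n) cat \<Rightarrow> ('x \<Rightarrow> 'y) \<Rightarrow> ('m \<Rightarrow> 'n) \<Rightarrow>
   ('x \<Rightarrow> 'y) \<Rightarrow> ('m \<Rightarrow> 'n) \<Rightarrow> ('x \<Rightarrow> 'n) \<Rightarrow> bool" where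
  "natural_iso A B F0 F1 G0 G1 \<epsilon> \<longleftrightarrow>
     (\<forall>x\<in>cObj A. cat_iso B (\<epsilon> x) (F0 x) (G0 x)) \<and>
     (\<forall>m x y. carr A m x y \<longrightarrow> cComp B (\<epsilon> y) (F1 m) = cComp B (G1 m) (\<epsilon> x))"

definition is_equivalence ::
  "('x, 'm) cat \<Rightarrow> ('y, 'n) cat \<Rightarrow> ('x \<Rightarrow> 'y) \<Rightarrow> ('m \<Rightarrow> 'n) \<Rightarrow> bool" where
  "is_equivalence A B F0 F1 \<longleftrightarrow> is_functor A B F0 F1 \<and>
     (\<exists>G0 G1 \<delta> \<epsilon>. is_functor B A G0 G1 \<and>
        natural_iso A A id id (G0 \<circ> F0) (G1 \<circ> F1) \<delta> \<and>
        natural_iso B B (F0 \<circ> G0) (F1 \<circ> G1) id id \<epsilon>)"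


section \<open>Strict 2-categories and strict 2-functors\<close>

record ('o, 'a, 'c) two_cat =
  Obj :: "'o set"
  Arr :: "'a set"
  Cell :: "'c set"
  Dom :: "'a \<Rightarrow> 'o"
  Cod :: "'a \<Rightarrow> 'o"
  Src :: "'c \<Rightarrow> 'a"
  Tgt :: "'c \<Rightarrow> 'a"
  Id1 :: "'o \<Rightarrow> 'a"
  Comp1 :: "'a \<Rightarrow> 'a \<Rightarrow> 'a"  (infixr "\<cdot>\<index>" 80)
  Id2 :: "'a \<Rightarrow> 'c"
  Vcomp :: "'c \<Rightarrow> 'c \<Rightarrow> 'c"  (infixr "\<bullet>\<index>" 65)
  Hcomp :: "'c \<Rightarrow> 'c \<Rightarrow> 'c"  (infixr "\<star>\<index>" 75)

text \<open>Composites are written in applicative order: in \<open>g \<cdot> f\<close>, in \<open>\<tau> \<bullet> \<sigma>\<close> (vertical) and in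
  \<open>\<tau> \<star> \<sigma>\<close> (horizontal) the right factor comes first.\<close>

definition arr :: "('o, 'a, 'c) two_cat \<Rightarrow> 'a \<Rightarrow> 'o \<Rightarrow> 'o \<Rightarrow> bool" where
  "arr K f X Y \<longleftrightarrow> f \<in> Arr K \<and> Dom K f = X \<and> Cod K f = Y"

definition cell :: "('o, 'a, 'c) two_cat \<Rightarrow> 'c \<Rightarrow> 'a \<Rightarrow> 'a \<Rightarrow> bool" where
  "cell K \<sigma> f g \<longleftrightarrow> \<sigma> \<in> Cell K \<and> Src K \<sigma> = f \<and> Tgt K \<sigma> = g"

definition whisker_left :: "('o, 'a, 'c) two_cat \<Rightarrow> 'a \<Rightarrow> 'c \<Rightarrow> 'c"  (infixr "\<lhd>\<index>" 72) where
  "whisker_left K h \<sigma> = Hcomp K (Id2 K h) \<sigma>"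

definition whisker_right :: "('o, 'a, 'c) two_cat \<Rightarrow> 'c \<Rightarrow> 'a \<Rightarrow> 'c"  (infixl "\<rhd>\<index>" 73) where
  "whisker_right K \<sigma> h = Hcomp K \<sigma> (Id2 K h)"

locale two_category =
  fixes K :: "('o, 'a, 'c) two_cat" (structure)
  assumes arr_obj: "arr K f X Y \<Longrightarrow> X \<in> Obj K \<and> Y \<in> Obj K"
    and cell_arr: "cell K \<sigma> f g \<Longrightarrow> f \<in> Arr K \<and> g \<in> Arr K \<and> Dom K f = Dom K g \<and> Cod K f = Cod K g"
    and id1_arr: "X \<in> Obj K \<Longrightarrow> arr K (Id1 K X) X X"
    and comp1_arr: "arr K f X Y \<Longrightarrow> arr K g Y Z \<Longrightarrow> arr K (g \<cdot> f) X Z"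
    and id1_left: "arr K f X Y \<Longrightarrow> Id1 K Y \<cdot> f = f"
    and id1_right: "arr K f X Y \<Longrightarrow> f \<cdot> Id1 K X = f"
    and comp1_assoc: "arr K f X Y \<Longrightarrow> arr K g Y Z \<Longrightarrow> arr K h Z W \<Longrightarrow> (h \<cdot> g) \<cdot> f = h \<cdot> (g \<cdot> f)"
    and id2_cell: "f \<in> Arr K \<Longrightarrow> cell K (Id2 K f) f f"
    and vcomp_cell: "cell K \<sigma> f g \<Longrightarrow> cell K \<tau> g h \<Longrightarrow> cell K (\<tau> \<bullet> \<sigma>) f h"
    and id2_left: "cell K \<sigma> f g \<Longrightarrow> Id2 K g \<bullet> \<sigma> = \<sigma>"
    and id2_right: "cell K \<sigma> f g \<Longrightarrow> \<sigma> \<bullet> Id2 K f = \<sigma>"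
    and vcomp_assoc: "cell K \<sigma> f g \<Longrightarrow> cell K \<tau> g h \<Longrightarrow> cell K \<upsilon> h k \<Longrightarrow>
      (\<upsilon> \<bullet> \<tau>) \<bullet> \<sigma> = \<upsilon> \<bullet> (\<tau> \<bullet> \<sigma>)"
    and hcomp_cell: "cell K \<sigma> f g \<Longrightarrow> cell K \<tau> h k \<Longrightarrow> Dom K h = Cod K f \<Longrightarrow>
      cell K (\<tau> \<star> \<sigma>) (h \<cdot> f) (k \<cdot> g)"
    and hcomp_id2: "arr K f X Y \<Longrightarrow> arr K g Y Z \<Longrightarrow> Id2 K g \<star> Id2 K f = Id2 K (g \<cdot> f)"
    and interchange: "cell K \<sigma> f g \<Longrightarrow> cell K \<sigma>' g h \<Longrightarrow> cell K \<tau> k l \<Longrightarrow> cell K \<tau>' l m \<Longrightarrow>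
      Dom K k = Cod K f \<Longrightarrow> (\<tau>' \<bullet> \<tau>) \<star> (\<sigma>' \<bullet> \<sigma>) = (\<tau>' \<star> \<sigma>') \<bullet> (\<tau> \<star> \<sigma>)"
    and hcomp_left: "cell K \<sigma> f g \<Longrightarrow> Id2 K (Id1 K (Cod K f)) \<star> \<sigma> = \<sigma>"
    and hcomp_right: "cell K \<sigma> f g \<Longrightarrow> \<sigma> \<star> Id2 K (Id1 K (Dom K f)) = \<sigma>"
    and hcomp_assoc: "cell K \<sigma> f f' \<Longrightarrow> cell K \<tau> g g' \<Longrightarrow> cell K \<upsilon> h h' \<Longrightarrow>
      Dom K g = Cod K f \<Longrightarrow> Dom K h = Cod K g \<Longrightarrow> (\<upsilon> \<star> \<tau>) \<star> \<sigma> = \<upsilon> \<star> (\<tau> \<star> \<sigma>)"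

definition iso_cell :: "('o, 'a, 'c) two_cat \<Rightarrow> 'c \<Rightarrow> 'a \<Rightarrow> 'a \<Rightarrow> bool" where
  "iso_cell K \<sigma> f g \<longleftrightarrow> cell K \<sigma> f g \<and>
     (\<exists>\<tau>. cell K \<tau> g f \<and> Vcomp K \<tau> \<sigma> = Id2 K f \<and> Vcomp K \<sigma> \<tau> = Id2 K g)"

definition cell_inv :: "('o, 'a, 'c) two_cat \<Rightarrow> 'c \<Rightarrow> 'c" where
  "cell_inv K \<sigma> = (THE \<tau>. cell K \<tau> (Tgt K \<sigma>) (Src K \<sigma>) \<and>
     Vcomp K \<tau> \<sigma> = Id2 K (Src K \<sigma>) \<and> Vcomp K \<sigma> \<tau> = Id2 K (Tgt K \<sigma>))"

definition hom_cat :: "('o, 'a, 'c) two_cat \<Rightarrow> 'o \<Rightarrow> 'o \<Rightarrow> ('a, 'c) cat" where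
  "hom_cat K X Y = \<lparr> cObj = {f. arr K f X Y},
     cArr = {\<sigma> \<in> Cell K. arr K (Src K \<sigma>) X Y \<and> arr K (Tgt K \<sigma>) X Y},
     cDom = Src K, cCod = Tgt K, cId = Id2 K, cComp = Vcomp K \<rparr>"

record ('o, 'a, 'c, 'p, 'b, 'd) two_fun =
  on_obj :: "'o \<Rightarrow> 'p"
  on_arr :: "'a \<Rightarrow> 'b"
  on_cell :: "'c \<Rightarrow> 'd"

locale two_functor =
  fixes K :: "('o, 'a, 'c) two_cat" and H :: "('p, 'b, 'd) two_cat"
    and F :: "('o, 'a, 'c, 'p, 'b, 'd) two_fun"
  assumes fun_obj: "X \<in> Obj K \<Longrightarrow> on_obj F X \<in> Obj H"
    and fun_arr: "arr K f X Y \<Longrightarrow> arr H (on_arr F f) (on_obj F X) (on_obj F Y)"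
    and fun_cell: "cell K \<sigma> f g \<Longrightarrow> cell H (on_cell F \<sigma>) (on_arr F f) (on_arr F g)"
    and fun_id1: "X \<in> Obj K \<Longrightarrow> on_arr F (Id1 K X) = Id1 H (on_obj F X)"
    and fun_comp1: "arr K f X Y \<Longrightarrow> arr K g Y Z \<Longrightarrow>
      on_arr F (g \<cdot>\<^bsub>K\<^esub> f) = on_arr F g \<cdot>\<^bsub>H\<^esub> on_arr F f"
    and fun_id2: "f \<in> Arr K \<Longrightarrow> on_cell F (Id2 K f) = Id2 H (on_arr F f)"
    and fun_vcomp: "cell K \<sigma> f g \<Longrightarrow> cell K \<tau> g h \<Longrightarrow>
      on_cell F (\<tau> \<bullet>\<^bsub>K\<^esub> \<sigma>) = on_cell F \<tau> \<bullet>\<^bsub>H\<^esub> on_cell F \<sigma>"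
    and fun_hcomp: "cell K \<sigma> f g \<Longrightarrow> cell K \<tau> h k \<Longrightarrow> Dom K h = Cod K f \<Longrightarrow>
      on_cell F (\<tau> \<star>\<^bsub>K\<^esub> \<sigma>) = on_cell F \<tau> \<star>\<^bsub>H\<^esub> on_cell F \<sigma>"

definition id_two_fun :: "('o, 'a, 'c, 'o, 'a, 'c) two_fun" where
  "id_two_fun = \<lparr> on_obj = id, on_arr = id, on_cell = id \<rparr>"

definition comp_two_fun ::
  "('p, 'b, 'd, 'r, 'e, 'g) two_fun \<Rightarrow> ('o, 'a, 'c, 'p, 'b, 'd) two_fun \<Rightarrow>
   ('o, 'a, 'c, 'r, 'e, 'g) two_fun"  (infixr "\<circ>\<^sub>2" 70) where
  "G \<circ>\<^sub>2 F = \<lparr> on_obj = on_obj G \<circ> on_obj F, on_arr = on_arr G \<circ> on_arr F,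
     on_cell = on_cell G \<circ> on_cell F \<rparr>"

text \<open>Pseudonatural transformations \<open>F \<Rightarrow> G\<close> with invertible cells
  \<open>\<alpha>c f : G f \<cdot> \<alpha> X \<Rightarrow> \<alpha> Y \<cdot> F f\<close>, and, in the second definition, the same notion presented by
  cells \<open>\<alpha>c f : \<alpha> Y \<cdot> F f \<Rightarrow> G f \<cdot> \<alpha> X\<close> in the opposite direction. The unit of a pseudomonad
  is given in the first form and its multiplication in the second.\<close>

definition pseudonatural ::
  "('o, 'a, 'c) two_cat \<Rightarrow> ('p, 'b, 'd) two_cat \<Rightarrow> ('o, 'a, 'c, 'p, 'b, 'd) two_fun \<Rightarrow>
   ('o, 'a, 'c, 'p, 'b, 'd) two_fun \<Rightarrow> ('o \<Rightarrow> 'b) \<Rightarrow> ('a \<Rightarrow> 'd) \<Rightarrow> bool" where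
  "pseudonatural K H F G \<alpha> \<alpha>c \<longleftrightarrow>
     (\<forall>X\<in>Obj K. arr H (\<alpha> X) (on_obj F X) (on_obj G X)) \<and>
     (\<forall>f X Y. arr K f X Y \<longrightarrow>
        iso_cell H (\<alpha>c f) (on_arr G f \<cdot>\<^bsub>H\<^esub> \<alpha> X) (\<alpha> Y \<cdot>\<^bsub>H\<^esub> on_arr F f)) \<and>
     (\<forall>\<sigma> f g X Y. arr K f X Y \<longrightarrow> cell K \<sigma> f g \<longrightarrow>
        (\<alpha> Y \<lhd>\<^bsub>H\<^esub> on_cell F \<sigma>) \<bullet>\<^bsub>H\<^esub> \<alpha>c f = \<alpha>c g \<bullet>\<^bsub>H\<^esub> (on_cell G \<sigma> \<rhd>\<^bsub>H\<^esub> \<alpha> X)) \<and>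
     (\<forall>X\<in>Obj K. \<alpha>c (Id1 K X) = Id2 H (\<alpha> X)) \<and>
     (\<forall>f g X Y Z. arr K f X Y \<longrightarrow> arr K g Y Z \<longrightarrow>
        \<alpha>c (g \<cdot>\<^bsub>K\<^esub> f) = (\<alpha>c g \<rhd>\<^bsub>H\<^esub> on_arr F f) \<bullet>\<^bsub>H\<^esub> (on_arr G g \<lhd>\<^bsub>H\<^esub> \<alpha>c f))"

definition pseudonatural_rev ::
  "('o, 'a, 'c) two_cat \<Rightarrow> ('p, 'b, 'd) two_cat \<Rightarrow> ('o, 'a, 'c, 'p, 'b, 'd) two_fun \<Rightarrow>
   ('o, 'a, 'c, 'p, 'b, 'd) two_fun \<Rightarrow> ('o \<Rightarrow> 'b) \<Rightarrow> ('a \<Rightarrow> 'd) \<Rightarrow> bool" where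
  "pseudonatural_rev K H F G \<alpha> \<alpha>c \<longleftrightarrow>
     (\<forall>X\<in>Obj K. arr H (\<alpha> X) (on_obj F X) (on_obj G X)) \<and>
     (\<forall>f X Y. arr K f X Y \<longrightarrow>
        iso_cell H (\<alpha>c f) (\<alpha> Y \<cdot>\<^bsub>H\<^esub> on_arr F f) (on_arr G f \<cdot>\<^bsub>H\<^esub> \<alpha> X)) \<and>
     (\<forall>\<sigma> f g X Y. arr K f X Y \<longrightarrow> cell K \<sigma> f g \<longrightarrow>
        (on_cell G \<sigma> \<rhd>\<^bsub>H\<^esub> \<alpha> X) \<bullet>\<^bsub>H\<^esub> \<alpha>c f = \<alpha>c g \<bullet>\<^bsub>H\<^esub> (\<alpha> Y \<lhd>\<^bsub>H\<^esub> on_cell F \<sigma>)) \<and>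
     (\<forall>X\<in>Obj K. \<alpha>c (Id1 K X) = Id2 H (\<alpha> X)) \<and>
     (\<forall>f g X Y Z. arr K f X Y \<longrightarrow> arr K g Y Z \<longrightarrow>
        \<alpha>c (g \<cdot>\<^bsub>K\<^esub> f) = (on_arr G g \<lhd>\<^bsub>H\<^esub> \<alpha>c f) \<bullet>\<^bsub>H\<^esub> (\<alpha>c g \<rhd>\<^bsub>H\<^esub> on_arr F f))"


section \<open>Smallness and weighted bicolimits\<close>

text \<open>The type parameter plays the role of the universe: a set is small if its cardinality is
  strictly below that of the universe. For a universe of inaccessible cardinality this is the
  usual notion; every small structure is isomorphic to one whose underlying sets consist of
  elements of the universe, which is why \<open>bicocomplete\<close> below may restrict attention to those.\<close>

definition small :: "'u itself \<Rightarrow> 'x set \<Rightarrow> bool" where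
  "small U S \<longleftrightarrow> S \<prec> (UNIV :: 'u set)"

definition small_cat :: "'u itself \<Rightarrow> ('x, 'm) cat \<Rightarrow> bool" where
  "small_cat U A \<longleftrightarrow> small U (cObj A) \<and> small U (cArr A)"

definition small_two_cat :: "'u itself \<Rightarrow> ('o, 'a, 'c) two_cat \<Rightarrow> bool" where
  "small_two_cat U K \<longleftrightarrow> small U (Obj K) \<and> small U (Arr K) \<and> small U (Cell K)"

text \<open>A weight is a strict 2-functor from \<open>J\<close> with reversed 1-cells to categories:
  \<open>(w_obj W d, w_arr W d)\<close> is the functor attached to a 1-cell \<open>d\<close>, and \<open>w_cell W \<sigma>\<close> gives the
  components of the natural transformation attached to a 2-cell \<open>\<sigma>\<close>.\<close>

record ('i, 'd, 's, 'x, 'm) weight =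
  w_cat :: "'i \<Rightarrow> ('x, 'm) cat"
  w_obj :: "'d \<Rightarrow> 'x \<Rightarrow> 'x"
  w_arr :: "'d \<Rightarrow> 'm \<Rightarrow> 'm"
  w_cell :: "'s \<Rightarrow> 'x \<Rightarrow> 'm"

locale weight_functor =
  fixes J :: "('i, 'd, 's) two_cat" and W :: "('i, 'd, 's, 'x, 'm) weight"
  assumes w_category: "i \<in> Obj J \<Longrightarrow> category (w_cat W i)"
    and w_functor: "arr J d i j \<Longrightarrow> is_functor (w_cat W j) (w_cat W i) (w_obj W d) (w_arr W d)"
    and w_component: "arr J d i j \<Longrightarrow> cell J \<sigma> d e \<Longrightarrow> x \<in> cObj (w_cat W j) \<Longrightarrow>
      carr (w_cat W i) (w_cell W \<sigma> x) (w_obj W d x) (w_obj W e x)"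
    and w_natural: "arr J d i j \<Longrightarrow> cell J \<sigma> d e \<Longrightarrow> carr (w_cat W j) m x y \<Longrightarrow>
      cComp (w_cat W i) (w_cell W \<sigma> y) (w_arr W d m) =
      cComp (w_cat W i) (w_arr W e m) (w_cell W \<sigma> x)"
    and w_id1_obj: "i \<in> Obj J \<Longrightarrow> x \<in> cObj (w_cat W i) \<Longrightarrow> w_obj W (Id1 J i) x = x"
    and w_id1_arr: "i \<in> Obj J \<Longrightarrow> m \<in> cArr (w_cat W i) \<Longrightarrow> w_arr W (Id1 J i) m = m"
    and w_comp1_obj: "arr J d i j \<Longrightarrow> arr J e j k \<Longrightarrow> x \<in> cObj (w_cat W k) \<Longrightarrow>
      w_obj W (e \<cdot>\<^bsub>J\<^esub> d) x = w_obj W d (w_obj W e x)"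
    and w_comp1_arr: "arr J d i j \<Longrightarrow> arr J e j k \<Longrightarrow> m \<in> cArr (w_cat W k) \<Longrightarrow>
      w_arr W (e \<cdot>\<^bsub>J\<^esub> d) m = w_arr W d (w_arr W e m)"
    and w_id2: "arr J d i j \<Longrightarrow> x \<in> cObj (w_cat W j) \<Longrightarrow>
      w_cell W (Id2 J d) x = cId (w_cat W i) (w_obj W d x)"
    and w_vcomp: "arr J d i j \<Longrightarrow> cell J \<sigma> d d' \<Longrightarrow> cell J \<tau> d' d'' \<Longrightarrow> x \<in> cObj (w_cat W j) \<Longrightarrow>
      w_cell W (\<tau> \<bullet>\<^bsub>J\<^esub> \<sigma>) x = cComp (w_cat W i) (w_cell W \<tau> x) (w_cell W \<sigma> x)"
    and w_hcomp: "arr J d i j \<Longrightarrow> arr J e j k \<Longrightarrow> cell J \<sigma> d d' \<Longrightarrow> cell J \<tau> e e' \<Longrightarrow>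
      x \<in> cObj (w_cat W k) \<Longrightarrow>
      w_cell W (\<tau> \<star>\<^bsub>J\<^esub> \<sigma>) x =
      cComp (w_cat W i) (w_cell W \<sigma> (w_obj W e' x)) (w_arr W d (w_cell W \<tau> x))"

text \<open>A \<open>W\<close>-weighted cocone on \<open>F\<close> with tip \<open>B\<close> is a pseudonatural transformation from \<open>W\<close> to
  \<open>i \<mapsto> K[F i, B]\<close>: functors \<open>(u (i, -), v (i, -))\<close> from \<open>W i\<close> to \<open>K[F i, B]\<close> together with invertible
  cells \<open>n (d, x) : u (j, x) \<cdot> F d \<Rightarrow> u (i, W d x)\<close> for \<open>d : i \<rightarrow> j\<close> and \<open>x\<close> in \<open>W j\<close>.
  Morphisms of weighted cocones are modifications.\<close>

definition weighted_cocone ::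
  "('o, 'a, 'c) two_cat \<Rightarrow> ('i, 'd, 's) two_cat \<Rightarrow> ('i, 'd, 's, 'x, 'm) weight \<Rightarrow>
   ('i, 'd, 's, 'o, 'a, 'c) two_fun \<Rightarrow> 'o \<Rightarrow>
   ('i \<times> 'x \<Rightarrow> 'a) \<Rightarrow> ('i \<times> 'm \<Rightarrow> 'c) \<Rightarrow> ('d \<times> 'x \<Rightarrow> 'c) \<Rightarrow> bool" where
  "weighted_cocone K J W F B u v n \<longleftrightarrow>
     B \<in> Obj K \<and>
     (\<forall>i\<in>Obj J. is_functor (w_cat W i) (hom_cat K (on_obj F i) B) (\<lambda>x. u (i, x)) (\<lambda>m. v (i, m))) \<and>
     (\<forall>d i j x. arr J d i j \<longrightarrow> x \<in> cObj (w_cat W j) \<longrightarrow>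
        iso_cell K (n (d, x)) (u (j, x) \<cdot>\<^bsub>K\<^esub> on_arr F d) (u (i, w_obj W d x))) \<and>
     (\<forall>d i j m x y. arr J d i j \<longrightarrow> carr (w_cat W j) m x y \<longrightarrow>
        n (d, y) \<bullet>\<^bsub>K\<^esub> (v (j, m) \<rhd>\<^bsub>K\<^esub> on_arr F d) = v (i, w_arr W d m) \<bullet>\<^bsub>K\<^esub> n (d, x)) \<and>
     (\<forall>i\<in>Obj J. \<forall>x\<in>cObj (w_cat W i). n (Id1 J i, x) = Id2 K (u (i, x))) \<and>
     (\<forall>d e i j k x. arr J d i j \<longrightarrow> arr J e j k \<longrightarrow> x \<in> cObj (w_cat W k) \<longrightarrow>
        n (e \<cdot>\<^bsub>J\<^esub> d, x) = n (d, w_obj W e x) \<bullet>\<^bsub>K\<^esub> (n (e, x) \<rhd>\<^bsub>K\<^esub> on_arr F d)) \<and>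
     (\<forall>\<sigma> d e i j x. arr J d i j \<longrightarrow> cell J \<sigma> d e \<longrightarrow> x \<in> cObj (w_cat W j) \<longrightarrow>
        v (i, w_cell W \<sigma> x) \<bullet>\<^bsub>K\<^esub> n (d, x) = n (e, x) \<bullet>\<^bsub>K\<^esub> (u (j, x) \<lhd>\<^bsub>K\<^esub> on_cell F \<sigma>))"

definition weighted_modification ::
  "('o, 'a, 'c) two_cat \<Rightarrow> ('i, 'd, 's) two_cat \<Rightarrow> ('i, 'd, 's, 'x, 'm) weight \<Rightarrow>
   ('i, 'd, 's, 'o, 'a, 'c) two_fun \<Rightarrow>
   ('i \<times> 'x \<Rightarrow> 'a) \<times> ('i \<times> 'm \<Rightarrow> 'c) \<times> ('d \<times> 'x \<Rightarrow> 'c) \<Rightarrow>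
   ('i \<times> 'x \<Rightarrow> 'a) \<times> ('i \<times> 'm \<Rightarrow> 'c) \<times> ('d \<times> 'x \<Rightarrow> 'c) \<Rightarrow> ('i \<times> 'x \<Rightarrow> 'c) \<Rightarrow> bool" where
  "weighted_modification K J W F = (\<lambda>(u, v, n) (u', v', n') \<Gamma>.
     (\<forall>i\<in>Obj J. \<forall>x\<in>cObj (w_cat W i). cell K (\<Gamma> (i, x)) (u (i, x)) (u' (i, x))) \<and>
     (\<forall>i m x y. i \<in> Obj J \<longrightarrow> carr (w_cat W i) m x y \<longrightarrow>
        \<Gamma> (i, y) \<bullet>\<^bsub>K\<^esub> v (i, m) = v' (i, m) \<bullet>\<^bsub>K\<^esub> \<Gamma> (i, x)) \<and>
     (\<forall>d i j x. arr J d i j \<longrightarrow> x \<in> cObj (w_cat W j) \<longrightarrow>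
        \<Gamma> (i, w_obj W d x) \<bullet>\<^bsub>K\<^esub> n (d, x) = n' (d, x) \<bullet>\<^bsub>K\<^esub> (\<Gamma> (j, x) \<rhd>\<^bsub>K\<^esub> on_arr F d)))"

text \<open>Families are extensional (equal to \<open>undefined\<close> off their index sets), so that equality in
  the categories of cocones is equality of families.\<close>

abbreviation w_objs :: "('i, 'd, 's) two_cat \<Rightarrow> ('i, 'd, 's, 'x, 'm) weight \<Rightarrow> ('i \<times> 'x) set" where
  "w_objs J W \<equiv> SIGMA i:Obj J. cObj (w_cat W i)"

abbreviation w_arrs :: "('i, 'd, 's) two_cat \<Rightarrow> ('i, 'd, 's, 'x, 'm) weight \<Rightarrow> ('i \<times> 'm) set" where
  "w_arrs J W \<equiv> SIGMA i:Obj J. cArr (w_cat W i)"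

abbreviation w_trans :: "('i, 'd, 's) two_cat \<Rightarrow> ('i, 'd, 's, 'x, 'm) weight \<Rightarrow> ('d \<times> 'x) set" where
  "w_trans J W \<equiv> SIGMA d:Arr J. cObj (w_cat W (Cod J d))"

definition weighted_cocones ::
  "('o, 'a, 'c) two_cat \<Rightarrow> ('i, 'd, 's) two_cat \<Rightarrow> ('i, 'd, 's, 'x, 'm) weight \<Rightarrow>
   ('i, 'd, 's, 'o, 'a, 'c) two_fun \<Rightarrow> 'o \<Rightarrow>
   (('i \<times> 'x \<Rightarrow> 'a) \<times> ('i \<times> 'm \<Rightarrow> 'c) \<times> ('d \<times> 'x \<Rightarrow> 'c),
    (('i \<times> 'x \<Rightarrow> 'a) \<times> ('i \<times> 'm \<Rightarrow> 'c) \<times> ('d \<times> 'x \<Rightarrow> 'c)) \<times> ('i \<times> 'x \<Rightarrow> 'c) \<times>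
    (('i \<times> 'x \<Rightarrow> 'a) \<times> ('i \<times> 'm \<Rightarrow> 'c) \<times> ('d \<times> 'x \<Rightarrow> 'c))) cat" where
  "weighted_cocones K J W F B = (let
     Ob = {(u, v, n). u \<in> extensional (w_objs J W) \<and> v \<in> extensional (w_arrs J W) \<and>
             n \<in> extensional (w_trans J W) \<and> weighted_cocone K J W F B u v n} in
     \<lparr> cObj = Ob,
       cArr = {(r, \<Gamma>, r'). r \<in> Ob \<and> r' \<in> Ob \<and> \<Gamma> \<in> extensional (w_objs J W) \<and>
                 weighted_modification K J W F r r' \<Gamma>},
       cDom = (\<lambda>(r, \<Gamma>, r'). r),
       cCod = (\<lambda>(r, \<Gamma>, r'). r'),
       cId = (\<lambda>(u, v, n). ((u, v, n), (\<lambda>z\<in>w_objs J W. Id2 K (u z)), (u, v, n))),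
       cComp = (\<lambda>(r', \<Delta>, r'') (r, \<Gamma>, s). (r, (\<lambda>z\<in>w_objs J W. \<Delta> z \<bullet>\<^bsub>K\<^esub> \<Gamma> z), r'')) \<rparr>)"

definition whisker_weighted_cocone ::
  "('o, 'a, 'c) two_cat \<Rightarrow> ('i, 'd, 's) two_cat \<Rightarrow> ('i, 'd, 's, 'x, 'm) weight \<Rightarrow>
   ('i \<times> 'x \<Rightarrow> 'a) \<Rightarrow> ('i \<times> 'm \<Rightarrow> 'c) \<Rightarrow> ('d \<times> 'x \<Rightarrow> 'c) \<Rightarrow> 'a \<Rightarrow>
   ('i \<times> 'x \<Rightarrow> 'a) \<times> ('i \<times> 'm \<Rightarrow> 'c) \<times> ('d \<times> 'x \<Rightarrow> 'c)" where
  "whisker_weighted_cocone K J W u v n h =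
     ((\<lambda>z\<in>w_objs J W. h \<cdot>\<^bsub>K\<^esub> u z), (\<lambda>z\<in>w_arrs J W. h \<lhd>\<^bsub>K\<^esub> v z), (\<lambda>z\<in>w_trans J W. h \<lhd>\<^bsub>K\<^esub> n z))"

definition is_weighted_bicolimit ::
  "('o, 'a, 'c) two_cat \<Rightarrow> ('i, 'd, 's) two_cat \<Rightarrow> ('i, 'd, 's, 'x, 'm) weight \<Rightarrow>
   ('i, 'd, 's, 'o, 'a, 'c) two_fun \<Rightarrow> 'o \<Rightarrow>
   ('i \<times> 'x \<Rightarrow> 'a) \<Rightarrow> ('i \<times> 'm \<Rightarrow> 'c) \<Rightarrow> ('d \<times> 'x \<Rightarrow> 'c) \<Rightarrow> bool" where
  "is_weighted_bicolimit K J W F L u v n \<longleftrightarrow> weighted_cocone K J W F L u v n \<and>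
     (\<forall>B\<in>Obj K. is_equivalence (hom_cat K L B) (weighted_cocones K J W F B)
        (whisker_weighted_cocone K J W u v n)
        (\<lambda>\<sigma>. (whisker_weighted_cocone K J W u v n (Src K \<sigma>),
              (\<lambda>z\<in>w_objs J W. \<sigma> \<rhd>\<^bsub>K\<^esub> u z),
              whisker_weighted_cocone K J W u v n (Tgt K \<sigma>))))"

definition bicocomplete :: "'u itself \<Rightarrow> ('o, 'a, 'c) two_cat \<Rightarrow> bool" where
  "bicocomplete U K \<longleftrightarrow>
     (\<forall>(J :: ('u, 'u, 'u) two_cat) (W :: ('u, 'u, 'u, 'u, 'u) weight) F.
        two_category J \<longrightarrow> small_two_cat U J \<longrightarrow> weight_functor J W \<longrightarrow>
        (\<forall>i\<in>Obj J. small_cat U (w_cat W i)) \<longrightarrow> two_functor J K F \<longrightarrow>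
        (\<exists>L u v n. is_weighted_bicolimit K J W F L u v n))"


section \<open>Oplax bicolimits\<close>

definition oplax_cocone ::
  "('o, 'a, 'c) two_cat \<Rightarrow> ('i, 'd, 's) two_cat \<Rightarrow> ('i, 'd, 's, 'o, 'a, 'c) two_fun \<Rightarrow> 'o \<Rightarrow>
   ('i \<Rightarrow> 'a) \<Rightarrow> ('d \<Rightarrow> 'c) \<Rightarrow> bool" where
  "oplax_cocone K I F B q qd \<longleftrightarrow>
     B \<in> Obj K \<and>
     (\<forall>i\<in>Obj I. arr K (q i) (on_obj F i) B) \<and>
     (\<forall>d i j. arr I d i j \<longrightarrow> cell K (qd d) (q j \<cdot>\<^bsub>K\<^esub> on_arr F d) (q i)) \<and>
     (\<forall>i\<in>Obj I. qd (Id1 I i) = Id2 K (q i)) \<and>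
     (\<forall>d e i j k. arr I d i j \<longrightarrow> arr I e j k \<longrightarrow>
        qd (e \<cdot>\<^bsub>I\<^esub> d) = qd d \<bullet>\<^bsub>K\<^esub> (qd e \<rhd>\<^bsub>K\<^esub> on_arr F d)) \<and>
     (\<forall>\<sigma> d d' i j. arr I d i j \<longrightarrow> cell I \<sigma> d d' \<longrightarrow>
        qd d' \<bullet>\<^bsub>K\<^esub> (q j \<lhd>\<^bsub>K\<^esub> on_cell F \<sigma>) = qd d)"

definition oplax_modification ::
  "('o, 'a, 'c) two_cat \<Rightarrow> ('i, 'd, 's) two_cat \<Rightarrow> ('i, 'd, 's, 'o, 'a, 'c) two_fun \<Rightarrow>
   ('i \<Rightarrow> 'a) \<times> ('d \<Rightarrow> 'c) \<Rightarrow> ('i \<Rightarrow> 'a) \<times> ('d \<Rightarrow> 'c) \<Rightarrow> ('i \<Rightarrow> 'c) \<Rightarrow> bool" where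
  "oplax_modification K I F = (\<lambda>(q, qd) (r, rd) \<Gamma>.
     (\<forall>i\<in>Obj I. cell K (\<Gamma> i) (q i) (r i)) \<and>
     (\<forall>d i j. arr I d i j \<longrightarrow> \<Gamma> i \<bullet>\<^bsub>K\<^esub> qd d = rd d \<bullet>\<^bsub>K\<^esub> (\<Gamma> j \<rhd>\<^bsub>K\<^esub> on_arr F d)))"

definition oplax_cocones ::
  "('o, 'a, 'c) two_cat \<Rightarrow> ('i, 'd, 's) two_cat \<Rightarrow> ('i, 'd, 's, 'o, 'a, 'c) two_fun \<Rightarrow> 'o \<Rightarrow>
   (('i \<Rightarrow> 'a) \<times> ('d \<Rightarrow> 'c),
    (('i \<Rightarrow> 'a) \<times> ('d \<Rightarrow> 'c)) \<times> ('i \<Rightarrow> 'c) \<times> (('i \<Rightarrow> 'a) \<times> ('d \<Rightarrow> 'c))) cat" where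
  "oplax_cocones K I F B = (let
     Ob = {(q, qd). q \<in> extensional (Obj I) \<and> qd \<in> extensional (Arr I) \<and>
             oplax_cocone K I F B q qd} in
     \<lparr> cObj = Ob,
       cArr = {(r, \<Gamma>, r'). r \<in> Ob \<and> r' \<in> Ob \<and> \<Gamma> \<in> extensional (Obj I) \<and>
                 oplax_modification K I F r r' \<Gamma>},
       cDom = (\<lambda>(r, \<Gamma>, r'). r),
       cCod = (\<lambda>(r, \<Gamma>, r'). r'),
       cId = (\<lambda>(q, qd). ((q, qd), (\<lambda>i\<in>Obj I. Id2 K (q i)), (q, qd))),
       cComp = (\<lambda>(r', \<Delta>, r'') (r, \<Gamma>, s). (r, (\<lambda>i\<in>Obj I. \<Delta> i \<bullet>\<^bsub>K\<^esub> \<Gamma> i), r'')) \<rparr>)"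

definition whisker_cocone ::
  "('o, 'a, 'c) two_cat \<Rightarrow> ('i, 'd, 's) two_cat \<Rightarrow> ('i \<Rightarrow> 'a) \<Rightarrow> ('d \<Rightarrow> 'c) \<Rightarrow> 'a \<Rightarrow>
   ('i \<Rightarrow> 'a) \<times> ('d \<Rightarrow> 'c)" where
  "whisker_cocone K I q qd h = ((\<lambda>i\<in>Obj I. h \<cdot>\<^bsub>K\<^esub> q i), (\<lambda>d\<in>Arr I. h \<lhd>\<^bsub>K\<^esub> qd d))"

text \<open>Naturality in \<open>B\<close> of the equivalences is automatic: \<open>(v \<cdot> h) \<cdot> q i = v \<cdot> (h \<cdot> q i)\<close> strictly.
  The same remark applies to the other universal properties.\<close>

definition is_oplax_bicolimit ::
  "('o, 'a, 'c) two_cat \<Rightarrow> ('i, 'd, 's) two_cat \<Rightarrow> ('i, 'd, 's, 'o, 'a, 'c) two_fun \<Rightarrow> 'o \<Rightarrow>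
   ('i \<Rightarrow> 'a) \<Rightarrow> ('d \<Rightarrow> 'c) \<Rightarrow> bool" where
  "is_oplax_bicolimit K I F L q qd \<longleftrightarrow> oplax_cocone K I F L q qd \<and>
     (\<forall>B\<in>Obj K. is_equivalence (hom_cat K L B) (oplax_cocones K I F B)
        (whisker_cocone K I q qd)
        (\<lambda>\<sigma>. (whisker_cocone K I q qd (Src K \<sigma>),
              (\<lambda>i\<in>Obj I. \<sigma> \<rhd>\<^bsub>K\<^esub> q i),
              whisker_cocone K I q qd (Tgt K \<sigma>))))"

text \<open>The 1-cell \<open>u\<close> out of the tip of \<open>(q, qd)\<close> is induced by the cocone \<open>(r, rd)\<close> through the
  invertible modification \<open>\<Gamma>\<close> from \<open>u (q, qd)\<close> to \<open>(r, rd)\<close>.\<close>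

definition induced_by_cocone ::
  "('o, 'a, 'c) two_cat \<Rightarrow> ('i, 'd, 's) two_cat \<Rightarrow> ('i, 'd, 's, 'o, 'a, 'c) two_fun \<Rightarrow>
   ('i \<Rightarrow> 'a) \<Rightarrow> ('d \<Rightarrow> 'c) \<Rightarrow> ('i \<Rightarrow> 'a) \<Rightarrow> ('d \<Rightarrow> 'c) \<Rightarrow> 'a \<Rightarrow> ('i \<Rightarrow> 'c) \<Rightarrow> bool" where
  "induced_by_cocone K I F q qd r rd u \<Gamma> \<longleftrightarrow>
     (\<forall>i\<in>Obj I. iso_cell K (\<Gamma> i) (u \<cdot>\<^bsub>K\<^esub> q i) (r i)) \<and>
     oplax_modification K I F ((\<lambda>i. u \<cdot>\<^bsub>K\<^esub> q i), (\<lambda>d. u \<lhd>\<^bsub>K\<^esub> qd d)) (r, rd) \<Gamma>"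

text \<open>The 1-cell \<open>u\<close> between the tips of \<open>(q, qd)\<close> and \<open>(r, rd)\<close> is induced by a family
  \<open>g i : F i \<rightarrow> G i\<close>, pseudonatural via cells \<open>\<gamma> d : g j \<cdot> F d \<Rightarrow> G d \<cdot> g i\<close> for \<open>d : i \<rightarrow> j\<close>:
  the relevant cocone has 1-cells \<open>r i \<cdot> g i\<close> and 2-cells
  \<open>r j \<cdot> g j \<cdot> F d \<Rightarrow> r j \<cdot> G d \<cdot> g i \<Rightarrow> r i \<cdot> g i\<close>.\<close>

definition induced_by_family ::
  "('o, 'a, 'c) two_cat \<Rightarrow> ('i, 'd, 's) two_cat \<Rightarrow> ('i, 'd, 's, 'o, 'a, 'c) two_fun \<Rightarrow>
   ('i \<Rightarrow> 'a) \<Rightarrow> ('d \<Rightarrow> 'c) \<Rightarrow> ('i \<Rightarrow> 'a) \<Rightarrow> ('d \<Rightarrow> 'c) \<Rightarrow> ('i \<Rightarrow> 'a) \<Rightarrow> ('d \<Rightarrow> 'c) \<Rightarrow>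
   'a \<Rightarrow> ('i \<Rightarrow> 'c) \<Rightarrow> bool" where
  "induced_by_family K I F q qd r rd g \<gamma> u \<Gamma> \<longleftrightarrow>
     induced_by_cocone K I F q qd (\<lambda>i. r i \<cdot>\<^bsub>K\<^esub> g i)
       (\<lambda>d. (rd d \<rhd>\<^bsub>K\<^esub> g (Dom I d)) \<bullet>\<^bsub>K\<^esub> (r (Cod I d) \<lhd>\<^bsub>K\<^esub> \<gamma> d)) u \<Gamma>"


section \<open>Codescent objects and bicoequalizers\<close>

record ('o, 'a, 'c) codescent =
  lev0 :: 'o
  lev1 :: 'o
  lev2 :: 'o
  cd_p0 :: 'a
  cd_p1 :: 'a
  cd_p2 :: 'a
  cd_d0 :: 'a
  cd_d1 :: 'a
  cd_i :: 'a
  cd_n0 :: 'c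
  cd_n1 :: 'c
  cd_\<theta>01 :: 'c
  cd_\<theta>02 :: 'c
  cd_\<theta>12 :: 'c

definition codescent_object :: "('o, 'a, 'c) two_cat \<Rightarrow> ('o, 'a, 'c) codescent \<Rightarrow> bool" where
  "codescent_object K X \<longleftrightarrow>
     lev0 X \<in> Obj K \<and> lev1 X \<in> Obj K \<and> lev2 X \<in> Obj K \<and>
     arr K (cd_p0 X) (lev2 X) (lev1 X) \<and> arr K (cd_p1 X) (lev2 X) (lev1 X) \<and>
     arr K (cd_p2 X) (lev2 X) (lev1 X) \<and>
     arr K (cd_d0 X) (lev1 X) (lev0 X) \<and> arr K (cd_d1 X) (lev1 X) (lev0 X) \<and>
     arr K (cd_i X) (lev0 X) (lev1 X) \<and>
     iso_cell K (cd_n0 X) (cd_d0 X \<cdot>\<^bsub>K\<^esub> cd_i X) (Id1 K (lev0 X)) \<and>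
     iso_cell K (cd_n1 X) (cd_d1 X \<cdot>\<^bsub>K\<^esub> cd_i X) (Id1 K (lev0 X)) \<and>
     iso_cell K (cd_\<theta>01 X) (cd_d0 X \<cdot>\<^bsub>K\<^esub> cd_p0 X) (cd_d0 X \<cdot>\<^bsub>K\<^esub> cd_p1 X) \<and>
     iso_cell K (cd_\<theta>02 X) (cd_d1 X \<cdot>\<^bsub>K\<^esub> cd_p0 X) (cd_d0 X \<cdot>\<^bsub>K\<^esub> cd_p2 X) \<and>
     iso_cell K (cd_\<theta>12 X) (cd_d1 X \<cdot>\<^bsub>K\<^esub> cd_p1 X) (cd_d1 X \<cdot>\<^bsub>K\<^esub> cd_p2 X)"

definition pseudocoequalizes ::
  "('o, 'a, 'c) two_cat \<Rightarrow> ('o, 'a, 'c) codescent \<Rightarrow> 'o \<Rightarrow> 'a \<Rightarrow> 'c \<Rightarrow> bool" where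
  "pseudocoequalizes K X B q \<xi> \<longleftrightarrow>
     arr K q (lev0 X) B \<and>
     iso_cell K \<xi> (q \<cdot>\<^bsub>K\<^esub> cd_d0 X) (q \<cdot>\<^bsub>K\<^esub> cd_d1 X) \<and>
     (q \<lhd>\<^bsub>K\<^esub> cd_n1 X) \<bullet>\<^bsub>K\<^esub> (\<xi> \<rhd>\<^bsub>K\<^esub> cd_i X) = q \<lhd>\<^bsub>K\<^esub> cd_n0 X \<and>
     (q \<lhd>\<^bsub>K\<^esub> cd_\<theta>12 X) \<bullet>\<^bsub>K\<^esub> (\<xi> \<rhd>\<^bsub>K\<^esub> cd_p1 X) \<bullet>\<^bsub>K\<^esub> (q \<lhd>\<^bsub>K\<^esub> cd_\<theta>01 X) =
     (\<xi> \<rhd>\<^bsub>K\<^esub> cd_p2 X) \<bullet>\<^bsub>K\<^esub> (q \<lhd>\<^bsub>K\<^esub> cd_\<theta>02 X) \<bullet>\<^bsub>K\<^esub> (\<xi> \<rhd>\<^bsub>K\<^esub> cd_p0 X)"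

definition pair_morphism ::
  "('o, 'a, 'c) two_cat \<Rightarrow> ('o, 'a, 'c) codescent \<Rightarrow> 'a \<times> 'c \<Rightarrow> 'a \<times> 'c \<Rightarrow> 'c \<Rightarrow> bool" where
  "pair_morphism K X = (\<lambda>(q, \<xi>) (q', \<xi>') \<sigma>. cell K \<sigma> q q' \<and>
     (\<sigma> \<rhd>\<^bsub>K\<^esub> cd_d1 X) \<bullet>\<^bsub>K\<^esub> \<xi> = \<xi>' \<bullet>\<^bsub>K\<^esub> (\<sigma> \<rhd>\<^bsub>K\<^esub> cd_d0 X))"

definition pseudocoequalizing_pairs ::
  "('o, 'a, 'c) two_cat \<Rightarrow> ('o, 'a, 'c) codescent \<Rightarrow> 'o \<Rightarrow>
   ('a \<times> 'c, ('a \<times> 'c) \<times> 'c \<times> ('a \<times> 'c)) cat" where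
  "pseudocoequalizing_pairs K X B = (let Ob = {(q, \<xi>). pseudocoequalizes K X B q \<xi>} in
     \<lparr> cObj = Ob,
       cArr = {(r, \<sigma>, r'). r \<in> Ob \<and> r' \<in> Ob \<and> pair_morphism K X r r' \<sigma>},
       cDom = (\<lambda>(r, \<sigma>, r'). r),
       cCod = (\<lambda>(r, \<sigma>, r'). r'),
       cId = (\<lambda>(q, \<xi>). ((q, \<xi>), Id2 K q, (q, \<xi>))),
       cComp = (\<lambda>(r', \<tau>, r'') (r, \<sigma>, s). (r, \<tau> \<bullet>\<^bsub>K\<^esub> \<sigma>, r'')) \<rparr>)"

definition is_bicoequalizer ::
  "('o, 'a, 'c) two_cat \<Rightarrow> ('o, 'a, 'c) codescent \<Rightarrow> 'o \<Rightarrow> 'a \<Rightarrow> 'c \<Rightarrow> bool" where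
  "is_bicoequalizer K X Z q \<xi> \<longleftrightarrow> pseudocoequalizes K X Z q \<xi> \<and>
     (\<forall>B\<in>Obj K. is_equivalence (hom_cat K Z B) (pseudocoequalizing_pairs K X B)
        (\<lambda>h. (h \<cdot>\<^bsub>K\<^esub> q, h \<lhd>\<^bsub>K\<^esub> \<xi>))
        (\<lambda>\<sigma>. ((Src K \<sigma> \<cdot>\<^bsub>K\<^esub> q, Src K \<sigma> \<lhd>\<^bsub>K\<^esub> \<xi>), \<sigma> \<rhd>\<^bsub>K\<^esub> q,
              (Tgt K \<sigma> \<cdot>\<^bsub>K\<^esub> q, Tgt K \<sigma> \<lhd>\<^bsub>K\<^esub> \<xi>))))"

definition has_bicoequalizers :: "('o, 'a, 'c) two_cat \<Rightarrow> bool" where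
  "has_bicoequalizers K \<longleftrightarrow>
     (\<forall>X. codescent_object K X \<longrightarrow> (\<exists>Z q \<xi>. is_bicoequalizer K X Z q \<xi>))"

text \<open>The cell of a morphism \<open>x : X \<rightarrow> Y\<close> at \<open>g : X(k) \<rightarrow> X(l)\<close> has the direction
  \<open>Y(g) \<cdot> x\<^sub>k \<Rightarrow> x\<^sub>l \<cdot> X(g)\<close>.\<close>

record ('a, 'c) codescent_mor =
  cm0 :: 'a
  cm1 :: 'a
  cm2 :: 'a
  cm_d0 :: 'c
  cm_d1 :: 'c
  cm_i :: 'c
  cm_p0 :: 'c
  cm_p1 :: 'c
  cm_p2 :: 'c

text \<open>\<open>(u, x')\<close> is the 1-cell induced on bicoequalizers by \<open>x\<close>, where \<open>(q, \<xi>)\<close> and \<open>(q', \<xi>')\<close> are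
  bicoequalizers of \<open>X\<close> and \<open>Y\<close>, with tips \<open>Z\<close> and \<open>Z'\<close>, and \<open>x' : q' \<cdot> x\<^sub>0 \<Rightarrow> u \<cdot> q\<close> is the invertible
  comparison 2-cell: it is compatible with \<open>u \<xi>\<close> and with the composite of \<open>\<xi>' x\<^sub>1\<close> with the cells
  of \<open>x\<close> at \<open>d\<^sub>0\<close> and \<open>d\<^sub>1\<close>.\<close>

definition is_bicoeq_map ::
  "('o, 'a, 'c) two_cat \<Rightarrow> ('o, 'a, 'c) codescent \<Rightarrow> ('a, 'c) codescent_mor \<Rightarrow>
   'o \<Rightarrow> 'a \<Rightarrow> 'c \<Rightarrow> 'o \<Rightarrow> 'a \<Rightarrow> 'c \<Rightarrow> 'a \<Rightarrow> 'c \<Rightarrow> bool" where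
  "is_bicoeq_map K X x Z q \<xi> Z' q' \<xi>' u x' \<longleftrightarrow>
     arr K u Z Z' \<and>
     iso_cell K x' (q' \<cdot>\<^bsub>K\<^esub> cm0 x) (u \<cdot>\<^bsub>K\<^esub> q) \<and>
     (u \<lhd>\<^bsub>K\<^esub> \<xi>) \<bullet>\<^bsub>K\<^esub> (x' \<rhd>\<^bsub>K\<^esub> cd_d0 X) \<bullet>\<^bsub>K\<^esub> (q' \<lhd>\<^bsub>K\<^esub> cm_d0 x) =
     (x' \<rhd>\<^bsub>K\<^esub> cd_d1 X) \<bullet>\<^bsub>K\<^esub> (q' \<lhd>\<^bsub>K\<^esub> cm_d1 x) \<bullet>\<^bsub>K\<^esub> (\<xi>' \<rhd>\<^bsub>K\<^esub> cm1 x)"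


section \<open>Pseudomonads and pseudo-algebras\<close>

record ('o, 'a, 'c) psmonad =
  monad_fun :: "('o, 'a, 'c, 'o, 'a, 'c) two_fun"
  unit1 :: "'o \<Rightarrow> 'a"
  unit2 :: "'a \<Rightarrow> 'c"
  mult1 :: "'o \<Rightarrow> 'a"
  mult2 :: "'a \<Rightarrow> 'c"
  mod_\<xi> :: "'o \<Rightarrow> 'c"
  mod_\<zeta> :: "'o \<Rightarrow> 'c"
  mod_\<rho> :: "'o \<Rightarrow> 'c"

record ('o, 'a, 'c) psalg =
  alg_obj :: 'o
  alg_act :: 'a
  alg_unit :: 'c
  alg_assoc :: 'c

text \<open>1-cells and 2-cells of the 2-category of pseudo-algebras carry their source and target.\<close>

record ('o, 'a, 'c) psmor =
  mor_dom :: "('o, 'a, 'c) psalg"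
  mor_cod :: "('o, 'a, 'c) psalg"
  mor_map :: 'a
  mor_cell :: 'c

record ('o, 'a, 'c) pstrans =
  tr_src :: "('o, 'a, 'c) psmor"
  tr_tgt :: "('o, 'a, 'c) psmor"
  tr_cell :: 'c

abbreviation mk_alg :: "'o \<Rightarrow> 'a \<Rightarrow> 'c \<Rightarrow> 'c \<Rightarrow> ('o, 'a, 'c) psalg" where
  "mk_alg A a t s \<equiv> \<lparr> alg_obj = A, alg_act = a, alg_unit = t, alg_assoc = s \<rparr>"

abbreviation mk_mor ::
  "('o, 'a, 'c) psalg \<Rightarrow> ('o, 'a, 'c) psalg \<Rightarrow> 'a \<Rightarrow> 'c \<Rightarrow> ('o, 'a, 'c) psmor" where
  "mk_mor A B f \<phi> \<equiv> \<lparr> mor_dom = A, mor_cod = B, mor_map = f, mor_cell = \<phi> \<rparr>"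

abbreviation mk_trans ::
  "('o, 'a, 'c) psmor \<Rightarrow> ('o, 'a, 'c) psmor \<Rightarrow> 'c \<Rightarrow> ('o, 'a, 'c) pstrans" where
  "mk_trans f g \<sigma> \<equiv> \<lparr> tr_src = f, tr_tgt = g, tr_cell = \<sigma> \<rparr>"

context
  fixes C :: "('o, 'a, 'c) two_cat" (structure) and M :: "('o, 'a, 'c) psmonad"
begin

abbreviation T0 :: "'o \<Rightarrow> 'o" where "T0 \<equiv> on_obj (monad_fun M)"
abbreviation T1 :: "'a \<Rightarrow> 'a" where "T1 \<equiv> on_arr (monad_fun M)"
abbreviation T2 :: "'c \<Rightarrow> 'c" where "T2 \<equiv> on_cell (monad_fun M)"
abbreviation \<eta> :: "'o \<Rightarrow> 'a" where "\<eta> \<equiv> unit1 M"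
abbreviation \<eta>c :: "'a \<Rightarrow> 'c" where "\<eta>c \<equiv> unit2 M"
abbreviation \<mu> :: "'o \<Rightarrow> 'a" where "\<mu> \<equiv> mult1 M"
abbreviation \<mu>c :: "'a \<Rightarrow> 'c" where "\<mu>c \<equiv> mult2 M"
abbreviation \<xi>m :: "'o \<Rightarrow> 'c" where "\<xi>m \<equiv> mod_\<xi> M"
abbreviation \<zeta>m :: "'o \<Rightarrow> 'c" where "\<zeta>m \<equiv> mod_\<zeta> M"
abbreviation \<rho>m :: "'o \<Rightarrow> 'c" where "\<rho>m \<equiv> mod_\<rho> M"

definition psalgebra :: "('o, 'a, 'c) psalg \<Rightarrow> bool" where
  "psalgebra A \<longleftrightarrow> (let X = alg_obj A; a = alg_act A; t = alg_unit A; s = alg_assoc A in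
     X \<in> Obj C \<and>
     arr C a (T0 X) X \<and>
     iso_cell C t (a \<cdot> \<eta> X) (Id1 C X) \<and>
     iso_cell C s (a \<cdot> T1 a) (a \<cdot> \<mu> X) \<and>
     (a \<lhd> \<zeta>m X) \<bullet> (s \<rhd> T1 (\<eta> X)) = a \<lhd> T2 t \<and>
     (a \<lhd> \<rho>m X) \<bullet> (s \<rhd> T1 (\<mu> X)) \<bullet> (a \<lhd> T2 s) =
     (s \<rhd> \<mu> (T0 X)) \<bullet> (a \<lhd> \<mu>c a) \<bullet> (s \<rhd> T1 (T1 a)))"

definition free_alg :: "'o \<Rightarrow> ('o, 'a, 'c) psalg" where
  "free_alg X = mk_alg (T0 X) (\<mu> X) (\<xi>m X) (\<rho>m X)"

text \<open>The conjuncts quantified over 1-cells say that \<open>\<xi>m\<close>, \<open>\<zeta>m\<close> and \<open>\<rho>m\<close> are modifications.\<close>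

definition pseudomonad :: bool where
  "pseudomonad \<longleftrightarrow>
     two_functor C C (monad_fun M) \<and>
     pseudonatural C C id_two_fun (monad_fun M) \<eta> \<eta>c \<and>
     pseudonatural_rev C C (monad_fun M \<circ>\<^sub>2 monad_fun M) (monad_fun M) \<mu> \<mu>c \<and>
     (\<forall>X\<in>Obj C. iso_cell C (\<xi>m X) (\<mu> X \<cdot> \<eta> (T0 X)) (Id1 C (T0 X)) \<and>
        iso_cell C (\<zeta>m X) (\<mu> X \<cdot> T1 (\<eta> X)) (Id1 C (T0 X)) \<and>
        iso_cell C (\<rho>m X) (\<mu> X \<cdot> T1 (\<mu> X)) (\<mu> X \<cdot> \<mu> (T0 X))) \<and>
     (\<forall>f X Y. arr C f X Y \<longrightarrow>
        (T1 f \<lhd> \<xi>m X) \<bullet> (\<mu>c f \<rhd> \<eta> (T0 X)) = (\<xi>m Y \<rhd> T1 f) \<bullet> (\<mu> Y \<lhd> \<eta>c (T1 f)) \<and>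
        (T1 f \<lhd> \<zeta>m X) \<bullet> (\<mu>c f \<rhd> T1 (\<eta> X)) = (\<zeta>m Y \<rhd> T1 f) \<bullet> (\<mu> Y \<lhd> T2 (\<eta>c f)) \<and>
        (T1 f \<lhd> \<rho>m X) \<bullet> (\<mu>c f \<rhd> T1 (\<mu> X)) \<bullet> (\<mu> Y \<lhd> T2 (\<mu>c f)) =
        (\<mu>c f \<rhd> \<mu> (T0 X)) \<bullet> (\<mu> Y \<lhd> \<mu>c (T1 f)) \<bullet> (\<rho>m Y \<rhd> T1 (T1 (T1 f)))) \<and>
     (\<forall>X\<in>Obj C. psalgebra (free_alg X))"

definition pseudomorphism :: "('o, 'a, 'c) psmor \<Rightarrow> bool" where
  "pseudomorphism F \<longleftrightarrow> (let A = mor_dom F; B = mor_cod F; f = mor_map F; \<phi> = mor_cell F;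
       X = alg_obj A; a = alg_act A; b = alg_act B in
     psalgebra A \<and> psalgebra B \<and>
     arr C f X (alg_obj B) \<and>
     iso_cell C \<phi> (b \<cdot> T1 f) (f \<cdot> a) \<and>
     (f \<lhd> alg_unit A) \<bullet> (\<phi> \<rhd> \<eta> X) = (alg_unit B \<rhd> f) \<bullet> (b \<lhd> \<eta>c f) \<and>
     (f \<lhd> alg_assoc A) \<bullet> (\<phi> \<rhd> T1 a) \<bullet> (b \<lhd> T2 \<phi>) =
     (\<phi> \<rhd> \<mu> X) \<bullet> (b \<lhd> \<mu>c f) \<bullet> (alg_assoc B \<rhd> T1 (T1 f)))"

definition alg_transformation :: "('o, 'a, 'c) pstrans \<Rightarrow> bool" where
  "alg_transformation S \<longleftrightarrow> (let F = tr_src S; G = tr_tgt S; \<sigma> = tr_cell S in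
     pseudomorphism F \<and> pseudomorphism G \<and>
     mor_dom F = mor_dom G \<and> mor_cod F = mor_cod G \<and>
     cell C \<sigma> (mor_map F) (mor_map G) \<and>
     (\<sigma> \<rhd> alg_act (mor_dom F)) \<bullet> mor_cell F =
     mor_cell G \<bullet> (alg_act (mor_cod F) \<lhd> T2 \<sigma>))"

definition mor_comp :: "('o, 'a, 'c) psmor \<Rightarrow> ('o, 'a, 'c) psmor \<Rightarrow> ('o, 'a, 'c) psmor" where
  "mor_comp G F = mk_mor (mor_dom F) (mor_cod G) (mor_map G \<cdot> mor_map F)
     ((mor_map G \<lhd> mor_cell F) \<bullet> (mor_cell G \<rhd> T1 (mor_map F)))"

definition psAlg ::
  "(('o, 'a, 'c) psalg, ('o, 'a, 'c) psmor, ('o, 'a, 'c) pstrans) two_cat" where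
  "psAlg = \<lparr> Obj = {A. psalgebra A}, Arr = {F. pseudomorphism F}, Cell = {S. alg_transformation S},
     Dom = mor_dom, Cod = mor_cod, Src = tr_src, Tgt = tr_tgt,
     Id1 = (\<lambda>A. mk_mor A A (Id1 C (alg_obj A)) (Id2 C (alg_act A))),
     Comp1 = mor_comp,
     Id2 = (\<lambda>F. mk_trans F F (Id2 C (mor_map F))),
     Vcomp = (\<lambda>S R. mk_trans (tr_src R) (tr_tgt S) (tr_cell S \<bullet> tr_cell R)),
     Hcomp = (\<lambda>S R. mk_trans (mor_comp (tr_src S) (tr_src R)) (mor_comp (tr_tgt S) (tr_tgt R))
       (tr_cell S \<star> tr_cell R)) \<rparr>"

definition forget ::
  "(('o, 'a, 'c) psalg, ('o, 'a, 'c) psmor, ('o, 'a, 'c) pstrans, 'o, 'a, 'c) two_fun" where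
  "forget = \<lparr> on_obj = alg_obj, on_arr = mor_map, on_cell = tr_cell \<rparr>"

text \<open>The pseudomorphisms \<open>(Tf, \<mu>\<^sub>f)\<close> between free algebras, \<open>(\<mu>\<^sub>X, \<rho>\<^sub>X) : TTX \<rightarrow> TX\<close> and
  \<open>(a, \<alpha>\<^sup>s) : TA \<rightarrow> A\<close>.\<close>

definition free_mor :: "'a \<Rightarrow> ('o, 'a, 'c) psmor" where
  "free_mor f = mk_mor (free_alg (Dom C f)) (free_alg (Cod C f)) (T1 f) (\<mu>c f)"

definition mult_mor :: "'o \<Rightarrow> ('o, 'a, 'c) psmor" where
  "mult_mor X = mk_mor (free_alg (T0 X)) (free_alg X) (\<mu> X) (\<rho>m X)"

definition act_mor :: "('o, 'a, 'c) psalg \<Rightarrow> ('o, 'a, 'c) psmor" where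
  "act_mor A = mk_mor (free_alg (alg_obj A)) A (alg_act A) (alg_assoc A)"

definition bar :: "('o, 'a, 'c) psalg \<Rightarrow>
    (('o, 'a, 'c) psalg, ('o, 'a, 'c) psmor, ('o, 'a, 'c) pstrans) codescent" where
  "bar A = (let X = alg_obj A; a = alg_act A;
     d0 = free_mor a; d1 = mult_mor X; i = free_mor (\<eta> X);
     p0 = free_mor (T1 a); p1 = free_mor (\<mu> X); p2 = mult_mor (T0 X);
     one = Id1 psAlg (free_alg X) in
     \<lparr> lev0 = free_alg X, lev1 = free_alg (T0 X), lev2 = free_alg (T0 (T0 X)),
       cd_p0 = p0, cd_p1 = p1, cd_p2 = p2, cd_d0 = d0, cd_d1 = d1, cd_i = i,
       cd_n0 = mk_trans (mor_comp d0 i) one (T2 (alg_unit A)),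
       cd_n1 = mk_trans (mor_comp d1 i) one (\<zeta>m X),
       cd_\<theta>01 = mk_trans (mor_comp d0 p0) (mor_comp d0 p1) (T2 (alg_assoc A)),
       cd_\<theta>02 = mk_trans (mor_comp d1 p0) (mor_comp d0 p2) (\<mu>c a),
       cd_\<theta>12 = mk_trans (mor_comp d1 p1) (mor_comp d1 p2) (\<rho>m X) \<rparr>)"

definition bar_cell :: "('o, 'a, 'c) psalg \<Rightarrow> ('o, 'a, 'c) pstrans" where
  "bar_cell A = mk_trans (mor_comp (act_mor A) (cd_d0 (bar A))) (mor_comp (act_mor A) (cd_d1 (bar A)))
     (alg_assoc A)"

end


section \<open>The codescent object of a diagram of pseudo-algebras\<close>

text \<open>Correspondence with the usual notation: the oplax bicolimits \<open>(L, q\<^sub>i, q\<^sub>d)\<close>,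
  \<open>(L\<^sub>1, q\<^sup>T\<^sub>i, q\<^sup>T\<^sub>d)\<close> and \<open>(L\<^sub>2, q\<^sup>T\<^sup>T\<^sub>i, q\<^sup>T\<^sup>T\<^sub>d)\<close> are \<open>(tip0, incl0, tran0)\<close>, \<open>(tip1, incl1, tran1)\<close> and
  \<open>(tip2, incl2, tran2)\<close>. The 1-cells induced by \<open>a\<^sub>i\<close>, \<open>\<eta>\<close>, \<open>T a\<^sub>i\<close>, \<open>\<mu>\<close> are \<open>bar_a\<close>, \<open>bar_\<eta>\<close>, \<open>bar_Ta\<close>,
  \<open>bar_\<mu>\<close>, with families of comparison 2-cells \<open>fam_a\<close>, \<open>fam_\<eta>\<close>, \<open>fam_Ta\<close>, \<open>fam_\<mu>\<close> (that is \<open>\<theta>\<^sub>i\<close>, \<open>\<theta>\<^sub>i\<close> with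
  tilde, \<open>\<theta>'\<^sub>i\<close>, \<open>\<mu>\<^sub>i\<close>); \<open>cmp_s\<close>, \<open>cmp_t\<close>, \<open>fam_s\<close>, \<open>fam_t\<close> are \<open>s\<close>, \<open>t\<close>, \<open>\<sigma>\<^sub>i\<close>, \<open>\<tau>\<^sub>i\<close>; \<open>ind_\<sigma>\<close>, \<open>ind_\<theta>\<close>, \<open>ind_\<tau>\<close> are
  \<open>\<sigma>\<close>, \<open>\<theta>\<close>, \<open>\<tau>\<close>; and \<open>ind_unit\<close>, \<open>ind_assoc\<close> are the 2-cells induced by the \<open>\<alpha>\<^sup>t\<^sub>i\<close> and the \<open>\<alpha>\<^sup>s\<^sub>i\<close>.\<close>

record ('o, 'a, 'c, 'i, 'd) colim_data =
  tip0 :: 'o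
  incl0 :: "'i \<Rightarrow> 'a"
  tran0 :: "'d \<Rightarrow> 'c"
  tip1 :: 'o
  incl1 :: "'i \<Rightarrow> 'a"
  tran1 :: "'d \<Rightarrow> 'c"
  tip2 :: 'o
  incl2 :: "'i \<Rightarrow> 'a"
  tran2 :: "'d \<Rightarrow> 'c"
  bar_a :: 'a
  fam_a :: "'i \<Rightarrow> 'c"
  bar_\<eta> :: 'a
  fam_\<eta> :: "'i \<Rightarrow> 'c"
  bar_Ta :: 'a
  fam_Ta :: "'i \<Rightarrow> 'c"
  bar_\<mu> :: 'a
  fam_\<mu> :: "'i \<Rightarrow> 'c"
  cmp_s :: 'a
  fam_s :: "'i \<Rightarrow> 'c"
  cmp_t :: 'a
  fam_t :: "'i \<Rightarrow> 'c"
  ind_\<sigma> :: 'c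
  ind_\<theta> :: 'c
  ind_\<tau> :: 'c
  ind_unit :: 'c
  ind_assoc :: 'c

context
  fixes C :: "('o, 'a, 'c) two_cat" (structure) and M :: "('o, 'a, 'c) psmonad"
    and I :: "('i, 'd, 's) two_cat"
    and AA :: "('i, 'd, 's, ('o, 'a, 'c) psalg, ('o, 'a, 'c) psmor, ('o, 'a, 'c) pstrans) two_fun"
    and D :: "('o, 'a, 'c, 'i, 'd) colim_data"
begin

text \<open>The equation for each 2-cell induced by a universal property determines it uniquely.
  Where the defining composite involves the inverse of a comparison 2-cell, that cell has been
  moved to the other side.\<close>

definition colim_construction :: bool where
  "colim_construction \<longleftrightarrow> (let
     T = monad_fun M; T\<^sub>0 = T0 M; T\<^sub>1 = T1 M; T\<^sub>2 = T2 M; \<eta> = \<eta> M; \<eta>c = \<eta>c M; \<mu> = \<mu> M; \<mu>c = \<mu>c M;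
     A = (\<lambda>i. alg_obj (on_obj AA i)); a = (\<lambda>i. alg_act (on_obj AA i));
     \<alpha>t = (\<lambda>i. alg_unit (on_obj AA i)); \<alpha>s = (\<lambda>i. alg_assoc (on_obj AA i));
     f = (\<lambda>d. mor_map (on_arr AA d)); \<phi> = (\<lambda>d. mor_cell (on_arr AA d));
     F = forget \<circ>\<^sub>2 AA;
     L = tip0 D; q = incl0 D; qd = tran0 D; L\<^sub>1 = tip1 D; qT = incl1 D; qdT = tran1 D;
     L\<^sub>2 = tip2 D; qTT = incl2 D; qdTT = tran2 D;
     abar = bar_a D; \<theta>a = fam_a D; \<eta>bar = bar_\<eta> D; \<theta>\<eta> = fam_\<eta> D;
     Tabar = bar_Ta D; \<theta>Ta = fam_Ta D; \<mu>bar = bar_\<mu> D; \<theta>\<mu> = fam_\<mu> D;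
     s = cmp_s D; \<sigma> = fam_s D; t = cmp_t D; \<tau> = fam_t D in
     is_oplax_bicolimit C I F L q qd \<and>
     is_oplax_bicolimit C I (T \<circ>\<^sub>2 F) L\<^sub>1 qT qdT \<and>
     is_oplax_bicolimit C I (T \<circ>\<^sub>2 T \<circ>\<^sub>2 F) L\<^sub>2 qTT qdTT \<and>
     arr C abar L\<^sub>1 L \<and>
     induced_by_family C I (T \<circ>\<^sub>2 F) qT qdT q qd a \<phi> abar \<theta>a \<and>
     arr C \<eta>bar L L\<^sub>1 \<and>
     induced_by_family C I F q qd qT qdT (\<lambda>i. \<eta> (A i)) (\<lambda>d. cell_inv C (\<eta>c (f d))) \<eta>bar \<theta>\<eta> \<and>
     arr C Tabar L\<^sub>2 L\<^sub>1 \<and>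
     induced_by_family C I (T \<circ>\<^sub>2 T \<circ>\<^sub>2 F) qTT qdTT qT qdT (\<lambda>i. T\<^sub>1 (a i)) (\<lambda>d. T\<^sub>2 (\<phi> d)) Tabar \<theta>Ta \<and>
     arr C \<mu>bar L\<^sub>2 L\<^sub>1 \<and>
     induced_by_family C I (T \<circ>\<^sub>2 T \<circ>\<^sub>2 F) qTT qdTT qT qdT (\<lambda>i. \<mu> (A i)) (\<lambda>d. \<mu>c (f d)) \<mu>bar \<theta>\<mu> \<and>
     arr C s L\<^sub>1 (T\<^sub>0 L) \<and>
     induced_by_cocone C I (T \<circ>\<^sub>2 F) qT qdT (\<lambda>i. T\<^sub>1 (q i)) (\<lambda>d. T\<^sub>2 (qd d)) s \<sigma> \<and>
     arr C t L\<^sub>2 (T\<^sub>0 L\<^sub>1) \<and>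
     induced_by_cocone C I (T \<circ>\<^sub>2 T \<circ>\<^sub>2 F) qTT qdTT (\<lambda>i. T\<^sub>1 (qT i)) (\<lambda>d. T\<^sub>2 (qdT d)) t \<tau> \<and>
     iso_cell C (ind_\<sigma> D) (s \<cdot> \<eta>bar) (\<eta> L) \<and>
     (\<forall>i\<in>Obj I. ind_\<sigma> D \<rhd> q i = \<eta>c (q i) \<bullet> (\<sigma> i \<rhd> \<eta> (A i)) \<bullet> (s \<lhd> \<theta>\<eta> i)) \<and>
     iso_cell C (ind_\<theta> D) (s \<cdot> Tabar) (T\<^sub>1 abar \<cdot> t) \<and>
     (\<forall>i\<in>Obj I. T\<^sub>2 (\<theta>a i) \<bullet> (T\<^sub>1 abar \<lhd> \<tau> i) \<bullet> (ind_\<theta> D \<rhd> qTT i) =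
        (\<sigma> i \<rhd> T\<^sub>1 (a i)) \<bullet> (s \<lhd> \<theta>Ta i)) \<and>
     iso_cell C (ind_\<tau> D) (s \<cdot> \<mu>bar) (\<mu> L \<cdot> T\<^sub>1 s \<cdot> t) \<and>
     (\<forall>i\<in>Obj I. \<mu>c (q i) \<bullet> (\<mu> L \<lhd> T\<^sub>2 (\<sigma> i)) \<bullet> ((\<mu> L \<cdot> T\<^sub>1 s) \<lhd> \<tau> i) \<bullet> (ind_\<tau> D \<rhd> qTT i) =
        (\<sigma> i \<rhd> \<mu> (A i)) \<bullet> (s \<lhd> \<theta>\<mu> i)) \<and>
     iso_cell C (ind_unit D) (abar \<cdot> \<eta>bar) (Id1 C L) \<and>
     (\<forall>i\<in>Obj I. ind_unit D \<rhd> q i = (q i \<lhd> \<alpha>t i) \<bullet> (\<theta>a i \<rhd> \<eta> (A i)) \<bullet> (abar \<lhd> \<theta>\<eta> i)) \<and>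
     iso_cell C (ind_assoc D) (abar \<cdot> Tabar) (abar \<cdot> \<mu>bar) \<and>
     (\<forall>i\<in>Obj I. (\<theta>a i \<rhd> \<mu> (A i)) \<bullet> (abar \<lhd> \<theta>\<mu> i) \<bullet> (ind_assoc D \<rhd> qTT i) =
        (q i \<lhd> \<alpha>s i) \<bullet> (\<theta>a i \<rhd> T\<^sub>1 (a i)) \<bullet> (abar \<lhd> \<theta>Ta i)))"

definition XA :: "(('o, 'a, 'c) psalg, ('o, 'a, 'c) psmor, ('o, 'a, 'c) pstrans) codescent" where
  "XA = (let
     T\<^sub>1 = T1 M; T\<^sub>2 = T2 M; \<mu> = \<mu> M; \<mu>c = \<mu>c M; L = tip0 D; L\<^sub>1 = tip1 D; s = cmp_s D; t = cmp_t D;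
     d0 = free_mor C M (bar_a D); d1 = mor_comp C M (mult_mor M L) (free_mor C M s);
     i = free_mor C M (bar_\<eta> D);
     p0 = free_mor C M (bar_Ta D); p1 = free_mor C M (bar_\<mu> D);
     p2 = mor_comp C M (mult_mor M L\<^sub>1) (free_mor C M t);
     one = Id1 (psAlg C M) (free_alg M L) in
     \<lparr> lev0 = free_alg M L, lev1 = free_alg M L\<^sub>1, lev2 = free_alg M (tip2 D),
       cd_p0 = p0, cd_p1 = p1, cd_p2 = p2, cd_d0 = d0, cd_d1 = d1, cd_i = i,
       cd_n0 = mk_trans (mor_comp C M d0 i) one (T\<^sub>2 (ind_unit D)),
       cd_n1 = mk_trans (mor_comp C M d1 i) one (mod_\<zeta> M L \<bullet> (\<mu> L \<lhd> T\<^sub>2 (ind_\<sigma> D))),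
       cd_\<theta>01 = mk_trans (mor_comp C M d0 p0) (mor_comp C M d0 p1) (T\<^sub>2 (ind_assoc D)),
       cd_\<theta>02 = mk_trans (mor_comp C M d1 p0) (mor_comp C M d0 p2)
         ((\<mu>c (bar_a D) \<rhd> T\<^sub>1 t) \<bullet> (\<mu> L \<lhd> T\<^sub>2 (ind_\<theta> D))),
       cd_\<theta>12 = mk_trans (mor_comp C M d1 p1) (mor_comp C M d1 p2)
         (((\<mu> L \<lhd> \<mu>c s) \<rhd> T\<^sub>1 t) \<bullet> (mod_\<rho> M L \<rhd> (T\<^sub>1 (T\<^sub>1 s) \<cdot> T\<^sub>1 t)) \<bullet> (\<mu> L \<lhd> T\<^sub>2 (ind_\<tau> D))) \<rparr>)"

text \<open>The morphism of codescent objects from the bar construction of \<open>A\<^sub>i\<close> to \<open>XA\<close>. (That it satisfies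
  the compatibilities of a morphism, and that \<open>bar\<close> and \<open>XA\<close> are codescent objects, follows from the
  construction and is not assumed.)\<close>

definition qbar :: "'i \<Rightarrow> (('o, 'a, 'c) psmor, ('o, 'a, 'c) pstrans) codescent_mor" where
  "qbar i = (let
     T\<^sub>2 = T2 M; \<mu> = \<mu> M; \<mu>c = \<mu>c M; B = bar C M (on_obj AA i);
     x0 = free_mor C M (incl0 D i); x1 = free_mor C M (incl1 D i); x2 = free_mor C M (incl2 D i);
     sq = (\<lambda>gY xk xl gX \<omega>. mk_trans (mor_comp C M gY xk) (mor_comp C M xl gX) \<omega>) in
     \<lparr> cm0 = x0, cm1 = x1, cm2 = x2,
       cm_d0 = sq (cd_d0 XA) x1 x0 (cd_d0 B) (T\<^sub>2 (fam_a D i)),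
       cm_d1 = sq (cd_d1 XA) x1 x0 (cd_d1 B) (\<mu>c (incl0 D i) \<bullet> (\<mu> (tip0 D) \<lhd> T\<^sub>2 (fam_s D i))),
       cm_i = sq (cd_i XA) x0 x1 (cd_i B) (T\<^sub>2 (fam_\<eta> D i)),
       cm_p0 = sq (cd_p0 XA) x2 x1 (cd_p0 B) (T\<^sub>2 (fam_Ta D i)),
       cm_p1 = sq (cd_p1 XA) x2 x1 (cd_p1 B) (T\<^sub>2 (fam_\<mu> D i)),
       cm_p2 = sq (cd_p2 XA) x2 x1 (cd_p2 B) (\<mu>c (incl1 D i) \<bullet> (\<mu> (tip1 D) \<lhd> T\<^sub>2 (fam_t D i))) \<rparr>)"

text \<open>The family \<open>l\<close>, with comparison 2-cells \<open>\<chi>\<close>, is induced by the \<open>qbar i\<close> on bicoequalizers, where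
  \<open>(P, \<psi>)\<close> is the bicoequalizer of \<open>XA\<close> with tip \<open>Z\<close>; and \<open>ld d\<close> is the 2-cell through which
  \<open>p Tq\<^sub>d\<close> factors, \<open>p\<close> being the underlying 1-cell of \<open>P\<close>.\<close>

definition induced_cocone ::
  "('o, 'a, 'c) psalg \<Rightarrow> ('o, 'a, 'c) psmor \<Rightarrow> ('o, 'a, 'c) pstrans \<Rightarrow>
   ('i \<Rightarrow> ('o, 'a, 'c) psmor) \<Rightarrow> ('i \<Rightarrow> ('o, 'a, 'c) pstrans) \<Rightarrow> ('d \<Rightarrow> ('o, 'a, 'c) pstrans) \<Rightarrow> bool"
  where
  "induced_cocone Z P \<psi> l \<chi> ld \<longleftrightarrow>
     (\<forall>i\<in>Obj I. is_bicoeq_map (psAlg C M) (bar C M (on_obj AA i)) (qbar i)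
        (on_obj AA i) (act_mor M (on_obj AA i)) (bar_cell C M (on_obj AA i)) Z P \<psi> (l i) (\<chi> i)) \<and>
     (\<forall>d i j. arr I d i j \<longrightarrow>
        cell (psAlg C M) (ld d) (l j \<cdot>\<^bsub>psAlg C M\<^esub> on_arr AA d) (l i) \<and>
        (tr_cell (ld d) \<rhd> alg_act (on_obj AA i)) \<bullet> (mor_map (l j) \<lhd> mor_cell (on_arr AA d)) \<bullet>
          (tr_cell (\<chi> j) \<rhd> T1 M (mor_map (on_arr AA d))) =
        tr_cell (\<chi> i) \<bullet> (mor_map P \<lhd> T2 M (tran0 D d)))"

end

end

theory Submission
  imports Defs
begin

text \<open>The free pseudo-algebra 2-functor preserves oplax bicolimits: a 1-cell or 2-cell out of \<open>TX\<close>
  amounts to its restriction along the unit of \<open>X\<close>. Hence \<open>XA\<close> is, by way of the morphisms \<open>qbar i\<close>,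
  the levelwise oplax bicolimit of the bar constructions of the \<open>A\<^sub>i\<close>. Since \<open>A\<^sub>i\<close> is the quotient of its
  bar construction and \<open>Z\<close> the quotient of \<open>XA\<close>, the result is an instance of the commutation of oplax
  bicolimits with bicoequalizers. This commutation only uses that precomposition with the action \<open>a\<^sub>i\<close>
  is fully faithful on 2-cells: all equations between 2-cells out of \<open>A\<^sub>i\<close>, out of \<open>Z\<close> and out of
  the levels of \<open>XA\<close> are tested after precomposition with the \<open>a\<^sub>i\<close> and with the inclusions.

  Two unit laws that are not among the axioms are needed, one for pseudo-algebras and one for the
  pseudomonad. They are derived like the redundant axioms of Mac Lane for monoidal categories.\<close>

section \<open>Equivalences of categories\<close>

text \<open>The universal properties are given as equivalences of hom-categories, whose
  quasi-inverses offer no formula to compute with. Each of them is therefore split into three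
  statements about 1-cells and 2-cells: 2-cells out of the tip are determined by their restrictions,
  compatible restrictions lift, and every cocone or pair is isomorphic to a composite with the
  universal one. The conclusion is assembled from the same three statements.

  The derived unit laws enter where data has to be recognised as living among pseudo-algebras. The
  one for algebras makes the action, with its associativity cell, a pseudomorphism out of the free
  algebra. The one for the pseudomonad makes \<zeta> an algebra transformation, and likewise the
  comparison between a pseudomorphism out of a free algebra and the extension of its restriction
  along the unit.

  Calculations with 2-cells follow one pattern: both sides are prolonged by an invertible composite
  until naturality and the given equations apply, and this composite is cancelled at the
  end.\<close>

lemma is_equivalence_full_faithful_ess:
  assumes "category A" "category B" and "is_equivalence A B F0 F1"
  shows "\<And>x y m m'. carr A m x y \<Longrightarrow> carr A m' x y \<Longrightarrow> F1 m = F1 m' \<Longrightarrow> m = m'"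
    and "\<And>x y n. x \<in> cObj A \<Longrightarrow> y \<in> cObj A \<Longrightarrow> carr B n (F0 x) (F0 y) \<Longrightarrow> \<exists>m. carr A m x y \<and> F1 m = n"
    and "\<And>z. z \<in> cObj B \<Longrightarrow> \<exists>x\<in>cObj A. \<exists>n. cat_iso B n (F0 x) z"
proof -
  interpret A: category A by fact
  interpret B: category B by fact
  from assms(3) obtain G0 G1 \<delta> \<epsilon> where F: "is_functor A B F0 F1" and G: "is_functor B A G0 G1"
    and d: "natural_iso A A id id (G0 \<circ> F0) (G1 \<circ> F1) \<delta>"
    and e: "natural_iso B B (F0 \<circ> G0) (F1 \<circ> G1) id id \<epsilon>"
    unfolding is_equivalence_def by blast
  have F1: "\<And>m x y. carr A m x y \<Longrightarrow> carr B (F1 m) (F0 x) (F0 y)" using F by (auto simp: is_functor_def)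
  have G1: "\<And>m x y. carr B m x y \<Longrightarrow> carr A (G1 m) (G0 x) (G0 y)" using G by (auto simp: is_functor_def)
  have dn: "\<And>m x y. carr A m x y \<Longrightarrow> cComp A (\<delta> y) m = cComp A (G1 (F1 m)) (\<delta> x)"
    using d by (auto simp: natural_iso_def)
  have en: "\<And>m x y. carr B m x y \<Longrightarrow> cComp B (\<epsilon> y) (F1 (G1 m)) = cComp B m (\<epsilon> x)"
    using e by (auto simp: natural_iso_def)
  have di: "\<And>x. x \<in> cObj A \<Longrightarrow> cat_iso A (\<delta> x) x (G0 (F0 x))" using d by (auto simp: natural_iso_def)
  have ei: "\<And>x. x \<in> cObj B \<Longrightarrow> cat_iso B (\<epsilon> x) (F0 (G0 x)) x" using e by (auto simp: natural_iso_def)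
  have monoA: "m = m'" if "cat_iso A k y z" "carr A m x y" "carr A m' x y" "cComp A k m = cComp A k m'"
    for k x y z m m'
  proof -
    from that(1) obtain n where k: "carr A k y z" and n: "carr A n z y" "cComp A n k = cId A y"
      by (auto simp: cat_iso_def)
    show ?thesis
      by (metis A.assoc[OF that(2) k n(1)] A.assoc[OF that(3) k n(1)] A.id_left[OF that(2)]
          A.id_left[OF that(3)] that(4) n(2))
  qed
  have epiB: "m = m'" if "cat_iso B k x y" "carr B m y z" "carr B m' y z" "cComp B m k = cComp B m' k"
    for k x y z m m'
  proof -
    from that(1) obtain n where k: "carr B k x y" and n: "carr B n y x" "cComp B k n = cId B y"
      by (auto simp: cat_iso_def)
    show ?thesis
      by (metis B.assoc[OF n(1) k that(2)] B.assoc[OF n(1) k that(3)] B.id_right[OF that(2)]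
          B.id_right[OF that(3)] that(4) n(2))
  qed
  show faith: "m = m'" if "carr A m x y" "carr A m' x y" "F1 m = F1 m'" for x y m m'
    using that dn[OF that(1)] dn[OF that(2)] di[of y] A.arr_obj[OF that(1)] monoA[of "\<delta> y"] by auto
  \<comment> \<open>Fullness of F rests on faithfulness of G, which \<epsilon> provides just as
    \<delta> provides that of F.\<close>
  have faithG: "n = n'" if "carr B n x y" "carr B n' x y" "G1 n = G1 n'" for x y n n'
  proof (rule epiB)
    show "cat_iso B (\<epsilon> x) (F0 (G0 x)) x" using ei B.arr_obj[OF that(1)] by blast
    show "cComp B n (\<epsilon> x) = cComp B n' (\<epsilon> x)" using en[OF that(1)] en[OF that(2)] that(3) by simp
  qed (use that in auto)
  show "\<exists>m. carr A m x y \<and> F1 m = n" if x: "x \<in> cObj A" and y: "y \<in> cObj A" and n: "carr B n (F0 x) (F0 y)"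
    for x y n
  proof -
    from di[OF y] obtain k where k: "carr A k (G0 (F0 y)) y" "cComp A k (\<delta> y) = cId A y"
      "cComp A (\<delta> y) k = cId A (G0 (F0 y))" and dy: "carr A (\<delta> y) y (G0 (F0 y))"
      by (auto simp: cat_iso_def)
    have dx: "carr A (\<delta> x) x (G0 (F0 x))" using di[OF x] by (simp add: cat_iso_def)
    \<comment> \<open>The candidate is \<open>G1 n\<close> transported along \<delta>. It has the
      same image under G as n after F, and faithfulness of G finishes the argument.\<close>
    define m where "m = cComp A k (cComp A (G1 n) (\<delta> x))"
    note c1 = A.comp_arr[OF dx G1[OF n]]
    have m: "carr A m x y" unfolding m_def by (rule A.comp_arr[OF c1 k(1)])
    have "cComp A (\<delta> y) m = cComp A (G1 n) (\<delta> x)"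
      unfolding m_def using A.assoc[OF c1 k(1) dy] A.id_left[OF c1] k(3) by simp
    then have "cComp A (G1 (F1 m)) (\<delta> x) = cComp A (G1 n) (\<delta> x)" using dn[OF m] by simp
    moreover obtain k' where k': "carr A k' (G0 (F0 x)) x" "cComp A (\<delta> x) k' = cId A (G0 (F0 x))"
      using di[OF x] by (auto simp: cat_iso_def)
    ultimately have "G1 (F1 m) = G1 n"
      using A.assoc[OF k'(1) dx G1[OF n]] A.assoc[OF k'(1) dx G1[OF F1[OF m]]]
        A.id_right[OF G1[OF n]] A.id_right[OF G1[OF F1[OF m]]] by simp
    then have "F1 m = n" using faithG F1[OF m] n by blast
    with m show ?thesis by blast
  qed
  show "\<exists>x\<in>cObj A. \<exists>n. cat_iso B n (F0 x) z" if "z \<in> cObj B" for z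
    using ei[OF that] G that by (auto simp: is_functor_def)
qed

text \<open>The quasi-inverse is chosen objectwise by essential surjectivity and on morphisms by
  fullness. Faithfulness reduces every equation in A to its image in B, where the chosen
  isomorphisms cancel.\<close>

lemma is_equivalenceI:
  assumes "category A" "category B" and F: "is_functor A B F0 F1"
    and faithful: "\<And>x y m m'. carr A m x y \<Longrightarrow> carr A m' x y \<Longrightarrow> F1 m = F1 m' \<Longrightarrow> m = m'"
    and full: "\<And>x y n. x \<in> cObj A \<Longrightarrow> y \<in> cObj A \<Longrightarrow> carr B n (F0 x) (F0 y) \<Longrightarrow> \<exists>m. carr A m x y \<and> F1 m = n"
    and ess: "\<And>z. z \<in> cObj B \<Longrightarrow> \<exists>x\<in>cObj A. \<exists>n. cat_iso B n (F0 x) z"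
  shows "is_equivalence A B F0 F1"
proof -
  interpret A: category A by fact
  interpret B: category B by fact
  have F1: "\<And>m x y. carr A m x y \<Longrightarrow> carr B (F1 m) (F0 x) (F0 y)" using F by (auto simp: is_functor_def)
  have Fi: "\<And>x. x \<in> cObj A \<Longrightarrow> F1 (cId A x) = cId B (F0 x)" using F by (auto simp: is_functor_def)
  have F0: "\<And>x. x \<in> cObj A \<Longrightarrow> F0 x \<in> cObj B" using F by (auto simp: is_functor_def)
  have Fc: "\<And>m n x y z. carr A m x y \<Longrightarrow> carr A n y z \<Longrightarrow> F1 (cComp A n m) = cComp B (F1 n) (F1 m)"
    using F unfolding is_functor_def by blast
  from ess have "\<forall>z\<in>cObj B. \<exists>x n n'. x \<in> cObj A \<and> carr B n (F0 x) z \<and> carr B n' z (F0 x) \<and>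
      cComp B n' n = cId B (F0 x) \<and> cComp B n n' = cId B z"
    by (fastforce simp: cat_iso_def)
  then obtain G0 \<epsilon> \<epsilon>' where
    G0: "\<And>z. z \<in> cObj B \<Longrightarrow> G0 z \<in> cObj A" and
    e: "\<And>z. z \<in> cObj B \<Longrightarrow> carr B (\<epsilon> z) (F0 (G0 z)) z" and
    e': "\<And>z. z \<in> cObj B \<Longrightarrow> carr B (\<epsilon>' z) z (F0 (G0 z))" and
    e1: "\<And>z. z \<in> cObj B \<Longrightarrow> cComp B (\<epsilon>' z) (\<epsilon> z) = cId B (F0 (G0 z))" and
    e2: "\<And>z. z \<in> cObj B \<Longrightarrow> cComp B (\<epsilon> z) (\<epsilon>' z) = cId B z"
    by metis
  \<comment> \<open>The preimage is unique by faithfulness, so the choice on morphisms is forced by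
    the chosen \<epsilon> and functoriality can be checked after \<open>F1\<close>.\<close>
  define G1 where "G1 n = (SOME m. carr A m (G0 (cDom B n)) (G0 (cCod B n)) \<and>
      F1 m = cComp B (\<epsilon>' (cCod B n)) (cComp B n (\<epsilon> (cDom B n))))" for n
  have G1: "carr A (G1 n) (G0 x) (G0 y) \<and> F1 (G1 n) = cComp B (\<epsilon>' y) (cComp B n (\<epsilon> x))"
    if n: "carr B n x y" for n x y
  proof -
    have xy: "x \<in> cObj B" "y \<in> cObj B" using B.arr_obj[OF n] by auto
    have "\<exists>m. carr A m (G0 x) (G0 y) \<and> F1 m = cComp B (\<epsilon>' y) (cComp B n (\<epsilon> x))"
      by (rule full[OF G0 G0]) (use xy in \<open>auto intro!: B.comp_arr e e' n\<close>)
    moreover have "cDom B n = x" "cCod B n = y" using n by (auto simp: carr_def)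
    ultimately show ?thesis unfolding G1_def by (metis (mono_tags, lifting) someI_ex)
  qed
  have eqA: "m = m'" if "carr A m (G0 x) (G0 y)" "carr A m' (G0 x) (G0 y)" "F1 m = F1 m'" for m m' x y
    using faithful that by blast
  have cancel: "cComp B (\<epsilon> y) (cComp B (\<epsilon>' y) k) = k" if "carr B k x y" for k x y
  proof -
    have y: "y \<in> cObj B" using B.arr_obj[OF that] by blast
    show ?thesis using B.assoc[OF that e'[OF y] e[OF y]] B.id_left[OF that] e2[OF y] by simp
  qed
  have "is_functor B A G0 G1"
    unfolding is_functor_def
  proof (intro conjI ballI allI impI)
    fix x assume x: "x \<in> cObj B"
    show "G0 x \<in> cObj A" by (rule G0[OF x])
    show "G1 (cId B x) = cId A (G0 x)"
      by (rule eqA[of _ x x]) (use x G1[OF B.id_arr[OF x]] in \<open>auto simp: Fi G0 A.id_arr e1 B.id_left[OF e]\<close>)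
  next
    fix m x y assume "carr B m x y" then show "carr A (G1 m) (G0 x) (G0 y)" using G1 by blast
  next
    fix m n x y z assume m: "carr B m x y" and n: "carr B n y z"
    have o: "x \<in> cObj B" "y \<in> cObj B" "z \<in> cObj B" using B.arr_obj m n by auto
    note mn = B.comp_arr[OF m n]
    have me: "carr B (cComp B m (\<epsilon> x)) (F0 (G0 x)) y" by (rule B.comp_arr[OF e[OF o(1)] m])
    note e'me = B.comp_arr[OF me e'[OF o(2)]]
    show "G1 (cComp B n m) = cComp A (G1 n) (G1 m)"
    proof (rule eqA[of _ x z])
      show "carr A (G1 (cComp B n m)) (G0 x) (G0 z)" using G1[OF mn] by blast
      show "carr A (cComp A (G1 n) (G1 m)) (G0 x) (G0 z)" using G1[OF m] G1[OF n] A.comp_arr by blast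
      have "F1 (cComp A (G1 n) (G1 m)) =
          cComp B (cComp B (\<epsilon>' z) (cComp B n (\<epsilon> y))) (cComp B (\<epsilon>' y) (cComp B m (\<epsilon> x)))"
        using G1[OF m] G1[OF n] Fc by auto
      also have "\<dots> = cComp B (\<epsilon>' z) (cComp B (cComp B n (\<epsilon> y)) (cComp B (\<epsilon>' y) (cComp B m (\<epsilon> x))))"
        by (rule B.assoc[OF e'me B.comp_arr[OF e[OF o(2)] n] e'[OF o(3)]])
      also have "cComp B (cComp B n (\<epsilon> y)) (cComp B (\<epsilon>' y) (cComp B m (\<epsilon> x))) = cComp B n (cComp B m (\<epsilon> x))"
        using B.assoc[OF e'me e[OF o(2)] n] cancel[OF me] by simp
      also have "\<dots> = cComp B (cComp B n m) (\<epsilon> x)" using B.assoc[OF e[OF o(1)] m n] by simp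
      finally show "F1 (G1 (cComp B n m)) = F1 (cComp A (G1 n) (G1 m))" using G1[OF mn] by simp
    qed
  qed
  moreover
  have "\<forall>x. \<exists>m. x \<in> cObj A \<longrightarrow> carr A m x (G0 (F0 x)) \<and> F1 m = \<epsilon>' (F0 x)"
    using full G0 F0 e' by metis
  \<comment> \<open>The unit is the preimage of the inverse of \<epsilon> at \<open>F0 x\<close>, as
    the triangle identity demands.\<close>
  then obtain \<delta> where d: "\<And>x. x \<in> cObj A \<Longrightarrow> carr A (\<delta> x) x (G0 (F0 x))"
    and Fd: "\<And>x. x \<in> cObj A \<Longrightarrow> F1 (\<delta> x) = \<epsilon>' (F0 x)" by metis
  have "natural_iso A A id id (G0 \<circ> F0) (G1 \<circ> F1) \<delta>"
    unfolding natural_iso_def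
  proof (intro conjI ballI allI impI)
    fix x assume x: "x \<in> cObj A"
    obtain k where k: "carr A k (G0 (F0 x)) x" "F1 k = \<epsilon> (F0 x)"
      using full[OF G0[OF F0[OF x]] x e[OF F0[OF x]]] by blast
    have "cComp A k (\<delta> x) = cId A x"
      by (rule faithful[OF A.comp_arr[OF d[OF x] k(1)] A.id_arr[OF x]])
         (simp add: Fc[OF d[OF x] k(1)] Fd k e2 F0 x Fi)
    moreover have "cComp A (\<delta> x) k = cId A (G0 (F0 x))"
      by (rule faithful[OF A.comp_arr[OF k(1) d[OF x]] A.id_arr[OF G0[OF F0[OF x]]]])
         (simp add: Fc[OF k(1) d[OF x]] Fd k e1 F0 G0 x Fi)
    ultimately show "cat_iso A (\<delta> x) (id x) ((G0 \<circ> F0) x)"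
      using d[OF x] k by (auto simp: cat_iso_def)
  next
    fix m x y assume m: "carr A m x y"
    have o: "x \<in> cObj A" "y \<in> cObj A" using A.arr_obj m by auto
    note g = conjunct1[OF G1[OF F1[OF m]]]
    note me = B.comp_arr[OF e[OF F0[OF o(1)]] F1[OF m]]
    have "cComp A (\<delta> y) m = cComp A (G1 (F1 m)) (\<delta> x)"
    proof (rule faithful[OF A.comp_arr[OF m d[OF o(2)]] A.comp_arr[OF d[OF o(1)] g]])
      have "F1 (cComp A (G1 (F1 m)) (\<delta> x)) = cComp B (cComp B (\<epsilon>' (F0 y)) (cComp B (F1 m) (\<epsilon> (F0 x))))
          (\<epsilon>' (F0 x))"
        using Fc[OF d[OF o(1)] g] G1[OF F1[OF m]] Fd o by simp
      also have "\<dots> = cComp B (\<epsilon>' (F0 y)) (F1 m)"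
        using B.assoc[OF e'[OF F0[OF o(1)]] me e'[OF F0[OF o(2)]]]
          B.assoc[OF e'[OF F0[OF o(1)]] e[OF F0[OF o(1)]] F1[OF m]] e2[OF F0[OF o(1)]] B.id_right[OF F1[OF m]]
        by simp
      finally show "F1 (cComp A (\<delta> y) m) = F1 (cComp A (G1 (F1 m)) (\<delta> x))"
        using Fc[OF m d[OF o(2)]] Fd o by simp
    qed
    then show "cComp A (\<delta> y) (id m) = cComp A ((G1 \<circ> F1) m) (\<delta> x)" by simp
  qed
  moreover have "natural_iso B B (F0 \<circ> G0) (F1 \<circ> G1) id id \<epsilon>"
    unfolding natural_iso_def
  proof (intro conjI ballI allI impI)
    fix z assume "z \<in> cObj B"
    then show "cat_iso B (\<epsilon> z) ((F0 \<circ> G0) z) (id z)" using e e' e1 e2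
      unfolding cat_iso_def comp_apply id_apply by blast
  next
    fix m x y assume m: "carr B m x y"
    have "x \<in> cObj B" using B.arr_obj m by auto
    from cancel[OF B.comp_arr[OF e[OF this] m]] G1[OF m]
    show "cComp B (\<epsilon> y) ((F1 \<circ> G1) m) = cComp B (id m) (\<epsilon> x)" by simp
  qed
  ultimately show ?thesis unfolding is_equivalence_def using F by blast
qed

section \<open>Calculus of 2-cells\<close>

context two_category
begin

lemma dom_cod_obj [simp]: "f \<in> Arr K \<Longrightarrow> Dom K f \<in> Obj K" "f \<in> Arr K \<Longrightarrow> Cod K f \<in> Obj K"
  using arr_obj by (auto simp: arr_def)

text \<open>The axioms speak of the ternary relations \<open>arr\<close> and \<open>cell\<close>.
  Here and below they are restated with membership and with equations for source and target, so that
  typing is computed by rewriting.\<close>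

lemma Id1_typing: "X \<in> Obj K \<Longrightarrow> Id1 K X \<in> Arr K" "X \<in> Obj K \<Longrightarrow> Dom K (Id1 K X) = X"
    "X \<in> Obj K \<Longrightarrow> Cod K (Id1 K X) = X"
  using id1_arr by (auto simp: arr_def)

lemma Comp1_typing:
  assumes "f \<in> Arr K" "g \<in> Arr K" "Cod K f = Dom K g"
  shows "g \<cdot> f \<in> Arr K" "Dom K (g \<cdot> f) = Dom K f" "Cod K (g \<cdot> f) = Cod K g"
  using comp1_arr[of f "Dom K f" "Cod K f" g "Cod K g"] assms by (auto simp: arr_def)

lemma Comp1_Id1: "f \<in> Arr K \<Longrightarrow> Y = Cod K f \<Longrightarrow> Id1 K Y \<cdot> f = f" "f \<in> Arr K \<Longrightarrow> X = Dom K f \<Longrightarrow> f \<cdot> Id1 K X = f"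
  using id1_left id1_right by (auto simp: arr_def)

lemma Comp1_assoc: "f \<in> Arr K \<Longrightarrow> g \<in> Arr K \<Longrightarrow> h \<in> Arr K \<Longrightarrow> Cod K f = Dom K g \<Longrightarrow> Cod K g = Dom K h \<Longrightarrow>
    (h \<cdot> g) \<cdot> f = h \<cdot> (g \<cdot> f)"
  using comp1_assoc by (auto simp: arr_def)

lemma Src_Tgt_typing:
  assumes "\<sigma> \<in> Cell K"
  shows "Src K \<sigma> \<in> Arr K" "Tgt K \<sigma> \<in> Arr K" "Dom K (Tgt K \<sigma>) = Dom K (Src K \<sigma>)"
    "Cod K (Tgt K \<sigma>) = Cod K (Src K \<sigma>)"
  using cell_arr assms by (auto simp: cell_def)

lemma Id2_typing: "f \<in> Arr K \<Longrightarrow> Id2 K f \<in> Cell K" "f \<in> Arr K \<Longrightarrow> Src K (Id2 K f) = f"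
    "f \<in> Arr K \<Longrightarrow> Tgt K (Id2 K f) = f"
  using id2_cell by (auto simp: cell_def)

lemma Vcomp_typing:
  assumes "\<sigma> \<in> Cell K" "\<tau> \<in> Cell K" "Tgt K \<sigma> = Src K \<tau>"
  shows "\<tau> \<bullet> \<sigma> \<in> Cell K" "Src K (\<tau> \<bullet> \<sigma>) = Src K \<sigma>" "Tgt K (\<tau> \<bullet> \<sigma>) = Tgt K \<tau>"
  using vcomp_cell[of \<sigma> "Src K \<sigma>" "Tgt K \<sigma>" \<tau> "Tgt K \<tau>"] assms by (auto simp: cell_def)

lemma Hcomp_typing:
  assumes "\<sigma> \<in> Cell K" "\<tau> \<in> Cell K" "Cod K (Src K \<sigma>) = Dom K (Src K \<tau>)"
  shows "\<tau> \<star> \<sigma> \<in> Cell K" "Src K (\<tau> \<star> \<sigma>) = Src K \<tau> \<cdot> Src K \<sigma>" "Tgt K (\<tau> \<star> \<sigma>) = Tgt K \<tau> \<cdot> Tgt K \<sigma>"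
  using hcomp_cell[of \<sigma> "Src K \<sigma>" "Tgt K \<sigma>" \<tau> "Src K \<tau>" "Tgt K \<tau>"] assms by (auto simp: cell_def)

lemma whisker_left_typing:
  assumes "g \<in> Arr K" "\<sigma> \<in> Cell K" "Cod K (Src K \<sigma>) = Dom K g"
  shows "g \<lhd> \<sigma> \<in> Cell K" "Src K (g \<lhd> \<sigma>) = g \<cdot> Src K \<sigma>" "Tgt K (g \<lhd> \<sigma>) = g \<cdot> Tgt K \<sigma>"
  using Hcomp_typing[of \<sigma> "Id2 K g"] assms by (auto simp: whisker_left_def Id2_typing)

lemma whisker_right_typing:
  assumes "f \<in> Arr K" "\<sigma> \<in> Cell K" "Cod K f = Dom K (Src K \<sigma>)"
  shows "\<sigma> \<rhd> f \<in> Cell K" "Src K (\<sigma> \<rhd> f) = Src K \<sigma> \<cdot> f" "Tgt K (\<sigma> \<rhd> f) = Tgt K \<sigma> \<cdot> f"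
  using Hcomp_typing[of "Id2 K f" \<sigma>] assms by (auto simp: whisker_right_def Id2_typing)

lemma Vcomp_Id2: "\<sigma> \<in> Cell K \<Longrightarrow> f = Tgt K \<sigma> \<Longrightarrow> Id2 K f \<bullet> \<sigma> = \<sigma>" "\<sigma> \<in> Cell K \<Longrightarrow> f = Src K \<sigma> \<Longrightarrow> \<sigma> \<bullet> Id2 K f = \<sigma>"
  using id2_left id2_right by (auto simp: cell_def)

lemma Vcomp_assoc: "\<sigma> \<in> Cell K \<Longrightarrow> \<tau> \<in> Cell K \<Longrightarrow> \<upsilon> \<in> Cell K \<Longrightarrow> Tgt K \<sigma> = Src K \<tau> \<Longrightarrow> Tgt K \<tau> = Src K \<upsilon> \<Longrightarrow>
    (\<upsilon> \<bullet> \<tau>) \<bullet> \<sigma> = \<upsilon> \<bullet> (\<tau> \<bullet> \<sigma>)"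
  using vcomp_assoc by (auto simp: cell_def)

lemma Interchange:
  assumes "\<sigma> \<in> Cell K" "\<sigma>' \<in> Cell K" "\<tau> \<in> Cell K" "\<tau>' \<in> Cell K" "Tgt K \<sigma> = Src K \<sigma>'" "Tgt K \<tau> = Src K \<tau>'"
    "Cod K (Src K \<sigma>) = Dom K (Src K \<tau>)"
  shows "(\<tau>' \<bullet> \<tau>) \<star> (\<sigma>' \<bullet> \<sigma>) = (\<tau>' \<star> \<sigma>') \<bullet> (\<tau> \<star> \<sigma>)"
  using interchange[of \<sigma> _ _ \<sigma>' _ \<tau> _ _ \<tau>'] assms by (auto simp: cell_def)

lemma Hcomp_Id2: "f \<in> Arr K \<Longrightarrow> g \<in> Arr K \<Longrightarrow> Cod K f = Dom K g \<Longrightarrow> Id2 K g \<star> Id2 K f = Id2 K (g \<cdot> f)"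
  using hcomp_id2 by (auto simp: arr_def)

lemma Hcomp_assoc: "\<sigma> \<in> Cell K \<Longrightarrow> \<tau> \<in> Cell K \<Longrightarrow> \<upsilon> \<in> Cell K \<Longrightarrow> Cod K (Src K \<sigma>) = Dom K (Src K \<tau>) \<Longrightarrow>
   Cod K (Src K \<tau>) = Dom K (Src K \<upsilon>) \<Longrightarrow> (\<upsilon> \<star> \<tau>) \<star> \<sigma> = \<upsilon> \<star> (\<tau> \<star> \<sigma>)"
  using hcomp_assoc by (auto simp: cell_def)

lemma whisker_left_Vcomp:
  assumes "g \<in> Arr K" "\<sigma> \<in> Cell K" "\<tau> \<in> Cell K" "Tgt K \<sigma> = Src K \<tau>" "Cod K (Src K \<sigma>) = Dom K g"
  shows "g \<lhd> (\<tau> \<bullet> \<sigma>) = (g \<lhd> \<tau>) \<bullet> (g \<lhd> \<sigma>)"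
  using Interchange[of \<sigma> \<tau> "Id2 K g" "Id2 K g"] assms
  by (simp add: whisker_left_def Id2_typing Vcomp_Id2)

lemma whisker_right_Vcomp:
  assumes "f \<in> Arr K" "\<sigma> \<in> Cell K" "\<tau> \<in> Cell K" "Tgt K \<sigma> = Src K \<tau>" "Cod K f = Dom K (Src K \<sigma>)"
  shows "(\<tau> \<bullet> \<sigma>) \<rhd> f = (\<tau> \<rhd> f) \<bullet> (\<sigma> \<rhd> f)"
  using Interchange[of "Id2 K f" "Id2 K f" \<sigma> \<tau>] assms
  by (simp add: whisker_right_def Id2_typing Vcomp_Id2)

lemma whisker_left_Id2: "f \<in> Arr K \<Longrightarrow> g \<in> Arr K \<Longrightarrow> Cod K f = Dom K g \<Longrightarrow> g \<lhd> Id2 K f = Id2 K (g \<cdot> f)"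
  by (simp add: whisker_left_def Hcomp_Id2)

lemma whisker_right_Id2: "f \<in> Arr K \<Longrightarrow> g \<in> Arr K \<Longrightarrow> Cod K f = Dom K g \<Longrightarrow> Id2 K g \<rhd> f = Id2 K (g \<cdot> f)"
  by (simp add: whisker_right_def Hcomp_Id2)

lemma whisker_left_left: "g \<in> Arr K \<Longrightarrow> h \<in> Arr K \<Longrightarrow> \<sigma> \<in> Cell K \<Longrightarrow> Cod K (Src K \<sigma>) = Dom K g \<Longrightarrow> Cod K g = Dom K h \<Longrightarrow>
    h \<lhd> (g \<lhd> \<sigma>) = h \<cdot> g \<lhd> \<sigma>"
  using Hcomp_assoc[of \<sigma> "Id2 K g" "Id2 K h"] by (simp add: whisker_left_def Id2_typing Hcomp_Id2)

lemma whisker_right_right: "g \<in> Arr K \<Longrightarrow> h \<in> Arr K \<Longrightarrow> \<sigma> \<in> Cell K \<Longrightarrow> Cod K h = Dom K (Src K \<sigma>) \<Longrightarrow> Cod K g =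
    Dom K h \<Longrightarrow>
    \<sigma> \<rhd> h \<rhd> g = \<sigma> \<rhd> (h \<cdot> g)"
  using Hcomp_assoc[of "Id2 K g" "Id2 K h" \<sigma>] by (simp add: whisker_right_def Id2_typing Hcomp_Id2)

lemma whisker_left_right: "f \<in> Arr K \<Longrightarrow> g \<in> Arr K \<Longrightarrow> \<sigma> \<in> Cell K \<Longrightarrow> Cod K f = Dom K (Src K \<sigma>) \<Longrightarrow> Cod K (Src K \<sigma>) =
    Dom K g \<Longrightarrow>
    (g \<lhd> \<sigma>) \<rhd> f = g \<lhd> \<sigma> \<rhd> f"
  using Hcomp_assoc[of "Id2 K f" \<sigma> "Id2 K g"] by (simp add: whisker_right_def whisker_left_def Id2_typing)

lemma whisker_Id1: "\<sigma> \<in> Cell K \<Longrightarrow> X = Cod K (Src K \<sigma>) \<Longrightarrow> Id1 K X \<lhd> \<sigma> = \<sigma>"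
    "\<sigma> \<in> Cell K \<Longrightarrow> X = Dom K (Src K \<sigma>) \<Longrightarrow> \<sigma> \<rhd> Id1 K X = \<sigma>"
  using hcomp_left hcomp_right by (auto simp: cell_def whisker_left_def whisker_right_def)

text \<open>Both forms are interchange with identity cells inserted in two different corners. They
  let horizontal composites be eliminated in favour of whiskerings.\<close>

lemma Hcomp_whisker:
  assumes "\<sigma> \<in> Cell K" "\<tau> \<in> Cell K" "Cod K (Src K \<sigma>) = Dom K (Src K \<tau>)"
  shows "\<tau> \<star> \<sigma> = (\<tau> \<rhd> Tgt K \<sigma>) \<bullet> (Src K \<tau> \<lhd> \<sigma>)" "\<tau> \<star> \<sigma> = (Tgt K \<tau> \<lhd> \<sigma>) \<bullet> (\<tau> \<rhd> Src K \<sigma>)"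
  using Interchange[of \<sigma> "Id2 K (Tgt K \<sigma>)" "Id2 K (Src K \<tau>)" \<tau>]
    Interchange[of "Id2 K (Src K \<sigma>)" \<sigma> \<tau> "Id2 K (Tgt K \<tau>)"] assms
  by (simp_all add: whisker_right_def whisker_left_def Id2_typing Vcomp_Id2 Src_Tgt_typing)

text \<open>Two cells on adjacent strings may be applied in either order. Instances of this
  equation, oriented by hand, move a cell past another one in the pasting calculations
  below.\<close>

lemma exchange:
  assumes "\<sigma> \<in> Cell K" "\<tau> \<in> Cell K" "Cod K (Src K \<sigma>) = Dom K (Src K \<tau>)"
  shows "(\<tau> \<rhd> Tgt K \<sigma>) \<bullet> (Src K \<tau> \<lhd> \<sigma>) = (Tgt K \<tau> \<lhd> \<sigma>) \<bullet> (\<tau> \<rhd> Src K \<sigma>)"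
  using Hcomp_whisker[OF assms] by simp

lemma reassoc:
  assumes "A \<bullet> B = E" "A \<in> Cell K" "B \<in> Cell K" "Src K A = Tgt K B" "R \<in> Cell K" "Tgt K R = Src K B"
  shows "A \<bullet> (B \<bullet> R) = E \<bullet> R"
  using assms Vcomp_assoc[of R B A] by simp

lemma reassoc3:
  assumes "A \<bullet> (B \<bullet> D) = E" "A \<in> Cell K" "B \<in> Cell K" "D \<in> Cell K" "Src K A = Tgt K B" "Src K B = Tgt K D" 
    "R \<in> Cell K" "Tgt K R = Src K D"
  shows "A \<bullet> (B \<bullet> (D \<bullet> R)) = E \<bullet> R"
  using assms Vcomp_assoc[of R "B \<bullet> D" A] Vcomp_assoc[of R D B] by (simp add: Vcomp_typing)

section \<open>Invertible 2-cells and their cancellation\<close>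

definition iso2 :: "'c \<Rightarrow> bool" where "iso2 \<sigma> \<longleftrightarrow> iso_cell K \<sigma> (Src K \<sigma>) (Tgt K \<sigma>)"

lemma iso2_Cell: "iso2 \<sigma> \<Longrightarrow> \<sigma> \<in> Cell K" by (simp add: iso2_def iso_cell_def cell_def)

lemma iso_cell_iff: "iso_cell K \<sigma> f g \<longleftrightarrow> iso2 \<sigma> \<and> Src K \<sigma> = f \<and> Tgt K \<sigma> = g"
  by (auto simp: iso2_def iso_cell_def cell_def)

abbreviation inv2 :: "'c \<Rightarrow> 'c" where "inv2 \<equiv> cell_inv K"

text \<open>Inverses are unique, so the definite description in \<open>cell_inv\<close> denotes any
  inverse that is exhibited.\<close>

lemma cell_inv_eqI:
  assumes "\<sigma> \<in> Cell K" "\<tau> \<in> Cell K" "Src K \<tau> = Tgt K \<sigma>" "Tgt K \<tau> = Src K \<sigma>"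
    "\<tau> \<bullet> \<sigma> = Id2 K (Src K \<sigma>)" "\<sigma> \<bullet> \<tau> = Id2 K (Tgt K \<sigma>)"
  shows "inv2 \<sigma> = \<tau>" "iso2 \<sigma>"
proof -
  show "inv2 \<sigma> = \<tau>" unfolding cell_inv_def
  proof (rule the_equality)
    fix u assume u: "cell K u (Tgt K \<sigma>) (Src K \<sigma>) \<and> u \<bullet> \<sigma> = Id2 K (Src K \<sigma>) \<and> \<sigma> \<bullet> u = Id2 K (Tgt K \<sigma>)"
    then have uc: "u \<in> Cell K" "Src K u = Tgt K \<sigma>" "Tgt K u = Src K \<sigma>" "\<sigma> \<bullet> u = Id2 K (Tgt K \<sigma>)"
      by (auto simp: cell_def)
    show "u = \<tau>"
      using Vcomp_assoc[OF uc(1) assms(1,2) uc(3) assms(3)[symmetric]] uc assms by (simp add: Vcomp_Id2)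
  qed (use assms in \<open>auto simp: cell_def\<close>)
  show "iso2 \<sigma>" unfolding iso2_def iso_cell_def cell_def using assms by auto
qed

lemma inv2_typing:
  assumes "iso2 \<sigma>"
  shows "inv2 \<sigma> \<in> Cell K" "Src K (inv2 \<sigma>) = Tgt K \<sigma>" "Tgt K (inv2 \<sigma>) = Src K \<sigma>"
    and inv2_comp: "inv2 \<sigma> \<bullet> \<sigma> = Id2 K (Src K \<sigma>)" "\<sigma> \<bullet> inv2 \<sigma> = Id2 K (Tgt K \<sigma>)"
proof -
  from assms obtain \<tau> where "\<sigma> \<in> Cell K" "\<tau> \<in> Cell K" "Src K \<tau> = Tgt K \<sigma>" "Tgt K \<tau> = Src K \<sigma>"
    "\<tau> \<bullet> \<sigma> = Id2 K (Src K \<sigma>)" "\<sigma> \<bullet> \<tau> = Id2 K (Tgt K \<sigma>)"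
    by (auto simp: iso2_def iso_cell_def cell_def)
  with cell_inv_eqI(1)[OF this]
  show "inv2 \<sigma> \<in> Cell K" "Src K (inv2 \<sigma>) = Tgt K \<sigma>" "Tgt K (inv2 \<sigma>) = Src K \<sigma>"
    "inv2 \<sigma> \<bullet> \<sigma> = Id2 K (Src K \<sigma>)" "\<sigma> \<bullet> inv2 \<sigma> = Id2 K (Tgt K \<sigma>)" by simp_all
qed

text \<open>As rewrite rules, the following equations turn a pasting composite into a right-associated
  vertical composite of whiskered generators \<open>g \<lhd> \<sigma> \<rhd> f\<close>. An equation between such normal forms is
  applied inside a longer composite through \<open>reassoc\<close> and \<open>reassoc3\<close>; the interchange law is no
  rewrite rule but used in explicit instances of \<open>exchange\<close>.\<close>

lemmas two_cat_simps = arr_def cell_def Id1_typing Comp1_typing Comp1_Id1 Comp1_assoc Src_Tgt_typing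
    Id2_typing
  Vcomp_typing whisker_left_typing whisker_right_typing Vcomp_Id2 Vcomp_assoc whisker_left_Vcomp
  whisker_right_Vcomp whisker_left_Id2 whisker_right_Id2 whisker_left_left whisker_right_right
  whisker_left_right whisker_Id1 inv2_typing inv2_comp iso2_Cell

lemmas [simp] = two_cat_simps

lemma inv2_inverse [simp]:
  assumes "iso2 \<sigma>"
  shows "iso2 (inv2 \<sigma>)" "inv2 (inv2 \<sigma>) = \<sigma>"
  by (rule cell_inv_eqI(2)[where \<tau> = "\<sigma>"]; simp add: assms)
    (rule cell_inv_eqI(1); simp add: assms)

lemma inv2_of_Id2 [simp]:
  assumes "f \<in> Arr K"
  shows "iso2 (Id2 K f)" "inv2 (Id2 K f) = Id2 K f"
  by (rule cell_inv_eqI(2)[where \<tau> = "Id2 K f"]; simp add: assms)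
    (rule cell_inv_eqI(1); simp add: assms)

lemma inv2_of_Vcomp [simp]:
  assumes "iso2 \<sigma>" "iso2 \<tau>" "Tgt K \<sigma> = Src K \<tau>"
  shows "iso2 (\<tau> \<bullet> \<sigma>)" "inv2 (\<tau> \<bullet> \<sigma>) = inv2 \<sigma> \<bullet> inv2 \<tau>"
  by (rule cell_inv_eqI(2)[where \<tau> = "inv2 \<sigma> \<bullet> inv2 \<tau>"]; simp add: assms reassoc[OF inv2_comp(1)[OF assms(2)],
      of \<sigma>]
      reassoc[OF inv2_comp(2)[OF assms(1)], of "inv2 \<tau>"])
    (rule cell_inv_eqI(1); simp add: assms reassoc[OF inv2_comp(1)[OF assms(2)], of \<sigma>]
      reassoc[OF inv2_comp(2)[OF assms(1)], of "inv2 \<tau>"])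

lemma inv2_of_whisker_left [simp]:
  assumes "iso2 \<sigma>" "g \<in> Arr K" "Cod K (Src K \<sigma>) = Dom K g"
  shows "iso2 (g \<lhd> \<sigma>)" "inv2 (g \<lhd> \<sigma>) = g \<lhd> inv2 \<sigma>"
  by (rule cell_inv_eqI(2)[where \<tau> = "g \<lhd> inv2 \<sigma>"]; simp add: assms flip: whisker_left_Vcomp)
    (rule cell_inv_eqI(1); simp add: assms flip: whisker_left_Vcomp)

lemma inv2_of_whisker_right [simp]:
  assumes "iso2 \<sigma>" "f \<in> Arr K" "Cod K f = Dom K (Src K \<sigma>)"
  shows "iso2 (\<sigma> \<rhd> f)" "inv2 (\<sigma> \<rhd> f) = inv2 \<sigma> \<rhd> f"
  by (rule cell_inv_eqI(2)[where \<tau> = "inv2 \<sigma> \<rhd> f"]; simp add: assms flip: whisker_right_Vcomp)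
    (rule cell_inv_eqI(1); simp add: assms flip: whisker_right_Vcomp)

lemma inv2_cancel [simp]:
  assumes "iso2 \<sigma>" "R \<in> Cell K"
  shows "Tgt K R = Src K \<sigma> \<Longrightarrow> inv2 \<sigma> \<bullet> \<sigma> \<bullet> R = R" "Tgt K R = Tgt K \<sigma> \<Longrightarrow> \<sigma> \<bullet> inv2 \<sigma> \<bullet> R = R"
  using reassoc[OF inv2_comp(1)[OF assms(1)], of R] reassoc[OF inv2_comp(2)[OF assms(1)], of R] assms by auto

lemma cancel_left:
  assumes "\<tau> \<bullet> \<sigma> = \<tau> \<bullet> \<sigma>'" "iso2 \<tau>" "\<sigma> \<in> Cell K" "\<sigma>' \<in> Cell K" "Tgt K \<sigma> = Src K \<tau>" "Tgt K \<sigma>' = Src K \<tau>"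
  shows "\<sigma> = \<sigma>'"
  using inv2_cancel(1)[OF assms(2,3,5)] inv2_cancel(1)[OF assms(2,4,6)] unfolding assms(1)
      by (rule trans[OF sym])

lemma cancel_right:
  assumes "\<sigma> \<bullet> \<tau> = \<sigma>' \<bullet> \<tau>" "iso2 \<tau>" "\<sigma> \<in> Cell K" "\<sigma>' \<in> Cell K" "Src K \<sigma> = Tgt K \<tau>" "Src K \<sigma>' = Tgt K \<tau>"
  shows "\<sigma> = \<sigma>'"
proof -
  have *: "(u \<bullet> \<tau>) \<bullet> inv2 \<tau> = u" if "u \<in> Cell K" "Src K u = Tgt K \<tau>" for u
    using assms(2) that by simp
  show ?thesis using *[OF assms(3,5)] *[OF assms(4,6)] unfolding assms(1) by (rule trans[OF sym])
qed

text \<open>The rewrite rules distribute whiskering over vertical composition, so an inverse pair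
  appears whiskered and possibly with a rest \<open>R\<close> behind it. Each of these shapes needs
  its own cancellation rule, here and in the next two lemmas.\<close>

lemma inv2_cancel_whisker_left [simp]:
  assumes "iso2 \<sigma>" "g \<in> Arr K" "Cod K (Src K \<sigma>) = Dom K g"
  shows "(g \<lhd> inv2 \<sigma>) \<bullet> (g \<lhd> \<sigma>) = Id2 K (g \<cdot> Src K \<sigma>)" "(g \<lhd> \<sigma>) \<bullet> (g \<lhd> inv2 \<sigma>) = Id2 K (g \<cdot> Tgt K \<sigma>)"
    "R \<in> Cell K \<Longrightarrow> Tgt K R = g \<cdot> Src K \<sigma> \<Longrightarrow> (g \<lhd> inv2 \<sigma>) \<bullet> (g \<lhd> \<sigma>) \<bullet> R = R"
    "R \<in> Cell K \<Longrightarrow> Tgt K R = g \<cdot> Tgt K \<sigma> \<Longrightarrow> (g \<lhd> \<sigma>) \<bullet> (g \<lhd> inv2 \<sigma>) \<bullet> R = R"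
  using inv2_comp[of "g \<lhd> \<sigma>"] inv2_cancel[of "g \<lhd> \<sigma>" R] assms by auto

lemma inv2_cancel_whisker_right [simp]:
  assumes "iso2 \<sigma>" "f \<in> Arr K" "Cod K f = Dom K (Src K \<sigma>)"
  shows "(inv2 \<sigma> \<rhd> f) \<bullet> (\<sigma> \<rhd> f) = Id2 K (Src K \<sigma> \<cdot> f)" "(\<sigma> \<rhd> f) \<bullet> (inv2 \<sigma> \<rhd> f) = Id2 K (Tgt K \<sigma> \<cdot> f)"
    "R \<in> Cell K \<Longrightarrow> Tgt K R = Src K \<sigma> \<cdot> f \<Longrightarrow> (inv2 \<sigma> \<rhd> f) \<bullet> (\<sigma> \<rhd> f) \<bullet> R = R"
    "R \<in> Cell K \<Longrightarrow> Tgt K R = Tgt K \<sigma> \<cdot> f \<Longrightarrow> (\<sigma> \<rhd> f) \<bullet> (inv2 \<sigma> \<rhd> f) \<bullet> R = R"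
  using inv2_comp[of "\<sigma> \<rhd> f"] inv2_cancel[of "\<sigma> \<rhd> f" R] assms by auto

lemma inv2_cancel_whisker [simp]:
  assumes "iso2 \<sigma>" "f \<in> Arr K" "Cod K f = Dom K (Src K \<sigma>)" "g \<in> Arr K" "Cod K (Src K \<sigma>) = Dom K g"
  shows "(g \<lhd> inv2 \<sigma> \<rhd> f) \<bullet> (g \<lhd> \<sigma> \<rhd> f) = Id2 K (g \<cdot> Src K \<sigma> \<cdot> f)" "(g \<lhd> \<sigma> \<rhd> f) \<bullet> (g \<lhd> inv2 \<sigma> \<rhd> f) =
      Id2 K (g \<cdot> Tgt K \<sigma> \<cdot> f)"
    "R \<in> Cell K \<Longrightarrow> Tgt K R = g \<cdot> Src K \<sigma> \<cdot> f \<Longrightarrow> (g \<lhd> inv2 \<sigma> \<rhd> f) \<bullet> (g \<lhd> \<sigma> \<rhd> f) \<bullet> R = R"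
    "R \<in> Cell K \<Longrightarrow> Tgt K R = g \<cdot> Tgt K \<sigma> \<cdot> f \<Longrightarrow> (g \<lhd> \<sigma> \<rhd> f) \<bullet> (g \<lhd> inv2 \<sigma> \<rhd> f) \<bullet> R = R"
  using inv2_comp[of "g \<lhd> \<sigma> \<rhd> f"] inv2_cancel[of "g \<lhd> \<sigma> \<rhd> f" R] assms by auto

lemma cellD: "cell K \<sigma> u v \<Longrightarrow> \<sigma> \<in> Cell K \<and> Src K \<sigma> = u \<and> Tgt K \<sigma> = v \<and> u \<in> Arr K \<and> v \<in> Arr K \<and> Dom K v =
    Dom K u \<and>
    Cod K v = Cod K u"
  by auto

lemma iso_cellD: "iso_cell K \<sigma> u v \<Longrightarrow> iso2 \<sigma> \<and> Src K \<sigma> = u \<and> Tgt K \<sigma> = v"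
  by (simp add: iso_cell_iff)

text \<open>The 1-cell e is a section of a up to the invertible \<alpha>. By exchange, conjugation
  with \<alpha> recovers \<sigma> from its whiskering with \<open>a \<cdot> e\<close>.\<close>

lemma whisker_right_faithful:
  assumes eq: "\<sigma> \<rhd> a = \<sigma>' \<rhd> a" and \<sigma>: "\<sigma> \<in> Cell K" "\<sigma>' \<in> Cell K" "Src K \<sigma>' = Src K \<sigma>" "Tgt K \<sigma>' = Tgt K \<sigma>"
    and \<alpha>: "iso2 \<alpha>" "Src K \<alpha> = a \<cdot> e" "Tgt K \<alpha> = Id1 K (Dom K e)" and a: "a \<in> Arr K" "e \<in> Arr K"
      "Cod K e = Dom K a" "Cod K a = Dom K e" "Dom K (Src K \<sigma>) = Dom K e"
  shows "\<sigma> = \<sigma>'"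
proof -
  obtain u v where uv: "Src K \<sigma> = u" "Tgt K \<sigma> = v" by simp
  have "u \<in> Arr K" "v \<in> Arr K" "Dom K v = Dom K u" "Cod K v = Cod K u"
    using Src_Tgt_typing[OF \<sigma>(1)] uv by auto
  note [simp] = this \<sigma>[unfolded uv] uv \<alpha> a[unfolded uv]
  have "\<sigma> \<rhd> (a \<cdot> e) = \<sigma>' \<rhd> (a \<cdot> e)"
    using arg_cong[OF eq, of "\<lambda>z. z \<rhd> e"] by simp
  then have "\<sigma> \<bullet> (u \<lhd> \<alpha>) = \<sigma>' \<bullet> (u \<lhd> \<alpha>)"
    using exchange[of \<alpha> \<sigma>] exchange[of \<alpha> \<sigma>'] by simp
  then show ?thesis by (rule cancel_right) simp_all
qed

end

lemma comp_two_fun_proj [simp]: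
  "on_obj (G \<circ>\<^sub>2 F) X = on_obj G (on_obj F X)" "on_arr (G \<circ>\<^sub>2 F) f = on_arr G (on_arr F f)"
  "on_cell (G \<circ>\<^sub>2 F) \<sigma> = on_cell G (on_cell F \<sigma>)"
  by (simp_all add: comp_two_fun_def)

lemma two_functor_comp:
  assumes "two_category I" "two_functor I K F" "two_functor K H G"
  shows "two_functor I H (G \<circ>\<^sub>2 F)"
proof -
  interpret F: two_functor I K F by fact
  interpret G: two_functor K H G by fact
  have F_typing: "d \<in> Arr I \<Longrightarrow> on_arr F d \<in> Arr K \<and> Dom K (on_arr F d) = on_obj F (Dom I d) \<and>
      Cod K (on_arr F d) = on_obj F (Cod I d)" for d
    using F.fun_arr[of d] by (simp add: arr_def)
  interpret I: two_category I by fact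
  show ?thesis
  proof
    fix \<sigma> \<tau> f g h k assume a: "cell I \<sigma> f g" "cell I \<tau> h k" "Dom I h = Cod I f"
    then have "Dom K (on_arr F h) = Cod K (on_arr F f)" using F_typing[of h] F_typing[of f] by auto
    then show "on_cell (G \<circ>\<^sub>2 F) (\<tau> \<star>\<^bsub>I\<^esub> \<sigma>) = on_cell (G \<circ>\<^sub>2 F) \<tau> \<star>\<^bsub>H\<^esub> on_cell (G \<circ>\<^sub>2 F) \<sigma>"
      using F.fun_hcomp[OF a] G.fun_hcomp[OF F.fun_cell[OF a(1)] F.fun_cell[OF a(2)]] by simp
  next
    fix \<sigma> \<tau> f g h assume a: "cell I \<sigma> f g" "cell I \<tau> g h"
    then show "on_cell (G \<circ>\<^sub>2 F) (\<tau> \<bullet>\<^bsub>I\<^esub> \<sigma>) = on_cell (G \<circ>\<^sub>2 F) \<tau> \<bullet>\<^bsub>H\<^esub> on_cell (G \<circ>\<^sub>2 F) \<sigma>"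
      using F.fun_vcomp[OF a] G.fun_vcomp[OF F.fun_cell[OF a(1)] F.fun_cell[OF a(2)]] by simp
  next
    fix f g X Y Z assume a: "arr I f X Y" "arr I g Y Z"
    then show "on_arr (G \<circ>\<^sub>2 F) (g \<cdot>\<^bsub>I\<^esub> f) = on_arr (G \<circ>\<^sub>2 F) g \<cdot>\<^bsub>H\<^esub> on_arr (G \<circ>\<^sub>2 F) f"
      using F.fun_comp1[OF a] G.fun_comp1[OF F.fun_arr[OF a(1)] F.fun_arr[OF a(2)]] by simp
  next
    fix f X Y assume "arr I f X Y"
    then show "arr H (on_arr (G \<circ>\<^sub>2 F) f) (on_obj (G \<circ>\<^sub>2 F) X) (on_obj (G \<circ>\<^sub>2 F) Y)"
      using G.fun_arr[OF F.fun_arr] by (simp del: I.two_cat_simps)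
  next
    fix \<sigma> f g assume "cell I \<sigma> f g"
    then show "cell H (on_cell (G \<circ>\<^sub>2 F) \<sigma>) (on_arr (G \<circ>\<^sub>2 F) f) (on_arr (G \<circ>\<^sub>2 F) g)"
      using G.fun_cell[OF F.fun_cell] by (simp del: I.two_cat_simps)
  qed (simp_all add: F.fun_obj G.fun_obj F.fun_id1 G.fun_id1 F.fun_id2 G.fun_id2 F_typing)
qed

section \<open>Coherence for pseudomonads\<close>

locale pseudomonad_on = two_category C for C :: "('o, 'a, 'c) two_cat" (structure) +
  fixes M :: "('o, 'a, 'c) psmonad"
  assumes pseudomonad: "pseudomonad C M"
begin

abbreviation T\<^sub>0 :: "'o \<Rightarrow> 'o" where "T\<^sub>0 \<equiv> T0 M"
abbreviation T\<^sub>1 :: "'a \<Rightarrow> 'a" where "T\<^sub>1 \<equiv> T1 M"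
abbreviation T\<^sub>2 :: "'c \<Rightarrow> 'c" where "T\<^sub>2 \<equiv> T2 M"
abbreviation \<eta> :: "'o \<Rightarrow> 'a" where "\<eta> \<equiv> unit1 M"
abbreviation \<eta>c :: "'a \<Rightarrow> 'c" where "\<eta>c \<equiv> unit2 M"
abbreviation \<mu> :: "'o \<Rightarrow> 'a" where "\<mu> \<equiv> mult1 M"
abbreviation \<mu>c :: "'a \<Rightarrow> 'c" where "\<mu>c \<equiv> mult2 M"
abbreviation \<xi> :: "'o \<Rightarrow> 'c" where "\<xi> \<equiv> mod_\<xi> M"
abbreviation \<zeta> :: "'o \<Rightarrow> 'c" where "\<zeta> \<equiv> mod_\<zeta> M"
abbreviation \<rho> :: "'o \<Rightarrow> 'c" where "\<rho> \<equiv> mod_\<rho> M"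

lemma T_functor: "two_functor C C (monad_fun M)"
  and unit_pseudonatural: "pseudonatural C C id_two_fun (monad_fun M) \<eta> \<eta>c"
  and mult_pseudonatural: "pseudonatural_rev C C (monad_fun M \<circ>\<^sub>2 monad_fun M) (monad_fun M) \<mu> \<mu>c"
  using pseudomonad unfolding pseudomonad_def by auto

lemma T_typing [simp]:
  "X \<in> Obj C \<Longrightarrow> T\<^sub>0 X \<in> Obj C"
  "f \<in> Arr C \<Longrightarrow> T\<^sub>1 f \<in> Arr C" "f \<in> Arr C \<Longrightarrow> Dom C (T\<^sub>1 f) = T\<^sub>0 (Dom C f)" "f \<in> Arr C \<Longrightarrow> Cod C (T\<^sub>1 f) =
      T\<^sub>0 (Cod C f)"
  "\<sigma> \<in> Cell C \<Longrightarrow> T\<^sub>2 \<sigma> \<in> Cell C" "\<sigma> \<in> Cell C \<Longrightarrow> Src C (T\<^sub>2 \<sigma>) = T\<^sub>1 (Src C \<sigma>)" "\<sigma> \<in> Cell C \<Longrightarrow> Tgt C (T\<^sub>2 \<sigma>) =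
      T\<^sub>1 (Tgt C \<sigma>)"
  using two_functor.fun_obj[OF T_functor] two_functor.fun_arr[OF T_functor, of f] two_functor.fun_cell[OF
      T_functor, of \<sigma>]
  by (auto simp: arr_def cell_def)

lemma T_comp [simp]:
  "X \<in> Obj C \<Longrightarrow> T\<^sub>1 (Id1 C X) = Id1 C (T\<^sub>0 X)"
  "f \<in> Arr C \<Longrightarrow> g \<in> Arr C \<Longrightarrow> Cod C f = Dom C g \<Longrightarrow> T\<^sub>1 (g \<cdot> f) = T\<^sub>1 g \<cdot> T\<^sub>1 f"
  "f \<in> Arr C \<Longrightarrow> T\<^sub>2 (Id2 C f) = Id2 C (T\<^sub>1 f)"
  "\<sigma> \<in> Cell C \<Longrightarrow> \<tau> \<in> Cell C \<Longrightarrow> Tgt C \<sigma> = Src C \<tau> \<Longrightarrow> T\<^sub>2 (\<tau> \<bullet> \<sigma>) = T\<^sub>2 \<tau> \<bullet> T\<^sub>2 \<sigma>"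
  using two_functor.fun_id1[OF T_functor] two_functor.fun_comp1[OF T_functor, of f _ _ g]
    two_functor.fun_id2[OF T_functor] two_functor.fun_vcomp[OF T_functor, of \<sigma> _ _ \<tau>]
  by (auto simp: arr_def cell_def)

lemma T_whisker [simp]:
  "g \<in> Arr C \<Longrightarrow> \<sigma> \<in> Cell C \<Longrightarrow> Cod C (Src C \<sigma>) = Dom C g \<Longrightarrow> T\<^sub>2 (g \<lhd> \<sigma>) = T\<^sub>1 g \<lhd> T\<^sub>2 \<sigma>"
  "f \<in> Arr C \<Longrightarrow> \<sigma> \<in> Cell C \<Longrightarrow> Cod C f = Dom C (Src C \<sigma>) \<Longrightarrow> T\<^sub>2 (\<sigma> \<rhd> f) = T\<^sub>2 \<sigma> \<rhd> T\<^sub>1 f"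
  using two_functor.fun_hcomp[OF T_functor, of \<sigma> _ _ "Id2 C g"]
    two_functor.fun_hcomp[OF T_functor, of "Id2 C f" _ _ \<sigma>]
  by (auto simp: whisker_left_def whisker_right_def)

lemma T_iso [simp]:
  assumes "iso2 \<sigma>"
  shows "iso2 (T\<^sub>2 \<sigma>)" "T\<^sub>2 (inv2 \<sigma>) = inv2 (T\<^sub>2 \<sigma>)"
proof -
  have "T\<^sub>2 (inv2 \<sigma>) \<bullet> T\<^sub>2 \<sigma> = Id2 C (T\<^sub>1 (Src C \<sigma>))" "T\<^sub>2 \<sigma> \<bullet> T\<^sub>2 (inv2 \<sigma>) = Id2 C (T\<^sub>1 (Tgt C \<sigma>))"
    using assms by (simp_all flip: T_comp)
  then show "iso2 (T\<^sub>2 \<sigma>)" "T\<^sub>2 (inv2 \<sigma>) = inv2 (T\<^sub>2 \<sigma>)"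
    using cell_inv_eqI[of "T\<^sub>2 \<sigma>" "T\<^sub>2 (inv2 \<sigma>)"] assms by auto
qed

lemma unit_typing [simp]:
  "X \<in> Obj C \<Longrightarrow> \<eta> X \<in> Arr C" "X \<in> Obj C \<Longrightarrow> Dom C (\<eta> X) = X" "X \<in> Obj C \<Longrightarrow> Cod C (\<eta> X) = T\<^sub>0 X"
  "f \<in> Arr C \<Longrightarrow> iso2 (\<eta>c f)" "f \<in> Arr C \<Longrightarrow> Src C (\<eta>c f) = T\<^sub>1 f \<cdot> \<eta> (Dom C f)"
  "f \<in> Arr C \<Longrightarrow> Tgt C (\<eta>c f) = \<eta> (Cod C f) \<cdot> f"
  using unit_pseudonatural unfolding pseudonatural_def by (auto simp: id_two_fun_def iso_cell_iff)

lemma unit_comp [simp]: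
  "X \<in> Obj C \<Longrightarrow> \<eta>c (Id1 C X) = Id2 C (\<eta> X)"
  "f \<in> Arr C \<Longrightarrow> g \<in> Arr C \<Longrightarrow> Cod C f = Dom C g \<Longrightarrow> \<eta>c (g \<cdot> f) = (\<eta>c g \<rhd> f) \<bullet> (T\<^sub>1 g \<lhd> \<eta>c f)"
  using unit_pseudonatural unfolding pseudonatural_def by (auto simp: id_two_fun_def)

lemma unit_natural:
  "\<sigma> \<in> Cell C \<Longrightarrow> X = Cod C (Src C \<sigma>) \<Longrightarrow> (\<eta> X \<lhd> \<sigma>) \<bullet> \<eta>c (Src C \<sigma>) = \<eta>c (Tgt C \<sigma>) \<bullet> (T\<^sub>2 \<sigma> \<rhd> \<eta> (Dom C (Src C \<sigma>)))"
  using unit_pseudonatural unfolding pseudonatural_def by (auto simp: id_two_fun_def)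

lemma mult_typing [simp]:
  "X \<in> Obj C \<Longrightarrow> \<mu> X \<in> Arr C" "X \<in> Obj C \<Longrightarrow> Dom C (\<mu> X) = T\<^sub>0 (T\<^sub>0 X)" "X \<in> Obj C \<Longrightarrow> Cod C (\<mu> X) = T\<^sub>0 X"
  "f \<in> Arr C \<Longrightarrow> iso2 (\<mu>c f)" "f \<in> Arr C \<Longrightarrow> Src C (\<mu>c f) = \<mu> (Cod C f) \<cdot> T\<^sub>1 (T\<^sub>1 f)"
  "f \<in> Arr C \<Longrightarrow> Tgt C (\<mu>c f) = T\<^sub>1 f \<cdot> \<mu> (Dom C f)"
  using mult_pseudonatural unfolding pseudonatural_rev_def by (auto simp: comp_two_fun_def iso_cell_iff)

lemma mult_comp [simp]:
  "X \<in> Obj C \<Longrightarrow> \<mu>c (Id1 C X) = Id2 C (\<mu> X)"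
  "f \<in> Arr C \<Longrightarrow> g \<in> Arr C \<Longrightarrow> Cod C f = Dom C g \<Longrightarrow> \<mu>c (g \<cdot> f) = (T\<^sub>1 g \<lhd> \<mu>c f) \<bullet> (\<mu>c g \<rhd> T\<^sub>1 (T\<^sub>1 f))"
  using mult_pseudonatural unfolding pseudonatural_rev_def by (auto simp: comp_two_fun_def)

lemma mult_natural:
  "\<sigma> \<in> Cell C \<Longrightarrow> X = Cod C (Src C \<sigma>) \<Longrightarrow> \<mu>c (Tgt C \<sigma>) \<bullet> (\<mu> X \<lhd> T\<^sub>2 (T\<^sub>2 \<sigma>)) = (T\<^sub>2 \<sigma> \<rhd> \<mu> (Dom C (Src C \<sigma>))) \<bullet>
      \<mu>c (Src C \<sigma>)"
  using mult_pseudonatural unfolding pseudonatural_rev_def by (auto simp: comp_two_fun_def)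

lemma modification_typing [simp]:
  assumes "X \<in> Obj C"
  shows "iso2 (\<xi> X)" "Src C (\<xi> X) = \<mu> X \<cdot> \<eta> (T\<^sub>0 X)" "Tgt C (\<xi> X) = Id1 C (T\<^sub>0 X)"
    "iso2 (\<zeta> X)" "Src C (\<zeta> X) = \<mu> X \<cdot> T\<^sub>1 (\<eta> X)" "Tgt C (\<zeta> X) = Id1 C (T\<^sub>0 X)"
    "iso2 (\<rho> X)" "Src C (\<rho> X) = \<mu> X \<cdot> T\<^sub>1 (\<mu> X)" "Tgt C (\<rho> X) = \<mu> X \<cdot> \<mu> (T\<^sub>0 X)"
  using pseudomonad assms unfolding pseudomonad_def by (auto simp: iso_cell_iff)

lemma modification:
  assumes "f \<in> Arr C" "X = Dom C f" "Y = Cod C f"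
  shows "(T\<^sub>1 f \<lhd> \<xi> X) \<bullet> (\<mu>c f \<rhd> \<eta> (T\<^sub>0 X)) = (\<xi> Y \<rhd> T\<^sub>1 f) \<bullet> (\<mu> Y \<lhd> \<eta>c (T\<^sub>1 f))"
    "(T\<^sub>1 f \<lhd> \<zeta> X) \<bullet> (\<mu>c f \<rhd> T\<^sub>1 (\<eta> X)) = (\<zeta> Y \<rhd> T\<^sub>1 f) \<bullet> (\<mu> Y \<lhd> T\<^sub>2 (\<eta>c f))"
    "(T\<^sub>1 f \<lhd> \<rho> X) \<bullet> (\<mu>c f \<rhd> T\<^sub>1 (\<mu> X)) \<bullet> (\<mu> Y \<lhd> T\<^sub>2 (\<mu>c f)) =
        (\<mu>c f \<rhd> \<mu> (T\<^sub>0 X)) \<bullet> (\<mu> Y \<lhd> \<mu>c (T\<^sub>1 f)) \<bullet> (\<rho> Y \<rhd> T\<^sub>1 (T\<^sub>1 (T\<^sub>1 f)))"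
  using pseudomonad assms unfolding pseudomonad_def by (auto simp: arr_def)

lemma psalgebra_free: "X \<in> Obj C \<Longrightarrow> psalgebra C M (free_alg M X)"
  using pseudomonad unfolding pseudomonad_def by auto

lemma free_axioms:
  assumes "X \<in> Obj C"
  shows "(\<mu> X \<lhd> \<zeta> (T\<^sub>0 X)) \<bullet> (\<rho> X \<rhd> T\<^sub>1 (\<eta> (T\<^sub>0 X))) = \<mu> X \<lhd> T\<^sub>2 (\<xi> X)"
    "(\<mu> X \<lhd> \<rho> (T\<^sub>0 X)) \<bullet> (\<rho> X \<rhd> T\<^sub>1 (\<mu> (T\<^sub>0 X))) \<bullet> (\<mu> X \<lhd> T\<^sub>2 (\<rho> X)) =
     (\<rho> X \<rhd> \<mu> (T\<^sub>0 (T\<^sub>0 X))) \<bullet> (\<mu> X \<lhd> \<mu>c (\<mu> X)) \<bullet> (\<rho> X \<rhd> T\<^sub>1 (T\<^sub>1 (\<mu> X)))"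
  using psalgebra_free[OF assms] unfolding psalgebra_def free_alg_def by (auto simp: Let_def)

lemma psalgebraD:
  assumes "psalgebra C M A"
  shows alg_typing: "alg_obj A \<in> Obj C" "alg_act A \<in> Arr C" "Dom C (alg_act A) = T\<^sub>0 (alg_obj A)"
      "Cod C (alg_act A) = alg_obj A"
      "iso2 (alg_unit A)" "Src C (alg_unit A) = alg_act A \<cdot> \<eta> (alg_obj A)"
      "Tgt C (alg_unit A) = Id1 C (alg_obj A)"
      "iso2 (alg_assoc A)" "Src C (alg_assoc A) = alg_act A \<cdot> T\<^sub>1 (alg_act A)"
      "Tgt C (alg_assoc A) = alg_act A \<cdot> \<mu> (alg_obj A)"
    and alg_axiom1: "(alg_act A \<lhd> \<zeta> (alg_obj A)) \<bullet> (alg_assoc A \<rhd> T\<^sub>1 (\<eta> (alg_obj A))) =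
        alg_act A \<lhd> T\<^sub>2 (alg_unit A)"
    and alg_axiom2: "(alg_act A \<lhd> \<rho> (alg_obj A)) \<bullet> (alg_assoc A \<rhd> T\<^sub>1 (\<mu> (alg_obj A))) \<bullet>
        (alg_act A \<lhd> T\<^sub>2 (alg_assoc A)) =
     (alg_assoc A \<rhd> \<mu> (T\<^sub>0 (alg_obj A))) \<bullet> (alg_act A \<lhd> \<mu>c (alg_act A)) \<bullet>
         (alg_assoc A \<rhd> T\<^sub>1 (T\<^sub>1 (alg_act A)))"
  using assms unfolding psalgebra_def by (auto simp: Let_def iso_cell_iff)

text \<open>The unit cell of the algebra conjugates \<sigma> into its whiskering with
  \<open>a \<cdot> \<eta> X\<close>, and naturality of \<eta> conjugates that into
  \<open>a \<lhd> T\<^sub>2 \<sigma>\<close> restricted along \<eta>. Thus an equation of cells into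
  an algebra may be proved for the images under T followed by the action.\<close>

lemma act_T_faithful:
  assumes eq: "alg_act A \<lhd> T\<^sub>2 \<sigma> = alg_act A \<lhd> T\<^sub>2 \<sigma>'" and A: "psalgebra C M A"
    and \<sigma>: "\<sigma> \<in> Cell C" "\<sigma>' \<in> Cell C" "Src C \<sigma>' = Src C \<sigma>" "Tgt C \<sigma>' = Tgt C \<sigma>" "Cod C (Src C \<sigma>) = alg_obj A"
  shows "\<sigma> = \<sigma>'"
proof -
  define X a t where defs: "X = alg_obj A" "a = alg_act A" "t = alg_unit A"
  obtain u v Y where uv: "Src C \<sigma> = u" "Tgt C \<sigma> = v" "Dom C u = Y" by simp
  have "u \<in> Arr C" "v \<in> Arr C" "Dom C v = Y" "Cod C v = X" "Cod C u = X" "Dom C u = Y" "Y \<in> Obj C"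
    using Src_Tgt_typing[OF \<sigma>(1)] uv defs \<sigma>(5) by auto
  note [simp] = this alg_typing[OF A, folded defs] \<sigma>(1-4)[unfolded uv] uv
  have \<sigma>c: "cell C \<sigma> u v" "cell C \<sigma>' u v" by simp_all
  have *: "(t \<rhd> v) \<bullet> (a \<cdot> \<eta> X \<lhd> z) = z \<bullet> (t \<rhd> u)"
      "(a \<cdot> \<eta> X \<lhd> z) \<bullet> (a \<lhd> \<eta>c u) = (a \<lhd> \<eta>c v) \<bullet> (a \<lhd> T\<^sub>2 z \<rhd> \<eta> Y)" if "cell C z u v" for z
  proof -
    note [simp] = cellD[OF that]
    show "(t \<rhd> v) \<bullet> (a \<cdot> \<eta> X \<lhd> z) = z \<bullet> (t \<rhd> u)"
      using exchange[of z t] by simp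
    show "(a \<cdot> \<eta> X \<lhd> z) \<bullet> (a \<lhd> \<eta>c u) = (a \<lhd> \<eta>c v) \<bullet> (a \<lhd> T\<^sub>2 z \<rhd> \<eta> Y)"
      using arg_cong[OF unit_natural[of z X], of "\<lambda>z. a \<lhd> z"] by simp
  qed
  have "a \<lhd> T\<^sub>2 \<sigma> \<rhd> \<eta> Y = a \<lhd> T\<^sub>2 \<sigma>' \<rhd> \<eta> Y"
    using arg_cong[OF eq[folded defs], of "\<lambda>z. z \<rhd> \<eta> Y"] by simp
  then have "(a \<cdot> \<eta> X \<lhd> \<sigma>) \<bullet> (a \<lhd> \<eta>c u) = (a \<cdot> \<eta> X \<lhd> \<sigma>') \<bullet> (a \<lhd> \<eta>c u)"
    using *(2)[OF \<sigma>c(1)] *(2)[OF \<sigma>c(2)] by simp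
  then have "a \<cdot> \<eta> X \<lhd> \<sigma> = a \<cdot> \<eta> X \<lhd> \<sigma>'" by (rule cancel_right) simp_all
  then have "\<sigma> \<bullet> (t \<rhd> u) = \<sigma>' \<bullet> (t \<rhd> u)" using *(1)[OF \<sigma>c(1)] *(1)[OF \<sigma>c(2)] by simp
  then show ?thesis by (rule cancel_right) simp_all
qed

text \<open>Associativity of the action, whiskered with \<open>T \<eta>\<close> at \<open>TX\<close>, and the unit axiom of the free algebra
  give the image of this equation under the faithful operation \<open>a \<lhd> T\<^sub>2 -\<close>.\<close>

lemma alg_left_unit:
  assumes A: "psalgebra C M A"
  shows "(alg_act A \<lhd> \<xi> (alg_obj A)) \<bullet> (alg_assoc A \<rhd> \<eta> (T\<^sub>0 (alg_obj A))) = (alg_unit A \<rhd> alg_act A) \<bullet>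
      (alg_act A \<lhd> \<eta>c (alg_act A))"
proof -
  define X a t s where defs: "X = alg_obj A" "a = alg_act A" "t = alg_unit A" "s = alg_assoc A"
  note [simp] = alg_typing[OF A, folded defs]
  let ?w = "T\<^sub>1 (\<eta> (T\<^sub>0 X))"
  note A2 = arg_cong[OF alg_axiom2[OF A, folded defs], of "\<lambda>z. z \<rhd> ?w", simplified]
  note F1 = arg_cong[OF free_axioms(1)[of X], of "\<lambda>z. a \<lhd> z", simplified]
  note A1 = arg_cong[OF alg_axiom1[OF A, folded defs], of "\<lambda>z. z \<rhd> T\<^sub>1 a", simplified]
  note Z = arg_cong[OF modification(2)[of a, OF _ refl refl], of "\<lambda>z. a \<lhd> z", simplified]
  note e1 = exchange[of "T\<^sub>2 (\<xi> X)" s, simplified, symmetric]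
  note e2 = exchange[of "\<zeta> (T\<^sub>0 X)" s, simplified, symmetric]
  note e3 = exchange[of "T\<^sub>2 (\<eta>c a)" s, simplified, symmetric]
  \<comment> \<open>Both sides of the law, under \<open>a \<lhd> T\<^sub>2 -\<close>, are composed
    with the invertible s. This completes them to composites to which the associativity and unit
    axioms apply.\<close>
  have "s \<bullet> (a \<cdot> T\<^sub>1 a \<lhd> T\<^sub>2 (\<xi> X)) \<bullet> (a \<lhd> T\<^sub>2 s \<rhd> ?w) =
     (a \<cdot> \<mu> X \<lhd> \<zeta> (T\<^sub>0 X)) \<bullet> (a \<lhd> \<rho> X \<rhd> ?w) \<bullet> (s \<rhd> T\<^sub>1 (\<mu> X) \<cdot> ?w) \<bullet> (a \<lhd> T\<^sub>2 s \<rhd> ?w)"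
    by (simp add: reassoc[OF F1] reassoc[OF e1])
  also have "\<dots> = (a \<cdot> \<mu> X \<lhd> \<zeta> (T\<^sub>0 X)) \<bullet> (s \<rhd> \<mu> (T\<^sub>0 X) \<cdot> ?w) \<bullet> (a \<lhd> \<mu>c a \<rhd> ?w) \<bullet> (s \<rhd> T\<^sub>1 (T\<^sub>1 a) \<cdot> ?w)"
    by (simp add: A2)
  also have "\<dots> = s \<bullet> (a \<lhd> T\<^sub>2 t \<rhd> T\<^sub>1 a) \<bullet> (a \<cdot> T\<^sub>1 a \<lhd> T\<^sub>2 (\<eta>c a))"
    by (simp add: reassoc[OF e2] reassoc[OF Z] e3 reassoc[OF A1])
  finally have "s \<bullet> (a \<lhd> T\<^sub>2 ((a \<lhd> \<xi> X) \<bullet> (s \<rhd> \<eta> (T\<^sub>0 X)))) = s \<bullet> (a \<lhd> T\<^sub>2 ((t \<rhd> a) \<bullet> (a \<lhd> \<eta>c a)))"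
    by simp
  then have "a \<lhd> T\<^sub>2 ((a \<lhd> \<xi> X) \<bullet> (s \<rhd> \<eta> (T\<^sub>0 X))) = a \<lhd> T\<^sub>2 ((t \<rhd> a) \<bullet> (a \<lhd> \<eta>c a))"
    by (rule cancel_left) simp_all
  then show ?thesis
    unfolding defs[symmetric] by (rule act_T_faithful[OF _ A, folded defs]) simp_all
qed

text \<open>Both sides of the right unit law of \<mu> vary with the object like modifications, and
  the composites A and B that transport them along f are the same. Comparing the two equations
  transfers the law at Y, whiskered with TTf, to the law at X, whiskered with Tf.\<close>

lemma mult_right_unit_natural:
  fixes f
  defines "X \<equiv> Dom C f" and "Y \<equiv> Cod C f"
  defines "A \<equiv> \<mu> Y \<cdot> T\<^sub>1 (\<mu> Y) \<lhd> T\<^sub>2 (T\<^sub>2 (\<eta>c f))"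
    and "B \<equiv> (\<mu>c f \<rhd> T\<^sub>1 (\<mu> X) \<cdot> T\<^sub>1 (T\<^sub>1 (\<eta> X))) \<bullet> (\<mu> Y \<lhd> T\<^sub>2 (\<mu>c f) \<rhd> T\<^sub>1 (T\<^sub>1 (\<eta> X)))"
  assumes f [simp]: "f \<in> Arr C"
  shows "\<mu>c f \<bullet> (\<mu> Y \<lhd> T\<^sub>2 (\<zeta> Y) \<rhd> T\<^sub>1 (T\<^sub>1 f)) \<bullet> A = (T\<^sub>1 f \<cdot> \<mu> X \<lhd> T\<^sub>2 (\<zeta> X)) \<bullet> B"
    and "\<mu>c f \<bullet> (((\<zeta> Y \<rhd> \<mu> Y) \<bullet> (\<mu> Y \<lhd> \<mu>c (\<eta> Y)) \<bullet> (\<rho> Y \<rhd> T\<^sub>1 (T\<^sub>1 (\<eta> Y)))) \<rhd> T\<^sub>1 (T\<^sub>1 f)) \<bullet> A =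
      (T\<^sub>1 f \<lhd> ((\<zeta> X \<rhd> \<mu> X) \<bullet> (\<mu> X \<lhd> \<mu>c (\<eta> X)) \<bullet> (\<rho> X \<rhd> T\<^sub>1 (T\<^sub>1 (\<eta> X))))) \<bullet> B"
proof -
  have XY: "Dom C f = X" "Cod C f = Y" "X \<in> Obj C" "Y \<in> Obj C" using f by (simp_all add: X_def Y_def)
  note [simp] = this
  note Z = modification(2)[of f, OF _ refl refl, simplified]
  note TZ = arg_cong[OF arg_cong[OF Z, of T\<^sub>2], of "\<lambda>z. \<mu> Y \<lhd> z", simplified]
  note e1 = exchange[of "T\<^sub>2 (\<zeta> X)" "\<mu>c f", simplified, symmetric]
  show "\<mu>c f \<bullet> (\<mu> Y \<lhd> T\<^sub>2 (\<zeta> Y) \<rhd> T\<^sub>1 (T\<^sub>1 f)) \<bullet> A = (T\<^sub>1 f \<cdot> \<mu> X \<lhd> T\<^sub>2 (\<zeta> X)) \<bullet> B"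
    unfolding A_def B_def by (simp add: reassoc[OF e1] TZ)
  note R = arg_cong[OF modification(3)[of f, OF _ refl refl], of "\<lambda>z. z \<rhd> T\<^sub>1 (T\<^sub>1 (\<eta> X))", simplified]
  note N = arg_cong[OF mult_natural[of "\<eta>c f", OF _ refl, simplified], of "\<lambda>z. \<mu> Y \<lhd> z", simplified,
      symmetric]
  note Zm = arg_cong[OF Z, of "\<lambda>z. z \<rhd> \<mu> X", simplified]
  note e2 = exchange[of "\<mu>c (\<eta> X)" "\<mu>c f", simplified, symmetric]
  note e3 = exchange[of "\<mu>c f" "\<zeta> Y", simplified, symmetric]
  note e4 = exchange[of "T\<^sub>2 (T\<^sub>2 (\<eta>c f))" "\<rho> Y", simplified, symmetric]
  show "\<mu>c f \<bullet> (((\<zeta> Y \<rhd> \<mu> Y) \<bullet> (\<mu> Y \<lhd> \<mu>c (\<eta> Y)) \<bullet> (\<rho> Y \<rhd> T\<^sub>1 (T\<^sub>1 (\<eta> Y)))) \<rhd> T\<^sub>1 (T\<^sub>1 f)) \<bullet> A =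
      (T\<^sub>1 f \<lhd> ((\<zeta> X \<rhd> \<mu> X) \<bullet> (\<mu> X \<lhd> \<mu>c (\<eta> X)) \<bullet> (\<rho> X \<rhd> T\<^sub>1 (T\<^sub>1 (\<eta> X))))) \<bullet> B"
    unfolding A_def B_def
    by (simp add: R reassoc[OF e2] reassoc[OF Zm] reassoc3[OF N] reassoc[OF e3] e4 reassoc[OF e4])
qed

text \<open>Associativity of \<open>\<mu>\<close>, whiskered with \<open>TT \<eta>\<close> at \<open>TX\<close>, gives this law at \<open>TX\<close> under \<open>\<mu> X \<lhd> -\<close>;
  by naturality along \<open>\<eta> X\<close> and \<open>\<zeta>\<close> it descends to \<open>X\<close>.\<close>

lemma mult_right_unit:
  assumes X [simp]: "X \<in> Obj C"
  shows "(\<zeta> X \<rhd> \<mu> X) \<bullet> (\<mu> X \<lhd> \<mu>c (\<eta> X)) \<bullet> (\<rho> X \<rhd> T\<^sub>1 (T\<^sub>1 (\<eta> X))) = \<mu> X \<lhd> T\<^sub>2 (\<zeta> X)"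
proof -
  define Y where "Y = T\<^sub>0 X"
  have Y [simp]: "T\<^sub>0 X = Y" "Y \<in> Obj C" unfolding Y_def by simp_all
  let ?w = "T\<^sub>1 (T\<^sub>1 (\<eta> Y))"
  let ?L = "\<lambda>X. \<mu> X \<lhd> T\<^sub>2 (\<zeta> X)"
  let ?R = "\<lambda>X. (\<zeta> X \<rhd> \<mu> X) \<bullet> (\<mu> X \<lhd> \<mu>c (\<eta> X)) \<bullet> (\<rho> X \<rhd> T\<^sub>1 (T\<^sub>1 (\<eta> X)))"
  let ?E = "(\<rho> X \<rhd> T\<^sub>1 (\<mu> Y) \<cdot> ?w) \<bullet> (\<mu> X \<lhd> T\<^sub>2 (\<rho> X) \<rhd> ?w)"
  note A2 = arg_cong[OF free_axioms(2)[of X, simplified], of "\<lambda>z. z \<rhd> ?w", simplified]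
  note A1 = free_axioms(1)[of X, simplified]
  note TA1 = arg_cong[OF arg_cong[OF A1, of T\<^sub>2], of "\<lambda>z. \<mu> X \<lhd> z", simplified]
  note A1m = arg_cong[OF A1, of "\<lambda>z. z \<rhd> \<mu> Y", simplified]
  note N = arg_cong[OF mult_natural[of "\<xi> X", OF _ refl, simplified], of "\<lambda>z. \<mu> X \<lhd> z", simplified, symmetric]
  note e1 = exchange[of "\<mu>c (\<eta> Y)" "\<rho> X", simplified, symmetric]
  note e2 = exchange[of "T\<^sub>2 (T\<^sub>2 (\<xi> X))" "\<rho> X", simplified, symmetric]
  note e3 = exchange[of "T\<^sub>2 (\<zeta> Y)" "\<rho> X", simplified, symmetric]
  \<comment> \<open>The invertible \<open>?E\<close> is what the associativity axiom of the free
    algebra needs in order to apply. With it, both sides of the law at TX reduce to the same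
    composite of \<rho> and the image of \<xi> under TT.\<close>
  have "(\<mu> X \<lhd> ?R Y) \<bullet> ?E = \<rho> X \<bullet> (\<mu> X \<cdot> T\<^sub>1 (\<mu> X) \<lhd> T\<^sub>2 (T\<^sub>2 (\<xi> X)))"
    by (simp add: A2 reassoc[OF e1] reassoc[OF A1m] reassoc3[OF N] e2)
  also have "\<dots> = (\<mu> X \<lhd> ?L Y) \<bullet> ?E"
    by (simp add: reassoc[OF e3] TA1)
  finally have "\<mu> X \<lhd> ?R Y = \<mu> X \<lhd> ?L Y" by (rule cancel_right) simp_all
  then have *: "(\<mu> X \<lhd> ?R Y) \<rhd> T\<^sub>1 (T\<^sub>1 (\<eta> X)) = (\<mu> X \<lhd> ?L Y) \<rhd> T\<^sub>1 (T\<^sub>1 (\<eta> X))" by (rule arg_cong)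
  note ** = mult_right_unit_natural[of "\<eta> X", THEN arg_cong, of "\<lambda>z. \<mu> X \<lhd> z", simplified]
  \<comment> \<open>The law at TX is carried to X by the preceding lemma for
    \<open>f = \<eta> X\<close>, and the transporting composite is cancelled.\<close>
  have "\<mu> X \<lhd> T\<^sub>1 (\<eta> X) \<lhd> ?R X = \<mu> X \<lhd> T\<^sub>1 (\<eta> X) \<lhd> ?L X"
    by (rule cancel_right[of _ "\<mu> X \<lhd> ((\<mu>c (\<eta> X) \<rhd> T\<^sub>1 (\<mu> X) \<cdot> T\<^sub>1 (T\<^sub>1 (\<eta> X))) \<bullet>
        (\<mu> Y \<lhd> T\<^sub>2 (\<mu>c (\<eta> X)) \<rhd> T\<^sub>1 (T\<^sub>1 (\<eta> X))))"])
       (simp_all add: **[symmetric] reassoc3[OF *[simplified]])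
  \<comment> \<open>What remains is whiskering with
    \<open>\<mu> X \<cdot> T\<^sub>1 (\<eta> X)\<close>, which \<zeta> identifies with the
    identity.\<close>
  then have "(\<zeta> X \<rhd> \<mu> X) \<bullet> (\<mu> X \<lhd> T\<^sub>1 (\<eta> X) \<lhd> ?R X) = (\<zeta> X \<rhd> \<mu> X) \<bullet> (\<mu> X \<lhd> T\<^sub>1 (\<eta> X) \<lhd> ?L X)"
    by simp
  then have "?R X \<bullet> (\<zeta> X \<rhd> Src C (?L X)) = ?L X \<bullet> (\<zeta> X \<rhd> Src C (?L X))"
    using exchange[of "?R X" "\<zeta> X"] exchange[of "?L X" "\<zeta> X"] by simp
  then show ?thesis by (rule cancel_right) simp_all
qed

end

section \<open>The 2-category of pseudo-algebras\<close>

context pseudomonad_on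
begin

lemma pseudomorphismD:
  assumes "pseudomorphism C M F"
  shows mor_typing: "psalgebra C M (mor_dom F)" "psalgebra C M (mor_cod F)"
      "mor_map F \<in> Arr C" "Dom C (mor_map F) = alg_obj (mor_dom F)" "Cod C (mor_map F) = alg_obj (mor_cod F)"
      "iso2 (mor_cell F)" "Src C (mor_cell F) = alg_act (mor_cod F) \<cdot> T\<^sub>1 (mor_map F)"
      "Tgt C (mor_cell F) = mor_map F \<cdot> alg_act (mor_dom F)"
    and mor_axiom1: "(mor_map F \<lhd> alg_unit (mor_dom F)) \<bullet> (mor_cell F \<rhd> \<eta> (alg_obj (mor_dom F))) =
        (alg_unit (mor_cod F) \<rhd> mor_map F) \<bullet> (alg_act (mor_cod F) \<lhd> \<eta>c (mor_map F))"
    and mor_axiom2: "(mor_map F \<lhd> alg_assoc (mor_dom F)) \<bullet> (mor_cell F \<rhd> T\<^sub>1 (alg_act (mor_dom F))) \<bullet>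
        (alg_act (mor_cod F) \<lhd> T\<^sub>2 (mor_cell F)) =
      (mor_cell F \<rhd> \<mu> (alg_obj (mor_dom F))) \<bullet> (alg_act (mor_cod F) \<lhd> \<mu>c (mor_map F)) \<bullet>
        (alg_assoc (mor_cod F) \<rhd> T\<^sub>1 (T\<^sub>1 (mor_map F)))"
  using assms unfolding pseudomorphism_def by (auto simp: Let_def iso_cell_iff)

lemma pseudomorphismI:
  assumes "psalgebra C M A" "psalgebra C M B" "f \<in> Arr C" "Dom C f = alg_obj A" "Cod C f = alg_obj B"
    "iso2 \<phi>" "Src C \<phi> = alg_act B \<cdot> T\<^sub>1 f" "Tgt C \<phi> = f \<cdot> alg_act A"
    "(f \<lhd> alg_unit A) \<bullet> (\<phi> \<rhd> \<eta> (alg_obj A)) = (alg_unit B \<rhd> f) \<bullet> (alg_act B \<lhd> \<eta>c f)"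
    "(f \<lhd> alg_assoc A) \<bullet> (\<phi> \<rhd> T\<^sub>1 (alg_act A)) \<bullet> (alg_act B \<lhd> T\<^sub>2 \<phi>) =
      (\<phi> \<rhd> \<mu> (alg_obj A)) \<bullet> (alg_act B \<lhd> \<mu>c f) \<bullet> (alg_assoc B \<rhd> T\<^sub>1 (T\<^sub>1 f))"
  shows "pseudomorphism C M (mk_mor A B f \<phi>)"
  using assms unfolding pseudomorphism_def by (auto simp: Let_def iso_cell_iff)

lemma alg_transformation_iff:
  "alg_transformation C M S \<longleftrightarrow> pseudomorphism C M (tr_src S) \<and> pseudomorphism C M (tr_tgt S) \<and>
     mor_dom (tr_src S) = mor_dom (tr_tgt S) \<and> mor_cod (tr_src S) = mor_cod (tr_tgt S) \<and>
     tr_cell S \<in> Cell C \<and> Src C (tr_cell S) = mor_map (tr_src S) \<and> Tgt C (tr_cell S) = mor_map (tr_tgt S) \<and>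
     (tr_cell S \<rhd> alg_act (mor_dom (tr_tgt S))) \<bullet> mor_cell (tr_src S) =
     mor_cell (tr_tgt S) \<bullet> (alg_act (mor_cod (tr_tgt S)) \<lhd> T\<^sub>2 (tr_cell S))"
  unfolding alg_transformation_def by (auto simp: Let_def)

lemma pseudomorphism_Id:
  assumes "psalgebra C M A"
  shows "pseudomorphism C M (mk_mor A A (Id1 C (alg_obj A)) (Id2 C (alg_act A)))"
  by (rule pseudomorphismI) (simp_all add: alg_typing[OF assms] assms)

text \<open>The axioms of F whiskered with g and those of G whiskered with f or TTf are pasted. They
  meet once \<gamma> has been exchanged with the cells of \<eta> and \<mu> at f and with the image
  of \<phi> under T.\<close>

lemma pseudomorphism_comp:
  assumes F: "pseudomorphism C M F" and G: "pseudomorphism C M G" and FG: "mor_cod F = mor_dom G"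
  shows "pseudomorphism C M (mor_comp C M G F)"
proof -
  obtain A f \<phi> where A: "mor_dom F = A" "mor_map F = f" "mor_cell F = \<phi>" by simp
  obtain B E g \<gamma> where B: "mor_dom G = B" "mor_cod G = E" "mor_map G = g" "mor_cell G = \<gamma>" by simp
  have FB: "mor_cod F = B" using B FG by simp
  note Fs = pseudomorphismD[OF F, unfolded A FB]
  note Gs = pseudomorphismD[OF G, unfolded B]
  note algs [simp] = Fs(1,2) Gs(2)
  note [simp] = Fs(3-8) Gs(3-8) algs[THEN alg_typing(1)] algs[THEN alg_typing(2)] algs[THEN alg_typing(3)]
    algs[THEN alg_typing(4)] algs[THEN alg_typing(5)] algs[THEN alg_typing(6)] algs[THEN alg_typing(7)]
    algs[THEN alg_typing(8)] algs[THEN alg_typing(9)] algs[THEN alg_typing(10)]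
  note F1 = arg_cong[OF Fs(9), of "\<lambda>z. g \<lhd> z", simplified]
  note F2 = arg_cong[OF Fs(10), of "\<lambda>z. g \<lhd> z", simplified]
  note G1 = arg_cong[OF Gs(9), of "\<lambda>z. z \<rhd> f", simplified]
  note G2 = arg_cong[OF Gs(10), of "\<lambda>z. z \<rhd> T\<^sub>1 (T\<^sub>1 f)", simplified]
  note e1 = exchange[of "\<eta>c f" \<gamma>, simplified, symmetric]
  note e2 = exchange[of "T\<^sub>2 \<phi>" \<gamma>, simplified]
  note e3 = exchange[of "\<mu>c f" \<gamma>, simplified, symmetric]
  show ?thesis
    unfolding mor_comp_def A B
  proof (rule pseudomorphismI)
    show "(g \<cdot> f \<lhd> alg_unit A) \<bullet> (((g \<lhd> \<phi>) \<bullet> (\<gamma> \<rhd> T\<^sub>1 f)) \<rhd> \<eta> (alg_obj A)) = (alg_unit E \<rhd> (g \<cdot> f)) \<bullet>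
        (alg_act E \<lhd> \<eta>c (g \<cdot> f))"
      by (simp add: reassoc[OF F1] reassoc[OF e1] e1 reassoc[OF G1])
    show "(g \<cdot> f \<lhd> alg_assoc A) \<bullet> (((g \<lhd> \<phi>) \<bullet> (\<gamma> \<rhd> T\<^sub>1 f)) \<rhd> T\<^sub>1 (alg_act A)) \<bullet>
        (alg_act E \<lhd> T\<^sub>2 ((g \<lhd> \<phi>) \<bullet> (\<gamma> \<rhd> T\<^sub>1 f))) =
      (((g \<lhd> \<phi>) \<bullet> (\<gamma> \<rhd> T\<^sub>1 f)) \<rhd> \<mu> (alg_obj A)) \<bullet> (alg_act E \<lhd> \<mu>c (g \<cdot> f)) \<bullet>
          (alg_assoc E \<rhd> T\<^sub>1 (T\<^sub>1 (g \<cdot> f)))"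
      by (simp add: reassoc[OF e2] reassoc3[OF F2] G2 reassoc[OF e3])
  qed (simp_all)
qed

abbreviation \<A> :: "(('o, 'a, 'c) psalg, ('o, 'a, 'c) psmor, ('o, 'a, 'c) pstrans) two_cat" where
  "\<A> \<equiv> psAlg C M"

lemma alg_transformation_vcomp:
  assumes S: "alg_transformation C M S" and R: "alg_transformation C M R" and RS: "tr_tgt R = tr_src S"
  shows "alg_transformation C M (mk_trans (tr_src R) (tr_tgt S) (tr_cell S \<bullet> tr_cell R))"
proof -
  obtain F G H \<sigma> \<tau> where defs: "tr_src R = F" "tr_tgt R = G" "tr_src S = G" "tr_tgt S = H" "tr_cell R = \<sigma>"
      "tr_cell S = \<tau>"
    using RS by simp
  note s = S[unfolded alg_transformation_iff defs] and r = R[unfolded alg_transformation_iff defs]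
  obtain A B where AB: "mor_dom F = A" "mor_cod F = B" "mor_dom G = A" "mor_cod G = B" "mor_dom H = A"
      "mor_cod H = B"
    using s r by auto
  have ps: "pseudomorphism C M F" "pseudomorphism C M G" "pseudomorphism C M H" using s r by auto
  note [simp] = ps AB
  note facts = mor_typing[OF ps(1), unfolded AB] mor_typing[OF ps(2), unfolded AB] mor_typing[OF ps(3),
      unfolded AB]
  note [simp] = facts facts(1,2)[THEN alg_typing(2)] facts(1,2)[THEN alg_typing(3)]
      facts(1,2)[THEN alg_typing(4)]
  have [simp]: "\<sigma> \<in> Cell C" "Src C \<sigma> = mor_map F" "Tgt C \<sigma> = mor_map G" "\<tau> \<in> Cell C" "Src C \<tau> = mor_map G"
      "Tgt C \<tau> = mor_map H"
    using s r by auto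
  have a: "(\<tau> \<rhd> alg_act A) \<bullet> mor_cell G = mor_cell H \<bullet> (alg_act B \<lhd> T\<^sub>2 \<tau>)"
    "(\<sigma> \<rhd> alg_act A) \<bullet> mor_cell F = mor_cell G \<bullet> (alg_act B \<lhd> T\<^sub>2 \<sigma>)"
    using s r AB by auto
  show ?thesis
    unfolding alg_transformation_iff defs by (simp add: a(2) reassoc[OF a(1)])
qed

text \<open>The horizontal composite is split into two whiskerings: the law of S serves the outer
  factor and that of R the inner one.\<close>

lemma alg_transformation_hcomp:
  assumes S: "alg_transformation C M S" and R: "alg_transformation C M R" and RS: "mor_dom (tr_src S) =
      mor_cod (tr_src R)"
  shows "alg_transformation C M (mk_trans (mor_comp C M (tr_src S) (tr_src R)) (mor_comp C M (tr_tgt S)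
      (tr_tgt R)) (tr_cell S \<star> tr_cell R))"
proof -
  obtain F F' G G' \<sigma> \<tau> where defs: "tr_src R = F" "tr_tgt R = F'" "tr_src S = G" "tr_tgt S = G'" "tr_cell R =
      \<sigma>" "tr_cell S = \<tau>" by simp
  note s = S[unfolded alg_transformation_iff defs] and r = R[unfolded alg_transformation_iff defs]
  obtain A B E where AB: "mor_dom F = A" "mor_cod F = B" "mor_dom F' = A" "mor_cod F' = B" "mor_dom G = B"
      "mor_dom G' = B" "mor_cod G = E" "mor_cod G' = E"
    using s r RS defs by auto
  have ps: "pseudomorphism C M F" "pseudomorphism C M F'" "pseudomorphism C M G" "pseudomorphism C M G'"
      using s r by auto
  note [simp] = pseudomorphism_comp[OF ps(1,3), unfolded mor_comp_def AB] pseudomorphism_comp[OF ps(2,4),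
      unfolded mor_comp_def AB] AB
  note facts = mor_typing[OF ps(1), unfolded AB] mor_typing[OF ps(2), unfolded AB] mor_typing[OF ps(3),
      unfolded AB] mor_typing[OF ps(4), unfolded AB]
  note [simp] = facts facts(1,2,18)[THEN alg_typing(2)] facts(1,2,18)[THEN alg_typing(3)]
      facts(1,2,18)[THEN alg_typing(4)]
  have [simp]: "\<sigma> \<in> Cell C" "Src C \<sigma> = mor_map F" "Tgt C \<sigma> = mor_map F'" "\<tau> \<in> Cell C" "Src C \<tau> = mor_map G"
      "Tgt C \<tau> = mor_map G'"
    using s r by auto
  have a: "(\<tau> \<rhd> alg_act B) \<bullet> mor_cell G = mor_cell G' \<bullet> (alg_act E \<lhd> T\<^sub>2 \<tau>)"
    "(\<sigma> \<rhd> alg_act A) \<bullet> mor_cell F = mor_cell F' \<bullet> (alg_act B \<lhd> T\<^sub>2 \<sigma>)"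
    using s r AB by auto
  note a1 = arg_cong[OF a(1), of "\<lambda>z. z \<rhd> T\<^sub>1 (mor_map F')", simplified]
  note a2 = arg_cong[OF a(2), of "\<lambda>z. mor_map G \<lhd> z", simplified]
  note e1 = exchange[of "T\<^sub>2 \<sigma>" "mor_cell G", simplified, symmetric]
  note e2 = exchange[of "mor_cell F'" \<tau>, simplified]
  have "(\<tau> \<star> \<sigma> \<rhd> alg_act A) \<bullet> (mor_map G \<lhd> mor_cell F) \<bullet> (mor_cell G \<rhd> T\<^sub>1 (mor_map F)) =
      (mor_map G' \<lhd> mor_cell F') \<bullet> (mor_cell G' \<rhd> T\<^sub>1 (mor_map F')) \<bullet> (alg_act E \<lhd> T\<^sub>2 (\<tau> \<star> \<sigma>))"
    by (simp add: Hcomp_whisker(1) reassoc[OF a1] reassoc[OF a2] e1 reassoc[OF e1] e2 reassoc[OF e2])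
  then show ?thesis
    unfolding alg_transformation_iff defs
    by (simp add: mor_comp_def Hcomp_typing)
qed

text \<open>Strictness is inherited from C. Composition of pseudomorphisms is associative and unital
  on the nose, also for the structure cells, because whiskering in C and the 2-functor T are
  strict.\<close>

lemma psAlg_two_category: "two_category \<A>"
proof
  fix X Y f assume "arr \<A> f X Y"
  then show "X \<in> Obj \<A> \<and> Y \<in> Obj \<A>"
    using mor_typing(1,2)[of f] by (auto simp: psAlg_def arr_def)
next
  fix \<sigma> f g assume "cell \<A> \<sigma> f g"
  then show "f \<in> Arr \<A> \<and> g \<in> Arr \<A> \<and> Dom \<A> f = Dom \<A> g \<and> Cod \<A> f = Cod \<A> g"
    by (auto simp: psAlg_def cell_def alg_transformation_iff)
next
  fix X assume "X \<in> Obj \<A>"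
  then show "arr \<A> (Id1 \<A> X) X X" by (auto simp: psAlg_def arr_def pseudomorphism_Id)
next
  fix f g X Y Z assume "arr \<A> f X Y" "arr \<A> g Y Z"
  then show "arr \<A> (g \<cdot>\<^bsub>\<A>\<^esub> f) X Z" by (auto simp: psAlg_def arr_def pseudomorphism_comp)
      (auto simp: mor_comp_def)
next
  fix f X Y assume "arr \<A> f X Y"
  then have f: "pseudomorphism C M f" and [simp]: "X = mor_dom f" "Y = mor_cod f"
      by (auto simp: psAlg_def arr_def)
  note [simp] = mor_typing[OF f] mor_typing(1,2)[OF f, THEN alg_typing(2)] mor_typing(1,2)[OF f, THEN
      alg_typing(3)] mor_typing(1,2)[OF f, THEN alg_typing(4)]
     mor_typing(1,2)[OF f, THEN alg_typing(1)]
  show "Id1 \<A> Y \<cdot>\<^bsub>\<A>\<^esub> f = f" by (simp add: psAlg_def mor_comp_def)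
  show "f \<cdot>\<^bsub>\<A>\<^esub> Id1 \<A> X = f" by (simp add: psAlg_def mor_comp_def)
next
  fix f g h X Y Z W assume "arr \<A> f X Y" "arr \<A> g Y Z" "arr \<A> h Z W"
  then have ps: "pseudomorphism C M f" "pseudomorphism C M g" "pseudomorphism C M h" and [simp]: "mor_cod f =
      Y" "mor_cod g = Z" "mor_dom g = Y"
      "mor_dom h = Z" "mor_dom f = X" "mor_cod h = W"
    by (auto simp: psAlg_def arr_def)
  note [simp] = mor_typing[OF ps(1)] mor_typing[OF ps(2)] mor_typing[OF ps(3)]
  have algs: "psalgebra C M X" "psalgebra C M Y" "psalgebra C M Z" "psalgebra C M W"
    using mor_typing(1,2)[OF ps(1)] mor_typing(1,2)[OF ps(3)] by auto
  note [simp] = algs[THEN alg_typing(2)] algs[THEN alg_typing(3)] algs[THEN alg_typing(4)]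
  show "(h \<cdot>\<^bsub>\<A>\<^esub> g) \<cdot>\<^bsub>\<A>\<^esub> f = h \<cdot>\<^bsub>\<A>\<^esub> (g \<cdot>\<^bsub>\<A>\<^esub> f)" by (simp add: psAlg_def mor_comp_def)
next
  fix f assume "f \<in> Arr \<A>"
  then have f: "pseudomorphism C M f" by (auto simp: psAlg_def)
  note [simp] = mor_typing[OF f] mor_typing(1,2)[OF f, THEN alg_typing(2)] mor_typing(1,2)[OF f, THEN
      alg_typing(3)] mor_typing(1,2)[OF f, THEN alg_typing(4)]
  show "cell \<A> (Id2 \<A> f) f f" using f by (simp add: psAlg_def cell_def alg_transformation_iff)
next
  fix \<sigma> \<tau> f g h assume "cell \<A> \<sigma> f g" "cell \<A> \<tau> g h"
  then show "cell \<A> (\<tau> \<bullet>\<^bsub>\<A>\<^esub> \<sigma>) f h"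
    using alg_transformation_vcomp[of \<tau> \<sigma>] by (auto simp: psAlg_def cell_def)
next
  fix \<sigma> f g assume "cell \<A> \<sigma> f g"
  then show "Id2 \<A> g \<bullet>\<^bsub>\<A>\<^esub> \<sigma> = \<sigma>" "\<sigma> \<bullet>\<^bsub>\<A>\<^esub> Id2 \<A> f = \<sigma>"
    by (auto simp: psAlg_def cell_def alg_transformation_iff)
next
  fix \<sigma> \<tau> \<upsilon> f g h k assume "cell \<A> \<sigma> f g" "cell \<A> \<tau> g h" "cell \<A> \<upsilon> h k"
  then show "(\<upsilon> \<bullet>\<^bsub>\<A>\<^esub> \<tau>) \<bullet>\<^bsub>\<A>\<^esub> \<sigma> = \<upsilon> \<bullet>\<^bsub>\<A>\<^esub> \<tau> \<bullet>\<^bsub>\<A>\<^esub> \<sigma>"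
    by (auto simp: psAlg_def cell_def alg_transformation_iff)
next
  fix \<sigma> \<tau> f g h k assume "cell \<A> \<sigma> f g" "cell \<A> \<tau> h k" "Dom \<A> h = Cod \<A> f"
  then show "cell \<A> (\<tau> \<star>\<^bsub>\<A>\<^esub> \<sigma>) (h \<cdot>\<^bsub>\<A>\<^esub> f) (k \<cdot>\<^bsub>\<A>\<^esub> g)"
    using alg_transformation_hcomp[of \<tau> \<sigma>] by (auto simp: psAlg_def cell_def)
next
  fix f g X Y Z assume "arr \<A> f X Y" "arr \<A> g Y Z"
  then show "Id2 \<A> g \<star>\<^bsub>\<A>\<^esub> Id2 \<A> f = Id2 \<A> (g \<cdot>\<^bsub>\<A>\<^esub> f)"
    using mor_typing(3-5)[of f] mor_typing(3-5)[of g] by (auto simp: psAlg_def arr_def mor_comp_def Hcomp_Id2)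
next
  fix \<sigma> \<sigma>' \<tau> \<tau>' f g h k l m
  assume "cell \<A> \<sigma> f g" "cell \<A> \<sigma>' g h" "cell \<A> \<tau> k l" "cell \<A> \<tau>' l m" "Dom \<A> k = Cod \<A> f"
  then show "(\<tau>' \<bullet>\<^bsub>\<A>\<^esub> \<tau>) \<star>\<^bsub>\<A>\<^esub> (\<sigma>' \<bullet>\<^bsub>\<A>\<^esub> \<sigma>) = (\<tau>' \<star>\<^bsub>\<A>\<^esub> \<sigma>') \<bullet>\<^bsub>\<A>\<^esub> (\<tau> \<star>\<^bsub>\<A>\<^esub> \<sigma>)"
    using mor_typing(3-5)[of f] mor_typing(3-5)[of k]
    by (auto simp: psAlg_def cell_def alg_transformation_iff Interchange)
next
  fix \<sigma> f g assume "cell \<A> \<sigma> f g"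
  then have s: "alg_transformation C M \<sigma>" "tr_src \<sigma> = f" "tr_tgt \<sigma> = g" by (auto simp: psAlg_def cell_def)
  then have f: "pseudomorphism C M f" and g: "pseudomorphism C M g" and [simp]: "mor_dom g = mor_dom f"
      "mor_cod g = mor_cod f"
    by (auto simp: alg_transformation_iff)
  note [simp] = mor_typing[OF f] mor_typing[OF g] mor_typing(1,2)[OF f, THEN alg_typing(2)]
      mor_typing(1,2)[OF f, THEN alg_typing(3)] mor_typing(1,2)[OF f, THEN alg_typing(4)]
    mor_typing(1,2)[OF f, THEN alg_typing(1)]
  have [simp]: "tr_cell \<sigma> \<in> Cell C" "Src C (tr_cell \<sigma>) = mor_map f" using s
      by (auto simp: alg_transformation_iff)
  have [simp]: "Id2 C (Id1 C (alg_obj (mor_cod f))) \<star> tr_cell \<sigma> = tr_cell \<sigma>"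
      "tr_cell \<sigma> \<star> Id2 C (Id1 C (alg_obj (mor_dom f))) = tr_cell \<sigma>"
    using whisker_Id1[of "tr_cell \<sigma>"] by (simp_all add: whisker_left_def whisker_right_def)
  have [simp]: "mor_comp C M (mk_mor (mor_cod f) (mor_cod f) (Id1 C (alg_obj (mor_cod f)))
      (Id2 C (alg_act (mor_cod f)))) h = h"
    "mor_comp C M h (mk_mor (mor_dom f) (mor_dom f) (Id1 C (alg_obj (mor_dom f)))
        (Id2 C (alg_act (mor_dom f)))) = h" if "h = f \<or> h = g" for h
    using that by (auto simp: mor_comp_def)
  show "Id2 \<A> (Id1 \<A> (Cod \<A> f)) \<star>\<^bsub>\<A>\<^esub> \<sigma> = \<sigma>"
    by (rule pstrans.equality) (simp_all add: psAlg_def s)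
  show "\<sigma> \<star>\<^bsub>\<A>\<^esub> Id2 \<A> (Id1 \<A> (Dom \<A> f)) = \<sigma>"
    by (rule pstrans.equality) (simp_all add: psAlg_def s)
next
  fix \<sigma> \<tau> \<upsilon> f f' g g' h h'
  assume a: "cell \<A> \<sigma> f f'" "cell \<A> \<tau> g g'" "cell \<A> \<upsilon> h h'" "Dom \<A> g = Cod \<A> f" "Dom \<A> h = Cod \<A> g"
  then have ps: "pseudomorphism C M f" "pseudomorphism C M g" "pseudomorphism C M h" "pseudomorphism C M f'"
      "pseudomorphism C M g'" "pseudomorphism C M h'"
    and [simp]: "tr_src \<sigma> = f" "tr_src \<tau> = g" "tr_src \<upsilon> = h" "tr_tgt \<sigma> = f'" "tr_tgt \<tau> = g'" "tr_tgt \<upsilon> = h'"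
    and e: "mor_dom g = mor_cod f" "mor_dom h = mor_cod g" "mor_dom g' = mor_cod f'" "mor_dom h' = mor_cod g'"
    and cs [simp]: "tr_cell \<sigma> \<in> Cell C" "Src C (tr_cell \<sigma>) = mor_map f" "tr_cell \<tau> \<in> Cell C"
        "Src C (tr_cell \<tau>) = mor_map g"
      "tr_cell \<upsilon> \<in> Cell C" "Src C (tr_cell \<upsilon>) = mor_map h"
    by (auto simp: psAlg_def cell_def alg_transformation_iff)
  have assoc: "mor_comp C M (mor_comp C M h g) f = mor_comp C M h (mor_comp C M g f)"
    if p: "pseudomorphism C M f" "pseudomorphism C M g" "pseudomorphism C M h" "mor_dom g = mor_cod f"
        "mor_dom h = mor_cod g" for f g h
  proof -
    have algs: "psalgebra C M (mor_dom f)" "psalgebra C M (mor_cod f)" "psalgebra C M (mor_cod g)"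
        "psalgebra C M (mor_cod h)"
      using mor_typing(1,2)[OF p(1)] mor_typing(2)[OF p(2)] mor_typing(2)[OF p(3)] by auto
    note [simp] = mor_typing[OF p(1)] mor_typing[OF p(2)] mor_typing[OF p(3)] p(4,5)
      algs[THEN alg_typing(2)] algs[THEN alg_typing(3)] algs[THEN alg_typing(4)]
    show ?thesis by (simp add: mor_comp_def)
  qed
  have "(tr_cell \<upsilon> \<star> tr_cell \<tau>) \<star> tr_cell \<sigma> = tr_cell \<upsilon> \<star> (tr_cell \<tau> \<star> tr_cell \<sigma>)"
    by (rule Hcomp_assoc) (simp_all add: mor_typing[OF ps(1)] mor_typing[OF ps(2)] mor_typing[OF ps(3)] e)
  then show "(\<upsilon> \<star>\<^bsub>\<A>\<^esub> \<tau>) \<star>\<^bsub>\<A>\<^esub> \<sigma> = \<upsilon> \<star>\<^bsub>\<A>\<^esub> \<tau> \<star>\<^bsub>\<A>\<^esub> \<sigma>"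
    using assoc[OF ps(1-3) e(1,2)] assoc[OF ps(4-6) e(3,4)] by (simp add: psAlg_def)
qed

end

section \<open>Universal properties\<close>

context two_category
begin

lemma hom_category: "category (hom_cat K X Y)"
proof
  show "carr (hom_cat K X Y) m x y \<Longrightarrow> x \<in> cObj (hom_cat K X Y) \<and> y \<in> cObj (hom_cat K X Y)" for m x y
    by (auto simp: carr_def hom_cat_def)
qed (auto simp: carr_def hom_cat_def)

lemma carr_hom_iff: "carr (hom_cat K X Y) \<sigma> f g \<longleftrightarrow> \<sigma> \<in> Cell K \<and> Src K \<sigma> = f \<and> Tgt K \<sigma> = g \<and> f \<in> Arr K \<and>
    Dom K f = X \<and> Cod K f = Y"
  by (auto simp: carr_def hom_cat_def)

end

section \<open>Oplax cocones and oplax bicolimits in terms of 1-cells and 2-cells\<close>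

locale diagram = two_category K + I: two_category I + F: two_functor I K F
  for K :: "('o, 'a, 'c) two_cat" (structure) and I :: "('i, 'd, 's) two_cat"
    and F :: "('i, 'd, 's, 'o, 'a, 'c) two_fun"
begin

lemma F_typing [simp]:
  "i \<in> Obj I \<Longrightarrow> on_obj F i \<in> Obj K"
  "d \<in> Arr I \<Longrightarrow> on_arr F d \<in> Arr K" "d \<in> Arr I \<Longrightarrow> Dom K (on_arr F d) = on_obj F (Dom I d)"
  "d \<in> Arr I \<Longrightarrow> Cod K (on_arr F d) = on_obj F (Cod I d)"
  "s \<in> Cell I \<Longrightarrow> on_cell F s \<in> Cell K" "s \<in> Cell I \<Longrightarrow> Src K (on_cell F s) = on_arr F (Src I s)"
  "s \<in> Cell I \<Longrightarrow> Tgt K (on_cell F s) = on_arr F (Tgt I s)"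
  "i \<in> Obj I \<Longrightarrow> on_arr F (Id1 I i) = Id1 K (on_obj F i)"
  "d \<in> Arr I \<Longrightarrow> e \<in> Arr I \<Longrightarrow> Cod I d = Dom I e \<Longrightarrow> on_arr F (e \<cdot>\<^bsub>I\<^esub> d) = on_arr F e \<cdot> on_arr F d"
  using F.fun_obj F.fun_arr[of d] F.fun_cell[of s] F.fun_id1 F.fun_comp1[of d _ _ e]
  by (auto simp: arr_def cell_def)

text \<open>Oplax cocones and modifications with the typing conditions written as equations for the
  projections, as required by the rewrite rules for 2-cells.\<close>

definition is_cocone :: "'o \<Rightarrow> ('i \<Rightarrow> 'a) \<Rightarrow> ('d \<Rightarrow> 'c) \<Rightarrow> bool" where
  "is_cocone B q qd \<longleftrightarrow> B \<in> Obj K \<and> (\<forall>i\<in>Obj I. q i \<in> Arr K \<and> Dom K (q i) = on_obj F i \<and> Cod K (q i) = B) \<and>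
     (\<forall>d\<in>Arr I. qd d \<in> Cell K \<and> Src K (qd d) = q (Cod I d) \<cdot> on_arr F d \<and> Tgt K (qd d) = q (Dom I d)) \<and>
     (\<forall>i\<in>Obj I. qd (Id1 I i) = Id2 K (q i)) \<and>
     (\<forall>d\<in>Arr I. \<forall>e\<in>Arr I. Cod I d = Dom I e \<longrightarrow> qd (e \<cdot>\<^bsub>I\<^esub> d) = qd d \<bullet> (qd e \<rhd> on_arr F d)) \<and>
     (\<forall>s\<in>Cell I. qd (Tgt I s) \<bullet> (q (Cod I (Src I s)) \<lhd> on_cell F s) = qd (Src I s))"

lemma oplax_cocone_iff: "oplax_cocone K I F B q qd \<longleftrightarrow> is_cocone B q qd"
  unfolding oplax_cocone_def is_cocone_def arr_def cell_def by (auto simp: I.Src_Tgt_typing)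

lemma is_coconeD:
  assumes "is_cocone B q qd"
  shows "B \<in> Obj K" "i \<in> Obj I \<Longrightarrow> q i \<in> Arr K" "i \<in> Obj I \<Longrightarrow> Dom K (q i) = on_obj F i" "i \<in> Obj I \<Longrightarrow>
      Cod K (q i) = B"
    "d \<in> Arr I \<Longrightarrow> qd d \<in> Cell K" "d \<in> Arr I \<Longrightarrow> Src K (qd d) = q (Cod I d) \<cdot> on_arr F d"
    "d \<in> Arr I \<Longrightarrow> Tgt K (qd d) = q (Dom I d)"
    and is_cocone_Id1: "i \<in> Obj I \<Longrightarrow> qd (Id1 I i) = Id2 K (q i)"
    and is_cocone_Comp1: "d \<in> Arr I \<Longrightarrow> e \<in> Arr I \<Longrightarrow> Cod I d = Dom I e \<Longrightarrow> qd (e \<cdot>\<^bsub>I\<^esub> d) = qd d \<bullet>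
        (qd e \<rhd> on_arr F d)"
    and is_cocone_cell: "s \<in> Cell I \<Longrightarrow> qd (Tgt I s) \<bullet> (q (Cod I (Src I s)) \<lhd> on_cell F s) = qd (Src I s)"
  using assms unfolding is_cocone_def by auto

lemma is_cocone_restrict [simp]: "is_cocone B (restrict q (Obj I)) (restrict qd (Arr I)) \<longleftrightarrow> is_cocone B q qd"
  unfolding is_cocone_def by (simp cong: conj_cong)

lemma is_cocone_whisker:
  assumes q: "is_cocone L q qd" and h: "h \<in> Arr K" "Dom K h = L"
  shows "is_cocone (Cod K h) (\<lambda>i. h \<cdot> q i) (\<lambda>d. h \<lhd> qd d)"
proof -
  note [simp] = is_coconeD(1-7)[OF q] h
  show ?thesis
    unfolding is_cocone_def
  proof (intro conjI ballI impI)
    fix s assume [simp]: "s \<in> Cell I"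
    show "(h \<lhd> qd (Tgt I s)) \<bullet> (h \<cdot> q (Cod I (Src I s)) \<lhd> on_cell F s) = h \<lhd> qd (Src I s)"
      using arg_cong[OF is_cocone_cell[OF q, of s], of "\<lambda>z. h \<lhd> z"] by simp
  qed (simp_all add: is_cocone_Id1[OF q] is_cocone_Comp1[OF q])
qed

definition is_modification :: "('i \<Rightarrow> 'a) \<times> ('d \<Rightarrow> 'c) \<Rightarrow> ('i \<Rightarrow> 'a) \<times> ('d \<Rightarrow> 'c) \<Rightarrow> ('i \<Rightarrow> 'c) \<Rightarrow> bool" where
  "is_modification x y \<Gamma> \<longleftrightarrow> (\<forall>i\<in>Obj I. \<Gamma> i \<in> Cell K \<and> Src K (\<Gamma> i) = fst x i \<and> Tgt K (\<Gamma> i) = fst y i) \<and>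
     (\<forall>d\<in>Arr I. \<Gamma> (Dom I d) \<bullet> snd x d = snd y d \<bullet> (\<Gamma> (Cod I d) \<rhd> on_arr F d))"

lemma oplax_modification_iff: "oplax_modification K I F x y \<Gamma> \<longleftrightarrow> is_modification x y \<Gamma>"
  unfolding oplax_modification_def is_modification_def by (cases x; cases y) (auto simp: arr_def cell_def)

lemma is_modification_restrict [simp]:
  "is_modification x y (restrict \<Gamma> (Obj I)) \<longleftrightarrow> is_modification x y \<Gamma>"
  "is_modification (restrict q (Obj I), restrict qd (Arr I)) y \<Gamma> \<longleftrightarrow> is_modification (q, qd) y \<Gamma>"
  "is_modification x (restrict q (Obj I), restrict qd (Arr I)) \<Gamma> \<longleftrightarrow> is_modification x (q, qd) \<Gamma>"
  unfolding is_modification_def by (simp_all cong: conj_cong)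

lemma cocones_simps:
  "x \<in> cObj (oplax_cocones K I F B) \<longleftrightarrow>
     fst x \<in> extensional (Obj I) \<and> snd x \<in> extensional (Arr I) \<and> is_cocone B (fst x) (snd x)"
  "carr (oplax_cocones K I F B) m x y \<longleftrightarrow> x \<in> cObj (oplax_cocones K I F B) \<and> y \<in> cObj (oplax_cocones K I F B) \<and>
     (\<exists>\<Gamma>. m = (x, \<Gamma>, y) \<and> \<Gamma> \<in> extensional (Obj I) \<and> is_modification x y \<Gamma>)"
  "cId (oplax_cocones K I F B) x = (x, (\<lambda>i\<in>Obj I. Id2 K (fst x i)), x)"
  "cComp (oplax_cocones K I F B) (y, \<Delta>, z) (x, \<Gamma>, y') = (x, (\<lambda>i\<in>Obj I. \<Delta> i \<bullet> \<Gamma> i), z)"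
  unfolding oplax_cocones_def carr_def
  by (cases m rule: prod_cases3; cases x; cases y; auto simp: Let_def oplax_cocone_iff
      oplax_modification_iff)+

lemma is_modification_comp:
  assumes "is_modification x y \<Gamma>" "is_modification y z \<Delta>" "is_cocone B (fst x) (snd x)"
      "is_cocone B (fst y) (snd y)" "is_cocone B (fst z) (snd z)"
  shows "is_modification x z (\<lambda>i. \<Delta> i \<bullet> \<Gamma> i)"
proof -
  note [simp] = is_coconeD(1-7)[OF assms(3)] is_coconeD(1-7)[OF assms(4)] is_coconeD(1-7)[OF assms(5)]
  have [simp]: "\<And>i. i \<in> Obj I \<Longrightarrow> \<Gamma> i \<in> Cell K" "\<And>i. i \<in> Obj I \<Longrightarrow> Src K (\<Gamma> i) = fst x i" "\<And>i. i \<in> Obj I \<Longrightarrow>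
      Tgt K (\<Gamma> i) = fst y i"
    "\<And>i. i \<in> Obj I \<Longrightarrow> \<Delta> i \<in> Cell K" "\<And>i. i \<in> Obj I \<Longrightarrow> Src K (\<Delta> i) = fst y i" "\<And>i. i \<in> Obj I \<Longrightarrow> Tgt K (\<Delta> i) =
        fst z i"
    and a: "\<And>d. d \<in> Arr I \<Longrightarrow> \<Gamma> (Dom I d) \<bullet> snd x d = snd y d \<bullet> (\<Gamma> (Cod I d) \<rhd> on_arr F d)"
    and b: "\<And>d. d \<in> Arr I \<Longrightarrow> \<Delta> (Dom I d) \<bullet> snd y d = snd z d \<bullet> (\<Delta> (Cod I d) \<rhd> on_arr F d)"
    using assms unfolding is_modification_def by auto
  show ?thesis unfolding is_modification_def by (simp add: a reassoc[OF b])
qed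

lemma cocones_category: "category (oplax_cocones K I F B)"
proof
  fix m n k x y z w
  let ?C = "oplax_cocones K I F B"
  show "carr ?C m x y \<Longrightarrow> x \<in> cObj ?C \<and> y \<in> cObj ?C" by (auto simp: cocones_simps(2))
  show "carr ?C (cId ?C x) x x" if "x \<in> cObj ?C"
  proof -
    have "is_cocone B (fst x) (snd x)" using that by (simp add: cocones_simps)
    note [simp] = is_coconeD(1-7)[OF this]
    show ?thesis using that by (auto simp: cocones_simps(2,3)) (simp add: is_modification_def)
  qed
  show "carr ?C (cComp ?C n m) x z" if "carr ?C m x y" "carr ?C n y z"
    using that by (auto simp: cocones_simps intro!: is_modification_comp)
  show "cComp ?C (cId ?C y) m = m" if m: "carr ?C m x y"
    using m by (auto simp: cocones_simps is_modification_def extensional_def fun_eq_iff)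
  show "cComp ?C m (cId ?C x) = m" if m: "carr ?C m x y"
    using m by (auto simp: cocones_simps is_modification_def extensional_def fun_eq_iff)
  show "cComp ?C (cComp ?C k n) m = cComp ?C k (cComp ?C n m)" if "carr ?C m x y" "carr ?C n y z"
      "carr ?C k z w"
    using that by (auto simp: cocones_simps is_modification_def fun_eq_iff)
qed

text \<open>Faithfulness, fullness and essential surjectivity of composition with the cocone, freed
  from the extensional encoding of families. Later arguments use bicolimits only in this
  form.\<close>

lemma oplax_bicolimitD:
  assumes "is_oplax_bicolimit K I F L q qd"
  shows bicolimit_cocone: "is_cocone L q qd"
    and bicolimit_faithful: "\<And>\<sigma> \<tau>. \<lbrakk>\<And>i. i \<in> Obj I \<Longrightarrow> \<sigma> \<rhd> q i = \<tau> \<rhd> q i; \<sigma> \<in> Cell K; \<tau> \<in> Cell K; Src K \<tau> =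
        Src K \<sigma>;
        Tgt K \<tau> = Tgt K \<sigma>; Dom K (Src K \<sigma>) = L\<rbrakk> \<Longrightarrow> \<sigma> = \<tau>"
    and bicolimit_full: "\<And>h k \<Gamma>. \<lbrakk>h \<in> Arr K; k \<in> Arr K; Dom K h = L; Dom K k = L; Cod K k = Cod K h;
        is_modification ((\<lambda>i. h \<cdot> q i), (\<lambda>d. h \<lhd> qd d)) ((\<lambda>i. k \<cdot> q i), (\<lambda>d. k \<lhd> qd d)) \<Gamma>\<rbrakk> \<Longrightarrow>
        \<exists>\<sigma>\<in>Cell K. Src K \<sigma> = h \<and> Tgt K \<sigma> = k \<and> (\<forall>i\<in>Obj I. \<sigma> \<rhd> q i = \<Gamma> i)"
    and bicolimit_ess_surj: "\<And>B r rd. is_cocone B r rd \<Longrightarrow>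
        \<exists>h\<in>Arr K. Dom K h = L \<and> Cod K h = B \<and> (\<exists>\<kappa>. (\<forall>i\<in>Obj I. iso2 (\<kappa> i)) \<and>
          is_modification ((\<lambda>i. h \<cdot> q i), (\<lambda>d. h \<lhd> qd d)) (r, rd) \<kappa>)"
proof -
  let ?F0 = "whisker_cocone K I q qd"
  let ?F1 = "\<lambda>\<sigma>. (?F0 (Src K \<sigma>), (\<lambda>i\<in>Obj I. \<sigma> \<rhd> q i), ?F0 (Tgt K \<sigma>))"
  show q: "is_cocone L q qd" using assms by (simp add: is_oplax_bicolimit_def oplax_cocone_iff)
  note equiv = is_equivalence_full_faithful_ess[OF hom_category cocones_category]
  have eq: "is_equivalence (hom_cat K L B) (oplax_cocones K I F B) ?F0 ?F1" if "B \<in> Obj K" for B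
    using assms that by (simp add: is_oplax_bicolimit_def)
  show "\<sigma> = \<tau>" if "\<And>i. i \<in> Obj I \<Longrightarrow> \<sigma> \<rhd> q i = \<tau> \<rhd> q i" "\<sigma> \<in> Cell K" "\<tau> \<in> Cell K" "Src K \<tau> = Src K \<sigma>"
     "Tgt K \<tau> = Tgt K \<sigma>" "Dom K (Src K \<sigma>) = L" for \<sigma> \<tau>
  proof (rule equiv(1)[OF eq])
    show "Cod K (Src K \<sigma>) \<in> Obj K" using that by simp
    show "carr (hom_cat K L (Cod K (Src K \<sigma>))) \<sigma> (Src K \<sigma>) (Tgt K \<sigma>)" "carr (hom_cat K L (Cod K (Src K \<sigma>))) \<tau>
        (Src K \<sigma>) (Tgt K \<sigma>)"
      using that by (auto simp: carr_hom_iff)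
    show "?F1 \<sigma> = ?F1 \<tau>" using that by (auto simp: fun_eq_iff)
  qed
  show "\<exists>\<sigma>\<in>Cell K. Src K \<sigma> = h \<and> Tgt K \<sigma> = k \<and> (\<forall>i\<in>Obj I. \<sigma> \<rhd> q i = \<Gamma> i)"
    if h: "h \<in> Arr K" "k \<in> Arr K" "Dom K h = L" "Dom K k = L" "Cod K k = Cod K h" and
        \<Gamma>: "is_modification ((\<lambda>i. h \<cdot> q i), (\<lambda>d. h \<lhd> qd d)) ((\<lambda>i. k \<cdot> q i), (\<lambda>d. k \<lhd> qd d)) \<Gamma>" for h k \<Gamma>
  proof -
    have B: "Cod K h \<in> Obj K" using h by simp
    have "\<exists>m. carr (hom_cat K L (Cod K h)) m h k \<and> ?F1 m = (?F0 h, restrict \<Gamma> (Obj I), ?F0 k)"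
    proof (rule equiv(2)[OF eq[OF B]])
      show "h \<in> cObj (hom_cat K L (Cod K h))" "k \<in> cObj (hom_cat K L (Cod K h))" using h
          by (auto simp: hom_cat_def)
      show "carr (oplax_cocones K I F (Cod K h)) (?F0 h, restrict \<Gamma> (Obj I), ?F0 k) (?F0 h) (?F0 k)"
        using is_cocone_whisker[OF q h(1,3)] is_cocone_whisker[OF q h(2,4)] \<Gamma> h(5)
        by (simp add: cocones_simps whisker_cocone_def)
    qed
    then show ?thesis by (auto simp: carr_hom_iff fun_eq_iff restrict_def) metis
  qed
  show "\<exists>h\<in>Arr K. Dom K h = L \<and> Cod K h = B \<and> (\<exists>\<kappa>. (\<forall>i\<in>Obj I. iso2 (\<kappa> i)) \<and>
      is_modification ((\<lambda>i. h \<cdot> q i), (\<lambda>d. h \<lhd> qd d)) (r, rd) \<kappa>)" if r: "is_cocone B r rd" for B r rd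
  proof -
    have B: "B \<in> Obj K" using is_coconeD[OF r] by simp
    let ?r = "(restrict r (Obj I), restrict rd (Arr I))"
    obtain h n where h: "h \<in> Arr K" "Dom K h = L" "Cod K h = B" and n: "cat_iso (oplax_cocones K I F B) n
        (?F0 h) ?r"
      using equiv(3)[OF eq[OF B], of ?r] r by (auto simp: cocones_simps hom_cat_def)
    from n obtain \<kappa> \<kappa>' where \<kappa>: "is_modification (?F0 h) ?r \<kappa>" "is_modification ?r (?F0 h) \<kappa>'"
      "(\<lambda>i\<in>Obj I. \<kappa>' i \<bullet> \<kappa> i) = (\<lambda>i\<in>Obj I. Id2 K (fst (?F0 h) i))" "(\<lambda>i\<in>Obj I. \<kappa> i \<bullet> \<kappa>' i) =
          (\<lambda>i\<in>Obj I. Id2 K (fst ?r i))"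
      by (auto simp: cat_iso_def cocones_simps)
    \<comment> \<open>Modifications are composed componentwise, so mutually inverse modifications
      have mutually inverse components.\<close>
    have "iso2 (\<kappa> i)" if "i \<in> Obj I" for i
      by (rule cell_inv_eqI[where \<tau> = "\<kappa>' i"])
         (use \<kappa>(1,2) \<kappa>(3,4)[THEN fun_cong, of i] that in \<open>auto simp: is_modification_def\<close>)
    moreover have "is_modification ((\<lambda>i. h \<cdot> q i), (\<lambda>d. h \<lhd> qd d)) (r, rd) \<kappa>"
      using \<kappa>(1) by (simp add: whisker_cocone_def)
    ultimately show ?thesis using h by blast
  qed
qed

text \<open>The converse of the preceding analysis. What has to be supplied is functoriality of
  whiskering and the passage from invertible components to an isomorphism of cocones.\<close>

lemma oplax_bicolimitI:
  assumes q: "is_cocone L q qd"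
    and faithful: "\<And>\<sigma> \<tau>. \<lbrakk>\<And>i. i \<in> Obj I \<Longrightarrow> \<sigma> \<rhd> q i = \<tau> \<rhd> q i; \<sigma> \<in> Cell K; \<tau> \<in> Cell K; Src K \<tau> = Src K \<sigma>;
        Tgt K \<tau> = Tgt K \<sigma>; Dom K (Src K \<sigma>) = L\<rbrakk> \<Longrightarrow> \<sigma> = \<tau>"
    and full: "\<And>h k \<Gamma>. \<lbrakk>h \<in> Arr K; k \<in> Arr K; Dom K h = L; Dom K k = L; Cod K k = Cod K h;
        is_modification ((\<lambda>i. h \<cdot> q i), (\<lambda>d. h \<lhd> qd d)) ((\<lambda>i. k \<cdot> q i), (\<lambda>d. k \<lhd> qd d)) \<Gamma>\<rbrakk> \<Longrightarrow>
        \<exists>\<sigma>\<in>Cell K. Src K \<sigma> = h \<and> Tgt K \<sigma> = k \<and> (\<forall>i\<in>Obj I. \<sigma> \<rhd> q i = \<Gamma> i)"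
    and ess: "\<And>B r rd. is_cocone B r rd \<Longrightarrow>
        \<exists>h\<in>Arr K. Dom K h = L \<and> Cod K h = B \<and> (\<exists>\<kappa>. (\<forall>i\<in>Obj I. iso2 (\<kappa> i)) \<and>
          is_modification ((\<lambda>i. h \<cdot> q i), (\<lambda>d. h \<lhd> qd d)) (r, rd) \<kappa>)"
  shows "is_oplax_bicolimit K I F L q qd"
proof -
  let ?F0 = "whisker_cocone K I q qd"
  let ?F1 = "\<lambda>\<sigma>. (?F0 (Src K \<sigma>), (\<lambda>i\<in>Obj I. \<sigma> \<rhd> q i), ?F0 (Tgt K \<sigma>))"
  note [simp] = is_coconeD(1-7)[OF q]
  \<comment> \<open>Restricting a 2-cell along the inclusions yields a modification by exchange with
    the transition cells.\<close>
  have modif: "is_modification (?F0 (Src K \<sigma>)) (?F0 (Tgt K \<sigma>)) (\<lambda>i. \<sigma> \<rhd> q i)"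
      if "\<sigma> \<in> Cell K" "Dom K (Src K \<sigma>) = L" for \<sigma>
    unfolding whisker_cocone_def is_modification_restrict unfolding is_modification_def
  proof (intro conjI ballI)
    fix d assume d [simp]: "d \<in> Arr I"
    show "(\<sigma> \<rhd> q (Dom I d)) \<bullet> snd (\<lambda>i. Src K \<sigma> \<cdot> q i, \<lambda>d. Src K \<sigma> \<lhd> qd d) d =
        snd (\<lambda>i. Tgt K \<sigma> \<cdot> q i, \<lambda>d. Tgt K \<sigma> \<lhd> qd d) d \<bullet> ((\<sigma> \<rhd> q (Cod I d)) \<rhd> on_arr F d)"
      using exchange[of "qd d" \<sigma>] that by simp
  qed (use that in simp_all)
  have F0: "?F0 h \<in> cObj (oplax_cocones K I F B)" if "h \<in> Arr K" "Dom K h = L" "Cod K h = B" for h B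
    using is_cocone_whisker[OF q that(1,2)] that(3) by (simp add: cocones_simps whisker_cocone_def)
  have "is_equivalence (hom_cat K L B) (oplax_cocones K I F B) ?F0 ?F1" if B: "B \<in> Obj K" for B
  proof (rule is_equivalenceI[OF hom_category cocones_category])
    show "is_functor (hom_cat K L B) (oplax_cocones K I F B) ?F0 ?F1"
      unfolding is_functor_def
    proof (intro conjI ballI allI impI)
      fix x assume "x \<in> cObj (hom_cat K L B)"
      then have x: "x \<in> Arr K" "Dom K x = L" "Cod K x = B" by (auto simp: hom_cat_def)
      show "?F0 x \<in> cObj (oplax_cocones K I F B)" by (rule F0[OF x])
      show "?F1 (cId (hom_cat K L B) x) = cId (oplax_cocones K I F B) (?F0 x)"
        using x by (auto simp: cocones_simps hom_cat_def whisker_cocone_def fun_eq_iff)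
    next
      fix m x y assume "carr (hom_cat K L B) m x y"
      then have m: "m \<in> Cell K" "Src K m = x" "Tgt K m = y" "Dom K x = L" "Cod K x = B"
          by (auto simp: carr_hom_iff)
      then show "carr (oplax_cocones K I F B) (?F1 m) (?F0 x) (?F0 y)"
        using modif[of m] F0[of x B] F0[of y B] Src_Tgt_typing[OF m(1)] by (auto simp: cocones_simps(2))
    next
      fix m n x y z assume "carr (hom_cat K L B) m x y" "carr (hom_cat K L B) n y z"
      then have m: "m \<in> Cell K" "Src K m = x" "Tgt K m = y" "Dom K x = L" "Cod K x = B" "n \<in> Cell K"
          "Src K n = y" "Tgt K n = z" "Dom K y = L"
        by (auto simp: carr_hom_iff)
      show "?F1 (cComp (hom_cat K L B) n m) = cComp (oplax_cocones K I F B) (?F1 n) (?F1 m)"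
        using m by (auto simp: cocones_simps(4) hom_cat_def fun_eq_iff)
    qed
  next
    fix x y m m' assume m: "carr (hom_cat K L B) m x y" "carr (hom_cat K L B) m' x y" and eq: "?F1 m = ?F1 m'"
    have "m \<rhd> q i = m' \<rhd> q i" if "i \<in> Obj I" for i
      using eq that by (auto simp: restrict_def fun_eq_iff) metis
    then show "m = m'" by (rule faithful) (use m in \<open>auto simp: carr_hom_iff\<close>)
  next
    fix x y n assume "x \<in> cObj (hom_cat K L B)" "y \<in> cObj (hom_cat K L B)" "carr (oplax_cocones K I F B) n
        (?F0 x) (?F0 y)"
    then have x: "x \<in> Arr K" "Dom K x = L" "Cod K x = B" "y \<in> Arr K" "Dom K y = L" "Cod K y = B" and
      n: "\<exists>\<Gamma>. n = (?F0 x, \<Gamma>, ?F0 y) \<and> \<Gamma> \<in> extensional (Obj I) \<and> is_modification (?F0 x) (?F0 y) \<Gamma>"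
          by (auto simp: hom_cat_def cocones_simps(2))
    from n obtain \<Gamma> where n: "n = (?F0 x, \<Gamma>, ?F0 y)" and \<Gamma>: "\<Gamma> \<in> extensional (Obj I)" "is_modification (?F0 x)
        (?F0 y) \<Gamma>" by blast
    obtain \<sigma> where "\<sigma> \<in> Cell K" "Src K \<sigma> = x" "Tgt K \<sigma> = y" "\<forall>i\<in>Obj I. \<sigma> \<rhd> q i = \<Gamma> i"
      using full[of x y \<Gamma>] x \<Gamma> by (auto simp: whisker_cocone_def)
    then show "\<exists>m. carr (hom_cat K L B) m x y \<and> ?F1 m = n"
      using x n \<Gamma>(1) by (intro exI[of _ \<sigma>]) (auto simp: carr_hom_iff fun_eq_iff extensional_def)
  next
    fix z assume "z \<in> cObj (oplax_cocones K I F B)"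
    then have z: "fst z \<in> extensional (Obj I)" "snd z \<in> extensional (Arr I)" "is_cocone B (fst z) (snd z)"
        by (auto simp: cocones_simps)
    from ess[OF z(3)] obtain h \<kappa> where h: "h \<in> Arr K" "Dom K h = L" "Cod K h = B" and \<kappa>: "\<And>i. i \<in> Obj I \<Longrightarrow>
        iso2 (\<kappa> i)"
      "is_modification ((\<lambda>i. h \<cdot> q i), (\<lambda>d. h \<lhd> qd d)) z \<kappa>" by auto
    note [simp] = h \<kappa>(1) is_coconeD(1-7)[OF z(3)]
    have [simp]: "\<And>i. i \<in> Obj I \<Longrightarrow> Src K (\<kappa> i) = h \<cdot> q i" "\<And>i. i \<in> Obj I \<Longrightarrow> Tgt K (\<kappa> i) = fst z i"
      and k: "\<And>d. d \<in> Arr I \<Longrightarrow> \<kappa> (Dom I d) \<bullet> (h \<lhd> qd d) = snd z d \<bullet> (\<kappa> (Cod I d) \<rhd> on_arr F d)"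
      using \<kappa>(2) by (auto simp: is_modification_def)
    \<comment> \<open>The inverse components again form a modification: the equation for \<kappa> is
      conjugated by its invertible components.\<close>
    have "is_modification z (?F0 h) (\<lambda>i. inv2 (\<kappa> i))"
      unfolding whisker_cocone_def is_modification_restrict unfolding is_modification_def
    proof (intro conjI ballI)
      fix d assume [simp]: "d \<in> Arr I"
      have "\<kappa> (Dom I d) \<bullet> (inv2 (\<kappa> (Dom I d)) \<bullet> snd z d) \<bullet> (\<kappa> (Cod I d) \<rhd> on_arr F d) =
        \<kappa> (Dom I d) \<bullet> ((h \<lhd> qd d) \<bullet> (inv2 (\<kappa> (Cod I d)) \<rhd> on_arr F d)) \<bullet> (\<kappa> (Cod I d) \<rhd> on_arr F d)"
        by (simp add: k)
      then have "(inv2 (\<kappa> (Dom I d)) \<bullet> snd z d) \<bullet> (\<kappa> (Cod I d) \<rhd> on_arr F d) =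
        ((h \<lhd> qd d) \<bullet> (inv2 (\<kappa> (Cod I d)) \<rhd> on_arr F d)) \<bullet> (\<kappa> (Cod I d) \<rhd> on_arr F d)"
        by (rule cancel_left) simp_all
      then show "inv2 (\<kappa> (Dom I d)) \<bullet> snd z d = snd ((\<lambda>i. h \<cdot> q i), (\<lambda>d. h \<lhd> qd d)) d \<bullet>
          (inv2 (\<kappa> (Cod I d)) \<rhd> on_arr F d)"
        unfolding snd_conv by (rule cancel_right) simp_all
    qed simp_all
    then have "carr (oplax_cocones K I F B) (z, (\<lambda>i\<in>Obj I. inv2 (\<kappa> i)), ?F0 h) z (?F0 h)"
      using F0[OF h] \<open>z \<in> _\<close> by (auto simp: cocones_simps(2))
    moreover have "carr (oplax_cocones K I F B) (?F0 h, restrict \<kappa> (Obj I), z) (?F0 h) z"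
      using F0[OF h] \<open>z \<in> _\<close> \<kappa>(2) by (auto simp: cocones_simps(2) whisker_cocone_def)
    ultimately have "cat_iso (oplax_cocones K I F B) (?F0 h, restrict \<kappa> (Obj I), z) (?F0 h) z"
      unfolding cat_iso_def
      by (intro conjI exI[of _ "(z, (\<lambda>i\<in>Obj I. inv2 (\<kappa> i)), ?F0 h)"])
         (simp_all add: cocones_simps(3,4) whisker_cocone_def cong: restrict_cong)
    moreover have "h \<in> cObj (hom_cat K L B)" using h by (simp add: hom_cat_def)
    ultimately show "\<exists>x\<in>cObj (hom_cat K L B). \<exists>n. cat_iso (oplax_cocones K I F B) n (?F0 x) z" by blast
  qed
  then show ?thesis unfolding is_oplax_bicolimit_def oplax_cocone_iff using q by blast
qed

text \<open>The inverses of the restrictions form a modification and hence lift to a 2-cell in the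
  other direction. Both composites with \<sigma> are identities because their restrictions
  are.\<close>

lemma bicolimit_iso:
  assumes L: "is_oplax_bicolimit K I F L q qd" and \<sigma>: "\<sigma> \<in> Cell K" "Dom K (Src K \<sigma>) = L"
    and iso: "\<And>i. i \<in> Obj I \<Longrightarrow> iso2 (\<sigma> \<rhd> q i)"
  shows "iso2 \<sigma>"
proof -
  obtain h k A where hk: "Src K \<sigma> = h" "Tgt K \<sigma> = k" and A: "\<And>i. A i = \<sigma> \<rhd> q i" by simp
  have "h \<in> Arr K" "k \<in> Arr K" "Dom K h = L" "Dom K k = L" "Cod K k = Cod K h"
    using Src_Tgt_typing[OF \<sigma>(1)] \<sigma>(2) hk by auto
  note [simp] = this hk \<sigma>(1) is_coconeD(1-7)[OF bicolimit_cocone[OF L]]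
  have [simp]: "iso2 (A i)" "Src K (A i) = h \<cdot> q i" "Tgt K (A i) = k \<cdot> q i" if "i \<in> Obj I" for i
    using that iso by (simp_all add: A)
  have "is_modification ((\<lambda>i. k \<cdot> q i), (\<lambda>d. k \<lhd> qd d)) ((\<lambda>i. h \<cdot> q i), (\<lambda>d. h \<lhd> qd d)) (\<lambda>i. inv2 (A i))"
    unfolding is_modification_def
  proof (intro conjI ballI)
    fix d assume d [simp]: "d \<in> Arr I"
    have *: "A (Dom I d) \<bullet> (h \<lhd> qd d) = (k \<lhd> qd d) \<bullet> (A (Cod I d) \<rhd> on_arr F d)"
      using exchange[of "qd d" \<sigma>] by (simp add: A)
    have "A (Dom I d) \<bullet> (inv2 (A (Dom I d)) \<bullet> (k \<lhd> qd d)) \<bullet> (A (Cod I d) \<rhd> on_arr F d) =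
        A (Dom I d) \<bullet> ((h \<lhd> qd d) \<bullet> (inv2 (A (Cod I d)) \<rhd> on_arr F d)) \<bullet> (A (Cod I d) \<rhd> on_arr F d)"
      by (simp add: *)
    then have "(inv2 (A (Dom I d)) \<bullet> (k \<lhd> qd d)) \<bullet> (A (Cod I d) \<rhd> on_arr F d) =
        ((h \<lhd> qd d) \<bullet> (inv2 (A (Cod I d)) \<rhd> on_arr F d)) \<bullet> (A (Cod I d) \<rhd> on_arr F d)"
      by (rule cancel_left) simp_all
    then show "inv2 (A (Dom I d)) \<bullet> snd (\<lambda>i. k \<cdot> q i, \<lambda>d. k \<lhd> qd d) d =
        snd (\<lambda>i. h \<cdot> q i, \<lambda>d. h \<lhd> qd d) d \<bullet> (inv2 (A (Cod I d)) \<rhd> on_arr F d)"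
      unfolding snd_conv by (rule cancel_right) simp_all
  qed simp_all
  then obtain \<tau> where \<tau> [simp]: "\<tau> \<in> Cell K" "Src K \<tau> = k" "Tgt K \<tau> = h" and \<tau>A: "\<And>i. i \<in> Obj I \<Longrightarrow> \<tau> \<rhd> q i =
      inv2 (A i)"
    using bicolimit_full[OF L, of k h "\<lambda>i. inv2 (A i)"] by auto
  show ?thesis
  proof (rule cell_inv_eqI[where \<tau> = \<tau>])
    show "\<tau> \<bullet> \<sigma> = Id2 K (Src K \<sigma>)" "\<sigma> \<bullet> \<tau> = Id2 K (Tgt K \<sigma>)"
      by (rule bicolimit_faithful[OF L]; simp add: \<tau>A A[symmetric])+
  qed simp_all
qed

lemma induced_by_cocone_iff:
  "induced_by_cocone K I F q qd r rd u \<Gamma> \<longleftrightarrow>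
     (\<forall>i\<in>Obj I. iso2 (\<Gamma> i)) \<and> is_modification ((\<lambda>i. u \<cdot> q i), (\<lambda>d. u \<lhd> qd d)) (r, rd) \<Gamma>"
  unfolding induced_by_cocone_def oplax_modification_iff by (auto simp: iso_cell_iff is_modification_def)

end

section \<open>Pseudocoequalizing pairs and bicoequalizers in terms of 1-cells and 2-cells\<close>

context two_category
begin

lemma codescent_objectD:
  assumes "codescent_object K X"
  shows "lev0 X \<in> Obj K" "lev1 X \<in> Obj K" "lev2 X \<in> Obj K"
    "cd_d0 X \<in> Arr K" "Dom K (cd_d0 X) = lev1 X" "Cod K (cd_d0 X) = lev0 X"
    "cd_d1 X \<in> Arr K" "Dom K (cd_d1 X) = lev1 X" "Cod K (cd_d1 X) = lev0 X"
    "cd_i X \<in> Arr K" "Dom K (cd_i X) = lev0 X" "Cod K (cd_i X) = lev1 X"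
    "cd_p0 X \<in> Arr K" "Dom K (cd_p0 X) = lev2 X" "Cod K (cd_p0 X) = lev1 X"
    "cd_p1 X \<in> Arr K" "Dom K (cd_p1 X) = lev2 X" "Cod K (cd_p1 X) = lev1 X"
    "cd_p2 X \<in> Arr K" "Dom K (cd_p2 X) = lev2 X" "Cod K (cd_p2 X) = lev1 X"
    "iso2 (cd_n0 X)" "Src K (cd_n0 X) = cd_d0 X \<cdot> cd_i X" "Tgt K (cd_n0 X) = Id1 K (lev0 X)"
    "iso2 (cd_n1 X)" "Src K (cd_n1 X) = cd_d1 X \<cdot> cd_i X" "Tgt K (cd_n1 X) = Id1 K (lev0 X)"
    "iso2 (cd_\<theta>01 X)" "Src K (cd_\<theta>01 X) = cd_d0 X \<cdot> cd_p0 X" "Tgt K (cd_\<theta>01 X) = cd_d0 X \<cdot> cd_p1 X"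
    "iso2 (cd_\<theta>02 X)" "Src K (cd_\<theta>02 X) = cd_d1 X \<cdot> cd_p0 X" "Tgt K (cd_\<theta>02 X) = cd_d0 X \<cdot> cd_p2 X"
    "iso2 (cd_\<theta>12 X)" "Src K (cd_\<theta>12 X) = cd_d1 X \<cdot> cd_p1 X" "Tgt K (cd_\<theta>12 X) = cd_d1 X \<cdot> cd_p2 X"
  using assms by (simp_all add: codescent_object_def iso_cell_iff)

definition is_pair :: "('o, 'a, 'c) codescent \<Rightarrow> 'o \<Rightarrow> 'a \<Rightarrow> 'c \<Rightarrow> bool" where
  "is_pair X B q \<xi> \<longleftrightarrow> q \<in> Arr K \<and> Dom K q = lev0 X \<and> Cod K q = B \<and> iso2 \<xi> \<and> Src K \<xi> = q \<cdot> cd_d0 X \<and> Tgt K \<xi> =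
      q \<cdot> cd_d1 X \<and>
     (q \<lhd> cd_n1 X) \<bullet> (\<xi> \<rhd> cd_i X) = q \<lhd> cd_n0 X \<and>
     (q \<lhd> cd_\<theta>12 X) \<bullet> (\<xi> \<rhd> cd_p1 X) \<bullet> (q \<lhd> cd_\<theta>01 X) = (\<xi> \<rhd> cd_p2 X) \<bullet> (q \<lhd> cd_\<theta>02 X) \<bullet> (\<xi> \<rhd> cd_p0 X)"

lemma pseudocoequalizes_iff: "pseudocoequalizes K X B q \<xi> \<longleftrightarrow> is_pair X B q \<xi>"
  unfolding pseudocoequalizes_def is_pair_def by (auto simp: iso_cell_iff)

lemma pairs_simps:
  "x \<in> cObj (pseudocoequalizing_pairs K X B) \<longleftrightarrow> is_pair X B (fst x) (snd x)"
  "carr (pseudocoequalizing_pairs K X B) m x y \<longleftrightarrow> is_pair X B (fst x) (snd x) \<and> is_pair X B (fst y) (snd y) \<and>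
     (\<exists>\<sigma>. m = (x, \<sigma>, y) \<and> \<sigma> \<in> Cell K \<and> Src K \<sigma> = fst x \<and> Tgt K \<sigma> = fst y \<and> (\<sigma> \<rhd> cd_d1 X) \<bullet> snd x = snd y \<bullet>
         (\<sigma> \<rhd> cd_d0 X))"
  "cId (pseudocoequalizing_pairs K X B) x = (x, Id2 K (fst x), x)"
  "cComp (pseudocoequalizing_pairs K X B) (y, \<tau>, z) (x, \<sigma>, y') = (x, \<tau> \<bullet> \<sigma>, z)"
  unfolding pseudocoequalizing_pairs_def carr_def
  by (cases m rule: prod_cases3; cases x; cases y; auto simp: Let_def pseudocoequalizes_iff
      pair_morphism_def)+

text \<open>The analogue of \<open>oplax_bicolimitD\<close>. A 2-cell lifts through q exactly when
  it is compatible with \<xi>, which replaces the modification condition.\<close>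

lemma bicoequalizerD:
  assumes X: "cd_d0 X \<in> Arr K" "Dom K (cd_d0 X) = lev1 X" "Cod K (cd_d0 X) = lev0 X"
      "cd_d1 X \<in> Arr K" "Dom K (cd_d1 X) = lev1 X" "Cod K (cd_d1 X) = lev0 X"
    and "is_bicoequalizer K X Z q \<xi>"
  shows bicoequalizer_pair: "is_pair X Z q \<xi>"
    and bicoequalizer_faithful: "\<And>\<sigma> \<tau>. \<lbrakk>\<sigma> \<rhd> q = \<tau> \<rhd> q; \<sigma> \<in> Cell K; \<tau> \<in> Cell K; Src K \<tau> = Src K \<sigma>;
        Tgt K \<tau> = Tgt K \<sigma>; Dom K (Src K \<sigma>) = Z\<rbrakk> \<Longrightarrow> \<sigma> = \<tau>"
    and bicoequalizer_full: "\<And>h k \<Gamma>. \<lbrakk>h \<in> Arr K; k \<in> Arr K; Dom K h = Z; Dom K k = Z; Cod K k = Cod K h;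
        \<Gamma> \<in> Cell K; Src K \<Gamma> = h \<cdot> q; Tgt K \<Gamma> = k \<cdot> q; (\<Gamma> \<rhd> cd_d1 X) \<bullet> (h \<lhd> \<xi>) = (k \<lhd> \<xi>) \<bullet> (\<Gamma> \<rhd> cd_d0 X)\<rbrakk> \<Longrightarrow>
        \<exists>\<sigma>\<in>Cell K. Src K \<sigma> = h \<and> Tgt K \<sigma> = k \<and> \<sigma> \<rhd> q = \<Gamma>"
    and bicoequalizer_ess_surj: "\<And>B r \<rho>. is_pair X B r \<rho> \<Longrightarrow> B \<in> Obj K \<Longrightarrow>
        \<exists>h\<in>Arr K. Dom K h = Z \<and> Cod K h = B \<and> (\<exists>\<kappa>. iso2 \<kappa> \<and> Src K \<kappa> = h \<cdot> q \<and> Tgt K \<kappa> = r \<and>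
          (\<kappa> \<rhd> cd_d1 X) \<bullet> (h \<lhd> \<xi>) = \<rho> \<bullet> (\<kappa> \<rhd> cd_d0 X))"
proof -
  note [simp] = X
  let ?F0 = "\<lambda>h. (h \<cdot> q, h \<lhd> \<xi>)"
  let ?F1 = "\<lambda>\<sigma>. (?F0 (Src K \<sigma>), \<sigma> \<rhd> q, ?F0 (Tgt K \<sigma>))"
  show q: "is_pair X Z q \<xi>" using assms by (simp add: is_bicoequalizer_def pseudocoequalizes_iff)
  have cat: "category (pseudocoequalizing_pairs K X B)" for B
  proof
    fix m n k x y z w
    let ?C = "pseudocoequalizing_pairs K X B"
    show "carr ?C m x y \<Longrightarrow> x \<in> cObj ?C \<and> y \<in> cObj ?C" by (auto simp: pairs_simps)
    show "carr ?C (cId ?C x) x x" if "x \<in> cObj ?C"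
      using that by (auto simp: pairs_simps is_pair_def)
    show "carr ?C (cComp ?C n m) x z" if mn: "carr ?C m x y" "carr ?C n y z"
    proof -
      from mn obtain \<sigma> \<tau> where [simp]: "m = (x, \<sigma>, y)" "n = (y, \<tau>, z)" by (auto simp: pairs_simps)
      from mn have p: "is_pair X B (fst x) (snd x)" "is_pair X B (fst y) (snd y)"
          "is_pair X B (fst z) (snd z)"
        and s [simp]: "\<sigma> \<in> Cell K" "Src K \<sigma> = fst x" "Tgt K \<sigma> = fst y" "\<tau> \<in> Cell K" "Src K \<tau> = fst y"
            "Tgt K \<tau> = fst z"
        and e: "(\<sigma> \<rhd> cd_d1 X) \<bullet> snd x = snd y \<bullet> (\<sigma> \<rhd> cd_d0 X)" "(\<tau> \<rhd> cd_d1 X) \<bullet> snd y = snd z \<bullet> (\<tau> \<rhd> cd_d0 X)"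
        by (auto simp: pairs_simps)
      note p' = p[unfolded is_pair_def]
      have [simp]: "iso2 (snd x)" "iso2 (snd y)" "iso2 (snd z)" using p' by auto
      have [simp]: "Src K (snd x) = fst x \<cdot> cd_d0 X" "Tgt K (snd x) = fst x \<cdot> cd_d1 X" "Src K (snd y) =
          fst y \<cdot> cd_d0 X" "Tgt K (snd y) = fst y \<cdot> cd_d1 X"
        "Src K (snd z) = fst z \<cdot> cd_d0 X" "Dom K (fst x) = lev0 X" "Dom K (fst y) = lev0 X" "Dom K (fst z) =
            lev0 X"
        "fst x \<in> Arr K" "fst y \<in> Arr K" "fst z \<in> Arr K"
        using p' by auto
      show ?thesis using p by (simp add: pairs_simps e(1) reassoc[OF e(2)])
    qed
    show "cComp ?C (cId ?C y) m = m" "cComp ?C m (cId ?C x) = m" if m: "carr ?C m x y"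
      using m by (auto simp: pairs_simps)
    show "cComp ?C (cComp ?C k n) m = cComp ?C k (cComp ?C n m)" if "carr ?C m x y" "carr ?C n y z"
        "carr ?C k z w"
      using that by (auto simp: pairs_simps)
  qed
  note equiv = is_equivalence_full_faithful_ess[OF hom_category cat]
  have eq: "is_equivalence (hom_cat K Z B) (pseudocoequalizing_pairs K X B) ?F0 ?F1" if "B \<in> Obj K" for B
    using assms that by (simp add: is_bicoequalizer_def)
  show "\<sigma> = \<tau>" if "\<sigma> \<rhd> q = \<tau> \<rhd> q" "\<sigma> \<in> Cell K" "\<tau> \<in> Cell K" "Src K \<tau> = Src K \<sigma>"
     "Tgt K \<tau> = Tgt K \<sigma>" "Dom K (Src K \<sigma>) = Z" for \<sigma> \<tau>
  proof (rule equiv(1)[OF eq])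
    show "Cod K (Src K \<sigma>) \<in> Obj K" using that by simp
    show "carr (hom_cat K Z (Cod K (Src K \<sigma>))) \<sigma> (Src K \<sigma>) (Tgt K \<sigma>)" "carr (hom_cat K Z (Cod K (Src K \<sigma>))) \<tau>
        (Src K \<sigma>) (Tgt K \<sigma>)"
      using that by (auto simp: carr_hom_iff)
    show "?F1 \<sigma> = ?F1 \<tau>" using that by auto
  qed
  \<comment> \<open>That a composite with the universal pair is again a pair need not be recomputed,
    since it is part of the functoriality contained in the equivalence.\<close>
  have F0: "is_pair X (Cod K h) (h \<cdot> q) (h \<lhd> \<xi>)" if h: "h \<in> Arr K" "Dom K h = Z" for h
  proof -
    have "?F0 h \<in> cObj (pseudocoequalizing_pairs K X (Cod K h))"
      using eq[of "Cod K h"] h by (auto simp: is_equivalence_def is_functor_def hom_cat_def)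
    then show ?thesis by (simp add: pairs_simps)
  qed
  show "\<exists>\<sigma>\<in>Cell K. Src K \<sigma> = h \<and> Tgt K \<sigma> = k \<and> \<sigma> \<rhd> q = \<Gamma>"
    if h: "h \<in> Arr K" "k \<in> Arr K" "Dom K h = Z" "Dom K k = Z" "Cod K k = Cod K h" and
        \<Gamma>: "\<Gamma> \<in> Cell K" "Src K \<Gamma> = h \<cdot> q" "Tgt K \<Gamma> = k \<cdot> q" "(\<Gamma> \<rhd> cd_d1 X) \<bullet> (h \<lhd> \<xi>) = (k \<lhd> \<xi>) \<bullet>
            (\<Gamma> \<rhd> cd_d0 X)" for h k \<Gamma>
  proof -
    have B: "Cod K h \<in> Obj K" using h by simp
    have "\<exists>m. carr (hom_cat K Z (Cod K h)) m h k \<and> ?F1 m = (?F0 h, \<Gamma>, ?F0 k)"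
    proof (rule equiv(2)[OF eq[OF B]])
      show "h \<in> cObj (hom_cat K Z (Cod K h))" "k \<in> cObj (hom_cat K Z (Cod K h))" using h
          by (auto simp: hom_cat_def)
      show "carr (pseudocoequalizing_pairs K X (Cod K h)) (?F0 h, \<Gamma>, ?F0 k) (?F0 h) (?F0 k)"
        using F0[OF h(1,3)] F0[OF h(2,4)] \<Gamma> h(5) by (simp add: pairs_simps)
    qed
    then show ?thesis by (auto simp: carr_hom_iff)
  qed
  show "\<exists>h\<in>Arr K. Dom K h = Z \<and> Cod K h = B \<and> (\<exists>\<kappa>. iso2 \<kappa> \<and> Src K \<kappa> = h \<cdot> q \<and> Tgt K \<kappa> = r \<and>
          (\<kappa> \<rhd> cd_d1 X) \<bullet> (h \<lhd> \<xi>) = \<rho> \<bullet> (\<kappa> \<rhd> cd_d0 X))" if r: "is_pair X B r \<rho>" and B: "B \<in> Obj K" for B r \<rho>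
  proof -
    obtain h n where h: "h \<in> Arr K" "Dom K h = Z" "Cod K h = B"
        and n: "cat_iso (pseudocoequalizing_pairs K X B) n (?F0 h) (r, \<rho>)"
      using equiv(3)[OF eq[OF B], of "(r, \<rho>)"] r by (auto simp: pairs_simps hom_cat_def)
    from n obtain \<kappa> \<kappa>' where \<kappa>: "\<kappa> \<in> Cell K" "\<kappa>' \<in> Cell K" "Src K \<kappa> = h \<cdot> q" "Tgt K \<kappa> = r" "Src K \<kappa>' = r"
        "Tgt K \<kappa>' = h \<cdot> q"
      "(\<kappa> \<rhd> cd_d1 X) \<bullet> (h \<lhd> \<xi>) = \<rho> \<bullet> (\<kappa> \<rhd> cd_d0 X)" "\<kappa>' \<bullet> \<kappa> = Id2 K (h \<cdot> q)" "\<kappa> \<bullet> \<kappa>' = Id2 K r"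
      by (auto simp: cat_iso_def pairs_simps)
    have "iso2 \<kappa>" by (rule cell_inv_eqI[where \<tau> = \<kappa>']) (use \<kappa> in auto)
    then show ?thesis using \<kappa> h by blast
  qed
qed

end

section \<open>Oplax bicolimits of codescent objects\<close>

text \<open>The \<open>a i : X i \<rightarrow> F i\<close> are quotients of codescent objects that vary pseudonaturally in \<open>i\<close>, with
  levels \<open>G0\<close>, \<open>G1\<close>, \<open>G2\<close>; the cells \<open>\<delta>0\<close> and \<open>\<delta>1\<close> express the pseudonaturality of \<open>d\<^sub>0\<close> and \<open>d\<^sub>1\<close>.
  The codescent object \<open>Y\<close> is their levelwise oplax bicolimit, with inclusions \<open>m i\<close>, and \<open>(P, \<psi>)\<close> is
  its bicoequalizer.\<close>

locale codescent_colimit = diagram K I F + N0: diagram K I G0 + N1: diagram K I G1 + N2: diagram K I G2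
  for K :: "('o, 'a, 'c) two_cat" (structure) and I :: "('i, 'd, 's) two_cat"
    and F G0 G1 G2 :: "('i, 'd, 's, 'o, 'a, 'c) two_fun" +
  fixes X :: "'i \<Rightarrow> ('o, 'a, 'c) codescent" and Y :: "('o, 'a, 'c) codescent"
    and m :: "'i \<Rightarrow> ('a, 'c) codescent_mor"
    and a :: "'i \<Rightarrow> 'a" and \<alpha> :: "'i \<Rightarrow> 'c" and \<phi> \<delta>0 \<delta>1 x0d x1d x2d :: "'d \<Rightarrow> 'c"
    and Z :: 'o and P :: 'a and \<psi> :: 'c and l :: "'i \<Rightarrow> 'a" and \<chi> :: "'i \<Rightarrow> 'c" and ld :: "'d \<Rightarrow> 'c"
  assumes levels: "i \<in> Obj I \<Longrightarrow> lev0 (X i) = on_obj G0 i" "i \<in> Obj I \<Longrightarrow> lev1 (X i) = on_obj G1 i"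
      "i \<in> Obj I \<Longrightarrow> lev2 (X i) = on_obj G2 i"
    and X_codescent: "i \<in> Obj I \<Longrightarrow> codescent_object K (X i)" and Y_codescent: "codescent_object K Y"
    and Xa: "i \<in> Obj I \<Longrightarrow> is_pair (X i) (on_obj F i) (a i) (\<alpha> i)"
    and a_faithful: "\<sigma> \<rhd> a i = \<tau> \<rhd> a i \<Longrightarrow> i \<in> Obj I \<Longrightarrow> \<sigma> \<in> Cell K \<Longrightarrow> \<tau> \<in> Cell K \<Longrightarrow> Src K \<tau> = Src K \<sigma> \<Longrightarrow>
        Tgt K \<tau> = Tgt K \<sigma> \<Longrightarrow> Dom K (Src K \<sigma>) = on_obj F i \<Longrightarrow> \<sigma> = \<tau>"
    and a_full: "i \<in> Obj I \<Longrightarrow> h \<in> Arr K \<Longrightarrow> k \<in> Arr K \<Longrightarrow> Dom K h = on_obj F i \<Longrightarrow> Dom K k = on_obj F i \<Longrightarrow> Cod K k =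
        Cod K h \<Longrightarrow>
        \<Gamma> \<in> Cell K \<Longrightarrow> Src K \<Gamma> = h \<cdot> a i \<Longrightarrow> Tgt K \<Gamma> = k \<cdot> a i \<Longrightarrow>
        (\<Gamma> \<rhd> cd_d1 (X i)) \<bullet> (h \<lhd> \<alpha> i) = (k \<lhd> \<alpha> i) \<bullet> (\<Gamma> \<rhd> cd_d0 (X i)) \<Longrightarrow>
        \<exists>\<sigma>\<in>Cell K. Src K \<sigma> = h \<and> Tgt K \<sigma> = k \<and> \<sigma> \<rhd> a i = \<Gamma>"
    and phi: "d \<in> Arr I \<Longrightarrow> iso2 (\<phi> d)" "d \<in> Arr I \<Longrightarrow> Src K (\<phi> d) = a (Cod I d) \<cdot> on_arr G0 d"
      "d \<in> Arr I \<Longrightarrow> Tgt K (\<phi> d) = on_arr F d \<cdot> a (Dom I d)"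
    and phi_Id1: "i \<in> Obj I \<Longrightarrow> \<phi> (Id1 I i) = Id2 K (a i)"
    and phi_Comp1: "d \<in> Arr I \<Longrightarrow> e \<in> Arr I \<Longrightarrow> Cod I d = Dom I e \<Longrightarrow>
        \<phi> (e \<cdot>\<^bsub>I\<^esub> d) = (on_arr F e \<lhd> \<phi> d) \<bullet> (\<phi> e \<rhd> on_arr G0 d)"
    and phi_cell: "s \<in> Cell I \<Longrightarrow> \<phi> (Tgt I s) \<bullet> (a (Cod I (Src I s)) \<lhd> on_cell G0 s) =
        (on_cell F s \<rhd> a (Dom I (Src I s))) \<bullet> \<phi> (Src I s)"
    and delta: "d \<in> Arr I \<Longrightarrow> \<delta>0 d \<in> Cell K" "d \<in> Arr I \<Longrightarrow> Src K (\<delta>0 d) = cd_d0 (X (Cod I d)) \<cdot> on_arr G1 d"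
      "d \<in> Arr I \<Longrightarrow> Tgt K (\<delta>0 d) = on_arr G0 d \<cdot> cd_d0 (X (Dom I d))"
      "d \<in> Arr I \<Longrightarrow> \<delta>1 d \<in> Cell K" "d \<in> Arr I \<Longrightarrow> Src K (\<delta>1 d) = cd_d1 (X (Cod I d)) \<cdot> on_arr G1 d"
      "d \<in> Arr I \<Longrightarrow> Tgt K (\<delta>1 d) = on_arr G0 d \<cdot> cd_d1 (X (Dom I d))"
    and phi_alpha: "d \<in> Arr I \<Longrightarrow>
        (on_arr F d \<lhd> \<alpha> (Dom I d)) \<bullet> (\<phi> d \<rhd> cd_d0 (X (Dom I d))) \<bullet> (a (Cod I d) \<lhd> \<delta>0 d) =
        (\<phi> d \<rhd> cd_d1 (X (Dom I d))) \<bullet> (a (Cod I d) \<lhd> \<delta>1 d) \<bullet> (\<alpha> (Cod I d) \<rhd> on_arr G1 d)"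
    and bicolim0: "is_oplax_bicolimit K I G0 (lev0 Y) (\<lambda>i. cm0 (m i)) x0d"
    and bicolim1: "is_oplax_bicolimit K I G1 (lev1 Y) (\<lambda>i. cm1 (m i)) x1d"
    and bicolim2: "is_oplax_bicolimit K I G2 (lev2 Y) (\<lambda>i. cm2 (m i)) x2d"
    and m_typing: "i \<in> Obj I \<Longrightarrow> iso_cell K (cm_d0 (m i)) (cd_d0 Y \<cdot> cm1 (m i)) (cm0 (m i) \<cdot> cd_d0 (X i))"
      "i \<in> Obj I \<Longrightarrow> iso_cell K (cm_d1 (m i)) (cd_d1 Y \<cdot> cm1 (m i)) (cm0 (m i) \<cdot> cd_d1 (X i))"
      "i \<in> Obj I \<Longrightarrow> iso_cell K (cm_i (m i)) (cd_i Y \<cdot> cm0 (m i)) (cm1 (m i) \<cdot> cd_i (X i))"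
      "i \<in> Obj I \<Longrightarrow> iso_cell K (cm_p0 (m i)) (cd_p0 Y \<cdot> cm2 (m i)) (cm1 (m i) \<cdot> cd_p0 (X i))"
      "i \<in> Obj I \<Longrightarrow> iso_cell K (cm_p1 (m i)) (cd_p1 Y \<cdot> cm2 (m i)) (cm1 (m i) \<cdot> cd_p1 (X i))"
      "i \<in> Obj I \<Longrightarrow> iso_cell K (cm_p2 (m i)) (cd_p2 Y \<cdot> cm2 (m i)) (cm1 (m i) \<cdot> cd_p2 (X i))"
    and m_n0: "i \<in> Obj I \<Longrightarrow> cd_n0 Y \<rhd> cm0 (m i) =
        (cm0 (m i) \<lhd> cd_n0 (X i)) \<bullet> (cm_d0 (m i) \<rhd> cd_i (X i)) \<bullet> (cd_d0 Y \<lhd> cm_i (m i))"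
    and m_n1: "i \<in> Obj I \<Longrightarrow> cd_n1 Y \<rhd> cm0 (m i) =
        (cm0 (m i) \<lhd> cd_n1 (X i)) \<bullet> (cm_d1 (m i) \<rhd> cd_i (X i)) \<bullet> (cd_d1 Y \<lhd> cm_i (m i))"
    and m_\<theta>01: "i \<in> Obj I \<Longrightarrow>
        (cm_d0 (m i) \<rhd> cd_p1 (X i)) \<bullet> (cd_d0 Y \<lhd> cm_p1 (m i)) \<bullet> (cd_\<theta>01 Y \<rhd> cm2 (m i)) =
        (cm0 (m i) \<lhd> cd_\<theta>01 (X i)) \<bullet> (cm_d0 (m i) \<rhd> cd_p0 (X i)) \<bullet> (cd_d0 Y \<lhd> cm_p0 (m i))"
    and m_\<theta>02: "i \<in> Obj I \<Longrightarrow>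
        (cm_d0 (m i) \<rhd> cd_p2 (X i)) \<bullet> (cd_d0 Y \<lhd> cm_p2 (m i)) \<bullet> (cd_\<theta>02 Y \<rhd> cm2 (m i)) =
        (cm0 (m i) \<lhd> cd_\<theta>02 (X i)) \<bullet> (cm_d1 (m i) \<rhd> cd_p0 (X i)) \<bullet> (cd_d1 Y \<lhd> cm_p0 (m i))"
    and m_\<theta>12: "i \<in> Obj I \<Longrightarrow>
        (cm_d1 (m i) \<rhd> cd_p2 (X i)) \<bullet> (cd_d1 Y \<lhd> cm_p2 (m i)) \<bullet> (cd_\<theta>12 Y \<rhd> cm2 (m i)) =
        (cm0 (m i) \<lhd> cd_\<theta>12 (X i)) \<bullet> (cm_d1 (m i) \<rhd> cd_p1 (X i)) \<bullet> (cd_d1 Y \<lhd> cm_p1 (m i))"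
    and x0d_modif: "d \<in> Arr I \<Longrightarrow>
        (x0d d \<rhd> cd_d0 (X (Dom I d))) \<bullet> (cm0 (m (Cod I d)) \<lhd> \<delta>0 d) \<bullet> (cm_d0 (m (Cod I d)) \<rhd> on_arr G1 d) =
        cm_d0 (m (Dom I d)) \<bullet> (cd_d0 Y \<lhd> x1d d)"
      "d \<in> Arr I \<Longrightarrow>
        (x0d d \<rhd> cd_d1 (X (Dom I d))) \<bullet> (cm0 (m (Cod I d)) \<lhd> \<delta>1 d) \<bullet> (cm_d1 (m (Cod I d)) \<rhd> on_arr G1 d) =
        cm_d1 (m (Dom I d)) \<bullet> (cd_d1 Y \<lhd> x1d d)"
    and bicoeq: "is_bicoequalizer K Y Z P \<psi>"
    and l_map: "i \<in> Obj I \<Longrightarrow> is_bicoeq_map K (X i) (m i) (on_obj F i) (a i) (\<alpha> i) Z P \<psi> (l i) (\<chi> i)"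
    and ld_typing: "d \<in> Arr I \<Longrightarrow> cell K (ld d) (l (Cod I d) \<cdot> on_arr F d) (l (Dom I d))"
    and ld_eq: "d \<in> Arr I \<Longrightarrow> (ld d \<rhd> a (Dom I d)) \<bullet> (l (Cod I d) \<lhd> \<phi> d) \<bullet> (\<chi> (Cod I d) \<rhd> on_arr G0 d) =
        \<chi> (Dom I d) \<bullet> (P \<lhd> x0d d)"
begin

lemmas [simp] = levels codescent_objectD[OF X_codescent] codescent_objectD[OF Y_codescent]

lemma a_typing [simp]:
  assumes "i \<in> Obj I"
  shows "a i \<in> Arr K" "Dom K (a i) = on_obj G0 i" "Cod K (a i) = on_obj F i" "iso2 (\<alpha> i)"
    "Src K (\<alpha> i) = a i \<cdot> cd_d0 (X i)" "Tgt K (\<alpha> i) = a i \<cdot> cd_d1 (X i)"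
  using Xa[OF assms] levels[OF assms] by (simp_all add: is_pair_def)

lemmas [simp] = phi delta N0.is_coconeD(1-7)[OF N0.bicolimit_cocone[OF bicolim0]]
  N1.is_coconeD(1-7)[OF N1.bicolimit_cocone[OF bicolim1]] N2.is_coconeD(1-7)[OF N2.bicolimit_cocone[OF
      bicolim2]]
  m_typing[THEN iso_cellD, THEN conjunct1] m_typing[THEN iso_cellD, THEN conjunct2, THEN conjunct1]
  m_typing[THEN iso_cellD, THEN conjunct2, THEN conjunct2]

lemma Z_typing [simp]:
  "P \<in> Arr K" "Dom K P = lev0 Y" "Cod K P = Z" "iso2 \<psi>" "Src K \<psi> = P \<cdot> cd_d0 Y" "Tgt K \<psi> = P \<cdot> cd_d1 Y"
      "Z \<in> Obj K"
proof -
  have "is_pair Y Z P \<psi>" by (rule bicoequalizer_pair[OF _ _ _ _ _ _ bicoeq]) simp_all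
  then show 1: "P \<in> Arr K" "Dom K P = lev0 Y" "Cod K P = Z" "iso2 \<psi>" "Src K \<psi> = P \<cdot> cd_d0 Y" "Tgt K \<psi> =
      P \<cdot> cd_d1 Y"
    by (simp_all add: is_pair_def)
  show "Z \<in> Obj K" using 1(1,3) dom_cod_obj by blast
qed

lemma l_typing [simp]:
  assumes "i \<in> Obj I"
  shows "l i \<in> Arr K" "Dom K (l i) = on_obj F i" "Cod K (l i) = Z" "iso2 (\<chi> i)" "Src K (\<chi> i) = P \<cdot> cm0 (m i)"
      "Tgt K (\<chi> i) = l i \<cdot> a i"
  using l_map[OF assms] by (simp_all add: is_bicoeq_map_def iso_cell_iff)

lemma l_eq: "i \<in> Obj I \<Longrightarrow> (l i \<lhd> \<alpha> i) \<bullet> (\<chi> i \<rhd> cd_d0 (X i)) \<bullet> (P \<lhd> cm_d0 (m i)) =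
     (\<chi> i \<rhd> cd_d1 (X i)) \<bullet> (P \<lhd> cm_d1 (m i)) \<bullet> (\<psi> \<rhd> cm1 (m i))"
  using l_map by (simp add: is_bicoeq_map_def)

lemma ld_typing' [simp]:
  assumes "d \<in> Arr I"
  shows "ld d \<in> Cell K" "Src K (ld d) = l (Cod I d) \<cdot> on_arr F d" "Tgt K (ld d) = l (Dom I d)"
  using ld_typing[OF assms] by simp_all

lemmas [simp] = F.fun_id2 N0.F.fun_id2

text \<open>Each cocone law is tested after precomposition with the a i. There \<open>ld_eq\<close>
  translates it into the corresponding law of \<open>x0d\<close>, combined with the pseudonaturality
  of \<phi>.\<close>

lemma l_cocone: "is_cocone Z l ld"
  unfolding is_cocone_def
proof (intro conjI ballI impI)
  fix i assume i [simp]: "i \<in> Obj I"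
  have "(ld (Id1 I i) \<rhd> a i) \<bullet> \<chi> i = Id2 K (l i \<cdot> a i) \<bullet> \<chi> i"
    using ld_eq[of "Id1 I i"] N0.is_cocone_Id1[OF N0.bicolimit_cocone[OF bicolim0], of i]
    by (simp add: phi_Id1)
  then have "ld (Id1 I i) \<rhd> a i = Id2 K (l i \<cdot> a i)" by (rule cancel_right) simp_all
  then have "ld (Id1 I i) \<rhd> a i = Id2 K (l i) \<rhd> a i" by simp
  then show "ld (Id1 I i) = Id2 K (l i)"
    by (rule a_faithful) simp_all
next
  fix d e assume d [simp]: "d \<in> Arr I" "e \<in> Arr I" "Cod I d = Dom I e"
  note E1 = ld_eq[of d, simplified] 
  note E2 = arg_cong[OF ld_eq[of e], of "\<lambda>z. z \<rhd> on_arr G0 d", simplified]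
  note E3 = ld_eq[of "e \<cdot>\<^bsub>I\<^esub> d", simplified, unfolded phi_Comp1[OF d] N0.is_cocone_Comp1[OF
      N0.bicolimit_cocone[OF bicolim0] d]]
  note ex = exchange[of "\<phi> d" "ld e", simplified, symmetric]
  \<comment> \<open>This invertible composite of \<chi> and the two cells \<phi> is the comparison
    that both sides share in \<open>ld_eq\<close>.\<close>
  let ?R = "(l (Cod I e) \<cdot> on_arr F e \<lhd> \<phi> d) \<bullet> (l (Cod I e) \<lhd> \<phi> e \<rhd> on_arr G0 d) \<bullet>
      (\<chi> (Cod I e) \<rhd> on_arr G0 e \<cdot> on_arr G0 d)"
  have "(ld (e \<cdot>\<^bsub>I\<^esub> d) \<rhd> a (Dom I d)) \<bullet> ?R = \<chi> (Dom I d) \<bullet> (P \<lhd> x0d d) \<bullet> (P \<lhd> x0d e \<rhd> on_arr G0 d)"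
    using E3 by simp
  also have "\<dots> = (ld d \<rhd> a (Dom I d)) \<bullet> (ld e \<rhd> on_arr F d \<cdot> a (Dom I d)) \<bullet> ?R"
    by (simp add: reassoc[OF E1[symmetric]] E2[symmetric] reassoc[OF ex])
  finally have "(ld (e \<cdot>\<^bsub>I\<^esub> d) \<rhd> a (Dom I d)) \<bullet> ?R = ((ld d \<bullet> (ld e \<rhd> on_arr F d)) \<rhd> a (Dom I d)) \<bullet> ?R"
    by simp
  then have "ld (e \<cdot>\<^bsub>I\<^esub> d) \<rhd> a (Dom I d) = (ld d \<bullet> (ld e \<rhd> on_arr F d)) \<rhd> a (Dom I d)"
    by (rule cancel_right) simp_all
  then show "ld (e \<cdot>\<^bsub>I\<^esub> d) = ld d \<bullet> (ld e \<rhd> on_arr F d)"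
    by (rule a_faithful) simp_all
next
  fix s assume s [simp]: "s \<in> Cell I"
  let ?i = "Dom I (Src I s)" and ?j = "Cod I (Src I s)"
  note E1 = ld_eq[of "Src I s", simplified] and E2 = ld_eq[of "Tgt I s", simplified]
  note ph = arg_cong[OF phi_cell[OF s], of "\<lambda>z. l ?j \<lhd> z", simplified, symmetric]
  note x = arg_cong[OF N0.is_cocone_cell[OF N0.bicolimit_cocone[OF bicolim0] s], of "\<lambda>z. P \<lhd> z", simplified]
  note ex = exchange[of "on_cell G0 s" "\<chi> ?j", simplified]
  let ?R = "(l ?j \<lhd> \<phi> (Src I s)) \<bullet> (\<chi> ?j \<rhd> on_arr G0 (Src I s))"
  have "(ld (Tgt I s) \<rhd> a ?i) \<bullet> (l ?j \<lhd> on_cell F s \<rhd> a ?i) \<bullet> ?R = \<chi> ?i \<bullet> (P \<lhd> x0d (Tgt I s)) \<bullet>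
      (P \<cdot> cm0 (m ?j) \<lhd> on_cell G0 s)"
    by (simp add: reassoc[OF ph] ex[symmetric] reassoc3[OF E2])
  also have "\<dots> = (ld (Src I s) \<rhd> a ?i) \<bullet> ?R"
    by (simp add: x E1)
  finally have "((ld (Tgt I s) \<bullet> (l ?j \<lhd> on_cell F s)) \<rhd> a ?i) \<bullet> ?R = (ld (Src I s) \<rhd> a ?i) \<bullet> ?R" by simp
  then have "(ld (Tgt I s) \<bullet> (l ?j \<lhd> on_cell F s)) \<rhd> a ?i = ld (Src I s) \<rhd> a ?i" by (rule cancel_right)
      simp_all
  then show "ld (Tgt I s) \<bullet> (l ?j \<lhd> on_cell F s) = ld (Src I s)" by (rule a_faithful) simp_all
qed simp_all

text \<open>The cells \<chi> identify \<open>l i \<cdot> a i\<close> with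
  \<open>P \<cdot> cm0 (m i)\<close>. Hence equality on the l i gives equality on the inclusions
  after P, then on P, and finally on Z.\<close>

lemma l_faithful:
  assumes eq: "\<And>i. i \<in> Obj I \<Longrightarrow> \<sigma> \<rhd> l i = \<tau> \<rhd> l i" and \<sigma>: "\<sigma> \<in> Cell K" "\<tau> \<in> Cell K" "Src K \<tau> = Src K \<sigma>"
        "Tgt K \<tau> = Tgt K \<sigma>" "Dom K (Src K \<sigma>) = Z"
  shows "\<sigma> = \<tau>"
proof -
  note [simp] = \<sigma>
  have "\<sigma> \<rhd> P = \<tau> \<rhd> P"
  proof (rule N0.bicolimit_faithful[OF bicolim0])
    fix i assume i [simp]: "i \<in> Obj I"
    have "(Tgt K \<sigma> \<lhd> \<chi> i) \<bullet> (\<sigma> \<rhd> P \<cdot> cm0 (m i)) = (Tgt K \<sigma> \<lhd> \<chi> i) \<bullet> (\<tau> \<rhd> P \<cdot> cm0 (m i))"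
      using exchange[of "\<chi> i" \<sigma>] exchange[of "\<chi> i" \<tau>] arg_cong[OF eq[OF i], of "\<lambda>z. z \<rhd> a i", simplified]
          by simp
    then have "\<sigma> \<rhd> P \<cdot> cm0 (m i) = \<tau> \<rhd> P \<cdot> cm0 (m i)" by (rule cancel_left) simp_all
    then show "\<sigma> \<rhd> P \<rhd> cm0 (m i) = \<tau> \<rhd> P \<rhd> cm0 (m i)" by simp
  qed simp_all
  then show ?thesis by (rule bicoequalizer_faithful[OF _ _ _ _ _ _ bicoeq, rotated 6]) simp_all
qed

text \<open>The modification is restricted along the a i, glued over level 0 of Y, and descended
  along P. The compatibility with \<psi> required for the descent is inherited from the exchange of
  \<Gamma> with \<alpha>.\<close>

lemma l_full:
  assumes h: "h \<in> Arr K" "k \<in> Arr K" "Dom K h = Z" "Dom K k = Z" "Cod K k = Cod K h"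
    and \<Gamma>: "is_modification ((\<lambda>i. h \<cdot> l i), (\<lambda>d. h \<lhd> ld d)) ((\<lambda>i. k \<cdot> l i), (\<lambda>d. k \<lhd> ld d)) \<Gamma>"
  shows "\<exists>\<sigma>\<in>Cell K. Src K \<sigma> = h \<and> Tgt K \<sigma> = k \<and> (\<forall>i\<in>Obj I. \<sigma> \<rhd> l i = \<Gamma> i)"
proof -
  note [simp] = h
  have [simp]: "\<And>i. i \<in> Obj I \<Longrightarrow> \<Gamma> i \<in> Cell K" "\<And>i. i \<in> Obj I \<Longrightarrow> Src K (\<Gamma> i) = h \<cdot> l i" "\<And>i. i \<in> Obj I \<Longrightarrow>
      Tgt K (\<Gamma> i) = k \<cdot> l i"
    and \<Gamma>eq: "\<And>d. d \<in> Arr I \<Longrightarrow> \<Gamma> (Dom I d) \<bullet> (h \<lhd> ld d) = (k \<lhd> ld d) \<bullet> (\<Gamma> (Cod I d) \<rhd> on_arr F d)"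
    using \<Gamma> by (auto simp: is_modification_def)
  \<comment> \<open>The cell \<open>\<Gamma> i \<rhd> a i\<close>, conjugated by \<chi>, becomes a
    cell between restrictions of \<open>h \<cdot> P\<close> and \<open>k \<cdot> P\<close>.\<close>
  define s where "s i = (k \<lhd> inv2 (\<chi> i)) \<bullet> (\<Gamma> i \<rhd> a i) \<bullet> (h \<lhd> \<chi> i)" for i
  have s_typing: "s i \<in> Cell K" "Src K (s i) = h \<cdot> P \<cdot> cm0 (m i)" "Tgt K (s i) = k \<cdot> P \<cdot> cm0 (m i)"
      if "i \<in> Obj I" for i
    using that by (simp_all add: s_def)
  have "N0.is_modification ((\<lambda>i. (h \<cdot> P) \<cdot> cm0 (m i)), (\<lambda>d. h \<cdot> P \<lhd> x0d d)) ((\<lambda>i. (k \<cdot> P) \<cdot> cm0 (m i)),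
      (\<lambda>d. k \<cdot> P \<lhd> x0d d)) s"
    unfolding N0.is_modification_def
  proof (intro conjI ballI)
    fix d assume d [simp]: "d \<in> Arr I"
    let ?i = "Dom I d" and ?j = "Cod I d"
    note hLD = arg_cong[OF ld_eq[OF d], of "\<lambda>z. h \<lhd> z", simplified, symmetric]
    note kLD = arg_cong[OF ld_eq[OF d], of "\<lambda>z. k \<lhd> z", simplified, symmetric]
    note G = arg_cong[OF \<Gamma>eq[OF d], of "\<lambda>z. z \<rhd> a ?i", simplified]
    note ex = exchange[of "\<phi> d" "\<Gamma> ?j", simplified]
    have "(k \<lhd> \<chi> ?i) \<bullet> s ?i \<bullet> (h \<cdot> P \<lhd> x0d d) = (k \<lhd> \<chi> ?i) \<bullet> (k \<cdot> P \<lhd> x0d d) \<bullet> (s ?j \<rhd> on_arr G0 d)"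
      by (simp add: s_def hLD reassoc[OF kLD] reassoc[OF G] reassoc[OF ex])
    then have "s ?i \<bullet> (h \<cdot> P \<lhd> x0d d) = (k \<cdot> P \<lhd> x0d d) \<bullet> (s ?j \<rhd> on_arr G0 d)"
      by (rule cancel_left) (simp_all add: s_typing)
    then show "s ?i \<bullet> snd (\<lambda>i. (h \<cdot> P) \<cdot> cm0 (m i), \<lambda>d. h \<cdot> P \<lhd> x0d d) d =
        snd (\<lambda>i. (k \<cdot> P) \<cdot> cm0 (m i), \<lambda>d. k \<cdot> P \<lhd> x0d d) d \<bullet> (s ?j \<rhd> on_arr G0 d)" by simp
  qed (simp_all add: s_typing)
  then obtain S where S [simp]: "S \<in> Cell K" "Src K S = h \<cdot> P" "Tgt K S = k \<cdot> P" and Ss: "\<And>i. i \<in> Obj I \<Longrightarrow>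
      S \<rhd> cm0 (m i) = s i"
    using N0.bicolimit_full[OF bicolim0, of "h \<cdot> P" "k \<cdot> P" s] by auto
  have SG: "(k \<lhd> \<chi> i) \<bullet> (S \<rhd> cm0 (m i)) = (\<Gamma> i \<rhd> a i) \<bullet> (h \<lhd> \<chi> i)" if "i \<in> Obj I" for i
    using that by (simp add: Ss s_def)
  \<comment> \<open>Compatibility with \<psi> is tested on the inclusions of level 1, where
    \<open>l_eq\<close> exchanges \<psi> for \<open>\<alpha> i\<close>.\<close>
  have "(S \<rhd> cd_d1 Y) \<bullet> (h \<lhd> \<psi>) = (k \<lhd> \<psi>) \<bullet> (S \<rhd> cd_d0 Y)"
  proof (rule N1.bicolimit_faithful[OF bicolim1])
    fix i assume i [simp]: "i \<in> Obj I"
    note L = l_eq[OF i]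
    note hL = arg_cong[OF L, of "\<lambda>z. h \<lhd> z", simplified, symmetric]
    note kL = arg_cong[OF L, of "\<lambda>z. k \<lhd> z", simplified, symmetric]
    note S0 = arg_cong[OF SG[OF i], of "\<lambda>z. z \<rhd> cd_d0 (X i)", simplified]
    note S1 = arg_cong[OF SG[OF i], of "\<lambda>z. z \<rhd> cd_d1 (X i)", simplified]
    note e0 = exchange[of "cm_d0 (m i)" S, simplified, symmetric]
    note e1 = exchange[of "cm_d1 (m i)" S, simplified, symmetric]
    note e = exchange[of "\<alpha> i" "\<Gamma> i", simplified]
    let ?W = "(k \<lhd> \<chi> i \<rhd> cd_d1 (X i)) \<bullet> (k \<cdot> P \<lhd> cm_d1 (m i))"
    have "?W \<bullet> (S \<rhd> cd_d1 Y \<cdot> cm1 (m i)) \<bullet> (h \<lhd> \<psi> \<rhd> cm1 (m i)) =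
       (\<Gamma> i \<rhd> a i \<cdot> cd_d1 (X i)) \<bullet> (h \<lhd> \<chi> i \<rhd> cd_d1 (X i)) \<bullet> (h \<cdot> P \<lhd> cm_d1 (m i)) \<bullet> (h \<lhd> \<psi> \<rhd> cm1 (m i))"
      by (simp add: reassoc[OF e1] reassoc[OF S1])
    also have "\<dots> = ?W \<bullet> (k \<lhd> \<psi> \<rhd> cm1 (m i)) \<bullet> (S \<rhd> cd_d0 Y \<cdot> cm1 (m i))"
      by (simp add: hL reassoc3[OF kL] reassoc[OF e] e0 reassoc[OF S0])
    finally have "?W \<bullet> (((S \<rhd> cd_d1 Y) \<bullet> (h \<lhd> \<psi>)) \<rhd> cm1 (m i)) = ?W \<bullet> (((k \<lhd> \<psi>) \<bullet> (S \<rhd> cd_d0 Y)) \<rhd> cm1 (m i))"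
        by simp
    then show "((S \<rhd> cd_d1 Y) \<bullet> (h \<lhd> \<psi>)) \<rhd> cm1 (m i) = ((k \<lhd> \<psi>) \<bullet> (S \<rhd> cd_d0 Y)) \<rhd> cm1 (m i)"
        by (rule cancel_left) simp_all
  qed simp_all
  then obtain \<sigma> where \<sigma> [simp]: "\<sigma> \<in> Cell K" "Src K \<sigma> = h" "Tgt K \<sigma> = k" and \<sigma>P: "\<sigma> \<rhd> P = S"
    using bicoequalizer_full[OF _ _ _ _ _ _ bicoeq, of h k S] by auto
  have "\<sigma> \<rhd> l i = \<Gamma> i" if i [simp]: "i \<in> Obj I" for i
  proof -
    have "(\<sigma> \<rhd> l i \<cdot> a i) \<bullet> (h \<lhd> \<chi> i) = (\<Gamma> i \<rhd> a i) \<bullet> (h \<lhd> \<chi> i)"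
      using exchange[of "\<chi> i" \<sigma>] SG[OF i, folded \<sigma>P] by simp
    then have "\<sigma> \<rhd> l i \<cdot> a i = \<Gamma> i \<rhd> a i" by (rule cancel_right) simp_all
    then have "\<sigma> \<rhd> l i \<rhd> a i = \<Gamma> i \<rhd> a i" by simp
    then show ?thesis by (rule a_faithful) simp_all
  qed
  then show ?thesis using \<sigma> by blast
qed

text \<open>The inverse of the whiskered cell still satisfies the descent condition with respect to
  \<open>\<alpha> i\<close>, so it descends; faithfulness makes the result inverse to
  \<sigma>.\<close>

lemma a_iso:
  assumes i [simp]: "i \<in> Obj I" and \<sigma>: "\<sigma> \<in> Cell K" "Dom K (Src K \<sigma>) = on_obj F i" and iso: "iso2 (\<sigma> \<rhd> a i)"
  shows "iso2 \<sigma>"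
proof -
  obtain h k A where hk: "Src K \<sigma> = h" "Tgt K \<sigma> = k" and A: "A = \<sigma> \<rhd> a i" by simp
  have "h \<in> Arr K" "k \<in> Arr K" "Dom K h = on_obj F i" "Dom K k = on_obj F i" "Cod K k = Cod K h"
    using Src_Tgt_typing[OF \<sigma>(1)] \<sigma>(2) hk by auto
  note [simp] = this hk \<sigma>(1)
  have [simp]: "iso2 A" "Src K A = h \<cdot> a i" "Tgt K A = k \<cdot> a i" using iso by (simp_all add: A)
  have *: "(A \<rhd> cd_d1 (X i)) \<bullet> (h \<lhd> \<alpha> i) = (k \<lhd> \<alpha> i) \<bullet> (A \<rhd> cd_d0 (X i))"
    using exchange[of "\<alpha> i" \<sigma>] by (simp add: A)
  have "(A \<rhd> cd_d1 (X i)) \<bullet> ((inv2 A \<rhd> cd_d1 (X i)) \<bullet> (k \<lhd> \<alpha> i)) \<bullet> (A \<rhd> cd_d0 (X i)) =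
      (A \<rhd> cd_d1 (X i)) \<bullet> ((h \<lhd> \<alpha> i) \<bullet> (inv2 A \<rhd> cd_d0 (X i))) \<bullet> (A \<rhd> cd_d0 (X i))"
    by (simp add: *)
  then have "((inv2 A \<rhd> cd_d1 (X i)) \<bullet> (k \<lhd> \<alpha> i)) \<bullet> (A \<rhd> cd_d0 (X i)) =
      ((h \<lhd> \<alpha> i) \<bullet> (inv2 A \<rhd> cd_d0 (X i))) \<bullet> (A \<rhd> cd_d0 (X i))"
    by (rule cancel_left) simp_all
  then have "(inv2 A \<rhd> cd_d1 (X i)) \<bullet> (k \<lhd> \<alpha> i) = (h \<lhd> \<alpha> i) \<bullet> (inv2 A \<rhd> cd_d0 (X i))"
    by (rule cancel_right) simp_all
  then obtain \<tau> where \<tau> [simp]: "\<tau> \<in> Cell K" "Src K \<tau> = k" "Tgt K \<tau> = h" and \<tau>A: "\<tau> \<rhd> a i = inv2 A"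
    using a_full[OF i, of k h "inv2 A"] by auto
  show ?thesis
  proof (rule cell_inv_eqI[where \<tau> = \<tau>])
    show "\<tau> \<bullet> \<sigma> = Id2 K (Src K \<sigma>)" "\<sigma> \<bullet> \<tau> = Id2 K (Tgt K \<sigma>)"
      by (rule a_faithful[OF _ i]; simp add: \<tau>A A[symmetric])+
  qed simp_all
qed

text \<open>An oplax cocone on F is pulled back to one on G0 along the pseudonatural family
  a.\<close>

lemma a_cocone:
  assumes r: "is_cocone B r rd"
  shows "N0.is_cocone B (\<lambda>i. r i \<cdot> a i) (\<lambda>d. (rd d \<rhd> a (Dom I d)) \<bullet> (r (Cod I d) \<lhd> \<phi> d))"
proof -
  note [simp] = is_coconeD(1-7)[OF r]
  show ?thesis
    unfolding N0.is_cocone_def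
  proof (intro conjI ballI impI)
    fix i assume [simp]: "i \<in> Obj I"
    show "(rd (Id1 I i) \<rhd> a (Dom I (Id1 I i))) \<bullet> (r (Cod I (Id1 I i)) \<lhd> \<phi> (Id1 I i)) = Id2 K (r i \<cdot> a i)"
      by (simp add: phi_Id1 is_cocone_Id1[OF r])
  next
    fix d e assume d [simp]: "d \<in> Arr I" "e \<in> Arr I" "Cod I d = Dom I e"
    note ex = exchange[of "\<phi> d" "rd e", simplified]
    show "(rd (e \<cdot>\<^bsub>I\<^esub> d) \<rhd> a (Dom I (e \<cdot>\<^bsub>I\<^esub> d))) \<bullet> (r (Cod I (e \<cdot>\<^bsub>I\<^esub> d)) \<lhd> \<phi> (e \<cdot>\<^bsub>I\<^esub> d)) =
       ((rd d \<rhd> a (Dom I d)) \<bullet> (r (Cod I d) \<lhd> \<phi> d)) \<bullet> (((rd e \<rhd> a (Dom I e)) \<bullet> (r (Cod I e) \<lhd> \<phi> e)) \<rhd> on_arr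
           G0 d)"
      by (simp add: phi_Comp1[OF d] is_cocone_Comp1[OF r d] reassoc[OF ex])
  next
    fix s assume s [simp]: "s \<in> Cell I"
    let ?i = "Dom I (Src I s)" and ?j = "Cod I (Src I s)"
    note ph = arg_cong[OF phi_cell[OF s], of "\<lambda>z. r ?j \<lhd> z", simplified]
    note c = arg_cong[OF is_cocone_cell[OF r s], of "\<lambda>z. z \<rhd> a ?i", simplified]
    show "((rd (Tgt I s) \<rhd> a (Dom I (Tgt I s))) \<bullet> (r (Cod I (Tgt I s)) \<lhd> \<phi> (Tgt I s))) \<bullet>
        (r ?j \<cdot> a ?j \<lhd> on_cell G0 s) =
      (rd (Src I s) \<rhd> a ?i) \<bullet> (r ?j \<lhd> \<phi> (Src I s))"
      by (simp add: ph reassoc[OF c])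
  qed simp_all
qed

text \<open>The pulled back cocone \<open>r i \<cdot> a i\<close> is represented by some H on level
  0 of Y, and the cells \<open>r i \<lhd> \<alpha> i\<close> glue to an invertible \<xi> making H a
  pseudocoequalizing pair. The 1-cell h is the one induced by this pair. Its comparison with the r i
  is known only after precomposition with the a i and must be descended.\<close>

lemma l_ess_surj:
  assumes r: "is_cocone B r rd"
  shows "\<exists>h\<in>Arr K. Dom K h = Z \<and> Cod K h = B \<and> (\<exists>\<omega>. (\<forall>i\<in>Obj I. iso2 (\<omega> i)) \<and>
          is_modification ((\<lambda>i. h \<cdot> l i), (\<lambda>d. h \<lhd> ld d)) (r, rd) \<omega>)"
proof -
  note [simp] = is_coconeD(1-7)[OF r]
  from N0.bicolimit_ess_surj[OF bicolim0 a_cocone[OF r]] obtain H \<kappa> where H [simp]: "H \<in> Arr K" "Dom K H =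
      lev0 Y" "Cod K H = B"
    and k_iso [simp]: "\<And>i. i \<in> Obj I \<Longrightarrow> iso2 (\<kappa> i)"
    and k_mod: "N0.is_modification ((\<lambda>i. H \<cdot> cm0 (m i)), (\<lambda>d. H \<lhd> x0d d)) (\<lambda>i. r i \<cdot> a i, \<lambda>d.
        (rd d \<rhd> a (Dom I d)) \<bullet> (r (Cod I d) \<lhd> \<phi> d)) \<kappa>"
    by auto
  have [simp]: "\<And>i. i \<in> Obj I \<Longrightarrow> Src K (\<kappa> i) = H \<cdot> cm0 (m i)" "\<And>i. i \<in> Obj I \<Longrightarrow> Tgt K (\<kappa> i) = r i \<cdot> a i"
    and k_eq: "\<And>d. d \<in> Arr I \<Longrightarrow> \<kappa> (Dom I d) \<bullet> (H \<lhd> x0d d) = (rd d \<rhd> a (Dom I d)) \<bullet> (r (Cod I d) \<lhd> \<phi> d) \<bullet>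
        (\<kappa> (Cod I d) \<rhd> on_arr G0 d)"
    using k_mod by (auto simp: N0.is_modification_def)
  \<comment> \<open>This is \<open>r i \<lhd> \<alpha> i\<close> transported along \<kappa> and the
    cells of \<open>m i\<close> at \<open>d0\<close> and \<open>d1\<close>, so that it becomes the
    restriction to level 1 of the desired \<xi>.\<close>
  define e where "e i = (H \<lhd> inv2 (cm_d1 (m i))) \<bullet> (inv2 (\<kappa> i) \<rhd> cd_d1 (X i)) \<bullet> (r i \<lhd> \<alpha> i) \<bullet>
      (\<kappa> i \<rhd> cd_d0 (X i)) \<bullet> (H \<lhd> cm_d0 (m i))" for i
  have e_typing [simp]: "iso2 (e i)" "Src K (e i) = H \<cdot> cd_d0 Y \<cdot> cm1 (m i)" "Tgt K (e i) = H \<cdot> cd_d1 Y \<cdot> cm1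
      (m i)" if "i \<in> Obj I" for i
    using that by (simp_all add: e_def)
  have e_eq: "(\<kappa> i \<rhd> cd_d1 (X i)) \<bullet> (H \<lhd> cm_d1 (m i)) \<bullet> e i = (r i \<lhd> \<alpha> i) \<bullet> (\<kappa> i \<rhd> cd_d0 (X i)) \<bullet>
      (H \<lhd> cm_d0 (m i))" if "i \<in> Obj I" for i
    using that by (simp add: e_def)
  have "N1.is_modification ((\<lambda>i. (H \<cdot> cd_d0 Y) \<cdot> cm1 (m i)), (\<lambda>d. H \<cdot> cd_d0 Y \<lhd> x1d d))
      ((\<lambda>i. (H \<cdot> cd_d1 Y) \<cdot> cm1 (m i)), (\<lambda>d. H \<cdot> cd_d1 Y \<lhd> x1d d)) e"
    unfolding N1.is_modification_def
  proof (intro conjI ballI)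
    fix d assume d [simp]: "d \<in> Arr I"
    let ?i = "Dom I d" and ?j = "Cod I d"
    let ?W = "(\<kappa> ?i \<rhd> cd_d1 (X ?i)) \<bullet> (H \<lhd> cm_d1 (m ?i))"
    note M0 = arg_cong[OF x0d_modif(1)[OF d], of "\<lambda>z. H \<lhd> z", simplified, symmetric]
    note M1 = arg_cong[OF x0d_modif(2)[OF d], of "\<lambda>z. H \<lhd> z", simplified, symmetric]
    note k0 = arg_cong[OF k_eq[OF d], of "\<lambda>z. z \<rhd> cd_d0 (X ?i)", simplified]
    note k1 = arg_cong[OF k_eq[OF d], of "\<lambda>z. z \<rhd> cd_d1 (X ?i)", simplified]
    note pa = arg_cong[OF phi_alpha[OF d], of "\<lambda>z. r ?j \<lhd> z", simplified]
    note ej = arg_cong[OF e_eq[of ?j], of "\<lambda>z. z \<rhd> on_arr G1 d", simplified]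
    note x0 = exchange[of "\<delta>0 d" "\<kappa> ?j", simplified]
    note x1 = exchange[of "\<delta>1 d" "\<kappa> ?j", simplified]
    note xa = exchange[of "\<alpha> ?i" "rd d", simplified, symmetric]
    \<comment> \<open>The compatibility of \<phi> with \<alpha> is the central equation here; the
      transition cells of levels 0 and 1 are matched through \<open>x0d_modif\<close>.\<close>
    have "?W \<bullet> e ?i \<bullet> (H \<cdot> cd_d0 Y \<lhd> x1d d) = (r ?i \<lhd> \<alpha> ?i) \<bullet> (\<kappa> ?i \<rhd> cd_d0 (X ?i)) \<bullet> (H \<lhd> cm_d0 (m ?i)) \<bullet>
        (H \<cdot> cd_d0 Y \<lhd> x1d d)"
      by (simp add: reassoc3[OF e_eq])
    also have "\<dots> = (rd d \<rhd> a ?i \<cdot> cd_d1 (X ?i)) \<bullet> (r ?j \<lhd> \<phi> d \<rhd> cd_d1 (X ?i)) \<bullet> (r ?j \<cdot> a ?j \<lhd> \<delta>1 d) \<bullet>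
        (r ?j \<lhd> \<alpha> ?j \<rhd> on_arr G1 d) \<bullet> (\<kappa> ?j \<rhd> cd_d0 (X ?j) \<cdot> on_arr G1 d) \<bullet> (H \<lhd> cm_d0 (m ?j) \<rhd> on_arr G1 d)"
      by (simp add: M0 reassoc[OF k0] reassoc[OF x0] reassoc[OF xa] reassoc3[OF pa])
    also have "\<dots> = ?W \<bullet> (H \<cdot> cd_d1 Y \<lhd> x1d d) \<bullet> (e ?j \<rhd> on_arr G1 d)"
      by (simp add: reassoc[OF M1] reassoc[OF k1] reassoc[OF x1] ej)
    finally have "e ?i \<bullet> (H \<cdot> cd_d0 Y \<lhd> x1d d) = (H \<cdot> cd_d1 Y \<lhd> x1d d) \<bullet> (e ?j \<rhd> on_arr G1 d)"
      by (rule cancel_left) simp_all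
    then show "e ?i \<bullet> snd (\<lambda>i. (H \<cdot> cd_d0 Y) \<cdot> cm1 (m i), \<lambda>d. H \<cdot> cd_d0 Y \<lhd> x1d d) d =
         snd (\<lambda>i. (H \<cdot> cd_d1 Y) \<cdot> cm1 (m i), \<lambda>d. H \<cdot> cd_d1 Y \<lhd> x1d d) d \<bullet> (e ?j \<rhd> on_arr G1 d)" by simp
  qed simp_all
  then obtain \<xi> where \<xi>c [simp]: "\<xi> \<in> Cell K" "Src K \<xi> = H \<cdot> cd_d0 Y" "Tgt K \<xi> = H \<cdot> cd_d1 Y"
      and \<xi>e: "\<And>i. i \<in> Obj I \<Longrightarrow> \<xi> \<rhd> cm1 (m i) = e i"
    using N1.bicolimit_full[OF bicolim1, of "H \<cdot> cd_d0 Y" "H \<cdot> cd_d1 Y" e] by auto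
  \<comment> \<open>A 2-cell out of a bicolimit is invertible when its restrictions are, and these
    are the \<open>e i\<close>.\<close>
  have \<xi>_iso [simp]: "iso2 \<xi>"
    by (rule N1.bicolimit_iso[OF bicolim1]) (simp_all add: \<xi>e)
  have \<xi>_eq: "(\<kappa> i \<rhd> cd_d1 (X i)) \<bullet> (H \<lhd> cm_d1 (m i)) \<bullet> (\<xi> \<rhd> cm1 (m i)) = (r i \<lhd> \<alpha> i) \<bullet> (\<kappa> i \<rhd> cd_d0 (X i)) \<bullet>
      (H \<lhd> cm_d0 (m i))" if "i \<in> Obj I" for i
    using e_eq \<xi>e that by simp
  \<comment> \<open>The normalization condition involves cells out of level 0. On each inclusion it
    becomes the one satisfied by \<open>(a i, \<alpha> i)\<close>.\<close>
  have pair1: "(H \<lhd> cd_n1 Y) \<bullet> (\<xi> \<rhd> cd_i Y) = H \<lhd> cd_n0 Y"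
  proof (rule N0.bicolimit_faithful[OF bicolim0])
    fix i assume i [simp]: "i \<in> Obj I"
    note n0 = arg_cong[OF m_n0[OF i], of "\<lambda>z. H \<lhd> z", simplified]
    note n1 = arg_cong[OF m_n1[OF i], of "\<lambda>z. H \<lhd> z", simplified]
    note x = exchange[of "cm_i (m i)" \<xi>, simplified, symmetric]
    note x1 = exchange[of "cd_n1 (X i)" "\<kappa> i", simplified]
    note x0 = exchange[of "cd_n0 (X i)" "\<kappa> i", simplified]
    note ei = arg_cong[OF \<xi>_eq[OF i], of "\<lambda>z. z \<rhd> cd_i (X i)", simplified]
    have "is_pair (X i) (on_obj F i) (a i) (\<alpha> i)" by (rule Xa[OF i])
    then have "(a i \<lhd> cd_n1 (X i)) \<bullet> (\<alpha> i \<rhd> cd_i (X i)) = a i \<lhd> cd_n0 (X i)" by (simp add: is_pair_def)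
    note p = arg_cong[OF this, of "\<lambda>z. r i \<lhd> z", simplified]
    have "\<kappa> i \<bullet> (H \<lhd> cd_n1 Y \<rhd> cm0 (m i)) \<bullet> (\<xi> \<rhd> cd_i Y \<cdot> cm0 (m i)) = \<kappa> i \<bullet> (H \<lhd> cd_n0 Y \<rhd> cm0 (m i))"
      by (simp add: n0 n1 x reassoc[OF x1] reassoc[OF x0] reassoc3[OF ei] reassoc[OF p])
    then have "(H \<lhd> cd_n1 Y \<rhd> cm0 (m i)) \<bullet> (\<xi> \<rhd> cd_i Y \<cdot> cm0 (m i)) = H \<lhd> cd_n0 Y \<rhd> cm0 (m i)"
        by (rule cancel_left) simp_all
    then show "((H \<lhd> cd_n1 Y) \<bullet> (\<xi> \<rhd> cd_i Y)) \<rhd> cm0 (m i) = (H \<lhd> cd_n0 Y) \<rhd> cm0 (m i)" by simp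
  qed simp_all
  \<comment> \<open>The cocycle condition involves cells out of level 2 and is tested on the
    inclusions \<open>cm2 (m i)\<close>. The compatibilities of \<open>m i\<close> with the \<theta>
    cells reduce it to the cocycle condition of \<open>(a i, \<alpha> i)\<close>.\<close>
  have pair2: "(H \<lhd> cd_\<theta>12 Y) \<bullet> (\<xi> \<rhd> cd_p1 Y) \<bullet> (H \<lhd> cd_\<theta>01 Y) = (\<xi> \<rhd> cd_p2 Y) \<bullet> (H \<lhd> cd_\<theta>02 Y) \<bullet>
      (\<xi> \<rhd> cd_p0 Y)"
  proof (rule N2.bicolimit_faithful[OF bicolim2])
    fix i assume i [simp]: "i \<in> Obj I"
    note t01 = arg_cong[OF m_\<theta>01[OF i], of "\<lambda>z. H \<lhd> z", simplified]
    note t02 = arg_cong[OF m_\<theta>02[OF i], of "\<lambda>z. H \<lhd> z", simplified]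
    note t12 = arg_cong[OF m_\<theta>12[OF i], of "\<lambda>z. H \<lhd> z", simplified]
    note y0 = exchange[of "cm_p0 (m i)" \<xi>, simplified]
    note y1 = exchange[of "cm_p1 (m i)" \<xi>, simplified]
    note y2 = exchange[of "cm_p2 (m i)" \<xi>, simplified]
    note z01 = exchange[of "cd_\<theta>01 (X i)" "\<kappa> i", simplified]
    note z02 = exchange[of "cd_\<theta>02 (X i)" "\<kappa> i", simplified]
    note z12 = exchange[of "cd_\<theta>12 (X i)" "\<kappa> i", simplified]
    note E0 = arg_cong[OF \<xi>_eq[OF i], of "\<lambda>z. z \<rhd> cd_p0 (X i)", simplified]
    note E1 = arg_cong[OF \<xi>_eq[OF i], of "\<lambda>z. z \<rhd> cd_p1 (X i)", simplified]
    note E2 = arg_cong[OF \<xi>_eq[OF i], of "\<lambda>z. z \<rhd> cd_p2 (X i)", simplified]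
    have "is_pair (X i) (on_obj F i) (a i) (\<alpha> i)" by (rule Xa[OF i])
    then have "(a i \<lhd> cd_\<theta>12 (X i)) \<bullet> (\<alpha> i \<rhd> cd_p1 (X i)) \<bullet> (a i \<lhd> cd_\<theta>01 (X i)) =
        (\<alpha> i \<rhd> cd_p2 (X i)) \<bullet> (a i \<lhd> cd_\<theta>02 (X i)) \<bullet> (\<alpha> i \<rhd> cd_p0 (X i))" by (simp add: is_pair_def)
    note p = arg_cong[OF this, of "\<lambda>z. r i \<lhd> z", simplified]
    let ?W = "(\<kappa> i \<rhd> cd_d1 (X i) \<cdot> cd_p2 (X i)) \<bullet> (H \<lhd> cm_d1 (m i) \<rhd> cd_p2 (X i)) \<bullet>
        (H \<cdot> cd_d1 Y \<lhd> cm_p2 (m i))"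
    let ?E = "(\<kappa> i \<rhd> cd_d0 (X i) \<cdot> cd_p0 (X i)) \<bullet> (H \<lhd> cm_d0 (m i) \<rhd> cd_p0 (X i)) \<bullet>
        (H \<cdot> cd_d0 Y \<lhd> cm_p0 (m i))"
    have "?W \<bullet> (H \<lhd> cd_\<theta>12 Y \<rhd> cm2 (m i)) \<bullet> (\<xi> \<rhd> cd_p1 Y \<cdot> cm2 (m i)) \<bullet> (H \<lhd> cd_\<theta>01 Y \<rhd> cm2 (m i)) =
        (r i \<cdot> a i \<lhd> cd_\<theta>12 (X i)) \<bullet> (\<kappa> i \<rhd> cd_d1 (X i) \<cdot> cd_p1 (X i)) \<bullet> (H \<lhd> cm_d1 (m i) \<rhd> cd_p1 (X i)) \<bullet>
        (\<xi> \<rhd> cm1 (m i) \<cdot> cd_p1 (X i)) \<bullet> (H \<cdot> cd_d0 Y \<lhd> cm_p1 (m i)) \<bullet> (H \<lhd> cd_\<theta>01 Y \<rhd> cm2 (m i))"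
      by (simp add: reassoc3[OF t12] reassoc[OF z12] reassoc[OF y1])
    also have "\<dots> = ((r i \<cdot> a i \<lhd> cd_\<theta>12 (X i)) \<bullet> (r i \<lhd> \<alpha> i \<rhd> cd_p1 (X i)) \<bullet> (r i \<cdot> a i \<lhd> cd_\<theta>01 (X i))) \<bullet> ?E"
      by (simp add: reassoc3[OF E1] t01 reassoc[OF z01])
    also have "\<dots> = ((r i \<lhd> \<alpha> i \<rhd> cd_p2 (X i)) \<bullet> (r i \<cdot> a i \<lhd> cd_\<theta>02 (X i)) \<bullet> (r i \<lhd> \<alpha> i \<rhd> cd_p0 (X i))) \<bullet> ?E"
      by (simp only: p)
    also have "\<dots> = (r i \<lhd> \<alpha> i \<rhd> cd_p2 (X i)) \<bullet> (\<kappa> i \<rhd> cd_d0 (X i) \<cdot> cd_p2 (X i)) \<bullet>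
        (H \<cdot> cm0 (m i) \<lhd> cd_\<theta>02 (X i)) \<bullet> 
         (H \<lhd> cm_d1 (m i) \<rhd> cd_p0 (X i)) \<bullet> (\<xi> \<rhd> cm1 (m i) \<cdot> cd_p0 (X i)) \<bullet> (H \<cdot> cd_d0 Y \<lhd> cm_p0 (m i))"
      by (simp add: reassoc[OF z02] reassoc3[OF E0])
    also have "\<dots> = ?W \<bullet> (\<xi> \<rhd> cd_p2 Y \<cdot> cm2 (m i)) \<bullet> (H \<lhd> cd_\<theta>02 Y \<rhd> cm2 (m i)) \<bullet> (\<xi> \<rhd> cd_p0 Y \<cdot> cm2 (m i))"
      by (simp add: y0 reassoc[OF y2[symmetric]] reassoc3[OF E2] reassoc3[OF t02])
    finally have "?W \<bullet> (((H \<lhd> cd_\<theta>12 Y) \<bullet> (\<xi> \<rhd> cd_p1 Y) \<bullet> (H \<lhd> cd_\<theta>01 Y)) \<rhd> cm2 (m i)) =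
        ?W \<bullet> (((\<xi> \<rhd> cd_p2 Y) \<bullet> (H \<lhd> cd_\<theta>02 Y) \<bullet> (\<xi> \<rhd> cd_p0 Y)) \<rhd> cm2 (m i))" by simp
    then show "((H \<lhd> cd_\<theta>12 Y) \<bullet> (\<xi> \<rhd> cd_p1 Y) \<bullet> (H \<lhd> cd_\<theta>01 Y)) \<rhd> cm2 (m i) =
        ((\<xi> \<rhd> cd_p2 Y) \<bullet> (H \<lhd> cd_\<theta>02 Y) \<bullet> (\<xi> \<rhd> cd_p0 Y)) \<rhd> cm2 (m i)"
      by (rule cancel_left) simp_all
  qed simp_all
  have "is_pair Y B H \<xi>" using pair1 pair2 by (simp add: is_pair_def)
  then obtain h \<Lambda> where h [simp]: "h \<in> Arr K" "Dom K h = Z" "Cod K h = B" and L [simp]: "iso2 \<Lambda>" "Src K \<Lambda> =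
      h \<cdot> P" "Tgt K \<Lambda> = H"
    and L_eq: "(\<Lambda> \<rhd> cd_d1 Y) \<bullet> (h \<lhd> \<psi>) = \<xi> \<bullet> (\<Lambda> \<rhd> cd_d0 Y)"
    using bicoequalizer_ess_surj[OF _ _ _ _ _ _ bicoeq, of B H \<xi>] by auto
  \<comment> \<open>This is what the comparison of \<open>h \<cdot> l i\<close> with
    \<open>r i\<close> has to become after whiskering with \<open>a i\<close>.\<close>
  define G where "G i = \<kappa> i \<bullet> (\<Lambda> \<rhd> cm0 (m i)) \<bullet> (h \<lhd> inv2 (\<chi> i))" for i
  have G_typing [simp]: "iso2 (G i)" "Src K (G i) = h \<cdot> l i \<cdot> a i" "Tgt K (G i) = r i \<cdot> a i" if "i \<in> Obj I"
      for i
    using that by (simp_all add: G_def)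
  have G_eq: "G i \<bullet> (h \<lhd> \<chi> i) = \<kappa> i \<bullet> (\<Lambda> \<rhd> cm0 (m i))" if "i \<in> Obj I" for i
    using that by (simp add: G_def)
  \<comment> \<open>The descent condition combines three compatibilities: that of \<chi> with \<psi>
    and \<open>\<alpha> i\<close>, that of \<Lambda> with \<psi> and \<xi>, and that of \<kappa>
    with \<xi> and \<open>\<alpha> i\<close>.\<close>
  have "\<exists>w\<in>Cell K. Src K w = h \<cdot> l i \<and> Tgt K w = r i \<and> w \<rhd> a i = G i" if i [simp]: "i \<in> Obj I" for i
  proof -
    note hl = arg_cong[OF l_eq[OF i], of "\<lambda>z. h \<lhd> z", simplified]
    note G0 = arg_cong[OF G_eq[OF i], of "\<lambda>z. z \<rhd> cd_d0 (X i)", simplified]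
    note G1 = arg_cong[OF G_eq[OF i], of "\<lambda>z. z \<rhd> cd_d1 (X i)", simplified]
    note Le = arg_cong[OF L_eq, of "\<lambda>z. z \<rhd> cm1 (m i)", simplified]
    note x0 = exchange[of "cm_d0 (m i)" \<Lambda>, simplified]
    note x1 = exchange[of "cm_d1 (m i)" \<Lambda>, simplified]
    let ?W = "(h \<lhd> \<chi> i \<rhd> cd_d0 (X i)) \<bullet> (h \<cdot> P \<lhd> cm_d0 (m i))"
    have "((G i \<rhd> cd_d1 (X i)) \<bullet> (h \<cdot> l i \<lhd> \<alpha> i)) \<bullet> ?W = ((r i \<lhd> \<alpha> i) \<bullet> (G i \<rhd> cd_d0 (X i))) \<bullet> ?W"
      by (simp add: hl reassoc[OF G1] reassoc[OF x1] Le reassoc[OF G0] x0 reassoc3[OF \<xi>_eq])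
    then have "(G i \<rhd> cd_d1 (X i)) \<bullet> (h \<cdot> l i \<lhd> \<alpha> i) = (r i \<lhd> \<alpha> i) \<bullet> (G i \<rhd> cd_d0 (X i))"
        by (rule cancel_right) simp_all
    then show ?thesis by (intro a_full[OF i]) simp_all
  qed
  then obtain \<omega> where w [simp]: "\<And>i. i \<in> Obj I \<Longrightarrow> \<omega> i \<in> Cell K" "\<And>i. i \<in> Obj I \<Longrightarrow> Src K (\<omega> i) = h \<cdot> l i"
      "\<And>i. i \<in> Obj I \<Longrightarrow> Tgt K (\<omega> i) = r i"
    and wG: "\<And>i. i \<in> Obj I \<Longrightarrow> \<omega> i \<rhd> a i = G i" by metis
  have w_iso: "iso2 (\<omega> i)" if "i \<in> Obj I" for i
    by (rule a_iso[OF that]) (simp_all add: that wG)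
  \<comment> \<open>The modification law is once more tested after whiskering with the a i, where it
    follows from \<open>ld_eq\<close> and the law for \<kappa>.\<close>
  have "is_modification ((\<lambda>i. h \<cdot> l i), (\<lambda>d. h \<lhd> ld d)) (r, rd) \<omega>"
    unfolding is_modification_def
  proof (intro conjI ballI)
    fix d assume d [simp]: "d \<in> Arr I"
    let ?i = "Dom I d" and ?j = "Cod I d"
    note hLD = arg_cong[OF ld_eq[OF d], of "\<lambda>z. h \<lhd> z", simplified]
    note xL = exchange[of "x0d d" \<Lambda>, simplified]
    note xw = exchange[of "\<phi> d" "\<omega> ?j", simplified]
    have wj: "\<omega> ?j \<rhd> a ?j \<cdot> on_arr G0 d = G ?j \<rhd> on_arr G0 d"
        using arg_cong[OF wG[of ?j], of "\<lambda>z. z \<rhd> on_arr G0 d"] by simp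
    let ?W = "(h \<cdot> l ?j \<lhd> \<phi> d) \<bullet> (h \<lhd> \<chi> ?j \<rhd> on_arr G0 d)"
    have Gj: "(G ?j \<rhd> on_arr G0 d) \<bullet> (h \<lhd> \<chi> ?j \<rhd> on_arr G0 d) = (\<kappa> ?j \<rhd> on_arr G0 d) \<bullet>
        (\<Lambda> \<rhd> cm0 (m ?j) \<cdot> on_arr G0 d)"
      using arg_cong[OF G_eq[of ?j], of "\<lambda>z. z \<rhd> on_arr G0 d"] by simp
    have "G ?i \<bullet> (h \<lhd> ld d \<rhd> a ?i) \<bullet> ?W = (rd d \<rhd> a ?i) \<bullet> (r ?j \<lhd> \<phi> d) \<bullet> (\<kappa> ?j \<rhd> on_arr G0 d) \<bullet>
        (\<Lambda> \<rhd> cm0 (m ?j) \<cdot> on_arr G0 d)"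
      by (simp add: hLD reassoc[OF G_eq] xL reassoc[OF k_eq])
    also have "\<dots> = (rd d \<rhd> a ?i) \<bullet> (\<omega> ?j \<rhd> on_arr F d \<cdot> a ?i) \<bullet> ?W"
      by (simp add: reassoc[OF xw] wj Gj)
    finally have "((\<omega> ?i \<bullet> (h \<lhd> ld d)) \<rhd> a ?i) \<bullet> ?W = ((rd d \<bullet> (\<omega> ?j \<rhd> on_arr F d)) \<rhd> a ?i) \<bullet> ?W"
      by (simp add: wG)
    then have "(\<omega> ?i \<bullet> (h \<lhd> ld d)) \<rhd> a ?i = (rd d \<bullet> (\<omega> ?j \<rhd> on_arr F d)) \<rhd> a ?i" by (rule cancel_right)
        simp_all
    then have "\<omega> ?i \<bullet> (h \<lhd> ld d) = rd d \<bullet> (\<omega> ?j \<rhd> on_arr F d)" by (rule a_faithful) simp_all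
    then show "\<omega> ?i \<bullet> snd (\<lambda>i. h \<cdot> l i, \<lambda>d. h \<lhd> ld d) d = snd (r, rd) d \<bullet> (\<omega> ?j \<rhd> on_arr F d)" by simp
  qed simp_all
  then show ?thesis using h w_iso by blast
qed

theorem oplax_bicolimit: "is_oplax_bicolimit K I F Z l ld"
  by (rule oplax_bicolimitI[OF l_cocone l_faithful l_full l_ess_surj])

end

section \<open>Free pseudo-algebras\<close>

sublocale pseudomonad_on \<subseteq> A: two_category "psAlg C M"
  by (rule psAlg_two_category)

context pseudomonad_on
begin

text \<open>Passage to underlying cells respects the operations. Together with
  \<open>psAlg_cell_eqI\<close> it turns an equation of algebra 2-cells with equal endpoints into
  one in C.\<close>

lemma psAlg_proj [simp]:
  "mor_map (G \<cdot>\<^bsub>\<A>\<^esub> F) = mor_map G \<cdot> mor_map F"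
  "mor_cell (G \<cdot>\<^bsub>\<A>\<^esub> F) = (mor_map G \<lhd> mor_cell F) \<bullet> (mor_cell G \<rhd> T\<^sub>1 (mor_map F))"
  "mor_map (Id1 \<A> B) = Id1 C (alg_obj B)" "mor_cell (Id1 \<A> B) = Id2 C (alg_act B)"
  "tr_cell (S \<bullet>\<^bsub>\<A>\<^esub> R) = tr_cell S \<bullet> tr_cell R" "tr_cell (Id2 \<A> F) = Id2 C (mor_map F)"
  "tr_cell (G \<lhd>\<^bsub>\<A>\<^esub> S) = mor_map G \<lhd> tr_cell S" "tr_cell (S \<rhd>\<^bsub>\<A>\<^esub> F) = tr_cell S \<rhd> mor_map F"
  "Dom \<A> (mk_mor B E f \<phi>) = B" "Cod \<A> (mk_mor B E f \<phi>) = E"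
  "Src \<A> (mk_trans F G \<sigma>) = F" "Tgt \<A> (mk_trans F G \<sigma>) = G"
  by (simp_all add: psAlg_def mor_comp_def whisker_left_def whisker_right_def)

text \<open>The record selectors are rewritten into operations of the 2-category, since the rewrite
  rules for 2-cells match only the latter.\<close>

lemma psAlg_iff:
  "B \<in> Obj \<A> \<longleftrightarrow> psalgebra C M B" "F \<in> Arr \<A> \<longleftrightarrow> pseudomorphism C M F" "S \<in> Cell \<A> \<longleftrightarrow> alg_transformation C M S"
  "mor_dom F = Dom \<A> F" "mor_cod F = Cod \<A> F" "tr_src S = Src \<A> S" "tr_tgt S = Tgt \<A> S" "mor_comp C M G F =
      G \<cdot>\<^bsub>\<A>\<^esub> F"
  by (simp_all add: psAlg_def)

lemma psAlg_Obj [simp]: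
  assumes "B \<in> Obj \<A>"
  shows "alg_obj B \<in> Obj C" "alg_act B \<in> Arr C" "Dom C (alg_act B) = T\<^sub>0 (alg_obj B)" "Cod C (alg_act B) =
      alg_obj B"
      "iso2 (alg_unit B)" "Src C (alg_unit B) = alg_act B \<cdot> \<eta> (alg_obj B)" "Tgt C (alg_unit B) =
          Id1 C (alg_obj B)"
      "iso2 (alg_assoc B)" "Src C (alg_assoc B) = alg_act B \<cdot> T\<^sub>1 (alg_act B)"
      "Tgt C (alg_assoc B) = alg_act B \<cdot> \<mu> (alg_obj B)"
  using alg_typing assms by (simp_all add: psAlg_iff)

lemma psAlg_Arr [simp]:
  assumes "F \<in> Arr \<A>"
  shows "mor_map F \<in> Arr C" "Dom C (mor_map F) = alg_obj (Dom \<A> F)" "Cod C (mor_map F) = alg_obj (Cod \<A> F)"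
      "iso2 (mor_cell F)" "Src C (mor_cell F) = alg_act (Cod \<A> F) \<cdot> T\<^sub>1 (mor_map F)"
      "Tgt C (mor_cell F) = mor_map F \<cdot> alg_act (Dom \<A> F)"
  using mor_typing assms by (simp_all add: psAlg_iff)

lemma psAlg_Cell [simp]:
  assumes "S \<in> Cell \<A>"
  shows "tr_cell S \<in> Cell C" "Src C (tr_cell S) = mor_map (Src \<A> S)" "Tgt C (tr_cell S) = mor_map (Tgt \<A> S)"
  using assms unfolding psAlg_iff(3) alg_transformation_iff unfolding psAlg_iff(4-7) by blast+

lemma psAlg_Cell_law:
  assumes "S \<in> Cell \<A>"
  shows "(tr_cell S \<rhd> alg_act (Dom \<A> (Src \<A> S))) \<bullet> mor_cell (Src \<A> S) =
      mor_cell (Tgt \<A> S) \<bullet> (alg_act (Cod \<A> (Src \<A> S)) \<lhd> T\<^sub>2 (tr_cell S))"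
  using assms unfolding psAlg_iff(3) alg_transformation_iff unfolding psAlg_iff(4-7) by metis

lemma psAlg_CellI:
  assumes "F \<in> Arr \<A>" "G \<in> Arr \<A>" "Dom \<A> F = Dom \<A> G" "Cod \<A> F = Cod \<A> G" "\<sigma> \<in> Cell C" "Src C \<sigma> = mor_map F"
      "Tgt C \<sigma> = mor_map G"
    "(\<sigma> \<rhd> alg_act (Dom \<A> G)) \<bullet> mor_cell F = mor_cell G \<bullet> (alg_act (Cod \<A> G) \<lhd> T\<^sub>2 \<sigma>)"
  shows "mk_trans F G \<sigma> \<in> Cell \<A>"
  using assms by (simp add: psAlg_iff alg_transformation_iff)

lemma psAlg_cell_eqI: "tr_cell S = tr_cell R \<Longrightarrow> Src \<A> S = Src \<A> R \<Longrightarrow> Tgt \<A> S = Tgt \<A> R \<Longrightarrow> S = R"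
  by (simp add: psAlg_def)

text \<open>The law of an algebra transformation, conjugated by its invertible cell, is the law of
  the inverse cell.\<close>

lemma psAlg_isoI:
  assumes S [simp]: "S \<in> Cell \<A>" and iso [simp]: "iso2 (tr_cell S)"
  shows "A.iso2 S"
proof -
  define F G \<sigma> B E where defs: "F = Src \<A> S" "G = Tgt \<A> S" "\<sigma> = tr_cell S" "B = Dom \<A> F" "E = Cod \<A> F"
  have [simp]: "F \<in> Arr \<A>" "G \<in> Arr \<A>" "Dom \<A> F = B" "Cod \<A> F = E" "Dom \<A> G = B" "Cod \<A> G = E" "Src \<A> S = F"
      "Tgt \<A> S = G"
    "iso2 \<sigma>" "Src C \<sigma> = mor_map F" "Tgt C \<sigma> = mor_map G"
    using defs by simp_all
  have [simp]: "B \<in> Obj \<A>" "E \<in> Obj \<A>" using A.dom_cod_obj[of F] by simp_all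
  have law: "(\<sigma> \<rhd> alg_act B) \<bullet> mor_cell F = mor_cell G \<bullet> (alg_act E \<lhd> T\<^sub>2 \<sigma>)"
      using psAlg_Cell_law[OF S, folded defs] by simp
  have "(\<sigma> \<rhd> alg_act B) \<bullet> ((inv2 \<sigma> \<rhd> alg_act B) \<bullet> mor_cell G) \<bullet> (alg_act E \<lhd> T\<^sub>2 \<sigma>) =
      (\<sigma> \<rhd> alg_act B) \<bullet> (mor_cell F \<bullet> (alg_act E \<lhd> T\<^sub>2 (inv2 \<sigma>))) \<bullet> (alg_act E \<lhd> T\<^sub>2 \<sigma>)"
    by (simp add: law)
  then have "((inv2 \<sigma> \<rhd> alg_act B) \<bullet> mor_cell G) \<bullet> (alg_act E \<lhd> T\<^sub>2 \<sigma>) =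
      (mor_cell F \<bullet> (alg_act E \<lhd> T\<^sub>2 (inv2 \<sigma>))) \<bullet> (alg_act E \<lhd> T\<^sub>2 \<sigma>)"
    by (rule cancel_left) simp_all
  then have *: "(inv2 \<sigma> \<rhd> alg_act B) \<bullet> mor_cell G = mor_cell F \<bullet> (alg_act E \<lhd> T\<^sub>2 (inv2 \<sigma>))"
    by (rule cancel_right) simp_all
  have R: "mk_trans G F (inv2 \<sigma>) \<in> Cell \<A>"
    by (rule psAlg_CellI) (use * in simp_all)
  show ?thesis
    by (rule A.cell_inv_eqI[where \<tau> = "mk_trans G F (inv2 \<sigma>)"]; (rule psAlg_cell_eqI)?)
        (simp_all add: R defs(3)[symmetric])
qed

lemma psAlg_iso [simp]:
  assumes "A.iso2 S"
  shows "iso2 (tr_cell S)" "tr_cell (A.inv2 S) = inv2 (tr_cell S)"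
proof -
  have *: "tr_cell (A.inv2 S) \<bullet> tr_cell S = Id2 C (mor_map (Src \<A> S))" "tr_cell S \<bullet> tr_cell (A.inv2 S) =
      Id2 C (mor_map (Tgt \<A> S))"
    using arg_cong[OF A.inv2_comp(1)[OF assms], of tr_cell] arg_cong[OF A.inv2_comp(2)[OF assms], of tr_cell]
        by (simp_all only: psAlg_proj)
  show "iso2 (tr_cell S)" by (rule cell_inv_eqI[where \<tau> = "tr_cell (A.inv2 S)"]) (use assms * in simp_all)
  show "tr_cell (A.inv2 S) = inv2 (tr_cell S)" by (rule cell_inv_eqI(1)[symmetric]) (use assms * in simp_all)
qed

section \<open>Free objects, and structure cells viewed as algebra 2-cells\<close>

lemma free_alg_proj [simp]: "alg_obj (free_alg M X) = T\<^sub>0 X" "alg_act (free_alg M X) = \<mu> X"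
    "alg_unit (free_alg M X) = \<xi> X"
    "alg_assoc (free_alg M X) = \<rho> X"
  by (simp_all add: free_alg_def)

lemma free_alg_Obj [simp]: "X \<in> Obj C \<Longrightarrow> free_alg M X \<in> Obj \<A>"
  by (simp add: psAlg_iff psalgebra_free)

lemma free_mor_proj [simp]: "mor_map (free_mor C M f) = T\<^sub>1 f" "mor_cell (free_mor C M f) = \<mu>c f"
    "Dom \<A> (free_mor C M f) = free_alg M (Dom C f)" "Cod \<A> (free_mor C M f) = free_alg M (Cod C f)"
  by (simp_all add: free_mor_def)

text \<open>The two axioms of a pseudomorphism are the modification equations of \<xi> and \<rho> at
  f.\<close>

lemma free_mor_Arr [simp]: "f \<in> Arr C \<Longrightarrow> free_mor C M f \<in> Arr \<A>"
  unfolding psAlg_iff free_mor_def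
  by (rule pseudomorphismI) (simp_all add: psalgebra_free modification(1,3)[of f])

lemma free_mor_comp [simp]:
  "f \<in> Arr C \<Longrightarrow> g \<in> Arr C \<Longrightarrow> Cod C f = Dom C g \<Longrightarrow> free_mor C M (g \<cdot> f) = free_mor C M g \<cdot>\<^bsub>\<A>\<^esub> free_mor C M f"
  "X \<in> Obj C \<Longrightarrow> free_mor C M (Id1 C X) = Id1 \<A> (free_alg M X)"
  by (simp_all add: psAlg_def free_mor_def mor_comp_def free_alg_def)

definition free_cell :: "'c \<Rightarrow> ('o, 'a, 'c) pstrans" where
  "free_cell \<sigma> = mk_trans (free_mor C M (Src C \<sigma>)) (free_mor C M (Tgt C \<sigma>)) (T\<^sub>2 \<sigma>)"

lemma free_cell_proj [simp]: "tr_cell (free_cell \<sigma>) = T\<^sub>2 \<sigma>" "Src \<A> (free_cell \<sigma>) = free_mor C M (Src C \<sigma>)"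
    "Tgt \<A> (free_cell \<sigma>) = free_mor C M (Tgt C \<sigma>)"
  by (simp_all add: free_cell_def)

lemma free_cell_Cell [simp]: "\<sigma> \<in> Cell C \<Longrightarrow> free_cell \<sigma> \<in> Cell \<A>"
  unfolding free_cell_def by (rule psAlg_CellI) (simp_all add: mult_natural[OF _ refl])

lemma free_cell_iso [simp]: "iso2 \<sigma> \<Longrightarrow> A.iso2 (free_cell \<sigma>)"
  by (rule psAlg_isoI) simp_all

definition free :: "('o, 'a, 'c, ('o, 'a, 'c) psalg, ('o, 'a, 'c) psmor, ('o, 'a, 'c) pstrans) two_fun" where
  "free = \<lparr> on_obj = free_alg M, on_arr = free_mor C M, on_cell = free_cell \<rparr>"

lemma free_proj [simp]: "on_obj free = free_alg M" "on_arr free = free_mor C M" "on_cell free = free_cell"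
  by (simp_all add: free_def)

lemma free_functor: "two_functor C \<A> free"
  by standard (auto simp: Hcomp_typing A.Hcomp_typing Hcomp_whisker(1) A.Hcomp_whisker(1) intro!:
      psAlg_cell_eqI)

lemma act_mor_proj [simp]: "mor_map (act_mor M B) = alg_act B" "mor_cell (act_mor M B) = alg_assoc B"
    "Dom \<A> (act_mor M B) = free_alg M (alg_obj B)" "Cod \<A> (act_mor M B) = B"
  by (simp_all add: act_mor_def)

text \<open>The multiplication axiom is (A2) of the algebra; the unit axiom is the derived law
  \<open>alg_left_unit\<close>.\<close>

lemma act_mor_Arr [simp]: "B \<in> Obj \<A> \<Longrightarrow> act_mor M B \<in> Arr \<A>"
  unfolding psAlg_iff act_mor_def
  by (rule pseudomorphismI) (simp_all add: psalgebra_free alg_left_unit alg_axiom2 alg_typing)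

lemma mult_mor_act: "mult_mor M X = act_mor M (free_alg M X)"
  by (simp add: mult_mor_def act_mor_def)

lemma mult_mor_proj [simp]: "mor_map (mult_mor M X) = \<mu> X" "mor_cell (mult_mor M X) = \<rho> X"
    "Dom \<A> (mult_mor M X) = free_alg M (T\<^sub>0 X)" "Cod \<A> (mult_mor M X) = free_alg M X" "X \<in> Obj C \<Longrightarrow>
        mult_mor M X \<in> Arr \<A>"
  by (simp_all add: mult_mor_act)

definition mult_cell :: "'a \<Rightarrow> ('o, 'a, 'c) pstrans" where
  "mult_cell f = mk_trans (mult_mor M (Cod C f) \<cdot>\<^bsub>\<A>\<^esub> free_mor C M (T\<^sub>1 f)) (free_mor C M f \<cdot>\<^bsub>\<A>\<^esub>
      mult_mor M (Dom C f)) (\<mu>c f)"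

text \<open>The transformation law for the cell of \<mu> at f is the modification equation of
  \<rho>.\<close>

lemma mult_cell_iso [simp]: "f \<in> Arr C \<Longrightarrow> A.iso2 (mult_cell f)"
  by (rule psAlg_isoI) (simp_all add: mult_cell_def psAlg_CellI modification(3)[of f])

lemma mult_cell_proj [simp]: "tr_cell (mult_cell f) = \<mu>c f"
    "Src \<A> (mult_cell f) = mult_mor M (Cod C f) \<cdot>\<^bsub>\<A>\<^esub> free_mor C M (T\<^sub>1 f)" 
    "Tgt \<A> (mult_cell f) = free_mor C M f \<cdot>\<^bsub>\<A>\<^esub> mult_mor M (Dom C f)"
  by (simp_all add: mult_cell_def)

definition act_cell :: "('o, 'a, 'c) psalg \<Rightarrow> ('o, 'a, 'c) pstrans" where
  "act_cell B = mk_trans (act_mor M B \<cdot>\<^bsub>\<A>\<^esub> free_mor C M (alg_act B)) (act_mor M B \<cdot>\<^bsub>\<A>\<^esub> mult_mor M (alg_obj B))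
      (alg_assoc B)"

text \<open>The transformation law for the associativity cell is (A2) itself.\<close>

lemma act_cell_iso [simp]: "B \<in> Obj \<A> \<Longrightarrow> A.iso2 (act_cell B)"
  by (rule psAlg_isoI) (simp_all add: act_cell_def psAlg_CellI alg_axiom2 psAlg_iff(1))

lemma act_cell_proj [simp]: "tr_cell (act_cell B) = alg_assoc B"
    "Src \<A> (act_cell B) = act_mor M B \<cdot>\<^bsub>\<A>\<^esub> free_mor C M (alg_act B)" 
    "Tgt \<A> (act_cell B) = act_mor M B \<cdot>\<^bsub>\<A>\<^esub> mult_mor M (alg_obj B)"
  by (simp_all add: act_cell_def)

definition unit_cell :: "'o \<Rightarrow> ('o, 'a, 'c) pstrans" where
  "unit_cell X = mk_trans (mult_mor M X \<cdot>\<^bsub>\<A>\<^esub> free_mor C M (\<eta> X)) (Id1 \<A> (free_alg M X)) (\<zeta> X)"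

text \<open>The transformation law for \<zeta> is the derived law
  \<open>mult_right_unit\<close>.\<close>

lemma unit_cell_iso [simp]: "X \<in> Obj C \<Longrightarrow> A.iso2 (unit_cell X)"
  by (rule psAlg_isoI) (simp_all add: unit_cell_def psAlg_CellI mult_right_unit)

lemma unit_cell_proj [simp]: "tr_cell (unit_cell X) = \<zeta> X"
    "Src \<A> (unit_cell X) = mult_mor M X \<cdot>\<^bsub>\<A>\<^esub> free_mor C M (\<eta> X)" "Tgt \<A> (unit_cell X) = Id1 \<A> (free_alg M X)"
  by (simp_all add: unit_cell_def)

text \<open>The object \<open>X\<close> is a separate argument since it is not determined by the domain \<open>free_alg M X\<close> of \<open>H\<close>.\<close>

definition counit :: "('o, 'a, 'c) psmor \<Rightarrow> 'o \<Rightarrow> ('o, 'a, 'c) pstrans" where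
  "counit H X = mk_trans (act_mor M (Cod \<A> H) \<cdot>\<^bsub>\<A>\<^esub> free_mor C M (mor_map H \<cdot> \<eta> X)) H ((mor_map H \<lhd> \<zeta> X) \<bullet>
      (mor_cell H \<rhd> T\<^sub>1 (\<eta> X)))"

lemma counit_proj [simp]: "tr_cell (counit H X) = (mor_map H \<lhd> \<zeta> X) \<bullet> (mor_cell H \<rhd> T\<^sub>1 (\<eta> X))"
    "Src \<A> (counit H X) = act_mor M (Cod \<A> H) \<cdot>\<^bsub>\<A>\<^esub> free_mor C M (mor_map H \<cdot> \<eta> X)" "Tgt \<A> (counit H X) = H"
  by (simp_all add: counit_def)

text \<open>A pseudomorphism out of a free algebra is isomorphic to the extension of its restriction
  along the unit, by inserting \<zeta> and then applying the structure cell of H. This is a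
  transformation by the multiplication axiom of H and the right unit law of \<mu>.\<close>

lemma counit_iso [simp]:
  assumes H [simp]: "H \<in> Arr \<A>" "Dom \<A> H = free_alg M X" and X [simp]: "X \<in> Obj C"
  shows "A.iso2 (counit H X)"
proof -
  obtain h \<phi> B where d [simp]: "mor_map H = h" "mor_cell H = \<phi>" "Cod \<A> H = B" by simp
  have B [simp]: "B \<in> Obj \<A>" using A.dom_cod_obj(2)[OF H(1)] by simp
  have [simp]: "h \<in> Arr C" "Dom C h = T\<^sub>0 X" "Cod C h = alg_obj B" "iso2 \<phi>" "Src C \<phi> = alg_act B \<cdot> T\<^sub>1 h"
      "Tgt C \<phi> = h \<cdot> \<mu> X"
    using psAlg_Arr[OF H(1)] by simp_all
  have "(h \<lhd> \<rho> X) \<bullet> (\<phi> \<rhd> T\<^sub>1 (\<mu> X)) \<bullet> (alg_act B \<lhd> T\<^sub>2 \<phi>) =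
      (\<phi> \<rhd> \<mu> (T\<^sub>0 X)) \<bullet> (alg_act B \<lhd> \<mu>c h) \<bullet> (alg_assoc B \<rhd> T\<^sub>1 (T\<^sub>1 h))"
    using mor_axiom2[of H] H(1) by (simp add: psAlg_iff(2,4,5))
  note m2 = arg_cong[OF this, of "\<lambda>z. z \<rhd> T\<^sub>1 (T\<^sub>1 (\<eta> X))", simplified, symmetric]
  note u = arg_cong[OF mult_right_unit[OF X], of "\<lambda>z. h \<lhd> z", simplified]
  note e1 = exchange[of "\<mu>c (\<eta> X)" \<phi>, simplified]
  note e2 = exchange[of "T\<^sub>2 (\<zeta> X)" \<phi>, simplified, symmetric]
  have law: "(((h \<lhd> \<zeta> X) \<bullet> (\<phi> \<rhd> T\<^sub>1 (\<eta> X))) \<rhd> \<mu> X) \<bullet> (alg_act B \<lhd> \<mu>c (h \<cdot> \<eta> X)) \<bullet>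
      (alg_assoc B \<rhd> T\<^sub>1 (T\<^sub>1 (h \<cdot> \<eta> X))) =
     \<phi> \<bullet> (alg_act B \<lhd> T\<^sub>2 ((h \<lhd> \<zeta> X) \<bullet> (\<phi> \<rhd> T\<^sub>1 (\<eta> X))))"
    by (simp add: reassoc[OF e1] m2 reassoc3[OF u] reassoc[OF e2])
  show ?thesis
  proof (rule psAlg_isoI)
    show "counit H X \<in> Cell \<A>"
      unfolding counit_def by (rule psAlg_CellI) (use law in simp_all)
  qed simp_all
qed

text \<open>The law of S, whiskered with the image of \<eta> under T, is combined with exchange
  against \<zeta>. As \<open>counit\<close> is invertible, S is thereby expressed through its
  restriction along \<eta>.\<close>

lemma counit_natural:
  assumes S [simp]: "S \<in> Cell \<A>" "Dom \<A> (Src \<A> S) = free_alg M X" and X [simp]: "X \<in> Obj C"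
  shows "S \<bullet>\<^bsub>\<A>\<^esub> counit (Src \<A> S) X = counit (Tgt \<A> S) X \<bullet>\<^bsub>\<A>\<^esub> (act_mor M (Cod \<A> (Src \<A> S)) \<lhd>\<^bsub>\<A>\<^esub>
      free_cell (tr_cell S \<rhd> \<eta> X))"
proof -
  obtain F G B \<sigma> where FG: "Src \<A> S = F" "Tgt \<A> S = G" "Cod \<A> F = B" "tr_cell S = \<sigma>" by simp
  have "F \<in> Arr \<A>" "G \<in> Arr \<A>" "Dom \<A> F = free_alg M X" "Dom \<A> G = free_alg M X" "Cod \<A> G = B" "B \<in> Obj \<A>"
      "\<sigma> \<in> Cell C"
     "Src C \<sigma> = mor_map F" "Tgt C \<sigma> = mor_map G"
    using A.Src_Tgt_typing[OF S(1)] FG S A.dom_cod_obj(2)[of F] psAlg_Cell[OF S(1)] by auto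
  note [simp] = this FG
  have "(\<sigma> \<rhd> \<mu> X) \<bullet> mor_cell F = mor_cell G \<bullet> (alg_act B \<lhd> T\<^sub>2 \<sigma>)"
    using psAlg_Cell_law[OF S(1)] by simp
  note l = arg_cong[OF this, of "\<lambda>z. z \<rhd> T\<^sub>1 (\<eta> X)", simplified]
  note e = exchange[of "\<zeta> X" \<sigma>, simplified]
  show ?thesis
    by (rule psAlg_cell_eqI) (simp_all add: reassoc[OF e] l)
qed

lemma free_faithful:
  assumes eq: "tr_cell S \<rhd> \<eta> X = tr_cell R \<rhd> \<eta> X" and S: "S \<in> Cell \<A>" "R \<in> Cell \<A>" "Src \<A> R = Src \<A> S"
      "Tgt \<A> R = Tgt \<A> S"
    "Dom \<A> (Src \<A> S) = free_alg M X" and X: "X \<in> Obj C"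
  shows "S = R"
proof -
  have "S \<bullet>\<^bsub>\<A>\<^esub> counit (Src \<A> S) X = R \<bullet>\<^bsub>\<A>\<^esub> counit (Src \<A> S) X"
    using counit_natural[OF S(1,5) X] counit_natural[of R X] S X eq by simp
  then show ?thesis by (rule A.cancel_right) (use S X in simp_all)
qed

text \<open>Naturality of \<open>counit\<close> leaves one candidate: the extension of \<tau>
  conjugated by the counits.\<close>

lemma free_full:
  assumes H: "H \<in> Arr \<A>" "G \<in> Arr \<A>" "Dom \<A> H = free_alg M X" "Dom \<A> G = free_alg M X" "Cod \<A> G = Cod \<A> H"
      and X: "X \<in> Obj C"
    and \<tau>: "\<tau> \<in> Cell C" "Src C \<tau> = mor_map H \<cdot> \<eta> X" "Tgt C \<tau> = mor_map G \<cdot> \<eta> X"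
  shows "\<exists>S\<in>Cell \<A>. Src \<A> S = H \<and> Tgt \<A> S = G \<and> tr_cell S \<rhd> \<eta> X = \<tau>"
proof -
  obtain B where B: "Cod \<A> H = B" by simp
  have [simp]: "B \<in> Obj \<A>" using A.dom_cod_obj(2)[OF H(1)] B by simp
  note [simp] = H[unfolded B] X \<tau> B
  define S where "S = counit G X \<bullet>\<^bsub>\<A>\<^esub> (act_mor M B \<lhd>\<^bsub>\<A>\<^esub> free_cell \<tau>) \<bullet>\<^bsub>\<A>\<^esub> A.inv2 (counit H X)"
  have S [simp]: "S \<in> Cell \<A>" "Src \<A> S = H" "Tgt \<A> S = G" by (simp_all add: S_def)
  have "counit G X \<bullet>\<^bsub>\<A>\<^esub> (act_mor M B \<lhd>\<^bsub>\<A>\<^esub> free_cell (tr_cell S \<rhd> \<eta> X)) = S \<bullet>\<^bsub>\<A>\<^esub> counit H X"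
    using counit_natural[OF S(1), of X] by simp
  also have "\<dots> = counit G X \<bullet>\<^bsub>\<A>\<^esub> (act_mor M B \<lhd>\<^bsub>\<A>\<^esub> free_cell \<tau>)" by (simp add: S_def)
  finally have "act_mor M B \<lhd>\<^bsub>\<A>\<^esub> free_cell (tr_cell S \<rhd> \<eta> X) = act_mor M B \<lhd>\<^bsub>\<A>\<^esub> free_cell \<tau>"
    by (rule A.cancel_left) simp_all
  \<comment> \<open>So far S restricts to \<tau> only after applying T and the action, and these are
    faithful together.\<close>
  from arg_cong[OF this, of tr_cell] have "alg_act B \<lhd> T\<^sub>2 (tr_cell S \<rhd> \<eta> X) = alg_act B \<lhd> T\<^sub>2 \<tau>"
    by (simp only: psAlg_proj act_mor_proj free_cell_proj)
  then have "tr_cell S \<rhd> \<eta> X = \<tau>" by (rule act_T_faithful) (simp_all add: psAlg_iff(1)[symmetric])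
  then show ?thesis using S by blast
qed

text \<open>Restricting along a free morphism changes the counit by the unit cell at f, because
  \<zeta> is a modification. This is what makes the counits compatible with the transitions of a
  cocone.\<close>

lemma counit_free_mor:
  assumes H [simp]: "H \<in> Arr \<A>" "Dom \<A> H = free_alg M (Cod C f)" and f [simp]: "f \<in> Arr C"
  shows "counit (H \<cdot>\<^bsub>\<A>\<^esub> free_mor C M f) (Dom C f) =
     (counit H (Cod C f) \<rhd>\<^bsub>\<A>\<^esub> free_mor C M f) \<bullet>\<^bsub>\<A>\<^esub> (act_mor M (Cod \<A> H) \<lhd>\<^bsub>\<A>\<^esub> free_cell (mor_map H \<lhd> \<eta>c f))"
proof -
  obtain h \<phi> B X Y where d [simp]: "mor_map H = h" "mor_cell H = \<phi>" "Cod \<A> H = B" "Dom C f = X" "Cod C f = Y"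
      by simp
  have B [simp]: "B \<in> Obj \<A>" "X \<in> Obj C" "Y \<in> Obj C" using A.dom_cod_obj(2)[OF H(1)] dom_cod_obj[OF f]
      by simp_all
  have [simp]: "h \<in> Arr C" "Dom C h = T\<^sub>0 Y" "Cod C h = alg_obj B" "iso2 \<phi>" "Src C \<phi> = alg_act B \<cdot> T\<^sub>1 h"
      "Tgt C \<phi> = h \<cdot> \<mu> Y"
    using psAlg_Arr[OF H(1)] H(2) by simp_all
  note z = arg_cong[OF modification(2)[OF f refl refl], of "\<lambda>z. h \<lhd> z", simplified]
  note e = exchange[of "T\<^sub>2 (\<eta>c f)" \<phi>, simplified, symmetric]
  show ?thesis
    using H(2) by (intro psAlg_cell_eqI) (simp_all add: reassoc[OF z] e)
qed

text \<open>In C the unit of B is a section of the action up to \<open>alg_unit B\<close>, and an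
  algebra transformation with given endpoints is determined by its underlying cell.\<close>

lemma act_mor_faithful:
  assumes eq: "S \<rhd>\<^bsub>\<A>\<^esub> act_mor M B = R \<rhd>\<^bsub>\<A>\<^esub> act_mor M B" and S: "S \<in> Cell \<A>" "R \<in> Cell \<A>" "Src \<A> R = Src \<A> S"
      "Tgt \<A> R = Tgt \<A> S"
    "Dom \<A> (Src \<A> S) = B" and B: "B \<in> Obj \<A>"
  shows "S = R"
proof (rule psAlg_cell_eqI)
  have "tr_cell S \<rhd> alg_act B = tr_cell R \<rhd> alg_act B" using arg_cong[OF eq, of tr_cell] by simp
  then show "tr_cell S = tr_cell R"
    by (rule whisker_right_faithful[of _ _ _ "alg_unit B" "\<eta> (alg_obj B)"]) (use S B in simp_all)
qed (use S in simp_all)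

text \<open>A 2-cell \<Gamma> compatible with the associativity cell descends by restriction along
  \<eta>, conjugated by the unit cell. Compatibility whiskered with \<eta> at TX, together with
  \<open>alg_left_unit\<close>, shows that the result whiskers back to \<Gamma>.\<close>

lemma act_mor_full:
  assumes B: "B \<in> Obj \<A>" and H: "H \<in> Arr \<A>" "G \<in> Arr \<A>" "Dom \<A> H = B" "Dom \<A> G = B" "Cod \<A> G = Cod \<A> H"
    and \<Gamma>: "\<Gamma> \<in> Cell \<A>" "Src \<A> \<Gamma> = H \<cdot>\<^bsub>\<A>\<^esub> act_mor M B" "Tgt \<A> \<Gamma> = G \<cdot>\<^bsub>\<A>\<^esub> act_mor M B"
    and eq: "(\<Gamma> \<rhd>\<^bsub>\<A>\<^esub> mult_mor M (alg_obj B)) \<bullet>\<^bsub>\<A>\<^esub> (H \<lhd>\<^bsub>\<A>\<^esub> act_cell B) = (G \<lhd>\<^bsub>\<A>\<^esub> act_cell B) \<bullet>\<^bsub>\<A>\<^esub>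
        (\<Gamma> \<rhd>\<^bsub>\<A>\<^esub> free_mor C M (alg_act B))"
  shows "\<exists>S\<in>Cell \<A>. Src \<A> S = H \<and> Tgt \<A> S = G \<and> S \<rhd>\<^bsub>\<A>\<^esub> act_mor M B = \<Gamma>"
proof -
  obtain X a t s where defs [simp]: "alg_obj B = X" "alg_act B = a" "alg_unit B = t" "alg_assoc B = s" by simp
  note Bs = psAlg_Obj[OF B, unfolded defs]
  obtain h g \<phi> \<gamma> \<tau> E where hg [simp]: "mor_map H = h" "mor_map G = g" "mor_cell H = \<phi>" "mor_cell G = \<gamma>"
      "tr_cell \<Gamma> = \<tau>" "Cod \<A> H = E" by simp
  have [simp]: "E \<in> Obj \<A>" using A.dom_cod_obj(2)[OF H(1)] by simp
  note [simp] = Bs B H[unfolded hg] \<Gamma>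
  note [simp] = psAlg_Arr[OF H(1), simplified] psAlg_Arr[OF H(2), simplified] psAlg_Cell[OF \<Gamma>(1), simplified]
  have comp: "(\<tau> \<rhd> \<mu> X) \<bullet> (h \<lhd> s) = (g \<lhd> s) \<bullet> (\<tau> \<rhd> T\<^sub>1 a)" using arg_cong[OF eq, of tr_cell] by simp
  have law: "(\<tau> \<rhd> \<mu> X) \<bullet> (h \<lhd> s) \<bullet> (\<phi> \<rhd> T\<^sub>1 a) = (g \<lhd> s) \<bullet> (\<gamma> \<rhd> T\<^sub>1 a) \<bullet> (alg_act E \<lhd> T\<^sub>2 \<tau>)"
    using psAlg_Cell_law[OF \<Gamma>(1)] by simp
  \<comment> \<open>The unit cell t turns the restriction of \<tau> along \<eta> into a cell from h
    to g.\<close>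
  define \<sigma> where "\<sigma> = (g \<lhd> t) \<bullet> (\<tau> \<rhd> \<eta> X) \<bullet> (h \<lhd> inv2 t)"
  have \<sigma> [simp]: "\<sigma> \<in> Cell C" "Src C \<sigma> = h" "Tgt C \<sigma> = g" by (simp_all add: \<sigma>_def)
  have U: "(a \<lhd> \<xi> X) \<bullet> (s \<rhd> \<eta> (T\<^sub>0 X)) = (t \<rhd> a) \<bullet> (a \<lhd> \<eta>c a)"
    using alg_left_unit[of B] by (simp add: psAlg_iff(1)[symmetric])
  note gU = arg_cong[OF U, of "\<lambda>z. g \<lhd> z", simplified] and hU = arg_cong[OF U, of "\<lambda>z. h \<lhd> z", simplified]
  note c = arg_cong[OF comp, of "\<lambda>z. z \<rhd> \<eta> (T\<^sub>0 X)", simplified]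
  note x1 = exchange[of "\<eta>c a" \<tau>, simplified]
  note x2 = exchange[of "\<xi> X" \<tau>, simplified]
  have "(\<sigma> \<rhd> a) \<bullet> (h \<lhd> t \<rhd> a) \<bullet> (h \<cdot> a \<lhd> \<eta>c a) = (g \<lhd> t \<rhd> a) \<bullet> (\<tau> \<rhd> \<eta> X \<cdot> a) \<bullet> (h \<cdot> a \<lhd> \<eta>c a)"
    by (simp add: \<sigma>_def)
  also have "\<dots> = (g \<cdot> a \<lhd> \<xi> X) \<bullet> (g \<lhd> s \<rhd> \<eta> (T\<^sub>0 X)) \<bullet> (\<tau> \<rhd> T\<^sub>1 a \<cdot> \<eta> (T\<^sub>0 X))"
    by (simp add: x1 reassoc[OF gU])
  also have "\<dots> = \<tau> \<bullet> (h \<cdot> a \<lhd> \<xi> X) \<bullet> (h \<lhd> s \<rhd> \<eta> (T\<^sub>0 X))"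
    by (simp add: c[symmetric] reassoc[OF x2[symmetric]])
  also have "\<dots> = \<tau> \<bullet> (h \<lhd> t \<rhd> a) \<bullet> (h \<cdot> a \<lhd> \<eta>c a)" by (simp add: hU)
  finally have "(\<sigma> \<rhd> a) \<bullet> ((h \<lhd> t \<rhd> a) \<bullet> (h \<cdot> a \<lhd> \<eta>c a)) = \<tau> \<bullet> ((h \<lhd> t \<rhd> a) \<bullet> (h \<cdot> a \<lhd> \<eta>c a))" by simp
  then have \<sigma>a: "\<sigma> \<rhd> a = \<tau>" by (rule cancel_right) simp_all
  \<comment> \<open>The transformation law of \<sigma> is verified after whiskering with Ta, where
    it follows from that of \<Gamma>. This whiskering is faithful because the image of t under T
    exhibits a section of Ta.\<close>
  have "(g \<lhd> s) \<bullet> (((\<sigma> \<rhd> a) \<bullet> \<phi>) \<rhd> T\<^sub>1 a) = (g \<lhd> s) \<bullet> ((\<gamma> \<bullet> (alg_act E \<lhd> T\<^sub>2 \<sigma>)) \<rhd> T\<^sub>1 a)"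
  proof -
    have T: "T\<^sub>2 \<sigma> \<rhd> T\<^sub>1 a = T\<^sub>2 \<tau>" using arg_cong[OF \<sigma>a, of T\<^sub>2] by simp
    have "(g \<lhd> s) \<bullet> (((\<sigma> \<rhd> a) \<bullet> \<phi>) \<rhd> T\<^sub>1 a) = (g \<lhd> s) \<bullet> (\<tau> \<rhd> T\<^sub>1 a) \<bullet> (\<phi> \<rhd> T\<^sub>1 a)"
      using arg_cong[OF \<sigma>a, of "\<lambda>z. z \<rhd> T\<^sub>1 a"] by simp
    also have "\<dots> = (g \<lhd> s) \<bullet> (\<gamma> \<rhd> T\<^sub>1 a) \<bullet> (alg_act E \<lhd> T\<^sub>2 \<tau>)"
      by (simp add: reassoc[OF comp[symmetric]] law)
    finally show ?thesis by (simp add: T)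
  qed
  then have "((\<sigma> \<rhd> a) \<bullet> \<phi>) \<rhd> T\<^sub>1 a = (\<gamma> \<bullet> (alg_act E \<lhd> T\<^sub>2 \<sigma>)) \<rhd> T\<^sub>1 a" by (rule cancel_left) simp_all
  then have "(\<sigma> \<rhd> a) \<bullet> \<phi> = \<gamma> \<bullet> (alg_act E \<lhd> T\<^sub>2 \<sigma>)"
    by (rule whisker_right_faithful[of _ _ _ "T\<^sub>2 t" "T\<^sub>1 (\<eta> X)"]) simp_all
  then have "mk_trans H G \<sigma> \<in> Cell \<A>" by (intro psAlg_CellI) simp_all
  moreover have "mk_trans H G \<sigma> \<rhd>\<^bsub>\<A>\<^esub> act_mor M B = \<Gamma>"
    by (rule psAlg_cell_eqI) (use calculation \<sigma>a in simp_all)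
  ultimately show ?thesis by (intro bexI[of _ "mk_trans H G \<sigma>"]) simp_all
qed

lemma unit_natural_inv:
  assumes [simp]: "\<sigma> \<in> Cell C" "X = Cod C (Src C \<sigma>)"
  shows "inv2 (\<eta>c (Tgt C \<sigma>)) \<bullet> (\<eta> X \<lhd> \<sigma>) = (T\<^sub>2 \<sigma> \<rhd> \<eta> (Dom C (Src C \<sigma>))) \<bullet> inv2 (\<eta>c (Src C \<sigma>))"
proof -
  have "\<eta>c (Tgt C \<sigma>) \<bullet> (inv2 (\<eta>c (Tgt C \<sigma>)) \<bullet> (\<eta> X \<lhd> \<sigma>)) \<bullet> \<eta>c (Src C \<sigma>) =
      \<eta>c (Tgt C \<sigma>) \<bullet> ((T\<^sub>2 \<sigma> \<rhd> \<eta> (Dom C (Src C \<sigma>))) \<bullet> inv2 (\<eta>c (Src C \<sigma>))) \<bullet> \<eta>c (Src C \<sigma>)"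
    by (simp add: unit_natural)
  then have "(inv2 (\<eta>c (Tgt C \<sigma>)) \<bullet> (\<eta> X \<lhd> \<sigma>)) \<bullet> \<eta>c (Src C \<sigma>) =
      ((T\<^sub>2 \<sigma> \<rhd> \<eta> (Dom C (Src C \<sigma>))) \<bullet> inv2 (\<eta>c (Src C \<sigma>))) \<bullet> \<eta>c (Src C \<sigma>)"
    by (rule cancel_left) simp_all
  then show ?thesis by (rule cancel_right) simp_all
qed

lemma free_cell_comp [simp]:
  "f \<in> Arr C \<Longrightarrow> free_cell (Id2 C f) = Id2 \<A> (free_mor C M f)"
  "\<sigma> \<in> Cell C \<Longrightarrow> \<tau> \<in> Cell C \<Longrightarrow> Tgt C \<sigma> = Src C \<tau> \<Longrightarrow> free_cell (\<tau> \<bullet> \<sigma>) = free_cell \<tau> \<bullet>\<^bsub>\<A>\<^esub> free_cell \<sigma>"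
  "g \<in> Arr C \<Longrightarrow> \<sigma> \<in> Cell C \<Longrightarrow> Cod C (Src C \<sigma>) = Dom C g \<Longrightarrow> free_cell (g \<lhd> \<sigma>) = free_mor C M g \<lhd>\<^bsub>\<A>\<^esub> free_cell \<sigma>"
  "f \<in> Arr C \<Longrightarrow> \<sigma> \<in> Cell C \<Longrightarrow> Cod C f = Dom C (Src C \<sigma>) \<Longrightarrow> free_cell (\<sigma> \<rhd> f) = free_cell \<sigma> \<rhd>\<^bsub>\<A>\<^esub> free_mor C M f"
  "iso2 \<sigma> \<Longrightarrow> free_cell (inv2 \<sigma>) = A.inv2 (free_cell \<sigma>)"
  by (rule psAlg_cell_eqI; simp)+

text \<open>Cells out of the free algebra on L correspond to cells out of L by restriction along the
  unit. The unit cells at the inclusions and transitions carry cocones and modifications across this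
  correspondence.\<close>

lemma free_preserves_bicolimit:
  assumes I: "two_category I" and F: "two_functor I C F" and L: "is_oplax_bicolimit C I F L q qd"
  shows "is_oplax_bicolimit \<A> I (free \<circ>\<^sub>2 F) (free_alg M L) (\<lambda>i. free_mor C M (q i)) (\<lambda>d. free_cell (qd d))"
proof -
  interpret D: diagram C I F by (intro diagram.intro two_category_axioms I F)
  interpret N: diagram \<A> I "free \<circ>\<^sub>2 F"
    by (intro diagram.intro A.two_category_axioms I two_functor_comp[OF I F free_functor])
  note q = D.bicolimit_cocone[OF L]
  note [simp] = D.is_coconeD(1-7)[OF q]
  show ?thesis
  proof (rule N.oplax_bicolimitI)
    show "N.is_cocone (free_alg M L) (\<lambda>i. free_mor C M (q i)) (\<lambda>d. free_cell (qd d))"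
      unfolding N.is_cocone_def
    proof (intro conjI ballI impI)
      fix s assume s [simp]: "s \<in> Cell I"
      show "free_cell (qd (Tgt I s)) \<bullet>\<^bsub>\<A>\<^esub> (free_mor C M (q (Cod I (Src I s))) \<lhd>\<^bsub>\<A>\<^esub> on_cell (free \<circ>\<^sub>2 F) s) =
          free_cell (qd (Src I s))"
        using arg_cong[OF D.is_cocone_cell[OF q s], of free_cell] by simp
    qed (simp_all add: D.is_cocone_Id1[OF q] D.is_cocone_Comp1[OF q])
  next
    fix S R
    assume eq: "\<And>i. i \<in> Obj I \<Longrightarrow> S \<rhd>\<^bsub>\<A>\<^esub> free_mor C M (q i) = R \<rhd>\<^bsub>\<A>\<^esub> free_mor C M (q i)"
      and S [simp]: "S \<in> Cell \<A>" "R \<in> Cell \<A>" "Src \<A> R = Src \<A> S" "Tgt \<A> R = Tgt \<A> S" "Dom \<A> (Src \<A> S) =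
          free_alg M L"
    have "tr_cell S \<rhd> \<eta> L = tr_cell R \<rhd> \<eta> L"
    proof (rule D.bicolimit_faithful[OF L])
      fix i assume i [simp]: "i \<in> Obj I"
      have e: "tr_cell S \<rhd> T\<^sub>1 (q i) \<cdot> \<eta> (on_obj F i) = tr_cell R \<rhd> T\<^sub>1 (q i) \<cdot> \<eta> (on_obj F i)"
        using arg_cong[OF arg_cong[OF eq[OF i], of tr_cell], of "\<lambda>z. z \<rhd> \<eta> (on_obj F i)"] by simp
      have "(tr_cell S \<rhd> \<eta> L \<cdot> q i) \<bullet> (mor_map (Src \<A> S) \<lhd> \<eta>c (q i)) = (tr_cell R \<rhd> \<eta> L \<cdot> q i) \<bullet>
          (mor_map (Src \<A> S) \<lhd> \<eta>c (q i))"
        using exchange[of "\<eta>c (q i)" "tr_cell S"] exchange[of "\<eta>c (q i)" "tr_cell R"] e by simp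
      then have "tr_cell S \<rhd> \<eta> L \<cdot> q i = tr_cell R \<rhd> \<eta> L \<cdot> q i" by (rule cancel_right) simp_all
      then show "tr_cell S \<rhd> \<eta> L \<rhd> q i = tr_cell R \<rhd> \<eta> L \<rhd> q i" by simp
    qed simp_all
    then show "S = R" by (rule free_faithful) simp_all
  next
    fix H G \<Gamma>
    assume H: "H \<in> Arr \<A>" "G \<in> Arr \<A>" "Dom \<A> H = free_alg M L" "Dom \<A> G = free_alg M L" "Cod \<A> G = Cod \<A> H"
      and \<Gamma>: "N.is_modification ((\<lambda>i. H \<cdot>\<^bsub>\<A>\<^esub> free_mor C M (q i)), (\<lambda>d. H \<lhd>\<^bsub>\<A>\<^esub> free_cell (qd d)))
        ((\<lambda>i. G \<cdot>\<^bsub>\<A>\<^esub> free_mor C M (q i)), (\<lambda>d. G \<lhd>\<^bsub>\<A>\<^esub> free_cell (qd d))) \<Gamma>"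
    obtain B h g where d: "Cod \<A> H = B" "mor_map H = h" "mor_map G = g" by simp
    have [simp]: "B \<in> Obj \<A>" using A.dom_cod_obj(2)[OF H(1)] d by simp
    note [simp] = H[unfolded d] d psAlg_Arr(1-3)[OF H(1), unfolded d H, simplified] psAlg_Arr(1-3)[OF H(2),
        unfolded d H, simplified]
    have \<Gamma>_typing [simp]: "\<Gamma> i \<in> Cell \<A>" "Src \<A> (\<Gamma> i) = H \<cdot>\<^bsub>\<A>\<^esub> free_mor C M (q i)" "Tgt \<A> (\<Gamma> i) = G \<cdot>\<^bsub>\<A>\<^esub>
        free_mor C M (q i)" if "i \<in> Obj I" for i
      using \<Gamma> that by (simp_all add: N.is_modification_def)
    define \<gamma> where "\<gamma> i = tr_cell (\<Gamma> i)" for i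
    have g_typing [simp]: "\<gamma> i \<in> Cell C" "Src C (\<gamma> i) = h \<cdot> T\<^sub>1 (q i)" "Tgt C (\<gamma> i) = g \<cdot> T\<^sub>1 (q i)"
        if "i \<in> Obj I" for i
      using that by (simp_all add: \<gamma>_def)
    have g_eq: "\<gamma> (Dom I d) \<bullet> (h \<lhd> T\<^sub>2 (qd d)) = (g \<lhd> T\<^sub>2 (qd d)) \<bullet> (\<gamma> (Cod I d) \<rhd> T\<^sub>1 (on_arr F d))"
        if "d \<in> Arr I" for d
    proof -
      have "\<Gamma> (Dom I d) \<bullet>\<^bsub>\<A>\<^esub> (H \<lhd>\<^bsub>\<A>\<^esub> free_cell (qd d)) = (G \<lhd>\<^bsub>\<A>\<^esub> free_cell (qd d)) \<bullet>\<^bsub>\<A>\<^esub>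
          (\<Gamma> (Cod I d) \<rhd>\<^bsub>\<A>\<^esub> on_arr (free \<circ>\<^sub>2 F) d)"
        using \<Gamma> that by (simp add: N.is_modification_def)
      from arg_cong[OF this, of tr_cell] show ?thesis by (simp add: \<gamma>_def)
    qed
    \<comment> \<open>The restriction of \<open>\<gamma> i\<close> along the unit is conjugated by
      the unit cell at \<open>q i\<close>, so that it becomes a cell between restrictions along
      \<open>q i\<close>.\<close>
    define t where "t i = (g \<lhd> \<eta>c (q i)) \<bullet> (\<gamma> i \<rhd> \<eta> (on_obj F i)) \<bullet> (h \<lhd> inv2 (\<eta>c (q i)))" for i
    have t_typing [simp]: "t i \<in> Cell C" "Src C (t i) = h \<cdot> \<eta> L \<cdot> q i" "Tgt C (t i) = g \<cdot> \<eta> L \<cdot> q i"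
        if "i \<in> Obj I" for i
      using that by (simp_all add: t_def)
    have t_eq: "t i \<bullet> (h \<lhd> \<eta>c (q i)) = (g \<lhd> \<eta>c (q i)) \<bullet> (\<gamma> i \<rhd> \<eta> (on_obj F i))" if "i \<in> Obj I" for i
      using that by (simp add: t_def)
    have "D.is_modification ((\<lambda>i. (h \<cdot> \<eta> L) \<cdot> q i), (\<lambda>d. h \<cdot> \<eta> L \<lhd> qd d)) ((\<lambda>i. (g \<cdot> \<eta> L) \<cdot> q i),
        (\<lambda>d. g \<cdot> \<eta> L \<lhd> qd d)) t"
      unfolding D.is_modification_def
    proof (intro conjI ballI)
      fix d assume d [simp]: "d \<in> Arr I"
      let ?i = "Dom I d" and ?j = "Cod I d"
      note hn = arg_cong[OF unit_natural[of "qd d", OF _ refl], of "\<lambda>z. h \<lhd> z", simplified]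
      note gn = arg_cong[OF unit_natural[of "qd d", OF _ refl], of "\<lambda>z. g \<lhd> z", simplified, symmetric]
      note ge = arg_cong[OF g_eq[OF d], of "\<lambda>z. z \<rhd> \<eta> (on_obj F ?i)", simplified]
      note te = arg_cong[OF t_eq[of ?j], of "\<lambda>z. z \<rhd> on_arr F d", simplified]
      note x = exchange[of "\<eta>c (on_arr F d)" "\<gamma> ?j", simplified]
      let ?W = "(h \<lhd> \<eta>c (q ?j) \<rhd> on_arr F d) \<bullet> (h \<cdot> T\<^sub>1 (q ?j) \<lhd> \<eta>c (on_arr F d))"
      have "(t ?i \<bullet> (h \<cdot> \<eta> L \<lhd> qd d)) \<bullet> ?W = ((g \<cdot> \<eta> L \<lhd> qd d) \<bullet> (t ?j \<rhd> on_arr F d)) \<bullet> ?W"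
        by (simp add: hn reassoc[OF t_eq] ge reassoc[OF gn] reassoc[OF te] x)
      then have "t ?i \<bullet> (h \<cdot> \<eta> L \<lhd> qd d) = (g \<cdot> \<eta> L \<lhd> qd d) \<bullet> (t ?j \<rhd> on_arr F d)" by (rule cancel_right)
          simp_all
      then show "t ?i \<bullet> snd (\<lambda>i. (h \<cdot> \<eta> L) \<cdot> q i, \<lambda>d. h \<cdot> \<eta> L \<lhd> qd d) d =
          snd (\<lambda>i. (g \<cdot> \<eta> L) \<cdot> q i, \<lambda>d. g \<cdot> \<eta> L \<lhd> qd d) d \<bullet> (t ?j \<rhd> on_arr F d)" by simp
    qed simp_all
    then obtain \<tau> where \<tau> [simp]: "\<tau> \<in> Cell C" "Src C \<tau> = h \<cdot> \<eta> L" "Tgt C \<tau> = g \<cdot> \<eta> L"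
        and \<tau>t: "\<And>i. i \<in> Obj I \<Longrightarrow> \<tau> \<rhd> q i = t i"
      using D.bicolimit_full[OF L, of "h \<cdot> \<eta> L" "g \<cdot> \<eta> L" t] by auto
    obtain S where S [simp]: "S \<in> Cell \<A>" "Src \<A> S = H" "Tgt \<A> S = G" and S\<tau>: "tr_cell S \<rhd> \<eta> L = \<tau>"
      using free_full[of H G L \<tau>] by auto
    have "S \<rhd>\<^bsub>\<A>\<^esub> free_mor C M (q i) = \<Gamma> i" if i [simp]: "i \<in> Obj I" for i
    \<comment> \<open>The source of \<open>\<Gamma> i\<close> is a 1-cell out of a free algebra, so
      comparison after restriction along the unit is enough.\<close>
    proof (rule free_faithful)
      have *: "tr_cell S \<rhd> \<eta> L \<cdot> q i = t i" using arg_cong[OF S\<tau>, of "\<lambda>z. z \<rhd> q i"] \<tau>t by simp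
      have "(g \<lhd> \<eta>c (q i)) \<bullet> (tr_cell S \<rhd> T\<^sub>1 (q i) \<cdot> \<eta> (on_obj F i)) = (g \<lhd> \<eta>c (q i)) \<bullet>
          (\<gamma> i \<rhd> \<eta> (on_obj F i))"
        using exchange[of "\<eta>c (q i)" "tr_cell S"] t_eq[OF i] by (simp add: *)
      then have "tr_cell S \<rhd> T\<^sub>1 (q i) \<cdot> \<eta> (on_obj F i) = \<gamma> i \<rhd> \<eta> (on_obj F i)" by (rule cancel_left) simp_all
      then show "tr_cell (S \<rhd>\<^bsub>\<A>\<^esub> free_mor C M (q i)) \<rhd> \<eta> (on_obj F i) = tr_cell (\<Gamma> i) \<rhd> \<eta> (on_obj F i)"
          by (simp add: \<gamma>_def)
    qed simp_all
    then show "\<exists>S\<in>Cell \<A>. Src \<A> S = H \<and> Tgt \<A> S = G \<and> (\<forall>i\<in>Obj I. S \<rhd>\<^bsub>\<A>\<^esub> free_mor C M (q i) = \<Gamma> i)"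
      using S by blast
  next
    fix B k kd assume k: "N.is_cocone B k kd"
    note [simp] = N.is_coconeD(1-7)[OF k]
    \<comment> \<open>The cocone of algebras is restricted along the units to a cocone in C. Its
      transition cells need the inverse of the unit cell at \<open>F d\<close> to pass from
      \<open>\<eta> \<cdot> F d\<close> to \<open>T F d \<cdot> \<eta>\<close>.\<close>
    define r where "r i = mor_map (k i) \<cdot> \<eta> (on_obj F i)" for i
    define rd where "rd d = (tr_cell (kd d) \<rhd> \<eta> (on_obj F (Dom I d))) \<bullet>
        (mor_map (k (Cod I d)) \<lhd> inv2 (\<eta>c (on_arr F d)))" for d
    have r: "D.is_cocone (alg_obj B) r rd"
      unfolding D.is_cocone_def
    proof (intro conjI ballI impI)
      fix i assume [simp]: "i \<in> Obj I"
      show "rd (Id1 I i) = Id2 C (r i)" by (simp add: rd_def r_def N.is_cocone_Id1[OF k])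
    next
      fix d e assume d [simp]: "d \<in> Arr I" "e \<in> Arr I" "Cod I d = Dom I e"
      note x = exchange[of "inv2 (\<eta>c (on_arr F d))" "tr_cell (kd e)", simplified, symmetric]
      show "rd (e \<cdot>\<^bsub>I\<^esub> d) = rd d \<bullet> (rd e \<rhd> on_arr F d)"
        by (simp add: rd_def N.is_cocone_Comp1[OF k d] reassoc[OF x])
    next
      fix s assume s [simp]: "s \<in> Cell I"
      let ?i = "Dom I (Src I s)" and ?j = "Cod I (Src I s)"
      note c = arg_cong[OF arg_cong[OF N.is_cocone_cell[OF k s], of tr_cell], of "\<lambda>z. z \<rhd> \<eta> (on_obj F ?i)",
          simplified]
      note n = arg_cong[OF unit_natural_inv[of "on_cell F s", OF _ refl], of "\<lambda>z. mor_map (k ?j) \<lhd> z",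
          simplified]
      show "rd (Tgt I s) \<bullet> (r ?j \<lhd> on_cell F s) = rd (Src I s)"
        by (simp add: rd_def r_def n reassoc[OF c])
    qed (simp_all add: r_def rd_def)
    from D.bicolimit_ess_surj[OF L r] obtain g \<gamma> where g [simp]: "g \<in> Arr C" "Dom C g = L" "Cod C g =
        alg_obj B"
      and g_iso [simp]: "\<And>i. i \<in> Obj I \<Longrightarrow> iso2 (\<gamma> i)"
          and g_mod: "D.is_modification ((\<lambda>i. g \<cdot> q i), (\<lambda>d. g \<lhd> qd d)) (r, rd) \<gamma>" by auto
    have [simp]: "\<And>i. i \<in> Obj I \<Longrightarrow> Src C (\<gamma> i) = g \<cdot> q i" "\<And>i. i \<in> Obj I \<Longrightarrow> Tgt C (\<gamma> i) = mor_map (k i) \<cdot> \<eta>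
        (on_obj F i)"
      and g_eq: "\<And>d. d \<in> Arr I \<Longrightarrow> \<gamma> (Dom I d) \<bullet> (g \<lhd> qd d) = rd d \<bullet> (\<gamma> (Cod I d) \<rhd> on_arr F d)"
      using g_mod by (auto simp: D.is_modification_def r_def)
    let ?H = "act_mor M B \<cdot>\<^bsub>\<A>\<^esub> free_mor C M g"
    \<comment> \<open>The extension of \<open>\<gamma> i\<close> leads to the extension of the
      restriction of \<open>k i\<close>, and the counit leads from there to
      \<open>k i\<close>.\<close>
    define \<kappa> where "\<kappa> i = counit (k i) (on_obj F i) \<bullet>\<^bsub>\<A>\<^esub> (act_mor M B \<lhd>\<^bsub>\<A>\<^esub> free_cell (\<gamma> i))" for i
    have k_typing: "A.iso2 (\<kappa> i)" "Src \<A> (\<kappa> i) = ?H \<cdot>\<^bsub>\<A>\<^esub> free_mor C M (q i)" "Tgt \<A> (\<kappa> i) = k i"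
        if "i \<in> Obj I" for i
      using that by (simp_all add: \<kappa>_def)
    have "N.is_modification ((\<lambda>i. ?H \<cdot>\<^bsub>\<A>\<^esub> free_mor C M (q i)), (\<lambda>d. ?H \<lhd>\<^bsub>\<A>\<^esub> free_cell (qd d))) (k, kd) \<kappa>"
      unfolding N.is_modification_def
    proof (intro conjI ballI)
      fix d assume d [simp]: "d \<in> Arr I"
      let ?i = "Dom I d" and ?j = "Cod I d"
      note e = arg_cong[OF arg_cong[OF g_eq[OF d], of free_cell], of "\<lambda>z. act_mor M B \<lhd>\<^bsub>\<A>\<^esub> z", simplified]
      note n = counit_natural[of "kd d" "on_obj F ?i", simplified, symmetric]
      note c = counit_free_mor[of "k ?j" "on_arr F d", simplified]
      show "\<kappa> ?i \<bullet>\<^bsub>\<A>\<^esub> snd (\<lambda>i. ?H \<cdot>\<^bsub>\<A>\<^esub> free_mor C M (q i), \<lambda>d. ?H \<lhd>\<^bsub>\<A>\<^esub> free_cell (qd d)) d =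
          snd (k, kd) d \<bullet>\<^bsub>\<A>\<^esub> (\<kappa> ?j \<rhd>\<^bsub>\<A>\<^esub> on_arr (free \<circ>\<^sub>2 F) d)"
        by (simp add: \<kappa>_def e rd_def A.reassoc[OF n] c)
    qed (simp_all add: k_typing)
    then show "\<exists>h\<in>Arr \<A>. Dom \<A> h = free_alg M L \<and> Cod \<A> h = B \<and> (\<exists>\<kappa>. (\<forall>i\<in>Obj I. A.iso2 (\<kappa> i)) \<and>
          N.is_modification ((\<lambda>i. h \<cdot>\<^bsub>\<A>\<^esub> free_mor C M (q i)), (\<lambda>d. h \<lhd>\<^bsub>\<A>\<^esub> free_cell (qd d))) (k, kd) \<kappa>)"
      using k_typing by (intro bexI[of _ ?H] conjI exI[of _ \<kappa>] ballI) simp_all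
  qed
qed

text \<open>From here on the action of a free algebra is displayed as \<open>mult_mor\<close>, the
  form in which the codescent objects are written.\<close>

lemmas [simp] = mult_mor_act[symmetric]

section \<open>The forgetful 2-functor and the bar construction\<close>

lemma forget_proj [simp]: "on_obj forget = alg_obj" "on_arr forget = mor_map" "on_cell forget = tr_cell"
  by (simp_all add: forget_def)

lemma forget_functor: "two_functor \<A> C forget"
  by standard (auto simp: A.Hcomp_whisker(1) Hcomp_whisker(1))

text \<open>The structure cell of a pseudomorphism, viewed as the pseudonaturality square of the
  actions. Its transformation law is the multiplication axiom of F.\<close>

definition action_cell :: "('o, 'a, 'c) psmor \<Rightarrow> ('o, 'a, 'c) pstrans" where
  "action_cell F = mk_trans (act_mor M (Cod \<A> F) \<cdot>\<^bsub>\<A>\<^esub> free_mor C M (mor_map F)) (F \<cdot>\<^bsub>\<A>\<^esub> act_mor M (Dom \<A> F))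
      (mor_cell F)"

lemma action_cell_proj [simp]: "tr_cell (action_cell F) = mor_cell F"
    "Src \<A> (action_cell F) = act_mor M (Cod \<A> F) \<cdot>\<^bsub>\<A>\<^esub> free_mor C M (mor_map F)"
    "Tgt \<A> (action_cell F) = F \<cdot>\<^bsub>\<A>\<^esub> act_mor M (Dom \<A> F)"
  by (simp_all add: action_cell_def)

lemma psAlg_Arr_law: "F \<in> Arr \<A> \<Longrightarrow>
    (mor_map F \<lhd> alg_assoc (Dom \<A> F)) \<bullet> (mor_cell F \<rhd> T\<^sub>1 (alg_act (Dom \<A> F))) \<bullet>
        (alg_act (Cod \<A> F) \<lhd> T\<^sub>2 (mor_cell F)) =
      (mor_cell F \<rhd> \<mu> (alg_obj (Dom \<A> F))) \<bullet> (alg_act (Cod \<A> F) \<lhd> \<mu>c (mor_map F)) \<bullet>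
        (alg_assoc (Cod \<A> F) \<rhd> T\<^sub>1 (T\<^sub>1 (mor_map F)))"
  using mor_axiom2[of F] by (simp add: psAlg_iff(2,4,5))

lemma action_cell_iso [simp]:
  assumes [simp]: "F \<in> Arr \<A>"
  shows "A.iso2 (action_cell F)"
  by (rule psAlg_isoI) (simp_all add: action_cell_def psAlg_CellI psAlg_Arr_law)

lemma psAlg_Obj_law:
  assumes "B \<in> Obj \<A>"
  shows "(alg_act B \<lhd> \<zeta> (alg_obj B)) \<bullet> (alg_assoc B \<rhd> T\<^sub>1 (\<eta> (alg_obj B))) = alg_act B \<lhd> T\<^sub>2 (alg_unit B)"
    "(alg_act B \<lhd> \<rho> (alg_obj B)) \<bullet> (alg_assoc B \<rhd> T\<^sub>1 (\<mu> (alg_obj B))) \<bullet> (alg_act B \<lhd> T\<^sub>2 (alg_assoc B)) =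
     (alg_assoc B \<rhd> \<mu> (T\<^sub>0 (alg_obj B))) \<bullet> (alg_act B \<lhd> \<mu>c (alg_act B)) \<bullet>
         (alg_assoc B \<rhd> T\<^sub>1 (T\<^sub>1 (alg_act B)))"
  using assms alg_axiom1 alg_axiom2 by (simp_all add: psAlg_iff)

text \<open>The 2-cells are rewritten as free, multiplication, unit and action cells, whose typing
  and invertibility are already known to the simplifier.\<close>

lemma bar_proj [simp]:
  assumes [simp]: "B \<in> Obj \<A>"
  shows "lev0 (bar C M B) = free_alg M (alg_obj B)" "lev1 (bar C M B) = free_alg M (T\<^sub>0 (alg_obj B))"
    "lev2 (bar C M B) = free_alg M (T\<^sub>0 (T\<^sub>0 (alg_obj B)))"
    "cd_d0 (bar C M B) = free_mor C M (alg_act B)" "cd_d1 (bar C M B) = mult_mor M (alg_obj B)"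
    "cd_i (bar C M B) = free_mor C M (\<eta> (alg_obj B))" "cd_p0 (bar C M B) = free_mor C M (T\<^sub>1 (alg_act B))"
    "cd_p1 (bar C M B) = free_mor C M (\<mu> (alg_obj B))" "cd_p2 (bar C M B) = mult_mor M (T\<^sub>0 (alg_obj B))"
    "cd_n0 (bar C M B) = free_cell (alg_unit B)" "cd_n1 (bar C M B) = unit_cell (alg_obj B)"
    "cd_\<theta>01 (bar C M B) = free_cell (alg_assoc B)" "cd_\<theta>02 (bar C M B) = mult_cell (alg_act B)"
    "cd_\<theta>12 (bar C M B) = act_cell (free_alg M (alg_obj B))"
  by (simp_all add: bar_def Let_def psAlg_iff(8)) ((rule psAlg_cell_eqI; simp)+)

lemma bar_cell_eq: "B \<in> Obj \<A> \<Longrightarrow> bar_cell C M B = act_cell B"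
  by (rule psAlg_cell_eqI) (simp_all add: bar_cell_def psAlg_iff(8))

lemma bar_codescent: "B \<in> Obj \<A> \<Longrightarrow> codescent_object \<A> (bar C M B)"
  by (simp add: codescent_object_def A.iso_cell_iff)

text \<open>On underlying cells the two conditions for a pair are the axioms (A1) and (A2) of
  B.\<close>

lemma bar_pair: "B \<in> Obj \<A> \<Longrightarrow> A.is_pair (bar C M B) B (act_mor M B) (act_cell B)"
  unfolding A.is_pair_def by (intro conjI; (rule psAlg_cell_eqI)?) (simp_all add: psAlg_Obj_law)

end

section \<open>The codescent object of a diagram\<close>

locale algebra_diagram = pseudomonad_on C M + I: two_category I
  for C :: "('o, 'a, 'c) two_cat" (structure) and M :: "('o, 'a, 'c) psmonad" and I :: "('i, 'd, 's) two_cat"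
      +
  fixes AA :: "('i, 'd, 's, ('o, 'a, 'c) psalg, ('o, 'a, 'c) psmor, ('o, 'a, 'c) pstrans) two_fun"
    and D :: "('o, 'a, 'c, 'i, 'd) colim_data"
  assumes AA: "two_functor I (psAlg C M) AA" and construction: "colim_construction C M I AA D"
begin

abbreviation U where "U \<equiv> forget \<circ>\<^sub>2 AA"
abbreviation TU where "TU \<equiv> monad_fun M \<circ>\<^sub>2 U"
abbreviation TTU where "TTU \<equiv> monad_fun M \<circ>\<^sub>2 monad_fun M \<circ>\<^sub>2 U"

lemma functors: "two_functor I C U" "two_functor I C TU" "two_functor I C TTU"
proof -
  note comp = two_functor_comp[OF I.two_category_axioms]
  show U: "two_functor I C U" by (rule comp[OF AA forget_functor])
  show TU: "two_functor I C TU" by (rule comp[OF U T_functor])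
  show "two_functor I C TTU" using comp[OF TU T_functor] by (simp add: comp_two_fun_def comp_assoc)
qed

sublocale D0: diagram C I U
  by (intro diagram.intro two_category_axioms I.two_category_axioms functors)

sublocale D1: diagram C I TU
  by (intro diagram.intro two_category_axioms I.two_category_axioms functors)

sublocale D2: diagram C I TTU
  by (intro diagram.intro two_category_axioms I.two_category_axioms functors)

sublocale N: diagram \<A> I AA
  by (intro diagram.intro A.two_category_axioms I.two_category_axioms AA)

lemma AA_typing [simp]:
  "i \<in> Obj I \<Longrightarrow> on_obj AA i \<in> Obj \<A>"
  "d \<in> Arr I \<Longrightarrow> on_arr AA d \<in> Arr \<A>" "d \<in> Arr I \<Longrightarrow> Dom \<A> (on_arr AA d) = on_obj AA (Dom I d)"
  "d \<in> Arr I \<Longrightarrow> Cod \<A> (on_arr AA d) = on_obj AA (Cod I d)"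
  by simp_all

lemma D_bicolimits:
  "is_oplax_bicolimit C I U (tip0 D) (incl0 D) (tran0 D)"
  "is_oplax_bicolimit C I TU (tip1 D) (incl1 D) (tran1 D)"
  "is_oplax_bicolimit C I TTU (tip2 D) (incl2 D) (tran2 D)"
  using construction unfolding colim_construction_def Let_def by blast+

lemmas D_cocones [simp] = D0.is_coconeD(1-7)[OF D0.bicolimit_cocone[OF D_bicolimits(1)], simplified]
  D1.is_coconeD(1-7)[OF D1.bicolimit_cocone[OF D_bicolimits(2)], simplified]
  D2.is_coconeD(1-7)[OF D2.bicolimit_cocone[OF D_bicolimits(3)], simplified]

lemma D_families:
  "induced_by_family C I TU (incl1 D) (tran1 D) (incl0 D) (tran0 D) (\<lambda>i. alg_act (on_obj AA i))
      (\<lambda>d. mor_cell (on_arr AA d)) (bar_a D) (fam_a D)"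
  "induced_by_family C I U (incl0 D) (tran0 D) (incl1 D) (tran1 D) (\<lambda>i. \<eta> (alg_obj (on_obj AA i)))
      (\<lambda>d. cell_inv C (\<eta>c (mor_map (on_arr AA d)))) (bar_\<eta> D) (fam_\<eta> D)"
  "induced_by_family C I TTU (incl2 D) (tran2 D) (incl1 D) (tran1 D) (\<lambda>i. T\<^sub>1 (alg_act (on_obj AA i)))
      (\<lambda>d. T\<^sub>2 (mor_cell (on_arr AA d))) (bar_Ta D) (fam_Ta D)"
  "induced_by_family C I TTU (incl2 D) (tran2 D) (incl1 D) (tran1 D) (\<lambda>i. \<mu> (alg_obj (on_obj AA i)))
      (\<lambda>d. \<mu>c (mor_map (on_arr AA d))) (bar_\<mu> D) (fam_\<mu> D)"
  "induced_by_cocone C I TU (incl1 D) (tran1 D) (\<lambda>i. T\<^sub>1 (incl0 D i)) (\<lambda>d. T\<^sub>2 (tran0 D d)) (cmp_s D)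
      (fam_s D)"
  "induced_by_cocone C I TTU (incl2 D) (tran2 D) (\<lambda>i. T\<^sub>1 (incl1 D i)) (\<lambda>d. T\<^sub>2 (tran1 D d)) (cmp_t D)
      (fam_t D)"
  using construction unfolding colim_construction_def Let_def by blast+

lemma D_arrows [simp]:
  "bar_a D \<in> Arr C" "Dom C (bar_a D) = tip1 D" "Cod C (bar_a D) = tip0 D"
  "bar_\<eta> D \<in> Arr C" "Dom C (bar_\<eta> D) = tip0 D" "Cod C (bar_\<eta> D) = tip1 D"
  "bar_Ta D \<in> Arr C" "Dom C (bar_Ta D) = tip2 D" "Cod C (bar_Ta D) = tip1 D"
  "bar_\<mu> D \<in> Arr C" "Dom C (bar_\<mu> D) = tip2 D" "Cod C (bar_\<mu> D) = tip1 D"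
  "cmp_s D \<in> Arr C" "Dom C (cmp_s D) = tip1 D" "Cod C (cmp_s D) = T\<^sub>0 (tip0 D)"
  "cmp_t D \<in> Arr C" "Dom C (cmp_t D) = tip2 D" "Cod C (cmp_t D) = T\<^sub>0 (tip1 D)"
  using construction unfolding colim_construction_def Let_def arr_def by blast+

lemma D_fam [simp]:
  assumes "i \<in> Obj I"
  shows "iso2 (fam_a D i)" "Src C (fam_a D i) = bar_a D \<cdot> incl1 D i" "Tgt C (fam_a D i) = incl0 D i \<cdot> alg_act
      (on_obj AA i)"
    "iso2 (fam_\<eta> D i)" "Src C (fam_\<eta> D i) = bar_\<eta> D \<cdot> incl0 D i" "Tgt C (fam_\<eta> D i) =
        incl1 D i \<cdot> \<eta> (alg_obj (on_obj AA i))"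
    "iso2 (fam_Ta D i)" "Src C (fam_Ta D i) = bar_Ta D \<cdot> incl2 D i" "Tgt C (fam_Ta D i) =
        incl1 D i \<cdot> T\<^sub>1 (alg_act (on_obj AA i))"
    "iso2 (fam_\<mu> D i)" "Src C (fam_\<mu> D i) = bar_\<mu> D \<cdot> incl2 D i" "Tgt C (fam_\<mu> D i) =
        incl1 D i \<cdot> \<mu> (alg_obj (on_obj AA i))"
    "iso2 (fam_s D i)" "Src C (fam_s D i) = cmp_s D \<cdot> incl1 D i" "Tgt C (fam_s D i) = T\<^sub>1 (incl0 D i)"
    "iso2 (fam_t D i)" "Src C (fam_t D i) = cmp_t D \<cdot> incl2 D i" "Tgt C (fam_t D i) = T\<^sub>1 (incl1 D i)"
  using D_families assms unfolding induced_by_family_def D0.induced_by_cocone_iff D1.induced_by_cocone_iff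
      D2.induced_by_cocone_iff
    D0.is_modification_def D1.is_modification_def D2.is_modification_def fst_conv snd_conv by blast+

lemma D_fam_modif:
  assumes "d \<in> Arr I"
  shows "fam_a D (Dom I d) \<bullet> (bar_a D \<lhd> tran1 D d) = ((tran0 D d \<rhd> alg_act (on_obj AA (Dom I d))) \<bullet>
      (incl0 D (Cod I d) \<lhd> mor_cell (on_arr AA d))) \<bullet> (fam_a D (Cod I d) \<rhd> T\<^sub>1 (mor_map (on_arr AA d)))"
    "fam_s D (Dom I d) \<bullet> (cmp_s D \<lhd> tran1 D d) = T\<^sub>2 (tran0 D d) \<bullet>
        (fam_s D (Cod I d) \<rhd> T\<^sub>1 (mor_map (on_arr AA d)))"
  using D_families(1,5) assms unfolding induced_by_family_def D1.induced_by_cocone_iff D1.is_modification_def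
      fst_conv snd_conv
  by (auto simp del: two_cat_simps)

lemma D_ind [simp]:
  "iso2 (ind_\<sigma> D)" "Src C (ind_\<sigma> D) = cmp_s D \<cdot> bar_\<eta> D" "Tgt C (ind_\<sigma> D) = \<eta> (tip0 D)"
  "iso2 (ind_\<theta> D)" "Src C (ind_\<theta> D) = cmp_s D \<cdot> bar_Ta D" "Tgt C (ind_\<theta> D) = T\<^sub>1 (bar_a D) \<cdot> cmp_t D"
  "iso2 (ind_\<tau> D)" "Src C (ind_\<tau> D) = cmp_s D \<cdot> bar_\<mu> D" "Tgt C (ind_\<tau> D) = \<mu> (tip0 D) \<cdot> T\<^sub>1 (cmp_s D) \<cdot> cmp_t
      D"
  "iso2 (ind_unit D)" "Src C (ind_unit D) = bar_a D \<cdot> bar_\<eta> D" "Tgt C (ind_unit D) = Id1 C (tip0 D)"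
  "iso2 (ind_assoc D)" "Src C (ind_assoc D) = bar_a D \<cdot> bar_Ta D" "Tgt C (ind_assoc D) = bar_a D \<cdot> bar_\<mu> D"
  using construction unfolding colim_construction_def Let_def iso_cell_iff by blast+

lemma D_ind_eq:
  assumes "i \<in> Obj I"
  shows "ind_\<sigma> D \<rhd> incl0 D i = \<eta>c (incl0 D i) \<bullet> (fam_s D i \<rhd> \<eta> (alg_obj (on_obj AA i))) \<bullet>
      (cmp_s D \<lhd> fam_\<eta> D i)"
    "T\<^sub>2 (fam_a D i) \<bullet> (T\<^sub>1 (bar_a D) \<lhd> fam_t D i) \<bullet> (ind_\<theta> D \<rhd> incl2 D i) =
        (fam_s D i \<rhd> T\<^sub>1 (alg_act (on_obj AA i))) \<bullet> (cmp_s D \<lhd> fam_Ta D i)"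
    "\<mu>c (incl0 D i) \<bullet> (\<mu> (tip0 D) \<lhd> T\<^sub>2 (fam_s D i)) \<bullet> ((\<mu> (tip0 D) \<cdot> T\<^sub>1 (cmp_s D)) \<lhd> fam_t D i) \<bullet>
        (ind_\<tau> D \<rhd> incl2 D i) =
        (fam_s D i \<rhd> \<mu> (alg_obj (on_obj AA i))) \<bullet> (cmp_s D \<lhd> fam_\<mu> D i)"
    "ind_unit D \<rhd> incl0 D i = (incl0 D i \<lhd> alg_unit (on_obj AA i)) \<bullet> (fam_a D i \<rhd> \<eta> (alg_obj (on_obj AA i))) \<bullet>
        (bar_a D \<lhd> fam_\<eta> D i)"
    "(fam_a D i \<rhd> \<mu> (alg_obj (on_obj AA i))) \<bullet> (bar_a D \<lhd> fam_\<mu> D i) \<bullet> (ind_assoc D \<rhd> incl2 D i) =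
        (incl0 D i \<lhd> alg_assoc (on_obj AA i)) \<bullet> (fam_a D i \<rhd> T\<^sub>1 (alg_act (on_obj AA i))) \<bullet>
            (bar_a D \<lhd> fam_Ta D i)"
  using construction assms unfolding colim_construction_def Let_def by blast+

text \<open>The underlying cells of the definition are recognised as pastings of algebra 2-cells
  built earlier, so that their transformation laws come for free.\<close>

lemma XA_proj [simp]:
  "lev0 (XA C M D) = free_alg M (tip0 D)" "lev1 (XA C M D) = free_alg M (tip1 D)" "lev2 (XA C M D) =
      free_alg M (tip2 D)"
  "cd_d0 (XA C M D) = free_mor C M (bar_a D)" "cd_d1 (XA C M D) = mult_mor M (tip0 D) \<cdot>\<^bsub>\<A>\<^esub>
      free_mor C M (cmp_s D)"
  "cd_i (XA C M D) = free_mor C M (bar_\<eta> D)" "cd_p0 (XA C M D) = free_mor C M (bar_Ta D)"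
  "cd_p1 (XA C M D) = free_mor C M (bar_\<mu> D)" "cd_p2 (XA C M D) = mult_mor M (tip1 D) \<cdot>\<^bsub>\<A>\<^esub>
      free_mor C M (cmp_t D)"
  "cd_n0 (XA C M D) = free_cell (ind_unit D)"
  "cd_n1 (XA C M D) = unit_cell (tip0 D) \<bullet>\<^bsub>\<A>\<^esub> (mult_mor M (tip0 D) \<lhd>\<^bsub>\<A>\<^esub> free_cell (ind_\<sigma> D))"
  "cd_\<theta>01 (XA C M D) = free_cell (ind_assoc D)"
  "cd_\<theta>02 (XA C M D) = (mult_cell (bar_a D) \<rhd>\<^bsub>\<A>\<^esub> free_mor C M (cmp_t D)) \<bullet>\<^bsub>\<A>\<^esub> (mult_mor M (tip0 D) \<lhd>\<^bsub>\<A>\<^esub>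
      free_cell (ind_\<theta> D))"
  "cd_\<theta>12 (XA C M D) = (mult_mor M (tip0 D) \<lhd>\<^bsub>\<A>\<^esub> mult_cell (cmp_s D) \<rhd>\<^bsub>\<A>\<^esub> free_mor C M (cmp_t D)) \<bullet>\<^bsub>\<A>\<^esub>
     (act_cell (free_alg M (tip0 D)) \<rhd>\<^bsub>\<A>\<^esub> free_mor C M (T\<^sub>1 (cmp_s D)) \<cdot>\<^bsub>\<A>\<^esub> free_mor C M (cmp_t D)) \<bullet>\<^bsub>\<A>\<^esub>
     (mult_mor M (tip0 D) \<lhd>\<^bsub>\<A>\<^esub> free_cell (ind_\<tau> D))"
  by (simp_all add: XA_def Let_def psAlg_iff(8)) ((rule psAlg_cell_eqI; simp)+)

lemma XA_codescent: "codescent_object \<A> (XA C M D)"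
  by (simp add: codescent_object_def A.iso_cell_iff)

lemma qbar_proj [simp]:
  assumes [simp]: "i \<in> Obj I"
  shows "cm0 (qbar C M AA D i) = free_mor C M (incl0 D i)" "cm1 (qbar C M AA D i) = free_mor C M (incl1 D i)"
      "cm2 (qbar C M AA D i) = free_mor C M (incl2 D i)"
    "cm_d0 (qbar C M AA D i) = free_cell (fam_a D i)"
    "cm_d1 (qbar C M AA D i) = mult_cell (incl0 D i) \<bullet>\<^bsub>\<A>\<^esub> (mult_mor M (tip0 D) \<lhd>\<^bsub>\<A>\<^esub> free_cell (fam_s D i))"
    "cm_i (qbar C M AA D i) = free_cell (fam_\<eta> D i)" "cm_p0 (qbar C M AA D i) = free_cell (fam_Ta D i)"
        "cm_p1 (qbar C M AA D i) = free_cell (fam_\<mu> D i)"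
    "cm_p2 (qbar C M AA D i) = mult_cell (incl1 D i) \<bullet>\<^bsub>\<A>\<^esub> (mult_mor M (tip1 D) \<lhd>\<^bsub>\<A>\<^esub> free_cell (fam_t D i))"
  by (simp_all add: qbar_def Let_def psAlg_iff(8)) ((rule psAlg_cell_eqI; simp)+)

lemma qbar_typing:
  assumes [simp]: "i \<in> Obj I"
  defines "m \<equiv> qbar C M AA D i" and "X \<equiv> bar C M (on_obj AA i)" and "Y \<equiv> XA C M D"
  shows "iso_cell \<A> (cm_d0 m) (cd_d0 Y \<cdot>\<^bsub>\<A>\<^esub> cm1 m) (cm0 m \<cdot>\<^bsub>\<A>\<^esub> cd_d0 X)"
    "iso_cell \<A> (cm_d1 m) (cd_d1 Y \<cdot>\<^bsub>\<A>\<^esub> cm1 m) (cm0 m \<cdot>\<^bsub>\<A>\<^esub> cd_d1 X)"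
    "iso_cell \<A> (cm_i m) (cd_i Y \<cdot>\<^bsub>\<A>\<^esub> cm0 m) (cm1 m \<cdot>\<^bsub>\<A>\<^esub> cd_i X)"
    "iso_cell \<A> (cm_p0 m) (cd_p0 Y \<cdot>\<^bsub>\<A>\<^esub> cm2 m) (cm1 m \<cdot>\<^bsub>\<A>\<^esub> cd_p0 X)"
    "iso_cell \<A> (cm_p1 m) (cd_p1 Y \<cdot>\<^bsub>\<A>\<^esub> cm2 m) (cm1 m \<cdot>\<^bsub>\<A>\<^esub> cd_p1 X)"
    "iso_cell \<A> (cm_p2 m) (cd_p2 Y \<cdot>\<^bsub>\<A>\<^esub> cm2 m) (cm1 m \<cdot>\<^bsub>\<A>\<^esub> cd_p2 X)"
  unfolding m_def X_def Y_def by (simp_all add: A.iso_cell_iff)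

text \<open>Both equations are images under T of the defining equations of the induced unit cells;
  the second uses in addition that \<zeta> is a modification along \<open>incl0 D i\<close>.\<close>

lemma qbar_n:
  assumes i [simp]: "i \<in> Obj I"
  defines "m \<equiv> qbar C M AA D i" and "X \<equiv> bar C M (on_obj AA i)" and "Y \<equiv> XA C M D"
  shows "cd_n0 Y \<rhd>\<^bsub>\<A>\<^esub> cm0 m = (cm0 m \<lhd>\<^bsub>\<A>\<^esub> cd_n0 X) \<bullet>\<^bsub>\<A>\<^esub> (cm_d0 m \<rhd>\<^bsub>\<A>\<^esub> cd_i X) \<bullet>\<^bsub>\<A>\<^esub> (cd_d0 Y \<lhd>\<^bsub>\<A>\<^esub> cm_i m)"
      (is ?eq1)
    "cd_n1 Y \<rhd>\<^bsub>\<A>\<^esub> cm0 m = (cm0 m \<lhd>\<^bsub>\<A>\<^esub> cd_n1 X) \<bullet>\<^bsub>\<A>\<^esub> (cm_d1 m \<rhd>\<^bsub>\<A>\<^esub> cd_i X) \<bullet>\<^bsub>\<A>\<^esub> (cd_d1 Y \<lhd>\<^bsub>\<A>\<^esub> cm_i m)"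
        (is ?eq2)
proof -
  note u = arg_cong[OF D_ind_eq(4)[OF i], of T\<^sub>2, simplified]
  show ?eq1
    unfolding m_def X_def Y_def by (rule psAlg_cell_eqI) (simp_all add: u)
  note s = arg_cong[OF arg_cong[OF D_ind_eq(1)[OF i], of T\<^sub>2], of "\<lambda>z. \<mu> (tip0 D) \<lhd> z", simplified]
  note z = modification(2)[of "incl0 D i", OF _ refl refl, simplified]
  show ?eq2
    unfolding m_def X_def Y_def by (rule psAlg_cell_eqI) (simp_all add: s reassoc[OF z])
qed

text \<open>The core of each equation is the image under T of the defining equation of the induced
  cell. The second also needs naturality of \<mu> along \<open>fam_a D i\<close>; the third needs it
  along \<open>fam_s D i\<close>, together with the modification property of \<rho> at
  \<open>incl0 D i\<close>.\<close>

lemma qbar_\<theta>: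
  assumes i [simp]: "i \<in> Obj I"
  defines "m \<equiv> qbar C M AA D i" and "X \<equiv> bar C M (on_obj AA i)" and "Y \<equiv> XA C M D"
  shows "(cm_d0 m \<rhd>\<^bsub>\<A>\<^esub> cd_p1 X) \<bullet>\<^bsub>\<A>\<^esub> (cd_d0 Y \<lhd>\<^bsub>\<A>\<^esub> cm_p1 m) \<bullet>\<^bsub>\<A>\<^esub> (cd_\<theta>01 Y \<rhd>\<^bsub>\<A>\<^esub> cm2 m) =
        (cm0 m \<lhd>\<^bsub>\<A>\<^esub> cd_\<theta>01 X) \<bullet>\<^bsub>\<A>\<^esub> (cm_d0 m \<rhd>\<^bsub>\<A>\<^esub> cd_p0 X) \<bullet>\<^bsub>\<A>\<^esub> (cd_d0 Y \<lhd>\<^bsub>\<A>\<^esub> cm_p0 m)" (is ?eq1)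
    "(cm_d0 m \<rhd>\<^bsub>\<A>\<^esub> cd_p2 X) \<bullet>\<^bsub>\<A>\<^esub> (cd_d0 Y \<lhd>\<^bsub>\<A>\<^esub> cm_p2 m) \<bullet>\<^bsub>\<A>\<^esub> (cd_\<theta>02 Y \<rhd>\<^bsub>\<A>\<^esub> cm2 m) =
        (cm0 m \<lhd>\<^bsub>\<A>\<^esub> cd_\<theta>02 X) \<bullet>\<^bsub>\<A>\<^esub> (cm_d1 m \<rhd>\<^bsub>\<A>\<^esub> cd_p0 X) \<bullet>\<^bsub>\<A>\<^esub> (cd_d1 Y \<lhd>\<^bsub>\<A>\<^esub> cm_p0 m)" (is ?eq2)
    "(cm_d1 m \<rhd>\<^bsub>\<A>\<^esub> cd_p2 X) \<bullet>\<^bsub>\<A>\<^esub> (cd_d1 Y \<lhd>\<^bsub>\<A>\<^esub> cm_p2 m) \<bullet>\<^bsub>\<A>\<^esub> (cd_\<theta>12 Y \<rhd>\<^bsub>\<A>\<^esub> cm2 m) =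
        (cm0 m \<lhd>\<^bsub>\<A>\<^esub> cd_\<theta>12 X) \<bullet>\<^bsub>\<A>\<^esub> (cm_d1 m \<rhd>\<^bsub>\<A>\<^esub> cd_p1 X) \<bullet>\<^bsub>\<A>\<^esub> (cd_d1 Y \<lhd>\<^bsub>\<A>\<^esub> cm_p1 m)" (is ?eq3)
proof -
  note as = arg_cong[OF D_ind_eq(5)[OF i], of T\<^sub>2, simplified]
  show ?eq1
    unfolding m_def X_def Y_def by (rule psAlg_cell_eqI) (simp_all add: as)
  note th = arg_cong[OF arg_cong[OF D_ind_eq(2)[OF i], of T\<^sub>2], of "\<lambda>z. \<mu> (tip0 D) \<lhd> z", simplified]
  note na = mult_natural[of "fam_a D i", OF _ refl, simplified, symmetric]
  note e1 = exchange[of "T\<^sub>2 (fam_t D i)" "\<mu>c (bar_a D)", simplified, symmetric]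
  show ?eq2
    unfolding m_def X_def Y_def by (rule psAlg_cell_eqI) (simp_all add: reassoc[OF e1] reassoc3[OF na] th)
  note ta = arg_cong[OF arg_cong[OF D_ind_eq(3)[OF i], of T\<^sub>2], of "\<lambda>z. \<mu> (tip0 D) \<lhd> z", simplified]
  note e2 = exchange[of "T\<^sub>2 (fam_t D i)" "\<mu>c (cmp_s D)", THEN arg_cong, of "\<lambda>z. \<mu> (tip0 D) \<lhd> z", simplified,
      symmetric]
  note ns = arg_cong[OF mult_natural[of "fam_s D i", OF _ refl, simplified], of "\<lambda>z. \<mu> (tip0 D) \<lhd> z",
      simplified, symmetric]
  note e3 = exchange[of "T\<^sub>2 (T\<^sub>2 (fam_s D i))" "\<rho> (tip0 D)", simplified, symmetric]
  note e4 = exchange[of "T\<^sub>1 (T\<^sub>1 (cmp_s D)) \<lhd> T\<^sub>2 (fam_t D i)" "\<rho> (tip0 D)", simplified, symmetric]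
  note r = modification(3)[of "incl0 D i", OF _ refl refl, simplified, symmetric]
  show ?eq3
    unfolding m_def X_def Y_def by (rule psAlg_cell_eqI) (simp_all add: reassoc[OF e2] reassoc3[OF ns]
        reassoc[OF e4] reassoc[OF e3] reassoc3[OF r] ta)
qed

text \<open>At \<open>d0\<close> this is the image under T of the modification law of
  \<open>fam_a\<close>. At \<open>d1\<close> it is that of \<open>fam_s\<close>, followed by
  naturality of \<mu> along the transition cell.\<close>

lemma qbar_modif:
  assumes d [simp]: "d \<in> Arr I"
  defines "mi \<equiv> qbar C M AA D (Dom I d)" and "mj \<equiv> qbar C M AA D (Cod I d)"
      and "X \<equiv> bar C M (on_obj AA (Dom I d))" and "Y \<equiv> XA C M D"
  shows "(free_cell (tran0 D d) \<rhd>\<^bsub>\<A>\<^esub> cd_d0 X) \<bullet>\<^bsub>\<A>\<^esub> (cm0 mj \<lhd>\<^bsub>\<A>\<^esub> free_cell (mor_cell (on_arr AA d))) \<bullet>\<^bsub>\<A>\<^esub>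
        (cm_d0 mj \<rhd>\<^bsub>\<A>\<^esub> on_arr (free \<circ>\<^sub>2 TU) d) = cm_d0 mi \<bullet>\<^bsub>\<A>\<^esub> (cd_d0 Y \<lhd>\<^bsub>\<A>\<^esub> free_cell (tran1 D d))" (is ?eq1)
    "(free_cell (tran0 D d) \<rhd>\<^bsub>\<A>\<^esub> cd_d1 X) \<bullet>\<^bsub>\<A>\<^esub> (cm0 mj \<lhd>\<^bsub>\<A>\<^esub> mult_cell (mor_map (on_arr AA d))) \<bullet>\<^bsub>\<A>\<^esub>
        (cm_d1 mj \<rhd>\<^bsub>\<A>\<^esub> on_arr (free \<circ>\<^sub>2 TU) d) = cm_d1 mi \<bullet>\<^bsub>\<A>\<^esub> (cd_d1 Y \<lhd>\<^bsub>\<A>\<^esub> free_cell (tran1 D d))" (is ?eq2)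
proof -
  note a = arg_cong[OF D_fam_modif(1)[OF d], of T\<^sub>2, simplified]
  show ?eq1
    unfolding mi_def mj_def X_def Y_def by (rule psAlg_cell_eqI) (simp_all add: a)
  note s = arg_cong[OF arg_cong[OF D_fam_modif(2)[OF d], of T\<^sub>2], of "\<lambda>z. \<mu> (tip0 D) \<lhd> z", simplified]
  note n = mult_natural[of "tran0 D d", OF _ refl, simplified]
  show ?eq2
    unfolding mi_def mj_def X_def Y_def by (rule psAlg_cell_eqI) (simp_all add: s reassoc[OF n])
qed

text \<open>The general commutation result applies to the bar constructions once its data is
  supplied: free functors as levels, actions as quotients, and the morphisms \<open>qbar\<close> as
  inclusions.\<close>

theorem induced_cocone_bicolimit:
  assumes bicoeq: "is_bicoequalizer \<A> (XA C M D) Z P \<psi>" and ind: "induced_cocone C M I AA D Z P \<psi> l \<chi> ld"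
  shows "is_oplax_bicolimit \<A> I AA Z l ld"
proof -
  have F: "two_functor I \<A> (free \<circ>\<^sub>2 U)" "two_functor I \<A> (free \<circ>\<^sub>2 TU)" "two_functor I \<A> (free \<circ>\<^sub>2 TTU)"
    by (intro two_functor_comp[OF I.two_category_axioms functors(1) free_functor]
        two_functor_comp[OF I.two_category_axioms functors(2) free_functor]
        two_functor_comp[OF I.two_category_axioms functors(3) free_functor])+
  have l: "is_bicoeq_map \<A> (bar C M (on_obj AA i)) (qbar C M AA D i) (on_obj AA i) (act_mor M (on_obj AA i))
      (act_cell (on_obj AA i)) Z P \<psi> (l i) (\<chi> i)"
    if "i \<in> Obj I" for i
    using ind that bar_cell_eq[OF AA_typing(1)[OF that]] unfolding induced_cocone_def by metis
  have P [simp]: "P \<in> Arr \<A>" "Dom \<A> P = free_alg M (tip0 D)" "Cod \<A> P = Z"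
    using A.bicoequalizer_pair[OF _ _ _ _ _ _ bicoeq] by (simp_all add: A.is_pair_def)
  have [simp]: "l i \<in> Arr \<A>" "Dom \<A> (l i) = on_obj AA i" "Cod \<A> (l i) = Z" "A.iso2 (\<chi> i)" "Src \<A> (\<chi> i) =
      P \<cdot>\<^bsub>\<A>\<^esub> free_mor C M (incl0 D i)"
     "Tgt \<A> (\<chi> i) = l i \<cdot>\<^bsub>\<A>\<^esub> act_mor M (on_obj AA i)" if "i \<in> Obj I" for i
    using l[OF that] that by (simp_all add: is_bicoeq_map_def A.iso_cell_iff)
  have ld: "cell \<A> (ld d) (l (Cod I d) \<cdot>\<^bsub>\<A>\<^esub> on_arr AA d) (l (Dom I d))"
    and ld_eq: "(tr_cell (ld d) \<rhd> alg_act (on_obj AA (Dom I d))) \<bullet>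
        (mor_map (l (Cod I d)) \<lhd> mor_cell (on_arr AA d)) \<bullet>
          (tr_cell (\<chi> (Cod I d)) \<rhd> T\<^sub>1 (mor_map (on_arr AA d))) = tr_cell (\<chi> (Dom I d)) \<bullet>
              (mor_map P \<lhd> T\<^sub>2 (tran0 D d))"
    if "d \<in> Arr I" for d
    using ind that unfolding induced_cocone_def arr_def by blast+
  note [simp] = ld[THEN A.cellD, THEN conjunct1] ld[THEN A.cellD, THEN conjunct2, THEN conjunct1]
    ld[THEN A.cellD, THEN conjunct2, THEN conjunct2, THEN conjunct1]
  \<comment> \<open>The actions are pseudonatural through \<open>action_cell\<close>. The bar
    constructions vary pseudonaturally through the image of the structure cell under T at
    \<open>d0\<close> and through the cell of \<mu> at \<open>d1\<close>.\<close>
  interpret codescent_colimit \<A> I AA "free \<circ>\<^sub>2 U" "free \<circ>\<^sub>2 TU" "free \<circ>\<^sub>2 TTU" "\<lambda>i. bar C M (on_obj AA i)"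
      "XA C M D" "qbar C M AA D"
    "\<lambda>i. act_mor M (on_obj AA i)" "\<lambda>i. act_cell (on_obj AA i)" "\<lambda>d. action_cell (on_arr AA d)"
        "\<lambda>d. free_cell (mor_cell (on_arr AA d))"
    "\<lambda>d. mult_cell (mor_map (on_arr AA d))" "\<lambda>d. free_cell (tran0 D d)" "\<lambda>d. free_cell (tran1 D d)"
        "\<lambda>d. free_cell (tran2 D d)" Z P \<psi> l \<chi> ld
  proof (intro codescent_colimit.intro diagram.intro codescent_colimit_axioms.intro A.two_category_axioms
      I.two_category_axioms AA F)
    fix i assume [simp]: "i \<in> Obj I"
    show "action_cell (on_arr AA (Id1 I i)) = Id2 \<A> (act_mor M (on_obj AA i))" by (rule psAlg_cell_eqI)
        simp_all
  next
    fix d assume [simp]: "d \<in> Arr I"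
    \<comment> \<open>On underlying cells, compatibility of the actions with the associativity cells
      is the multiplication axiom of the pseudomorphism \<open>on_arr AA d\<close>.\<close>
    show "(on_arr AA d \<lhd>\<^bsub>\<A>\<^esub> act_cell (on_obj AA (Dom I d))) \<bullet>\<^bsub>\<A>\<^esub> (action_cell (on_arr AA d) \<rhd>\<^bsub>\<A>\<^esub>
        cd_d0 (bar C M (on_obj AA (Dom I d)))) \<bullet>\<^bsub>\<A>\<^esub>
          (act_mor M (on_obj AA (Cod I d)) \<lhd>\<^bsub>\<A>\<^esub> free_cell (mor_cell (on_arr AA d))) =
        (action_cell (on_arr AA d) \<rhd>\<^bsub>\<A>\<^esub> cd_d1 (bar C M (on_obj AA (Dom I d)))) \<bullet>\<^bsub>\<A>\<^esub>
          (act_mor M (on_obj AA (Cod I d)) \<lhd>\<^bsub>\<A>\<^esub> mult_cell (mor_map (on_arr AA d))) \<bullet>\<^bsub>\<A>\<^esub>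
              (act_cell (on_obj AA (Cod I d)) \<rhd>\<^bsub>\<A>\<^esub> on_arr (free \<circ>\<^sub>2 TU) d)"
      by (rule psAlg_cell_eqI) (use psAlg_Arr_law[of "on_arr AA d"] in simp_all)
    show "(ld d \<rhd>\<^bsub>\<A>\<^esub> act_mor M (on_obj AA (Dom I d))) \<bullet>\<^bsub>\<A>\<^esub> (l (Cod I d) \<lhd>\<^bsub>\<A>\<^esub> action_cell (on_arr AA d)) \<bullet>\<^bsub>\<A>\<^esub>
        (\<chi> (Cod I d) \<rhd>\<^bsub>\<A>\<^esub> on_arr (free \<circ>\<^sub>2 U) d) = \<chi> (Dom I d) \<bullet>\<^bsub>\<A>\<^esub> (P \<lhd>\<^bsub>\<A>\<^esub> free_cell (tran0 D d))"
      by (rule psAlg_cell_eqI) (simp_all add: ld_eq)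
  next
    fix d e assume [simp]: "d \<in> Arr I" "e \<in> Arr I" "Cod I d = Dom I e"
    show "action_cell (on_arr AA (e \<cdot>\<^bsub>I\<^esub> d)) = (on_arr AA e \<lhd>\<^bsub>\<A>\<^esub> action_cell (on_arr AA d)) \<bullet>\<^bsub>\<A>\<^esub>
        (action_cell (on_arr AA e) \<rhd>\<^bsub>\<A>\<^esub> on_arr (free \<circ>\<^sub>2 U) d)"
      by (rule psAlg_cell_eqI) simp_all
  next
    fix s assume [simp]: "s \<in> Cell I"
    \<comment> \<open>Naturality of the actions in the 2-cells of I is the law of the algebra
      transformation \<open>on_cell AA s\<close>.\<close>
    show "action_cell (on_arr AA (Tgt I s)) \<bullet>\<^bsub>\<A>\<^esub> (act_mor M (on_obj AA (Cod I (Src I s))) \<lhd>\<^bsub>\<A>\<^esub>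
        on_cell (free \<circ>\<^sub>2 U) s) =
        (on_cell AA s \<rhd>\<^bsub>\<A>\<^esub> act_mor M (on_obj AA (Dom I (Src I s)))) \<bullet>\<^bsub>\<A>\<^esub> action_cell (on_arr AA (Src I s))"
      by (rule psAlg_cell_eqI) (use psAlg_Cell_law[of "on_cell AA s"] in simp_all)
  next
    fix i S R
    assume "S \<rhd>\<^bsub>\<A>\<^esub> act_mor M (on_obj AA i) = R \<rhd>\<^bsub>\<A>\<^esub> act_mor M (on_obj AA i)" "i \<in> Obj I" "S \<in> Cell \<A>"
        "R \<in> Cell \<A>" "Src \<A> R = Src \<A> S"
      "Tgt \<A> R = Tgt \<A> S" "Dom \<A> (Src \<A> S) = on_obj AA i"
    then show "S = R" using act_mor_faithful[of S "on_obj AA i" R] by simp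
  next
    fix i H G \<Gamma>
    assume "i \<in> Obj I" "H \<in> Arr \<A>" "G \<in> Arr \<A>" "Dom \<A> H = on_obj AA i" "Dom \<A> G = on_obj AA i" "Cod \<A> G =
        Cod \<A> H"
      "\<Gamma> \<in> Cell \<A>" "Src \<A> \<Gamma> = H \<cdot>\<^bsub>\<A>\<^esub> act_mor M (on_obj AA i)" "Tgt \<A> \<Gamma> = G \<cdot>\<^bsub>\<A>\<^esub> act_mor M (on_obj AA i)"
      "(\<Gamma> \<rhd>\<^bsub>\<A>\<^esub> cd_d1 (bar C M (on_obj AA i))) \<bullet>\<^bsub>\<A>\<^esub> (H \<lhd>\<^bsub>\<A>\<^esub> act_cell (on_obj AA i)) =
        (G \<lhd>\<^bsub>\<A>\<^esub> act_cell (on_obj AA i)) \<bullet>\<^bsub>\<A>\<^esub> (\<Gamma> \<rhd>\<^bsub>\<A>\<^esub> cd_d0 (bar C M (on_obj AA i)))"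
    then show "\<exists>S\<in>Cell \<A>. Src \<A> S = H \<and> Tgt \<A> S = G \<and> S \<rhd>\<^bsub>\<A>\<^esub> act_mor M (on_obj AA i) = \<Gamma>"
      by (intro act_mor_full[of "on_obj AA i"]) simp_all
  next
    show "is_oplax_bicolimit \<A> I (free \<circ>\<^sub>2 U) (lev0 (XA C M D)) (\<lambda>i. cm0 (qbar C M AA D i))
        (\<lambda>d. free_cell (tran0 D d))"
      "is_oplax_bicolimit \<A> I (free \<circ>\<^sub>2 TU) (lev1 (XA C M D)) (\<lambda>i. cm1 (qbar C M AA D i))
          (\<lambda>d. free_cell (tran1 D d))"
      "is_oplax_bicolimit \<A> I (free \<circ>\<^sub>2 TTU) (lev2 (XA C M D)) (\<lambda>i. cm2 (qbar C M AA D i))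
          (\<lambda>d. free_cell (tran2 D d))"
      using free_preserves_bicolimit[OF I.two_category_axioms functors(1) D_bicolimits(1)]
        free_preserves_bicolimit[OF I.two_category_axioms functors(2) D_bicolimits(2)]
        free_preserves_bicolimit[OF I.two_category_axioms functors(3) D_bicolimits(3)]
      by (simp_all add: qbar_def Let_def)
  qed (fact XA_codescent bicoeq qbar_typing qbar_n qbar_\<theta> qbar_modif l ld | simp add: bar_codescent bar_pair)+
  show ?thesis by (rule oplax_bicolimit)
qed

end

theorem proposition3p12:
  fixes C :: "('o, 'a, 'c) two_cat" and M :: "('o, 'a, 'c) psmonad"
    and I :: "('i, 'd, 's) two_cat"
    and AA :: "('i, 'd, 's, ('o, 'a, 'c) psalg, ('o, 'a, 'c) psmor, ('o, 'a, 'c) pstrans) two_fun"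
    and D :: "('o, 'a, 'c, 'i, 'd) colim_data"
    and Z :: "('o, 'a, 'c) psalg"
    and P :: "('o, 'a, 'c) psmor" and \<psi> :: "('o, 'a, 'c) pstrans"
    and l :: "'i \<Rightarrow> ('o, 'a, 'c) psmor" and \<chi> :: "'i \<Rightarrow> ('o, 'a, 'c) pstrans"
    and ld :: "'d \<Rightarrow> ('o, 'a, 'c) pstrans"
  assumes "two_category C"
    and "bicocomplete TYPE('u) C"
    and "pseudomonad C M"
    and "has_bicoequalizers (psAlg C M)"
    and "two_category I"
    and "small_two_cat TYPE('u) I"
    and "two_functor I (psAlg C M) AA"
    and "colim_construction C M I AA D"
    and "is_bicoequalizer (psAlg C M) (XA C M D) Z P \<psi>"
    and "induced_cocone C M I AA D Z P \<psi> l \<chi> ld"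
  shows "is_oplax_bicolimit (psAlg C M) I AA Z l ld"
proof -
  interpret algebra_diagram C M I AA D
    by (intro algebra_diagram.intro pseudomonad_on.intro pseudomonad_on_axioms.intro
        algebra_diagram_axioms.intro assms)
  show ?thesis by (rule induced_cocone_bicolimit[OF assms(9,10)])
qed

end
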